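(* Let $K$ be a field of characteristic zero and let $R$ be a unique factorization domain of Krull dimension $2$ which is an affine $K$-algebra. Suppose that $\delta$ is a derivation of $R$ such that no maximal ideal of $R$ is a $\delta$-ideal. Then the following conditions are equivalent: (1) $S = R[\theta;\delta]$ satisfies $(\diamond)$; (2) $R$ is not $\delta$-primitive; (3) $S$ is not a primitive ring.
   Context: An affine $K$-algebra is a finitely generated commutative $K$-algebra. A derivation of $R$ is an additive map $\delta: R\to R$ with $\delta(ab)=\delta(a)b+a\delta(b)$ (it is not required to be $K$-linear). A $\delta$-ideal is an ideal $I$ of $R$ with $\delta(I)\subseteq I$; $R$ is $\delta$-primitive if it has a maximal ideal that contains no non-zero $\delta$-ideal of $R$. The differential operator ring $R[\theta;\delta]$ is the free left $R$-module with basis $1,\theta,\theta^2,\ldots$ with multiplication extending that of $R$ and determined by $\theta a = a\theta+\delta(a)$ for $a\in R$. A ring is primitive if it has a faithful simple left module. A Noetherian ring $S$ satisfies property $(\diamond)$ if every cyclic essential extension of a simple $S$-module is Artinian; modules are left modules. *)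

theory Defs
  imports "HOL-Algebra.Algebra" "HOL-Library.Extended_Nat"
begin

section \<open>Commutative algebra\<close>

definition field_char_zero :: "('k, 'm) ring_scheme \<Rightarrow> bool" where
  "field_char_zero K \<longleftrightarrow> field K \<and> (\<forall>n::nat. n > 0 \<longrightarrow> add_pow K n \<one>\<^bsub>K\<^esub> \<noteq> \<zero>\<^bsub>K\<^esub>)"

text \<open>A \<open>K\<close>-algebra \<open>R\<close> is a record carrying both the ring structure and the scalar
  multiplication; the second argument of \<open>generate_ring\<close> contains the image of \<open>K\<close>, so the
  generated subring is the generated \<open>K\<close>-subalgebra.\<close>

definition affine_algebra :: "('k, 'l) ring_scheme \<Rightarrow> ('k, 'r, 'm) module_scheme \<Rightarrow> bool" where
  "affine_algebra K R \<longleftrightarrow> algebra K R \<and>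
     (\<exists>G \<subseteq> carrier R. finite G \<and>
        generate_ring R ((\<lambda>c. c \<odot>\<^bsub>R\<^esub> \<one>\<^bsub>R\<^esub>) ` carrier K \<union> G) = carrier R)"

definition krull_dim :: "('r, 'm) ring_scheme \<Rightarrow> enat" where
  "krull_dim R = Sup {enat n |n. \<exists>P :: nat \<Rightarrow> 'r set.
     (\<forall>i\<le>n. primeideal (P i) R) \<and> (\<forall>i<n. P i \<subset> P (Suc i))}"

locale derivation = R?: cring R for R :: "('r, 'm) ring_scheme" (structure) +
  fixes \<delta> :: "'r \<Rightarrow> 'r"
  assumes deriv_closed [simp, intro]: "a \<in> carrier R \<Longrightarrow> \<delta> a \<in> carrier R"
    and deriv_add: "\<lbrakk>a \<in> carrier R; b \<in> carrier R\<rbrakk> \<Longrightarrow> \<delta> (a \<oplus> b) = \<delta> a \<oplus> \<delta> b"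
    and deriv_mult:
      "\<lbrakk>a \<in> carrier R; b \<in> carrier R\<rbrakk> \<Longrightarrow> \<delta> (a \<otimes> b) = \<delta> a \<otimes> b \<oplus> a \<otimes> \<delta> b"

definition delta_ideal :: "('r, 'm) ring_scheme \<Rightarrow> ('r \<Rightarrow> 'r) \<Rightarrow> 'r set \<Rightarrow> bool" where
  "delta_ideal R \<delta> I \<longleftrightarrow> ideal I R \<and> \<delta> ` I \<subseteq> I"

definition delta_primitive :: "('r, 'm) ring_scheme \<Rightarrow> ('r \<Rightarrow> 'r) \<Rightarrow> bool" where
  "delta_primitive R \<delta> \<longleftrightarrow>
     (\<exists>M. maximalideal M R \<and> (\<forall>I. delta_ideal R \<delta> I \<and> I \<subseteq> M \<longrightarrow> I = {\<zero>\<^bsub>R\<^esub>}))"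


section \<open>The differential operator ring\<close>

text \<open>The sequence \<open>p\<close> of coefficients (finitely many of which are nonzero) stands for
  \<open>\<Sum>i. p i \<theta>\<^sup>i\<close>, so that addition is coefficientwise. Left multiplication by
  \<open>\<theta>\<close> is determined by \<open>\<theta> (a \<theta>\<^sup>j) = a \<theta>\<^sup>j\<^sup>+\<^sup>1 + \<delta>(a) \<theta>\<^sup>j\<close>, and a general product is
  \<open>p q = \<Sum>i. p i (\<theta>\<^sup>i q)\<close>. The set \<open>up R\<close> of finitely supported sequences is the library's
  carrier of the univariate polynomials.\<close>

definition theta_times ::
    "('r, 'm) ring_scheme \<Rightarrow> ('r \<Rightarrow> 'r) \<Rightarrow> (nat \<Rightarrow> 'r) \<Rightarrow> nat \<Rightarrow> 'r" where
  "theta_times R \<delta> q = (\<lambda>n. (case n of 0 \<Rightarrow> \<zero>\<^bsub>R\<^esub> | Suc m \<Rightarrow> q m) \<oplus>\<^bsub>R\<^esub> \<delta> (q n))"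

definition diff_op_ring :: "('r, 'm) ring_scheme \<Rightarrow> ('r \<Rightarrow> 'r) \<Rightarrow> (nat \<Rightarrow> 'r) ring" where
  "diff_op_ring R \<delta> = \<lparr>
     carrier = up R,
     monoid.mult = (\<lambda>p q n. \<Oplus>\<^bsub>R\<^esub>i \<in> {i. p i \<noteq> \<zero>\<^bsub>R\<^esub>}. p i \<otimes>\<^bsub>R\<^esub> (theta_times R \<delta> ^^ i) q n),
     one = (\<lambda>n. if n = 0 then \<one>\<^bsub>R\<^esub> else \<zero>\<^bsub>R\<^esub>),
     ring.zero = (\<lambda>n. \<zero>\<^bsub>R\<^esub>),
     ring.add = (\<lambda>p q n. p n \<oplus>\<^bsub>R\<^esub> q n)\<rparr>"

definition dconst :: "('r, 'm) ring_scheme \<Rightarrow> 'r \<Rightarrow> nat \<Rightarrow> 'r" where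
  "dconst R a = (\<lambda>n. if n = 0 then a else \<zero>\<^bsub>R\<^esub>)"

definition dtheta :: "('r, 'm) ring_scheme \<Rightarrow> nat \<Rightarrow> 'r" where
  "dtheta R = (\<lambda>n. if n = 1 then \<one>\<^bsub>R\<^esub> else \<zero>\<^bsub>R\<^esub>)"


subsection \<open>It is a ring with the defining presentation\<close>

text \<open>Besides the ring axioms, we check that \<open>dconst R\<close> embeds \<open>R\<close> as a ring, that
  \<open>\<theta> a = a \<theta> + \<delta>(a)\<close>, and that \<open>a \<theta>\<^sup>n\<close> is the sequence with the single
  entry \<open>a\<close> at \<open>n\<close>, so that the powers of \<open>\<theta>\<close> form a left basis.\<close>

context derivation
begin

abbreviation "T \<equiv> theta_times R \<delta>"
abbreviation "S \<equiv> diff_op_ring R \<delta>"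

lemma deriv_zero [simp]: "\<delta> \<zero> = \<zero>"
  by (metis R.add.l_cancel_one' R.l_zero R.zero_closed deriv_add deriv_closed)

lemma deriv_one [simp]: "\<delta> \<one> = \<zero>"
proof -
  have "\<delta> (\<one> \<otimes> \<one>) = \<delta> \<one> \<oplus> \<delta> \<one>" by (subst deriv_mult) auto
  then show ?thesis by (metis R.add.l_cancel_one' R.l_one R.one_closed deriv_closed)
qed

lemma deriv_finsum:
  "finite A \<Longrightarrow> f \<in> A \<rightarrow> carrier R \<Longrightarrow> \<delta> (finsum R f A) = finsum R (\<lambda>i. \<delta> (f i)) A"
  by (induction A rule: finite_induct) (auto simp: deriv_add finsum_insert finsum_closed Pi_def)

lemma up_bound: "p \<in> up R \<Longrightarrow> \<exists>N. \<forall>n>N. p n = \<zero>"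
  by (auto simp: up_def bound_def)

lemma upI: "(\<And>n. p n \<in> carrier R) \<Longrightarrow> (\<And>n. n > N \<Longrightarrow> p n = \<zero>) \<Longrightarrow> p \<in> up R"
  by (auto simp: up_def bound_def)

lemma up_closed [simp]: "p \<in> up R \<Longrightarrow> p n \<in> carrier R"
  by (auto simp: up_def)

lemma up_add [simp]: "p \<in> up R \<Longrightarrow> q \<in> up R \<Longrightarrow> (\<lambda>n. p n \<oplus> q n) \<in> up R"
  by (rule up_add_closed)

lemma up_scale [simp]:
  assumes "a \<in> carrier R" "p \<in> up R" shows "(\<lambda>n. a \<otimes> p n) \<in> up R"
proof -
  obtain N where "\<forall>n>N. p n = \<zero>" using assms(2) up_bound by blast
  then show ?thesis using assms by (intro upI[of _ N]) auto
qed

lemma up_dconst [simp]: "a \<in> carrier R \<Longrightarrow> dconst R a \<in> up R"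
  by (rule upI[of _ 0]) (auto simp: dconst_def)

lemma up_T [simp]:
  assumes "p \<in> up R" shows "T p \<in> up R"
proof -
  obtain N where "\<forall>n>N. p n = \<zero>" using assms(1) up_bound by blast
  then show ?thesis using assms by (intro upI[of _ "Suc N"]) (auto simp: theta_times_def split: nat.split)
qed

lemma up_funpow_T [simp]: "p \<in> up R \<Longrightarrow> (T ^^ i) p \<in> up R"
  by (induction i) auto

lemma T_add: "p \<in> up R \<Longrightarrow> q \<in> up R \<Longrightarrow> T (\<lambda>n. p n \<oplus> q n) = (\<lambda>n. T p n \<oplus> T q n)"
  by (auto simp: theta_times_def deriv_add fun_eq_iff R.a_ac split: nat.split)

lemma up_induct [consumes 1, case_names const add theta]:
  assumes "p \<in> up R"
    and const: "\<And>a. a \<in> carrier R \<Longrightarrow> P (dconst R a)"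
    and add: "\<And>p q. p \<in> up R \<Longrightarrow> q \<in> up R \<Longrightarrow> P p \<Longrightarrow> P q \<Longrightarrow> P (\<lambda>n. p n \<oplus> q n)"
    and theta: "\<And>p. p \<in> up R \<Longrightarrow> P p \<Longrightarrow> P (T p)"
  shows "P p"
proof -
  have "P p" if "\<And>n. p n \<in> carrier R" "\<And>n. n > N \<Longrightarrow> p n = \<zero>" for N p
    using that
  proof (induction N arbitrary: p)
    case 0
    then have "p = dconst R (p 0)" by (auto simp: dconst_def fun_eq_iff)
    then show ?case using const[of "p 0"] 0(1) by simp
  next
    case (Suc N)
    define p' where "p' = (\<lambda>n. p (Suc n))"
    define q where "q = (\<lambda>n. if n = 0 then p 0 \<ominus> \<delta> (p (Suc 0)) else \<ominus> \<delta> (p (Suc n)))"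
    have p': "\<And>n. p' n \<in> carrier R" "\<And>n. n > N \<Longrightarrow> p' n = \<zero>"
      using Suc.prems by (auto simp: p'_def)
    have q: "\<And>n. q n \<in> carrier R" "\<And>n. n > N \<Longrightarrow> q n = \<zero>"
      using Suc.prems by (auto simp: q_def)
    have "p n = T p' n \<oplus> q n" for n
    proof (cases n)
      case 0
      have "p 0 \<in> carrier R" "\<delta> (p (Suc 0)) \<in> carrier R" using Suc.prems by auto
      then have "p 0 = \<zero> \<oplus> \<delta> (p (Suc 0)) \<oplus> (p 0 \<ominus> \<delta> (p (Suc 0)))"
        by algebra
      then show ?thesis using 0 by (simp add: theta_times_def p'_def q_def)
    next
      case (Suc m)
      have "p n \<in> carrier R" "\<delta> (p (Suc n)) \<in> carrier R" using Suc.prems by auto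
      then have "p n = p n \<oplus> \<delta> (p (Suc n)) \<oplus> (\<ominus> \<delta> (p (Suc n)))"
        by algebra
      then show ?thesis using Suc by (simp add: theta_times_def p'_def q_def)
    qed
    then have "p = (\<lambda>n. T p' n \<oplus> q n)" by blast
    moreover have "p' \<in> up R" using p' by (rule upI)
    moreover have "q \<in> up R" using q by (rule upI)
    ultimately show ?case
      using add[of "T p'" q] theta[of p'] Suc.IH[OF p'] Suc.IH[OF q] by simp
  qed
  then show ?thesis using assms(1) up_bound up_closed by blast
qed

lemma dmult_bound:
  assumes "p \<in> up R" "q \<in> up R" "\<And>n. n > N \<Longrightarrow> p n = \<zero>"
  shows "(p \<otimes>\<^bsub>S\<^esub> q) n = (\<Oplus>i\<in>{..N}. p i \<otimes> (T ^^ i) q n)"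
proof -
  have "{i. p i \<noteq> \<zero>} \<subseteq> {..N}" using assms(3) by (force simp: not_less[symmetric])
  then have "(\<Oplus>i\<in>{i. p i \<noteq> \<zero>}. p i \<otimes> (T ^^ i) q n) = (\<Oplus>i\<in>{..N}. p i \<otimes> (T ^^ i) q n)"
    using assms(1,2) by (intro R.add.finprod_mono_neutral_cong_left) auto
  then show ?thesis by (simp add: diff_op_ring_def)
qed

lemma dmult_const:
  assumes "a \<in> carrier R" "q \<in> up R" shows "dconst R a \<otimes>\<^bsub>S\<^esub> q = (\<lambda>n. a \<otimes> q n)"
proof
  fix n
  have "dconst R a m = \<zero>" if "m > 0" for m using that by (simp add: dconst_def)
  then have "(dconst R a \<otimes>\<^bsub>S\<^esub> q) n = (\<Oplus>i\<in>{..0}. dconst R a i \<otimes> (T ^^ i) q n)"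
    by (rule dmult_bound[OF up_dconst[OF assms(1)] assms(2)])
  then show "(dconst R a \<otimes>\<^bsub>S\<^esub> q) n = a \<otimes> q n"
    using assms by (simp add: dconst_def[of R a])
qed

lemma dmult_add_left:
  assumes "p \<in> up R" "p' \<in> up R" "q \<in> up R"
  shows "(\<lambda>n. p n \<oplus> p' n) \<otimes>\<^bsub>S\<^esub> q = (\<lambda>n. (p \<otimes>\<^bsub>S\<^esub> q) n \<oplus> (p' \<otimes>\<^bsub>S\<^esub> q) n)"
proof
  fix n
  obtain N N' where N: "\<forall>n>N. p n = \<zero>" "\<forall>n>N'. p' n = \<zero>"
    using assms up_bound by blast
  show "((\<lambda>n. p n \<oplus> p' n) \<otimes>\<^bsub>S\<^esub> q) n = (p \<otimes>\<^bsub>S\<^esub> q) n \<oplus> (p' \<otimes>\<^bsub>S\<^esub> q) n"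
  proof -
    let ?N = "max N N'"
    have "((\<lambda>n. p n \<oplus> p' n) \<otimes>\<^bsub>S\<^esub> q) n = (\<Oplus>i\<in>{..?N}. (p i \<oplus> p' i) \<otimes> (T ^^ i) q n)"
      using N by (intro dmult_bound up_add assms) simp
    also have "\<dots> = (\<Oplus>i\<in>{..?N}. p i \<otimes> (T ^^ i) q n \<oplus> p' i \<otimes> (T ^^ i) q n)"
      using assms by (intro R.finsum_cong') (auto simp: R.l_distr)
    also have "\<dots> = (\<Oplus>i\<in>{..?N}. p i \<otimes> (T ^^ i) q n) \<oplus> (\<Oplus>i\<in>{..?N}. p' i \<otimes> (T ^^ i) q n)"
      using assms by (intro R.finsum_addf) auto
    also have "(\<Oplus>i\<in>{..?N}. p i \<otimes> (T ^^ i) q n) = (p \<otimes>\<^bsub>S\<^esub> q) n"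
      using N by (intro dmult_bound[symmetric] assms) simp
    also have "(\<Oplus>i\<in>{..?N}. p' i \<otimes> (T ^^ i) q n) = (p' \<otimes>\<^bsub>S\<^esub> q) n"
      using N by (intro dmult_bound[symmetric] assms) simp
    finally show ?thesis .
  qed
qed

lemma dmult_scale:
  assumes "a \<in> carrier R" "p \<in> up R" "q \<in> up R"
  shows "(\<lambda>n. a \<otimes> p n) \<otimes>\<^bsub>S\<^esub> q = (\<lambda>n. a \<otimes> (p \<otimes>\<^bsub>S\<^esub> q) n)"
proof
  fix n
  obtain N where N: "\<forall>n>N. p n = \<zero>" using assms up_bound by blast
  show "((\<lambda>n. a \<otimes> p n) \<otimes>\<^bsub>S\<^esub> q) n = a \<otimes> (p \<otimes>\<^bsub>S\<^esub> q) n"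
  proof -
    have "((\<lambda>n. a \<otimes> p n) \<otimes>\<^bsub>S\<^esub> q) n = (\<Oplus>i\<in>{..N}. a \<otimes> p i \<otimes> (T ^^ i) q n)"
      using N assms by (intro dmult_bound up_scale) auto
    also have "\<dots> = (\<Oplus>i\<in>{..N}. a \<otimes> (p i \<otimes> (T ^^ i) q n))"
      using assms by (intro R.finsum_cong') (auto simp: R.m_assoc)
    also have "\<dots> = a \<otimes> (\<Oplus>i\<in>{..N}. p i \<otimes> (T ^^ i) q n)"
      using assms by (intro R.finsum_rdistr[symmetric]) auto
    also have "(\<Oplus>i\<in>{..N}. p i \<otimes> (T ^^ i) q n) = (p \<otimes>\<^bsub>S\<^esub> q) n"
      using N by (intro dmult_bound[symmetric] assms) simp
    finally show ?thesis .
  qed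
qed

lemma dmult_T:
  assumes p: "p \<in> up R" and q: "q \<in> up R"
  shows "T p \<otimes>\<^bsub>S\<^esub> q = T (p \<otimes>\<^bsub>S\<^esub> q)"
proof
  fix n
  obtain N where N: "\<And>n. n > N \<Longrightarrow> p n = \<zero>" using p up_bound by blast
  define t where "t = (\<lambda>i m. (T ^^ i) q m)"
  have t [simp]: "t i m \<in> carrier R" for i m using q by (simp add: t_def)
  define s where "s = (\<lambda>i. case n of 0 \<Rightarrow> \<zero> | Suc m \<Rightarrow> t i m)"
  have s [simp]: "s i \<in> carrier R" for i by (auto simp: s_def split: nat.split)
  have tS: "t (Suc i) n = s i \<oplus> \<delta> (t i n)" for i
    by (cases n) (simp_all add: t_def s_def theta_times_def)
  define c where "c = (\<lambda>i. case i of 0 \<Rightarrow> \<zero> | Suc m \<Rightarrow> p m)"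
  have c [simp]: "c i \<in> carrier R" for i using p by (auto simp: c_def split: nat.split)
  have pq: "(p \<otimes>\<^bsub>S\<^esub> q) m = (\<Oplus>i\<in>{..N}. p i \<otimes> t i m)" for m
    unfolding t_def by (rule dmult_bound[OF p q]) (use N in auto)
  have c0: "c 0 = \<zero>" and cS: "c (Suc i) = p i" for i by (simp_all add: c_def)
  have pc [simp]: "p i \<in> carrier R" for i using p by simp
  have Tp: "T p i = c i \<oplus> \<delta> (p i)" for i by (simp add: theta_times_def c_def)
  have "(T p \<otimes>\<^bsub>S\<^esub> q) n = (\<Oplus>i\<in>{..Suc N}. T p i \<otimes> t i n)"
    unfolding t_def
    by (rule dmult_bound[OF up_T[OF p] q]) (use N in \<open>auto simp: theta_times_def split: nat.split\<close>)
  also have "\<dots> = (\<Oplus>i\<in>{..Suc N}. c i \<otimes> t i n \<oplus> \<delta> (p i) \<otimes> t i n)"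
    by (intro R.finsum_cong') (auto simp: Tp R.l_distr)
  also have "\<dots> = (\<Oplus>i\<in>{..Suc N}. c i \<otimes> t i n) \<oplus> (\<Oplus>i\<in>{..Suc N}. \<delta> (p i) \<otimes> t i n)"
    by (intro R.finsum_addf) auto
  also have "(\<Oplus>i\<in>{..Suc N}. c i \<otimes> t i n) = (\<Oplus>i\<in>{..N}. p i \<otimes> t (Suc i) n)"
    by (subst R.finsum_Suc2) (auto simp: c0 cS R.finsum_closed)
  also have "(\<Oplus>i\<in>{..Suc N}. \<delta> (p i) \<otimes> t i n) = (\<Oplus>i\<in>{..N}. \<delta> (p i) \<otimes> t i n)"
    using N[of "Suc N"] by (subst R.finsum_Suc) (auto simp: R.finsum_closed)
  also have "(\<Oplus>i\<in>{..N}. p i \<otimes> t (Suc i) n) =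
      (\<Oplus>i\<in>{..N}. p i \<otimes> s i) \<oplus> (\<Oplus>i\<in>{..N}. p i \<otimes> \<delta> (t i n))"
    by (subst R.finsum_addf[symmetric]) (auto simp: tS R.r_distr intro!: R.finsum_cong')
  finally have "(T p \<otimes>\<^bsub>S\<^esub> q) n = (\<Oplus>i\<in>{..N}. p i \<otimes> s i) \<oplus>
      ((\<Oplus>i\<in>{..N}. \<delta> (p i) \<otimes> t i n) \<oplus> (\<Oplus>i\<in>{..N}. p i \<otimes> \<delta> (t i n)))"
    by (simp add: R.a_ac R.finsum_closed)
  also have "(\<Oplus>i\<in>{..N}. \<delta> (p i) \<otimes> t i n) \<oplus> (\<Oplus>i\<in>{..N}. p i \<otimes> \<delta> (t i n)) =
      (\<Oplus>i\<in>{..N}. \<delta> (p i \<otimes> t i n))"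
    by (subst R.finsum_addf[symmetric]) (auto simp: deriv_mult intro!: R.finsum_cong')
  also have "\<dots> = \<delta> ((p \<otimes>\<^bsub>S\<^esub> q) n)"
    unfolding pq by (subst deriv_finsum) auto
  also have "(\<Oplus>i\<in>{..N}. p i \<otimes> s i) = (case n of 0 \<Rightarrow> \<zero> | Suc m \<Rightarrow> (p \<otimes>\<^bsub>S\<^esub> q) m)"
    by (cases n) (auto simp: s_def pq R.finsum_zero intro!: R.add.finprod_one_eqI)
  finally show "(T p \<otimes>\<^bsub>S\<^esub> q) n = T (p \<otimes>\<^bsub>S\<^esub> q) n" by (simp add: theta_times_def)
qed

lemma dmult_closed [simp]: "p \<in> up R \<Longrightarrow> q \<in> up R \<Longrightarrow> p \<otimes>\<^bsub>S\<^esub> q \<in> up R"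
  by (induction p rule: up_induct) (simp_all add: dmult_const dmult_add_left dmult_T)

lemma dmult_add_right:
  assumes "p \<in> up R" "q \<in> up R" "q' \<in> up R"
  shows "p \<otimes>\<^bsub>S\<^esub> (\<lambda>n. q n \<oplus> q' n) = (\<lambda>n. (p \<otimes>\<^bsub>S\<^esub> q) n \<oplus> (p \<otimes>\<^bsub>S\<^esub> q') n)"
  using assms(1)
proof (induction p rule: up_induct)
  case (const a)
  then show ?case using assms by (simp add: dmult_const R.r_distr)
next
  case (add p p')
  then show ?case using assms by (simp add: dmult_add_left R.a_ac)
next
  case (theta p)
  then show ?case using assms by (simp add: dmult_T T_add)
qed

lemma dmult_assoc:
  assumes "p \<in> up R" "q \<in> up R" "r \<in> up R"
  shows "(p \<otimes>\<^bsub>S\<^esub> q) \<otimes>\<^bsub>S\<^esub> r = p \<otimes>\<^bsub>S\<^esub> (q \<otimes>\<^bsub>S\<^esub> r)"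
  using assms(1)
proof (induction p rule: up_induct)
  case (const a)
  then show ?case using assms by (simp add: dmult_const dmult_scale)
next
  case (add p p')
  then show ?case using assms by (simp add: dmult_add_left)
next
  case (theta p)
  then show ?case using assms by (simp add: dmult_T)
qed

lemma diff_op_simps:
  "carrier S = up R" "\<one>\<^bsub>S\<^esub> = dconst R \<one>" "\<zero>\<^bsub>S\<^esub> = (\<lambda>n. \<zero>)" "p \<oplus>\<^bsub>S\<^esub> q = (\<lambda>n. p n \<oplus> q n)"
  by (simp_all add: diff_op_ring_def dconst_def)

lemma dmult_one_right: "p \<in> up R \<Longrightarrow> p \<otimes>\<^bsub>S\<^esub> dconst R \<one> = p"
proof (induction p rule: up_induct)
  case (const a)
  then have "dconst R a \<otimes>\<^bsub>S\<^esub> dconst R \<one> = (\<lambda>n. a \<otimes> dconst R \<one> n)"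
    by (simp add: dmult_const)
  then show ?case using const by (auto simp: dconst_def fun_eq_iff)
qed (simp_all add: dmult_add_left dmult_T)

theorem diff_op_ring_ring: "ring S"
proof (rule ringI)
  show "abelian_group S"
  proof (rule abelian_groupI)
    fix p assume "p \<in> carrier S"
    then have p: "p \<in> up R" by (simp add: diff_op_simps)
    then obtain N where "\<forall>n>N. p n = \<zero>" using up_bound by blast
    then have "(\<lambda>n. \<ominus> p n) \<in> up R" using p by (intro upI[of _ N]) auto
    then show "\<exists>q\<in>carrier S. q \<oplus>\<^bsub>S\<^esub> p = \<zero>\<^bsub>S\<^esub>"
      using p by (auto simp: diff_op_simps R.l_neg intro!: bexI[of _ "\<lambda>n. \<ominus> p n"])
  qed (auto simp: diff_op_simps R.a_ac intro: upI)
  show "Group.monoid S"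
    by (rule Group.monoidI)
       (auto simp: diff_op_simps dmult_assoc dmult_one_right dmult_const)
qed (auto simp: diff_op_simps dmult_add_left dmult_add_right)

lemma dconst_ring_hom: "dconst R \<in> ring_hom R S"
  by (rule ring_hom_memI) (auto simp: diff_op_simps dmult_const, auto simp: dconst_def)

lemma dtheta_eq: "dtheta R = T (dconst R \<one>)"
  by (auto simp: dtheta_def theta_times_def dconst_def fun_eq_iff split: nat.split)

lemma dtheta_closed: "dtheta R \<in> carrier S"
  by (simp add: dtheta_eq diff_op_simps)

lemma dtheta_mult: "q \<in> up R \<Longrightarrow> dtheta R \<otimes>\<^bsub>S\<^esub> q = T q"
  by (simp add: dtheta_eq dmult_T dmult_const)

theorem dtheta_commute:
  assumes a: "a \<in> carrier R"
  shows "dtheta R \<otimes>\<^bsub>S\<^esub> dconst R a = dconst R a \<otimes>\<^bsub>S\<^esub> dtheta R \<oplus>\<^bsub>S\<^esub> dconst R (\<delta> a)"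
proof -
  have "dtheta R \<in> up R" using dtheta_closed by (simp add: diff_op_simps)
  then have "dconst R a \<otimes>\<^bsub>S\<^esub> dtheta R = (\<lambda>n. a \<otimes> dtheta R n)" using a by (simp add: dmult_const)
  moreover have "dtheta R \<otimes>\<^bsub>S\<^esub> dconst R a = T (dconst R a)" using a by (simp add: dtheta_mult)
  ultimately show ?thesis
    using a by (auto simp: diff_op_simps fun_eq_iff theta_times_def dconst_def dtheta_def
        split: nat.split)
qed

theorem monomial_eq:
  assumes "a \<in> carrier R"
  shows "dconst R a \<otimes>\<^bsub>S\<^esub> (dtheta R [^]\<^bsub>S\<^esub> n) = (\<lambda>m. if m = n then a else \<zero>)"
proof -
  interpret S: ring S by (rule diff_op_ring_ring)
  have "dtheta R [^]\<^bsub>S\<^esub> n = (\<lambda>m. if m = n then \<one> else \<zero>)"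
  proof (induction n)
    case (Suc n)
    have "dtheta R [^]\<^bsub>S\<^esub> Suc n = T (dtheta R [^]\<^bsub>S\<^esub> n)"
      using dtheta_closed S.nat_pow_closed[OF dtheta_closed, of n]
      by (subst S.nat_pow_Suc2) (simp_all add: dtheta_mult diff_op_simps)
    also have "\<dots> = (\<lambda>m. if m = Suc n then \<one> else \<zero>)"
      unfolding Suc by (auto simp: theta_times_def fun_eq_iff split: nat.split)
    finally show ?case .
  qed (auto simp: diff_op_simps dconst_def)
  then show ?thesis
    using assms dmult_const[of a "dtheta R [^]\<^bsub>S\<^esub> n"] S.nat_pow_closed[OF dtheta_closed, of n]
    by (auto simp: diff_op_simps fun_eq_iff)
qed

end


section \<open>Left modules over a ring that need not be commutative\<close>

text \<open>The axioms are those of the library locale \<open>module\<close>, which requires a commutative ring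
  of scalars. The library predicate \<open>submodule\<close> makes no such requirement.\<close>

locale left_module = S?: ring S + M?: abelian_group M
  for S :: "('s, 'm) ring_scheme" (structure) and M :: "('s, 'a, 'n) module_scheme" (structure) +
  assumes smult_closed [simp, intro]:
      "\<lbrakk>s \<in> carrier S; x \<in> carrier M\<rbrakk> \<Longrightarrow> s \<odot>\<^bsub>M\<^esub> x \<in> carrier M"
    and smult_l_distr:
      "\<lbrakk>s \<in> carrier S; t \<in> carrier S; x \<in> carrier M\<rbrakk> \<Longrightarrow>
       (s \<oplus> t) \<odot>\<^bsub>M\<^esub> x = s \<odot>\<^bsub>M\<^esub> x \<oplus>\<^bsub>M\<^esub> t \<odot>\<^bsub>M\<^esub> x"
    and smult_r_distr:
      "\<lbrakk>s \<in> carrier S; x \<in> carrier M; y \<in> carrier M\<rbrakk> \<Longrightarrow>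
       s \<odot>\<^bsub>M\<^esub> (x \<oplus>\<^bsub>M\<^esub> y) = s \<odot>\<^bsub>M\<^esub> x \<oplus>\<^bsub>M\<^esub> s \<odot>\<^bsub>M\<^esub> y"
    and smult_assoc:
      "\<lbrakk>s \<in> carrier S; t \<in> carrier S; x \<in> carrier M\<rbrakk> \<Longrightarrow>
       (s \<otimes> t) \<odot>\<^bsub>M\<^esub> x = s \<odot>\<^bsub>M\<^esub> (t \<odot>\<^bsub>M\<^esub> x)"
    and smult_one [simp]: "x \<in> carrier M \<Longrightarrow> \<one> \<odot>\<^bsub>M\<^esub> x = x"

definition simple_module :: "('s, 'm) ring_scheme \<Rightarrow> ('s, 'a, 'n) module_scheme \<Rightarrow> bool" where
  "simple_module S M \<longleftrightarrow> left_module S M \<and> carrier M \<noteq> {\<zero>\<^bsub>M\<^esub>} \<and>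
     (\<forall>N. submodule N S M \<longrightarrow> N = {\<zero>\<^bsub>M\<^esub>} \<or> N = carrier M)"

definition cyclic_module :: "('s, 'm) ring_scheme \<Rightarrow> ('s, 'a, 'n) module_scheme \<Rightarrow> bool" where
  "cyclic_module S M \<longleftrightarrow> left_module S M \<and>
     (\<exists>x \<in> carrier M. carrier M = (\<lambda>s. s \<odot>\<^bsub>M\<^esub> x) ` carrier S)"

definition faithful_module :: "('s, 'm) ring_scheme \<Rightarrow> ('s, 'a, 'n) module_scheme \<Rightarrow> bool" where
  "faithful_module S M \<longleftrightarrow> left_module S M \<and>
     (\<forall>s \<in> carrier S. (\<forall>x \<in> carrier M. s \<odot>\<^bsub>M\<^esub> x = \<zero>\<^bsub>M\<^esub>) \<longrightarrow> s = \<zero>\<^bsub>S\<^esub>)"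

definition essential_submodule ::
    "('s, 'm) ring_scheme \<Rightarrow> 'a set \<Rightarrow> ('s, 'a, 'n) module_scheme \<Rightarrow> bool" where
  "essential_submodule S N M \<longleftrightarrow> left_module S M \<and> submodule N S M \<and>
     (\<forall>L. submodule L S M \<and> L \<noteq> {\<zero>\<^bsub>M\<^esub>} \<longrightarrow> N \<inter> L \<noteq> {\<zero>\<^bsub>M\<^esub>})"

definition artinian_module :: "('s, 'm) ring_scheme \<Rightarrow> ('s, 'a, 'n) module_scheme \<Rightarrow> bool" where
  "artinian_module S M \<longleftrightarrow> left_module S M \<and>
     (\<forall>C :: nat \<Rightarrow> 'a set.
        (\<forall>i. submodule (C i) S M) \<and> (\<forall>i. C (Suc i) \<subseteq> C i) \<longrightarrow>
        (\<exists>n. \<forall>i\<ge>n. C i = C n))"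

text \<open>HOL cannot quantify over the types of module elements inside a formula. Both definitions
  below let modules range over the type of sets of ring elements; up to isomorphism these
  include every cyclic module, since the quotient of \<open>S\<close> by a left ideal consists of cosets.
  The lemmas \<open>diamondD\<close> and \<open>primitive_ringI\<close> below show that nothing is lost for modules whose
  elements have any other type.\<close>

definition diamond :: "('s, 'm) ring_scheme \<Rightarrow> bool" where
  "diamond S \<longleftrightarrow> (\<forall>(M :: ('s, 's set) module) N.
     cyclic_module S M \<and> essential_submodule S N M \<and> simple_module S (M\<lparr>carrier := N\<rparr>) \<longrightarrow>
     artinian_module S M)"

definition primitive_ring :: "('s, 'm) ring_scheme \<Rightarrow> bool" where
  "primitive_ring S \<longleftrightarrow>
     (\<exists>M :: ('s, 's set) module. simple_module S M \<and> faithful_module S M)"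


subsection \<open>Independence of the type of module elements\<close>

context left_module
begin

lemma smult_l_null: "x \<in> carrier M \<Longrightarrow> \<zero> \<odot>\<^bsub>M\<^esub> x = \<zero>\<^bsub>M\<^esub>"
  by (metis M.add.r_cancel_one' S.l_zero S.zero_closed smult_closed smult_l_distr)

lemma smult_l_minus_one: "x \<in> carrier M \<Longrightarrow> (\<ominus> \<one>) \<odot>\<^bsub>M\<^esub> x = \<ominus>\<^bsub>M\<^esub> x"
  by (metis M.minus_equality S.a_inv_closed S.l_neg S.one_closed smult_closed
      smult_l_distr smult_l_null smult_one)

lemma submodule_iff:
  "submodule N S M \<longleftrightarrow> N \<subseteq> carrier M \<and> \<zero>\<^bsub>M\<^esub> \<in> N \<and>
     (\<forall>x\<in>N. \<forall>y\<in>N. x \<oplus>\<^bsub>M\<^esub> y \<in> N) \<and> (\<forall>s\<in>carrier S. \<forall>x\<in>N. s \<odot>\<^bsub>M\<^esub> x \<in> N)"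
  (is "_ \<longleftrightarrow> ?R")
proof
  assume "submodule N S M"
  then interpret N: submodule N S M .
  show ?R using N.subset N.one_closed N.m_closed N.smult_closed by auto
next
  assume R: ?R
  then have "inv\<^bsub>add_monoid M\<^esub> x \<in> N" if "x \<in> N" for x
    using that smult_l_minus_one[of x] S.a_inv_closed[OF S.one_closed]
    unfolding a_inv_def[symmetric] by (metis subsetD)
  with R show "submodule N S M"
    by (auto intro!: submodule.intro subgroup.intro submodule_axioms.intro)
qed

end

lemma submodule_subset: "submodule N S M \<Longrightarrow> N \<subseteq> carrier M"
  using subgroup.subset submodule.axioms(1) by fastforce

lemma submodule_zero: "submodule N S M \<Longrightarrow> \<zero>\<^bsub>M\<^esub> \<in> N"
  using subgroup.one_closed submodule.axioms(1) by fastforce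

definition module_iso ::
    "('s, 'm) ring_scheme \<Rightarrow> ('s, 'a, 'n) module_scheme \<Rightarrow> ('s, 'b, 'o) module_scheme \<Rightarrow>
     ('a \<Rightarrow> 'b) \<Rightarrow> bool" where
  "module_iso S M M' h \<longleftrightarrow> left_module S M \<and> left_module S M' \<and>
     bij_betw h (carrier M) (carrier M') \<and>
     (\<forall>x\<in>carrier M. \<forall>y\<in>carrier M. h (x \<oplus>\<^bsub>M\<^esub> y) = h x \<oplus>\<^bsub>M'\<^esub> h y) \<and>
     (\<forall>s\<in>carrier S. \<forall>x\<in>carrier M. h (s \<odot>\<^bsub>M\<^esub> x) = s \<odot>\<^bsub>M'\<^esub> h x)"

lemma module_iso_sym:
  assumes "module_iso S M M' h"
  shows "module_iso S M' M (inv_into (carrier M) h)"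
proof -
  interpret M: left_module S M using assms by (simp add: module_iso_def)
  interpret M': left_module S M' using assms by (simp add: module_iso_def)
  have bij: "bij_betw h (carrier M) (carrier M')" using assms by (simp add: module_iso_def)
  let ?g = "inv_into (carrier M) h"
  have g: "?g y \<in> carrier M" "h (?g y) = y" if "y \<in> carrier M'" for y
    using that bij by (auto simp: bij_betw_def inv_into_into f_inv_into_f)
  have gh: "?g (h x) = x" if "x \<in> carrier M" for x
    using that bij by (auto simp: bij_betw_def)
  have "?g (x \<oplus>\<^bsub>M'\<^esub> y) = ?g x \<oplus>\<^bsub>M\<^esub> ?g y" if "x \<in> carrier M'" "y \<in> carrier M'" for x y
  proof -
    have "h (?g x \<oplus>\<^bsub>M\<^esub> ?g y) = x \<oplus>\<^bsub>M'\<^esub> y"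
      using assms that g by (simp add: module_iso_def)
    then show ?thesis using gh[of "?g x \<oplus>\<^bsub>M\<^esub> ?g y"] g that by simp
  qed
  moreover have "?g (s \<odot>\<^bsub>M'\<^esub> x) = s \<odot>\<^bsub>M\<^esub> ?g x" if "s \<in> carrier S" "x \<in> carrier M'" for s x
  proof -
    have "h (s \<odot>\<^bsub>M\<^esub> ?g x) = s \<odot>\<^bsub>M'\<^esub> x"
      using assms that g by (simp add: module_iso_def)
    then show ?thesis using gh[of "s \<odot>\<^bsub>M\<^esub> ?g x"] g that by simp
  qed
  ultimately show ?thesis
    using assms bij by (simp add: module_iso_def bij_betw_inv_into)
qed

lemma module_iso_zero:
  assumes "module_iso S M M' h"
  shows "h \<zero>\<^bsub>M\<^esub> = \<zero>\<^bsub>M'\<^esub>"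
proof -
  interpret M: left_module S M using assms by (simp add: module_iso_def)
  interpret M': left_module S M' using assms by (simp add: module_iso_def)
  have c: "h \<zero>\<^bsub>M\<^esub> \<in> carrier M'" using assms by (auto simp: module_iso_def bij_betw_def)
  have "h \<zero>\<^bsub>M\<^esub> = h (\<zero>\<^bsub>S\<^esub> \<odot>\<^bsub>M\<^esub> \<zero>\<^bsub>M\<^esub>)" using M.smult_l_null[of "\<zero>\<^bsub>M\<^esub>"] by simp
  also have "\<dots> = \<zero>\<^bsub>S\<^esub> \<odot>\<^bsub>M'\<^esub> h \<zero>\<^bsub>M\<^esub>" using assms by (simp add: module_iso_def)
  also have "\<dots> = \<zero>\<^bsub>M'\<^esub>" using c by (rule M'.smult_l_null)
  finally show ?thesis .
qed

lemma module_iso_submodule: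
  assumes "module_iso S M M' h" "submodule N S M"
  shows "submodule (h ` N) S M'"
proof -
  interpret M: left_module S M using assms by (simp add: module_iso_def)
  interpret M': left_module S M' using assms by (simp add: module_iso_def)
  have N: "N \<subseteq> carrier M" "\<zero>\<^bsub>M\<^esub> \<in> N" "\<And>x y. x \<in> N \<Longrightarrow> y \<in> N \<Longrightarrow> x \<oplus>\<^bsub>M\<^esub> y \<in> N"
    "\<And>s x. s \<in> carrier S \<Longrightarrow> x \<in> N \<Longrightarrow> s \<odot>\<^bsub>M\<^esub> x \<in> N"
    using assms(2) by (auto simp: M.submodule_iff)
  have h: "\<And>x. x \<in> N \<Longrightarrow> h x \<in> carrier M'"
    "\<And>x y. x \<in> N \<Longrightarrow> y \<in> N \<Longrightarrow> h x \<oplus>\<^bsub>M'\<^esub> h y = h (x \<oplus>\<^bsub>M\<^esub> y)"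
    "\<And>s x. s \<in> carrier S \<Longrightarrow> x \<in> N \<Longrightarrow> s \<odot>\<^bsub>M'\<^esub> h x = h (s \<odot>\<^bsub>M\<^esub> x)"
    using assms(1) N(1) by (auto simp: module_iso_def bij_betw_def subset_iff)
  show ?thesis
    unfolding M'.submodule_iff using N h module_iso_zero[OF assms(1)]
    by (auto intro: rev_image_eqI[of "\<zero>\<^bsub>M\<^esub>"])
qed

lemma left_module_submodule:
  assumes "left_module S M" "submodule N S M"
  shows "left_module S (M\<lparr>carrier := N\<rparr>)"
proof -
  interpret M: left_module S M by fact
  have N: "N \<subseteq> carrier M" "\<zero>\<^bsub>M\<^esub> \<in> N" "\<And>x y. x \<in> N \<Longrightarrow> y \<in> N \<Longrightarrow> x \<oplus>\<^bsub>M\<^esub> y \<in> N"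
    "\<And>s x. s \<in> carrier S \<Longrightarrow> x \<in> N \<Longrightarrow> s \<odot>\<^bsub>M\<^esub> x \<in> N"
    using assms(2) by (auto simp: M.submodule_iff)
  have neg: "\<ominus>\<^bsub>M\<^esub> x \<in> N" if "x \<in> N" for x
    using N(4)[of "\<ominus>\<^bsub>S\<^esub> \<one>\<^bsub>S\<^esub>" x] that N(1) by (auto simp: M.smult_l_minus_one)
  have "abelian_group (M\<lparr>carrier := N\<rparr>)"
  proof (rule abelian_groupI)
    fix x assume "x \<in> carrier (M\<lparr>carrier := N\<rparr>)"
    then show "\<exists>y\<in>carrier (M\<lparr>carrier := N\<rparr>). y \<oplus>\<^bsub>M\<lparr>carrier := N\<rparr>\<^esub> x = \<zero>\<^bsub>M\<lparr>carrier := N\<rparr>\<^esub>"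
      using neg[of x] N(1) by (auto intro!: bexI[of _ "\<ominus>\<^bsub>M\<^esub> x"] simp: M.l_neg subset_iff)
  qed (use N in \<open>auto simp: M.a_ac subset_iff\<close>)
  then show ?thesis
    using N M.S.ring_axioms
    by (auto intro!: left_module.intro left_module_axioms.intro
        simp: M.smult_l_distr M.smult_r_distr M.smult_assoc subset_iff)
qed

lemma module_iso_restrict:
  assumes "module_iso S M M' h" "submodule N S M"
  shows "module_iso S (M\<lparr>carrier := N\<rparr>) (M'\<lparr>carrier := h ` N\<rparr>) h"
proof -
  interpret M: left_module S M using assms by (simp add: module_iso_def)
  have N: "N \<subseteq> carrier M" using assms(2) by (simp add: M.submodule_iff)
  have "left_module S M'" using assms by (simp add: module_iso_def)
  then have "left_module S (M'\<lparr>carrier := h ` N\<rparr>)"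
    using module_iso_submodule[OF assms] by (rule left_module_submodule)
  moreover have "left_module S (M\<lparr>carrier := N\<rparr>)"
    using M.left_module_axioms assms(2) by (rule left_module_submodule)
  ultimately show ?thesis
    using assms(1) N by (auto simp: module_iso_def subset_iff bij_betw_def intro: inj_on_subset)
qed

lemma module_iso_image:
  assumes "module_iso S M M' h" "L \<subseteq> carrier M'"
  shows "h ` inv_into (carrier M) h ` L = L"
  using assms by (metis bij_betw_def image_inv_into_cancel module_iso_def)

lemma module_iso_image':
  assumes "module_iso S M M' h" "L \<subseteq> carrier M"
  shows "inv_into (carrier M) h ` h ` L = L"
  using assms by (metis bij_betw_def inv_into_image_cancel module_iso_def)

lemma module_iso_simple:
  assumes iso: "module_iso S M M' h" and s: "simple_module S M"
  shows "simple_module S M'"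
proof -
  let ?g = "inv_into (carrier M) h"
  have M': "left_module S M'" and im: "h ` carrier M = carrier M'"
    using iso by (auto simp: module_iso_def bij_betw_def)
  have "carrier M' \<noteq> {\<zero>\<^bsub>M'\<^esub>}"
  proof
    assume "carrier M' = {\<zero>\<^bsub>M'\<^esub>}"
    then have "?g ` h ` carrier M = {\<zero>\<^bsub>M\<^esub>}"
      using module_iso_zero[OF module_iso_sym[OF iso]] im by simp
    then show False using s module_iso_image'[OF iso] by (simp add: simple_module_def)
  qed
  moreover have "N = {\<zero>\<^bsub>M'\<^esub>} \<or> N = carrier M'" if N: "submodule N S M'" for N
  proof -
    have "N \<subseteq> carrier M'" using N by (rule submodule_subset)
    then have N': "h ` ?g ` N = N" by (rule module_iso_image[OF iso])
    have "?g ` N = {\<zero>\<^bsub>M\<^esub>} \<or> ?g ` N = carrier M"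
      using s module_iso_submodule[OF module_iso_sym[OF iso] N] by (simp add: simple_module_def)
    then show ?thesis using N' im module_iso_zero[OF iso] by auto
  qed
  ultimately show ?thesis using M' by (simp add: simple_module_def)
qed

lemma module_iso_faithful:
  assumes "module_iso S M M' h" "faithful_module S M"
  shows "faithful_module S M'"
  unfolding faithful_module_def
proof (intro conjI ballI impI)
  interpret M: left_module S M using assms by (simp add: module_iso_def)
  show "left_module S M'" using assms by (simp add: module_iso_def)
  fix s assume s: "s \<in> carrier S" "\<forall>x\<in>carrier M'. s \<odot>\<^bsub>M'\<^esub> x = \<zero>\<^bsub>M'\<^esub>"
  have "s \<odot>\<^bsub>M\<^esub> x = \<zero>\<^bsub>M\<^esub>" if x: "x \<in> carrier M" for x
  proof -
    have "h (s \<odot>\<^bsub>M\<^esub> x) = h \<zero>\<^bsub>M\<^esub>"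
      using assms(1) s x module_iso_zero[OF assms(1)] by (auto simp: module_iso_def bij_betw_def)
    moreover have "inj_on h (carrier M)" using assms(1) by (simp add: module_iso_def bij_betw_def)
    ultimately show ?thesis using s(1) x by (auto dest: inj_onD)
  qed
  then show "s = \<zero>\<^bsub>S\<^esub>" using assms(2) s(1) by (simp add: faithful_module_def)
qed

lemma module_iso_cyclic:
  assumes "module_iso S M M' h" "cyclic_module S M"
  shows "cyclic_module S M'"
proof -
  obtain x where x: "x \<in> carrier M" "carrier M = (\<lambda>s. s \<odot>\<^bsub>M\<^esub> x) ` carrier S"
    using assms(2) by (auto simp: cyclic_module_def)
  have "carrier M' = h ` carrier M" using assms(1) by (simp add: module_iso_def bij_betw_def)
  also have "\<dots> = (\<lambda>s. h (s \<odot>\<^bsub>M\<^esub> x)) ` carrier S" by (subst x(2)) (simp add: image_image)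
  also have "\<dots> = (\<lambda>s. s \<odot>\<^bsub>M'\<^esub> h x) ` carrier S"
    using assms(1) x(1) by (intro image_cong) (auto simp: module_iso_def)
  finally have "carrier M' = (\<lambda>s. s \<odot>\<^bsub>M'\<^esub> h x) ` carrier S" .
  moreover have "h x \<in> carrier M'" "left_module S M'"
    using assms(1) x(1) by (auto simp: module_iso_def bij_betw_def)
  ultimately show ?thesis unfolding cyclic_module_def by blast
qed

lemma module_iso_essential:
  assumes iso: "module_iso S M M' h" and N: "essential_submodule S N M"
  shows "essential_submodule S (h ` N) M'"
proof -
  let ?g = "inv_into (carrier M) h"
  have M': "left_module S M'" and M: "left_module S M" and inj: "inj_on h (carrier M)"
    using iso by (auto simp: module_iso_def bij_betw_def)
  have sub: "submodule N S M" using N by (simp add: essential_submodule_def)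
  then have Nc: "N \<subseteq> carrier M" by (rule submodule_subset)
  have "h ` N \<inter> L \<noteq> {\<zero>\<^bsub>M'\<^esub>}" if L: "submodule L S M'" "L \<noteq> {\<zero>\<^bsub>M'\<^esub>}" for L
  proof
    assume eq: "h ` N \<inter> L = {\<zero>\<^bsub>M'\<^esub>}"
    have Lc: "L \<subseteq> carrier M'" using L(1) by (rule submodule_subset)
    have gL: "submodule (?g ` L) S M"
      by (rule module_iso_submodule[OF module_iso_sym[OF iso] L(1)])
    then have gLc: "?g ` L \<subseteq> carrier M" by (rule submodule_subset)
    have "?g ` L \<noteq> {\<zero>\<^bsub>M\<^esub>}"
      using module_iso_image[OF iso Lc] module_iso_zero[OF iso] L(2) by auto
    then have ne: "N \<inter> ?g ` L \<noteq> {\<zero>\<^bsub>M\<^esub>}"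
      using N gL by (simp add: essential_submodule_def)
    have "h ` (N \<inter> ?g ` L) = h ` N \<inter> L"
      using inj_on_image_Int[OF inj Nc gLc] module_iso_image[OF iso Lc] by simp
    with eq have "h ` (N \<inter> ?g ` L) = h ` {\<zero>\<^bsub>M\<^esub>}" using module_iso_zero[OF iso] by simp
    moreover have "\<zero>\<^bsub>M\<^esub> \<in> carrier M" using submodule_zero[OF sub] Nc by blast
    ultimately show False
      using ne Nc inj_on_image_eq_iff[OF inj, of "N \<inter> ?g ` L" "{\<zero>\<^bsub>M\<^esub>}"] by blast
  qed
  then show ?thesis
    using M' module_iso_submodule[OF iso sub] by (simp add: essential_submodule_def)
qed

lemma module_iso_artinian:
  fixes M :: "('s, 'a, 'n) module_scheme" and M' :: "('s, 'b, 'o) module_scheme"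
  assumes iso: "module_iso S M M' h" and art: "artinian_module S M"
  shows "artinian_module S M'"
  unfolding artinian_module_def
proof (intro conjI allI impI)
  let ?g = "inv_into (carrier M) h"
  show M': "left_module S M'" using iso by (simp add: module_iso_def)
  fix C :: "nat \<Rightarrow> 'b set"
  assume C: "(\<forall>i. submodule (C i) S M') \<and> (\<forall>i. C (Suc i) \<subseteq> C i)"
  then have "\<forall>i. submodule (?g ` C i) S M"
    using module_iso_submodule[OF module_iso_sym[OF iso]] by blast
  moreover have "\<forall>i. ?g ` C (Suc i) \<subseteq> ?g ` C i" using C by blast
  moreover have "(\<forall>i. submodule (D i) S M) \<and> (\<forall>i. D (Suc i) \<subseteq> D i) \<Longrightarrow> \<exists>n. \<forall>i\<ge>n. D i = D n"
    for D using art by (simp add: artinian_module_def)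
  ultimately obtain n where n: "\<forall>i\<ge>n. ?g ` C i = ?g ` C n" by meson
  have "h ` ?g ` C i = C i" for i
    using C submodule_subset by (intro module_iso_image[OF iso]) blast
  then show "\<exists>n. \<forall>i\<ge>n. C i = C n" using n by metis
qed

lemma cyclic_module_transport:
  fixes S :: "('s, 'm) ring_scheme" and M :: "('s, 'a, 'n) module_scheme"
  assumes "cyclic_module S M"
  shows "\<exists>(M' :: ('s, 's set) module) h. module_iso S M M' h"
proof -
  interpret M: left_module S M using assms by (simp add: cyclic_module_def)
  obtain m where m: "m \<in> carrier M" "carrier M = (\<lambda>s. s \<odot>\<^bsub>M\<^esub> m) ` carrier S"
    using assms by (auto simp: cyclic_module_def)
  define h where "h = (\<lambda>x. {s \<in> carrier S. s \<odot>\<^bsub>M\<^esub> m = x})"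
  define g where "g = inv_into (carrier M) h"
  have inj: "inj_on h (carrier M)"
  proof (rule inj_onI)
    fix x y assume xy: "x \<in> carrier M" "y \<in> carrier M" "h x = h y"
    then obtain s where "s \<in> carrier S" "s \<odot>\<^bsub>M\<^esub> m = x" using m(2) by auto
    then have "s \<in> h x" by (simp add: h_def)
    then show "x = y" using xy(3) by (auto simp: h_def)
  qed
  then have gh [simp]: "g (h x) = x" if "x \<in> carrier M" for x using that by (simp add: g_def)
  define M' :: "('s, 's set) module" where
    "M' = \<lparr>carrier = h ` carrier M, monoid.mult = undefined, one = undefined, ring.zero = h \<zero>\<^bsub>M\<^esub>,
       ring.add = (\<lambda>x y. h (g x \<oplus>\<^bsub>M\<^esub> g y)), smult = (\<lambda>s x. h (s \<odot>\<^bsub>M\<^esub> g x))\<rparr>"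
  have "abelian_group M'"
  proof (rule abelian_groupI)
    fix x assume "x \<in> carrier M'"
    then obtain y where "y \<in> carrier M" "x = h y" by (auto simp: M'_def)
    then show "\<exists>y\<in>carrier M'. y \<oplus>\<^bsub>M'\<^esub> x = \<zero>\<^bsub>M'\<^esub>"
      using M.l_neg[of y] by (intro bexI[of _ "h (\<ominus>\<^bsub>M\<^esub> y)"]) (simp_all add: M'_def)
  qed (auto simp: M'_def M.a_ac)
  then have "left_module S M'"
    using M.S.ring_axioms
    by (auto intro!: left_module.intro left_module_axioms.intro
        simp: M'_def M.smult_l_distr M.smult_r_distr M.smult_assoc)
  then have "module_iso S M M' h"
    using inj M.left_module_axioms by (auto simp: module_iso_def M'_def bij_betw_def)
  then show ?thesis by blast
qed

lemma simple_imp_cyclic: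
  assumes "simple_module S M"
  shows "cyclic_module S M"
proof -
  interpret M: left_module S M using assms by (simp add: simple_module_def)
  obtain x where x: "x \<in> carrier M" "x \<noteq> \<zero>\<^bsub>M\<^esub>"
    using assms M.M.zero_closed by (auto simp: simple_module_def)
  let ?N = "(\<lambda>s. s \<odot>\<^bsub>M\<^esub> x) ` carrier S"
  have "\<zero>\<^bsub>M\<^esub> \<in> ?N" using M.smult_l_null[OF x(1)] M.S.zero_closed by (metis image_eqI)
  then have "submodule ?N S M"
    unfolding M.submodule_iff using x(1)
    by (auto simp: M.smult_l_distr[symmetric] M.smult_assoc[symmetric])
  moreover have "x \<in> ?N" using x(1) M.smult_one M.S.one_closed by (metis image_eqI)
  then have "?N \<noteq> {\<zero>\<^bsub>M\<^esub>}" using x by blast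
  ultimately have "carrier M = ?N" using assms unfolding simple_module_def by metis
  then show ?thesis using x(1) M.left_module_axioms unfolding cyclic_module_def by blast
qed

lemma diamondD:
  fixes M :: "('s, 'a, 'n) module_scheme"
  assumes "diamond S" "cyclic_module S M" "essential_submodule S N M"
    and "simple_module S (M\<lparr>carrier := N\<rparr>)"
  shows "artinian_module S M"
proof -
  obtain M' :: "('s, 's set) module" and h where iso: "module_iso S M M' h"
    using cyclic_module_transport[OF assms(2)] by blast
  have "submodule N S M" using assms(3) by (simp add: essential_submodule_def)
  then have "simple_module S (M'\<lparr>carrier := h ` N\<rparr>)"
    using module_iso_simple[OF module_iso_restrict[OF iso] assms(4)] by blast
  then have "artinian_module S M'"
    using assms(1) module_iso_cyclic[OF iso assms(2)] module_iso_essential[OF iso assms(3)]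
    unfolding diamond_def by blast
  then show ?thesis by (rule module_iso_artinian[OF module_iso_sym[OF iso]])
qed

lemma primitive_ringI:
  fixes M :: "('s, 'a, 'n) module_scheme"
  assumes "simple_module S M" "faithful_module S M"
  shows "primitive_ring S"
proof -
  obtain M' :: "('s, 's set) module" and h where iso: "module_iso S M M' h"
    using cyclic_module_transport[OF simple_imp_cyclic[OF assms(1)]] by blast
  show ?thesis
    using module_iso_simple[OF iso assms(1)] module_iso_faithful[OF iso assms(2)]
    unfolding primitive_ring_def by blast
qed

end

theory Submission
  imports Defs
begin

text \<open>Cyclic modules are replaced by left ideals throughout. In characteristic zero the largest
  \<open>\<delta>\<close>-ideal in a maximal ideal \<open>M\<close> is prime, and it is not \<open>M\<close>, so in the two-dimensional UFD \<open>R\<close> it is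
  \<open>0\<close> or generated by a Darboux prime element \<open>p\<close>, and then \<open>p\<close> generates a maximal proper \<open>\<delta>\<close>-ideal.

  If it is \<open>0\<close>, then \<open>S/SM\<close> is a faithful simple module, and \<open>S/SM\<theta>\<close>, or \<open>S/SM\<theta>f\<close> for a suitable prime
  element \<open>f\<close> of \<open>R\<close>, is an essential extension of a copy of \<open>S/SM\<close> that is not artinian. The
  latter module is used if there is no Darboux element.

  If it is nonzero for every \<open>M\<close>, then each simple module is annihilated by some Darboux element \<open>p\<close>;
  here the torsion-free simple modules are excluded with the help of the vanishing of the Jacobson
  radical of \<open>R\<close>. A cyclic essential extension of the simple module is then annihilated by a power of
  \<open>p\<close>, and \<open>S/pS\<close> modulo a nonzero left ideal is artinian, by a comparison of leading coefficients.\<close>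

section \<open>Chain conditions on left ideals\<close>

text \<open>Right multiplication by \<theta> is injective, so S\<theta>/SM\<theta> is a copy of
  S/SM, and the remaining factor S/S\<theta> is R with \<theta> acting as \<delta>. Its submodules
  are the \<delta>-ideals, and a Darboux element p yields the endless chain p^i R. Without Darboux
  elements R has no proper nonzero \<delta>-ideal, S/S\<theta> is simple, and one more factor has to
  be inserted: S/Sf, whose submodules SI/Sf come from ideals I of R above f. In the other direction
  p is a normal element of S, which cuts a module into layers by powers of p. Inside a layer
  everything happens in (R/(p))[\<theta>;\<delta>], where R/(p) has dimension one and no proper
  nonzero \<delta>-ideal. The Jacobson radical is handled by divisibility instead of residue fields:
  units of R that lie in K[a] must divide powers of one fixed element of K[a], and this passes
  through the adjunction of one generator at a time, algebraic or transcendental.\<close>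

definition acc_on :: "'a set set \<Rightarrow> bool" where
  "acc_on F \<longleftrightarrow> (\<forall>C :: nat \<Rightarrow> 'a set.
     (\<forall>i. C i \<in> F \<and> C i \<subseteq> C (Suc i)) \<longrightarrow> (\<exists>n. \<forall>i\<ge>n. C i = C n))"

definition dcc_on :: "'a set set \<Rightarrow> bool" where
  "dcc_on F \<longleftrightarrow> (\<forall>C :: nat \<Rightarrow> 'a set.
     (\<forall>i. C i \<in> F \<and> C (Suc i) \<subseteq> C i) \<longrightarrow> (\<exists>n. \<forall>i\<ge>n. C i = C n))"

definition between :: "'a set set \<Rightarrow> 'a set \<Rightarrow> 'a set \<Rightarrow> 'a set set" where
  "between F A C = {W \<in> F. A \<subseteq> W \<and> W \<subseteq> C}"

text \<open>The left \<open>B\<close>-submodules of \<open>R\<close> that are contained in \<open>B\<close>; for a subring \<open>B\<close> these are the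
  left ideals of \<open>B\<close>.\<close>

definition lideals :: "('a, 'm) ring_scheme \<Rightarrow> 'a set \<Rightarrow> 'a set set" where
  "lideals R B = {L. L \<subseteq> B \<and> \<zero>\<^bsub>R\<^esub> \<in> L \<and> (\<forall>x\<in>L. \<forall>y\<in>L. x \<oplus>\<^bsub>R\<^esub> y \<in> L) \<and>
     (\<forall>b\<in>B. \<forall>x\<in>L. b \<otimes>\<^bsub>R\<^esub> x \<in> L)}"

lemma dcc_onD:
  assumes "dcc_on F" "\<And>i. C i \<in> F" "\<And>i. C (Suc i) \<subseteq> C i"
  shows "\<exists>n. \<forall>i\<ge>n. C i = C n"
  using assms unfolding dcc_on_def by blast

lemma acc_onD:
  assumes "acc_on F" "\<And>i. C i \<in> F" "\<And>i. C i \<subseteq> C (Suc i)"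
  shows "\<exists>n. \<forall>i\<ge>n. C i = C n"
  using assms unfolding acc_on_def by blast

lemma acc_on_maximal:
  assumes "acc_on F" "G \<subseteq> F" "G \<noteq> {}"
  shows "\<exists>W\<in>G. \<forall>Y\<in>G. W \<subseteq> Y \<longrightarrow> Y \<subseteq> W"
proof (rule ccontr)
  assume "\<not> ?thesis"
  then have *: "\<exists>Y. Y \<in> G \<and> W \<subset> Y" if "W \<in> G" for W using that by blast
  obtain X0 where "X0 \<in> G" using assms by blast
  then obtain C where C: "\<And>n::nat. C n \<in> G" "\<And>n. C n \<subset> C (Suc n)"
    using dependent_nat_choice[of "\<lambda>_ W. W \<in> G" "\<lambda>_ W Y. W \<subset> Y"] * by metis
  have "C i \<in> F" "C i \<subseteq> C (Suc i)" for i using C assms(2) by blast+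
  then have "\<exists>n. \<forall>i\<ge>n. C i = C n" by (intro acc_onD[OF assms(1)])
  then obtain n where n: "\<forall>i\<ge>n. C i = C n" ..
  have "C (Suc n) = C n" by (rule n[rule_format]) simp
  then show False using C(2)[of n] by blast
qed

text \<open>A strictly monotone map pulls the condition back. Strictness on comparable members
  suffices, because only members of one chain are ever compared.\<close>

lemma dcc_on_embed:
  assumes "dcc_on F" "\<And>W. W \<in> G \<Longrightarrow> f W \<in> F"
    and "\<And>W Y. W \<in> G \<Longrightarrow> Y \<in> G \<Longrightarrow> W \<subseteq> Y \<Longrightarrow> f W \<subseteq> f Y"
    and "\<And>W Y. W \<in> G \<Longrightarrow> Y \<in> G \<Longrightarrow> W \<subseteq> Y \<Longrightarrow> f W = f Y \<Longrightarrow> Y \<subseteq> W"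
  shows "dcc_on G"
  unfolding dcc_on_def
proof (intro allI impI)
  fix C :: "nat \<Rightarrow> _" assume C: "\<forall>i. C i \<in> G \<and> C (Suc i) \<subseteq> C i"
  have "\<exists>n. \<forall>i\<ge>n. f (C i) = f (C n)"
  proof (rule dcc_onD[OF assms(1), of "\<lambda>i. f (C i)"])
    show "f (C i) \<in> F" for i using C assms(2) by blast
    show "f (C (Suc i)) \<subseteq> f (C i)" for i using C assms(3) by blast
  qed
  then obtain n where n: "\<forall>i\<ge>n. f (C i) = f (C n)" ..
  have "C i = C n" if "i \<ge> n" for i
  proof
    show "C i \<subseteq> C n" using lift_Suc_antimono_le[of C n i] C that by blast
    then show "C n \<subseteq> C i" using assms(4)[of "C i" "C n"] C n[rule_format, OF that] by blast
  qed
  then have "\<forall>i\<ge>n. C i = C n" by (intro allI impI)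
  then show "\<exists>n. \<forall>i\<ge>n. C i = C n" ..
qed

lemma between_mem: "W \<in> between F A C \<longleftrightarrow> W \<in> F \<and> A \<subseteq> W \<and> W \<subseteq> C"
  by (auto simp: between_def)

lemma dcc_on_mono: "dcc_on F \<Longrightarrow> G \<subseteq> F \<Longrightarrow> dcc_on G"
  unfolding dcc_on_def by (meson subsetD)

lemma lidealsD:
  assumes "L \<in> lideals R B"
  shows "L \<subseteq> B" "\<zero>\<^bsub>R\<^esub> \<in> L" "\<And>x y. x \<in> L \<Longrightarrow> y \<in> L \<Longrightarrow> x \<oplus>\<^bsub>R\<^esub> y \<in> L"
    "\<And>b x. b \<in> B \<Longrightarrow> x \<in> L \<Longrightarrow> b \<otimes>\<^bsub>R\<^esub> x \<in> L"
  using assms by (auto simp: lideals_def)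

lemma lidealsI:
  assumes "L \<subseteq> B" "\<zero>\<^bsub>R\<^esub> \<in> L" "\<And>x y. x \<in> L \<Longrightarrow> y \<in> L \<Longrightarrow> x \<oplus>\<^bsub>R\<^esub> y \<in> L"
    "\<And>b x. b \<in> B \<Longrightarrow> x \<in> L \<Longrightarrow> b \<otimes>\<^bsub>R\<^esub> x \<in> L"
  shows "L \<in> lideals R B"
  using assms by (auto simp: lideals_def)

section \<open>Intervals in the lattice of left ideals\<close>

context ring
begin

abbreviation "lids \<equiv> lideals R (carrier R)"

text \<open>The annihilator of the class of \<open>x\<close> in the module R/L, so that R modulo
  \<open>colon L x\<close> is isomorphic to (L + R x)/L.\<close>

definition colon :: "'a set \<Rightarrow> 'a \<Rightarrow> 'a set" where
  "colon L x = {t \<in> carrier R. t \<otimes> x \<in> L}"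

definition lsum :: "'a set \<Rightarrow> 'a set \<Rightarrow> 'a set" where
  "lsum W Y = {x \<oplus> y |x y. x \<in> W \<and> y \<in> Y}"

definition lprinc :: "'a \<Rightarrow> 'a set" where
  "lprinc x = {t \<otimes> x |t. t \<in> carrier R}"

lemma lids_minus:
  assumes "L \<in> lids" "x \<in> L" "y \<in> L"
  shows "x \<ominus> y \<in> L"
proof -
  have c: "x \<in> carrier R" "y \<in> carrier R" using lidealsD(1)[OF assms(1)] assms by auto
  have "x \<ominus> y = x \<oplus> (\<ominus> \<one>) \<otimes> y" using c by (simp add: l_minus minus_eq)
  then show ?thesis using lidealsD(3,4)[OF assms(1)] assms by simp
qed

lemma lids_cancel:
  assumes "L \<in> lids" "y \<in> L" "x \<in> carrier R"
  shows "x \<oplus> y \<in> L \<Longrightarrow> x \<in> L" "y \<oplus> x \<in> L \<Longrightarrow> x \<in> L" "x \<ominus> y \<in> L \<Longrightarrow> x \<in> L" "y \<ominus> x \<in> L \<Longrightarrow> x \<in> L"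
proof -
  have y: "y \<in> carrier R" using lidealsD(1)[OF assms(1)] assms by auto
  show "x \<in> L" if "x \<oplus> y \<in> L"
    using lids_minus[OF assms(1) that assms(2)] assms(3) y by (simp add: minus_eq a_assoc r_neg)
  show "x \<in> L" if "y \<oplus> x \<in> L"
    using lids_minus[OF assms(1) that assms(2)] assms(3) y by (simp add: minus_eq a_comm[of y x] a_assoc r_neg)
  show "x \<in> L" if "x \<ominus> y \<in> L"
    using lidealsD(3)[OF assms(1) that assms(2)] assms(3) y by (simp add: minus_eq a_assoc l_neg)
  show "x \<in> L" if "y \<ominus> x \<in> L"
    using lids_minus[OF assms(1,2) that] assms(3) y
    by (simp add: minus_eq minus_add r_neg a_assoc[symmetric])
qed

lemma lids_one: "L \<in> lids \<Longrightarrow> \<one> \<in> L \<Longrightarrow> L = carrier R"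
  proof -
  assume L: "L \<in> lids" "\<one> \<in> L"
  have "x \<in> L" if "x \<in> carrier R" for x using lidealsD(4)[OF L(1) that L(2)] that by simp
  then show ?thesis using lidealsD(1)[OF L(1)] by blast
qed

lemma lids_carrier: "carrier R \<in> lids" by (auto simp: lideals_def)

lemma lids_Int: "W \<in> lids \<Longrightarrow> Y \<in> lids \<Longrightarrow> W \<inter> Y \<in> lids"
  by (auto simp: lideals_def)

lemma lids_lsum:
  assumes "W \<in> lids" "Y \<in> lids" shows "lsum W Y \<in> lids"
proof (rule lidealsI)
  have W: "x \<in> W \<Longrightarrow> x \<in> carrier R" and Y: "x \<in> Y \<Longrightarrow> x \<in> carrier R" for x
    using assms lidealsD(1) by blast+
  show "lsum W Y \<subseteq> carrier R" using W Y by (auto simp: lsum_def)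
  have "\<zero> = \<zero> \<oplus> \<zero>" by simp
  then show "\<zero> \<in> lsum W Y" unfolding lsum_def using assms lidealsD(2) by blast
  fix u v assume "u \<in> lsum W Y" "v \<in> lsum W Y"
  then obtain x y x' y' where *: "x \<in> W" "y \<in> Y" "x' \<in> W" "y' \<in> Y" "u = x \<oplus> y" "v = x' \<oplus> y'"
    by (auto simp: lsum_def)
  then have "u \<oplus> v = (x \<oplus> x') \<oplus> (y \<oplus> y')" using W Y by (simp add: a_ac)
  moreover have "x \<oplus> x' \<in> W" "y \<oplus> y' \<in> Y"
    using * lidealsD(3)[OF assms(1)] lidealsD(3)[OF assms(2)] by auto
  ultimately show "u \<oplus> v \<in> lsum W Y" unfolding lsum_def by blast
next
  have W: "x \<in> W \<Longrightarrow> x \<in> carrier R" and Y: "x \<in> Y \<Longrightarrow> x \<in> carrier R" for x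
    using assms lidealsD(1) by blast+
  fix b u assume "b \<in> carrier R" "u \<in> lsum W Y"
  then obtain x y where *: "x \<in> W" "y \<in> Y" "u = x \<oplus> y" "b \<in> carrier R" by (auto simp: lsum_def)
  then have "b \<otimes> u = b \<otimes> x \<oplus> b \<otimes> y" using W Y by (simp add: r_distr)
  moreover have "b \<otimes> x \<in> W" "b \<otimes> y \<in> Y"
    using * lidealsD(4)[OF assms(1)] lidealsD(4)[OF assms(2)] by auto
  ultimately show "b \<otimes> u \<in> lsum W Y" unfolding lsum_def by blast
qed

lemma lsum_upper:
  assumes "W \<in> lids" "Y \<in> lids" shows "W \<subseteq> lsum W Y" "Y \<subseteq> lsum W Y"
proof -
  have "x = x \<oplus> \<zero>" if "x \<in> W" for x using that lidealsD(1)[OF assms(1)] by auto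
  then show "W \<subseteq> lsum W Y" unfolding lsum_def using lidealsD(2)[OF assms(2)] by blast
  have "x = \<zero> \<oplus> x" if "x \<in> Y" for x using that lidealsD(1)[OF assms(2)] by auto
  then show "Y \<subseteq> lsum W Y" unfolding lsum_def using lidealsD(2)[OF assms(1)] by blast
qed

lemma lsum_least:
  assumes "Z \<in> lids" "W \<subseteq> Z" "Y \<subseteq> Z" shows "lsum W Y \<subseteq> Z"
  using assms lidealsD(3)[OF assms(1)] by (auto simp: lsum_def)

lemma lsum_mono: "W \<subseteq> W' \<Longrightarrow> Y \<subseteq> Y' \<Longrightarrow> lsum W Y \<subseteq> lsum W' Y'"
  by (auto simp: lsum_def)

lemma lids_lprinc:
  assumes "x \<in> carrier R" shows "lprinc x \<in> lids" "x \<in> lprinc x"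
proof -
  have "\<zero> = \<zero> \<otimes> x" "x = \<one> \<otimes> x" using assms by auto
  then show "x \<in> lprinc x" unfolding lprinc_def by blast
  show "lprinc x \<in> lids"
  proof (rule lidealsI)
    show "\<zero> \<in> lprinc x" unfolding lprinc_def using \<open>\<zero> = \<zero> \<otimes> x\<close> by blast
    fix u v assume "u \<in> lprinc x" "v \<in> lprinc x"
    then obtain s t where "s \<in> carrier R" "t \<in> carrier R" "u = s \<otimes> x" "v = t \<otimes> x"
      by (auto simp: lprinc_def)
    then have "u \<oplus> v = (s \<oplus> t) \<otimes> x" "s \<oplus> t \<in> carrier R" using assms by (auto simp: l_distr)
    then show "u \<oplus> v \<in> lprinc x" unfolding lprinc_def by blast
  next
    fix b u assume "b \<in> carrier R" "u \<in> lprinc x"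
    then obtain s where "s \<in> carrier R" "u = s \<otimes> x" by (auto simp: lprinc_def)
    then have "b \<otimes> u = (b \<otimes> s) \<otimes> x" "b \<otimes> s \<in> carrier R"
      using assms \<open>b \<in> carrier R\<close> by (auto simp: m_assoc)
    then show "b \<otimes> u \<in> lprinc x" unfolding lprinc_def by blast
  qed (use assms in \<open>auto simp: lprinc_def\<close>)
qed

lemma lprinc_least: "L \<in> lids \<Longrightarrow> x \<in> L \<Longrightarrow> lprinc x \<subseteq> L"
  using lidealsD(4) by (fastforce simp: lprinc_def)

lemma lids_colon:
  assumes "L \<in> lids" "x \<in> carrier R" shows "colon L x \<in> lids"
proof (rule lidealsI)
  show "\<zero> \<in> colon L x" using assms lidealsD(2)[OF assms(1)] by (simp add: colon_def)
qed (use assms lidealsD(3,4)[OF assms(1)] in \<open>auto simp: colon_def l_distr m_assoc\<close>)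

text \<open>By the modular law, comparable left ideals above \<open>A\<close> with the same
  intersection with \<open>B\<close> and the same sum with \<open>B\<close> coincide. Along a
  descending chain both stabilise.\<close>

lemma dcc_between_trans:
  assumes A: "A \<in> lids" and B: "B \<in> lids" and C: "C \<in> lids" and AB: "A \<subseteq> B" and BC: "B \<subseteq> C"
    and d1: "dcc_on (between lids A B)" and d2: "dcc_on (between lids B C)"
  shows "dcc_on (between lids A C)"
  unfolding dcc_on_def
proof (intro allI impI)
  fix W :: "nat \<Rightarrow> _" assume W: "\<forall>i. W i \<in> between lids A C \<and> W (Suc i) \<subseteq> W i"
  have Xl: "W i \<in> lids" "A \<subseteq> W i" "W i \<subseteq> C" "W (Suc i) \<subseteq> W i" for i
    using W by (auto simp: between_mem)
  have "\<exists>m. \<forall>i\<ge>m. W i \<inter> B = W m \<inter> B"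
  proof (rule dcc_onD[OF d1, of "\<lambda>i. W i \<inter> B"])
    show "W i \<inter> B \<in> between lids A B" for i using Xl(1,2)[of i] B AB lids_Int by (auto simp: between_mem)
    show "W (Suc i) \<inter> B \<subseteq> W i \<inter> B" for i using Xl(4)[of i] by blast
  qed
  then obtain m where m: "\<forall>i\<ge>m. W i \<inter> B = W m \<inter> B" ..
  have "\<exists>n. \<forall>i\<ge>n. lsum (W i) B = lsum (W n) B"
  proof (rule dcc_onD[OF d2, of "\<lambda>i. lsum (W i) B"])
    show "lsum (W i) B \<in> between lids B C" for i
      using Xl[of i] B BC C lids_lsum lsum_upper lsum_least by (auto simp: between_mem)
    show "lsum (W (Suc i)) B \<subseteq> lsum (W i) B" for i using Xl(4)[of i] by (intro lsum_mono) auto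
  qed
  then obtain n where n: "\<forall>i\<ge>n. lsum (W i) B = lsum (W n) B" ..
  define k where "k = max m n"
  have "W i = W k" if "i \<ge> k" for i
  proof
    show sub: "W i \<subseteq> W k" using lift_Suc_antimono_le[of W k i] Xl(4) that by blast
    have e1: "W i \<inter> B = W k \<inter> B" using m[rule_format, of i] m[rule_format, of k] that by (simp add: k_def)
    have e2: "lsum (W i) B = lsum (W k) B" using n[rule_format, of i] n[rule_format, of k] that by (simp add: k_def)
    show "W k \<subseteq> W i"
    proof
      fix y assume y: "y \<in> W k"
      then have "y \<in> lsum (W i) B" using lsum_upper(1)[OF Xl(1) B] unfolding e2 by blast
      then obtain x b where xb: "x \<in> W i" "b \<in> B" "y = x \<oplus> b" by (auto simp: lsum_def)
      have "b \<in> carrier R" using xb(2) lidealsD(1)[OF B] by blast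
      then have "b \<in> W k" using lids_cancel(2)[OF Xl(1)[of k], of x b] xb y sub by blast
      then have "b \<in> W i" using e1 xb(2) by blast
      then show "y \<in> W i" using xb lidealsD(3)[OF Xl(1)] by simp
    qed
  qed
  then have "\<forall>i\<ge>k. W i = W k" by (intro allI impI)
  then show "\<exists>n. \<forall>i\<ge>n. W i = W n" ..
qed

text \<open>The interval from L to L + R x is the submodule lattice of a cyclic module generated by
  the class of \<open>x\<close>; \<open>colon W x\<close> is the left ideal that corresponds to
  \<open>W\<close>.\<close>

lemma dcc_between_lprinc:
  assumes L: "L \<in> lids" and x: "x \<in> carrier R"
    and d: "dcc_on (between lids (colon L x) (carrier R))"
  shows "dcc_on (between lids L (lsum L (lprinc x)))"
proof (rule dcc_on_embed[OF d, of _ "\<lambda>W. colon W x"])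
  fix W assume "W \<in> between lids L (lsum L (lprinc x))"
  then show "colon W x \<in> between lids (colon L x) (carrier R)"
    using x lids_colon by (auto simp: between_mem colon_def)
next
  fix W Y assume W: "W \<in> between lids L (lsum L (lprinc x))" and Y: "Y \<in> between lids L (lsum L (lprinc x))"
    and XY: "W \<subseteq> Y"
  then show "colon W x \<subseteq> colon Y x" by (auto simp: colon_def)
  assume eq: "colon W x = colon Y x"
  show "Y \<subseteq> W"
  proof
    fix y assume y: "y \<in> Y"
    then have "y \<in> lsum L (lprinc x)" using Y by (auto simp: between_mem)
    then obtain l t where lt: "l \<in> L" "t \<in> carrier R" "y = l \<oplus> t \<otimes> x"
      by (auto simp: lsum_def lprinc_def)
    have "t \<otimes> x \<in> Y" using lids_cancel(2)[of Y l "t \<otimes> x"] Y y lt x by (auto simp: between_mem)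
    then have "t \<in> colon W x" using lt eq by (auto simp: colon_def)
    then have "t \<otimes> x \<in> W" by (simp add: colon_def)
    moreover have "W \<in> lids" "l \<in> W" using W lt(1) by (auto simp: between_mem)
    ultimately show "y \<in> W" unfolding lt(3) by (intro lidealsD(3))
  qed
qed

text \<open>By noetherian induction it suffices to glue the intervals \<open>[W, W + R x]\<close>.\<close>

lemma dcc_between_of_colon:
  assumes acc: "acc_on lids" and L: "L \<in> lids" and K: "K \<in> lids" and LK: "L \<subseteq> K"
    and d: "\<And>x. x \<in> K \<Longrightarrow> dcc_on (between lids (colon L x) (carrier R))"
  shows "dcc_on (between lids L K)"
proof -
  have base: "dcc_on (between lids L L)"
    unfolding dcc_on_def
  proof (intro allI impI)
    fix C :: "nat \<Rightarrow> _" assume C: "\<forall>i. C i \<in> between lids L L \<and> C (Suc i) \<subseteq> C i"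
    have "C i = L" for i using spec[OF C, of i] by (auto simp: between_mem)
    then show "\<exists>n. \<forall>i\<ge>n. C i = C n" by simp
  qed
  let ?G = "{W \<in> between lids L K. dcc_on (between lids L W)}"
  have "?G \<subseteq> lids" "?G \<noteq> {}" using L LK base by (auto simp: between_mem)
  then have "\<exists>W\<in>?G. \<forall>Y\<in>?G. W \<subseteq> Y \<longrightarrow> Y \<subseteq> W" by (rule acc_on_maximal[OF acc])
  then obtain W where W: "W \<in> ?G" and mx: "\<forall>Y\<in>?G. W \<subseteq> Y \<longrightarrow> Y \<subseteq> W"
    by (rule bexE)
  have Xl: "W \<in> lids" "L \<subseteq> W" "W \<subseteq> K" "dcc_on (between lids L W)" using W by (auto simp: between_mem)
  have "K \<subseteq> W"
  proof
    fix x assume x: "x \<in> K"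
    have xc: "x \<in> carrier R" using x lidealsD(1)[OF K] by blast
    have Y: "lsum W (lprinc x) \<in> lids" using lids_lsum lids_lprinc Xl xc by blast
    have "colon L x \<subseteq> colon W x" using Xl(2) by (auto simp: colon_def)
    then have "between lids (colon W x) (carrier R) \<subseteq> between lids (colon L x) (carrier R)"
      unfolding between_def by blast
    then have "dcc_on (between lids W (lsum W (lprinc x)))"
      using dcc_between_lprinc[OF Xl(1) xc] d[OF x] dcc_on_mono by blast
    then have "dcc_on (between lids L (lsum W (lprinc x)))"
      using dcc_between_trans[OF L Xl(1) Y Xl(2) lsum_upper(1)] Xl lids_lprinc xc by blast
    moreover have "lsum W (lprinc x) \<subseteq> K" using lsum_least[OF K Xl(3) lprinc_least[OF K x]] .
    ultimately have "lsum W (lprinc x) \<in> ?G"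
      using Y Xl(1,2) lsum_upper(1)[OF Xl(1)] lids_lprinc[OF xc] by (fastforce simp: between_mem)
    then have "lsum W (lprinc x) \<subseteq> W" using mx lsum_upper(1)[OF Xl(1)] lids_lprinc[OF xc] by blast
    then show "x \<in> W" using lsum_upper(2)[OF Xl(1) lids_lprinc(1)[OF xc]] lids_lprinc(2)[OF xc] by blast
  qed
  then have "K = W" using Xl by blast
  then show ?thesis using Xl by simp
qed

end

section \<open>Adjoining an element to a subring\<close>

text \<open>Left combinations of the powers of \<open>x\<close> below the exponent \<open>n\<close>,
  peeled from the top so that induction on \<open>n\<close> is induction on the formal degree.
  Nothing makes the coefficients unique, since \<open>x\<close> may be algebraic over
  \<open>B\<close>.\<close>

primrec pspan :: "('a, 'm) ring_scheme \<Rightarrow> 'a set \<Rightarrow> 'a \<Rightarrow> nat \<Rightarrow> 'a set" where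
  "pspan R B x 0 = {\<zero>\<^bsub>R\<^esub>}"
| "pspan R B x (Suc n) = {b \<otimes>\<^bsub>R\<^esub> x [^]\<^bsub>R\<^esub> n \<oplus>\<^bsub>R\<^esub> v |b v. b \<in> B \<and> v \<in> pspan R B x n}"

text \<open>The commutator condition is weak enough for both uses: commuting elements of a domain,
  and \<theta> over the coefficient ring, where the commutator with \<open>a\<close> is
  \<delta>(a).\<close>

locale adjoin = ring R for R :: "('a, 'm) ring_scheme" (structure) +
  fixes B :: "'a set" and x :: 'a
  assumes subB: "subring B R" and xc [simp]: "x \<in> carrier R"
    and comm: "b \<in> B \<Longrightarrow> x \<otimes> b \<ominus> b \<otimes> x \<in> B"
begin

lemma Bc [simp]: "b \<in> B \<Longrightarrow> b \<in> carrier R" using subringE(1)[OF subB] by blast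
lemma B0 [simp]: "\<zero> \<in> B" using subringE(2)[OF subB] .
lemma B1 [simp]: "\<one> \<in> B" using subringE(3)[OF subB] .
lemma Bneg [simp]: "b \<in> B \<Longrightarrow> \<ominus> b \<in> B" using subringE(5)[OF subB] .
lemma Bmult [simp]: "b \<in> B \<Longrightarrow> c \<in> B \<Longrightarrow> b \<otimes> c \<in> B" using subringE(6)[OF subB] .
lemma Badd [simp]: "b \<in> B \<Longrightarrow> c \<in> B \<Longrightarrow> b \<oplus> c \<in> B" using subringE(7)[OF subB] .

abbreviation "tspan \<equiv> pspan R B x"

definition adj :: "'a set" where "adj = (\<Union>n. tspan n)"

lemma spanI: "b \<in> B \<Longrightarrow> v \<in> tspan n \<Longrightarrow> b \<otimes> x [^] n \<oplus> v \<in> tspan (Suc n)"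
  by auto

lemma span_carrier: "v \<in> tspan n \<Longrightarrow> v \<in> carrier R"
  by (induction n arbitrary: v) auto

lemma span_zero [simp]: "\<zero> \<in> tspan n"
proof (induction n)
  case (Suc n)
  have "\<zero> = \<zero> \<otimes> x [^] n \<oplus> \<zero>" by simp
  then show ?case using spanI[OF B0 Suc] by simp
qed simp

lemma span_add: "u \<in> tspan n \<Longrightarrow> v \<in> tspan n \<Longrightarrow> u \<oplus> v \<in> tspan n"
proof (induction n arbitrary: u v)
  case (Suc n)
  then obtain b w c z where *: "b \<in> B" "w \<in> tspan n" "u = b \<otimes> x [^] n \<oplus> w"
    "c \<in> B" "z \<in> tspan n" "v = c \<otimes> x [^] n \<oplus> z" by auto
  then have "u \<oplus> v = (b \<oplus> c) \<otimes> x [^] n \<oplus> (w \<oplus> z)"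
    using span_carrier by (simp add: l_distr a_ac)
  then show ?case using spanI[of "b \<oplus> c" "w \<oplus> z" n] Suc.IH[of w z] * by simp
qed simp

lemma span_smult: "b \<in> B \<Longrightarrow> v \<in> tspan n \<Longrightarrow> b \<otimes> v \<in> tspan n"
proof (induction n arbitrary: v)
  case (Suc n)
  then obtain c z where *: "c \<in> B" "z \<in> tspan n" "v = c \<otimes> x [^] n \<oplus> z" by auto
  then have "b \<otimes> v = (b \<otimes> c) \<otimes> x [^] n \<oplus> b \<otimes> z"
    using span_carrier Suc.prems by (simp add: r_distr m_assoc)
  then show ?case using spanI[of "b \<otimes> c" "b \<otimes> z" n] Suc.IH[of z] Suc.prems * by simp
qed simp

lemma span_neg: "v \<in> tspan n \<Longrightarrow> \<ominus> v \<in> tspan n"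
  using span_smult[of "\<ominus> \<one>" v n] span_carrier[of v n] by (simp add: l_minus)

lemma span_minus: "u \<in> tspan n \<Longrightarrow> v \<in> tspan n \<Longrightarrow> u \<ominus> v \<in> tspan n"
  using span_add span_neg by (simp add: minus_eq)

lemma span_Suc: "v \<in> tspan n \<Longrightarrow> v \<in> tspan (Suc n)"
  using spanI[OF B0, of v n] span_carrier[of v n] by simp

lemma span_mono: "m \<le> n \<Longrightarrow> v \<in> tspan m \<Longrightarrow> v \<in> tspan n"
  by (induction rule: dec_induct) (auto simp: span_Suc simp del: pspan.simps)

lemma span_monom: "b \<in> B \<Longrightarrow> b \<otimes> x [^] n \<in> tspan (Suc n)"
  using spanI[OF _ span_zero[of n], of b] by simp

text \<open>Moving \<open>x\<close> past a coefficient \<open>b\<close> costs the commutator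
  \<open>d\<close>, which lies in \<open>B\<close> and is attached to a power of \<open>x\<close>
  one lower.\<close>

lemma span_x: "v \<in> tspan n \<Longrightarrow> x \<otimes> v \<in> tspan (Suc n)"
proof (induction n arbitrary: v)
  case (Suc n)
  then obtain b w where *: "b \<in> B" "w \<in> tspan n" "v = b \<otimes> x [^] n \<oplus> w" by auto
  define d where "d = x \<otimes> b \<ominus> b \<otimes> x"
  have d: "d \<in> B" using comm * by (simp add: d_def)
  have wc: "w \<in> carrier R" using span_carrier * by blast
  have "x \<otimes> b = b \<otimes> x \<oplus> d" using * d by (simp add: d_def minus_eq a_comm[of "x \<otimes> b"] a_assoc[symmetric] r_neg)
  then have "x \<otimes> v = b \<otimes> x [^] Suc n \<oplus> (d \<otimes> x [^] n \<oplus> x \<otimes> w)"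
    using * d wc by (simp add: r_distr l_distr m_assoc[symmetric] a_assoc nat_pow_Suc2)
      (simp add: m_assoc nat_pow_Suc2[symmetric] nat_pow_comm)
  moreover have "d \<otimes> x [^] n \<oplus> x \<otimes> w \<in> tspan (Suc n)"
    using span_add span_monom[OF d] Suc.IH[OF *(2)] by blast
  ultimately show ?case using spanI[OF *(1)] by metis
next
  case 0
  then show ?case using span_zero[of "Suc 0"] by (simp del: pspan.simps(2))
qed

lemma span_x_pow: "v \<in> tspan n \<Longrightarrow> x [^] k \<otimes> v \<in> tspan (n + k)"
proof (induction k)
  case (Suc k)
  have "x [^] Suc k \<otimes> v = x \<otimes> (x [^] k \<otimes> v)"
    using span_carrier Suc.prems by (simp add: m_assoc[symmetric] nat_pow_Suc2[symmetric] nat_pow_Suc)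
  then show ?case using span_x[OF Suc.IH[OF Suc.prems]] by (simp del: pspan.simps)
qed (use span_carrier in auto)

lemma adjE: "v \<in> adj \<Longrightarrow> \<exists>n. v \<in> tspan n" by (auto simp: adj_def)
lemma span_adj: "v \<in> tspan n \<Longrightarrow> v \<in> adj" by (auto simp: adj_def)

lemma adj_carrier: "v \<in> adj \<Longrightarrow> v \<in> carrier R" using adjE span_carrier by blast

lemma adj_common: "u \<in> adj \<Longrightarrow> v \<in> adj \<Longrightarrow> \<exists>n. u \<in> tspan n \<and> v \<in> tspan n"
  using adjE span_mono by (metis max.cobounded1 max.cobounded2)

lemma adj_add: "u \<in> adj \<Longrightarrow> v \<in> adj \<Longrightarrow> u \<oplus> v \<in> adj"
  using adj_common span_add span_adj by meson

lemma B_adj: "b \<in> B \<Longrightarrow> b \<in> adj"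
  using span_adj[OF span_monom[of b 0]] by simp

lemma x_adj: "x \<in> adj"
  using span_adj[OF span_x[OF span_monom[OF B1, of 0]]] by simp

lemma adj_mult:
  assumes "v \<in> adj" shows "u \<in> adj \<Longrightarrow> u \<otimes> v \<in> adj"
proof -
  have "u \<otimes> v \<in> adj" if "u \<in> tspan n" for n u
    using that
  proof (induction n arbitrary: u)
    case 0
    then show ?case using assms adj_carrier B_adj by simp
  next
    case (Suc n)
    then obtain b w where *: "b \<in> B" "w \<in> tspan n" "u = b \<otimes> x [^] n \<oplus> w" by auto
    have "u \<otimes> v = b \<otimes> (x [^] n \<otimes> v) \<oplus> w \<otimes> v"
      using * span_carrier[OF *(2)] adj_carrier[OF assms] by (simp add: l_distr m_assoc)
    moreover have "b \<otimes> (x [^] n \<otimes> v) \<in> adj"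
      using adjE[OF assms] span_smult[OF *(1) span_x_pow] span_adj by blast
    ultimately show ?case using adj_add Suc.IH[OF *(2)] by simp
  qed
  then show "u \<in> adj \<Longrightarrow> u \<otimes> v \<in> adj" using adjE by blast
qed

lemma adj_subring: "subring adj R"
proof (rule subringI)
  show "\<And>h. h \<in> adj \<Longrightarrow> \<ominus> h \<in> adj" using adjE span_neg span_adj by blast
qed (use adj_carrier B_adj adj_mult adj_add in auto)

text \<open>An element can have several formal expressions of degree \<open>n\<close>; the top
  coefficients of all of them are collected. Multiplication by \<open>x\<close> makes the sets
  increase with \<open>n\<close>.\<close>

definition lcoeffs :: "nat \<Rightarrow> 'a set \<Rightarrow> 'a set" where
  "lcoeffs n L = {b \<in> B. \<exists>v \<in> tspan n. b \<otimes> x [^] n \<oplus> v \<in> L}"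

lemma lcoeffs_lideals:
  assumes L: "L \<in> lideals R adj" shows "lcoeffs n L \<in> lideals R B"
proof (rule lidealsI)
  show "\<zero> \<in> lcoeffs n L"
    using lidealsD(2)[OF L] by (auto simp: lcoeffs_def intro!: bexI[of _ \<zero>])
next
  fix b c assume "b \<in> lcoeffs n L" "c \<in> lcoeffs n L"
  then obtain v w where *: "b \<in> B" "c \<in> B" "v \<in> tspan n" "w \<in> tspan n"
    "b \<otimes> x [^] n \<oplus> v \<in> L" "c \<otimes> x [^] n \<oplus> w \<in> L" by (auto simp: lcoeffs_def)
  then have "(b \<otimes> x [^] n \<oplus> v) \<oplus> (c \<otimes> x [^] n \<oplus> w) = (b \<oplus> c) \<otimes> x [^] n \<oplus> (v \<oplus> w)"
    using span_carrier by (simp add: l_distr a_ac)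
  then have "(b \<oplus> c) \<otimes> x [^] n \<oplus> (v \<oplus> w) \<in> L" using lidealsD(3)[OF L] * by metis
  then show "b \<oplus> c \<in> lcoeffs n L" using * span_add by (auto simp: lcoeffs_def)
next
  fix b c assume "b \<in> B" "c \<in> lcoeffs n L"
  then obtain w where *: "b \<in> B" "c \<in> B" "w \<in> tspan n" "c \<otimes> x [^] n \<oplus> w \<in> L"
    by (auto simp: lcoeffs_def)
  then have "b \<otimes> (c \<otimes> x [^] n \<oplus> w) = (b \<otimes> c) \<otimes> x [^] n \<oplus> b \<otimes> w"
    using span_carrier by (simp add: r_distr m_assoc)
  then have "(b \<otimes> c) \<otimes> x [^] n \<oplus> b \<otimes> w \<in> L" using lidealsD(4)[OF L B_adj] * by metis
  then show "b \<otimes> c \<in> lcoeffs n L" using * span_smult by (auto simp: lcoeffs_def)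
qed (auto simp: lcoeffs_def)

lemma lcoeffs_Suc:
  assumes L: "L \<in> lideals R adj" shows "lcoeffs n L \<subseteq> lcoeffs (Suc n) L"
proof
  fix b assume "b \<in> lcoeffs n L"
  then obtain v where *: "b \<in> B" "v \<in> tspan n" "b \<otimes> x [^] n \<oplus> v \<in> L" by (auto simp: lcoeffs_def)
  define u where "u = x \<otimes> (b \<otimes> x [^] n \<oplus> v)"
  have u: "u \<in> L" unfolding u_def by (rule lidealsD(4)[OF L x_adj *(3)])
  define d where "d = x \<otimes> b \<ominus> b \<otimes> x"
  have d: "d \<in> B" using comm * by (simp add: d_def)
  have vc: "v \<in> carrier R" using span_carrier * by blast
  have "x \<otimes> b = b \<otimes> x \<oplus> d" using * d by (simp add: d_def minus_eq a_comm[of "x \<otimes> b"] a_assoc[symmetric] r_neg)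
  then have "u = b \<otimes> x [^] Suc n \<oplus> (d \<otimes> x [^] n \<oplus> x \<otimes> v)"
    unfolding u_def
    using * d vc by (simp add: r_distr l_distr m_assoc[symmetric] a_assoc nat_pow_Suc2)
      (simp add: m_assoc nat_pow_Suc2[symmetric] nat_pow_comm)
  moreover have "d \<otimes> x [^] n \<oplus> x \<otimes> v \<in> tspan (Suc n)"
    using span_add span_monom[OF d] span_x[OF *(2)] by blast
  ultimately show "b \<in> lcoeffs (Suc n) L" using u * unfolding lcoeffs_def by blast
qed

lemma lcoeffs_mono: "L \<subseteq> L' \<Longrightarrow> lcoeffs n L \<subseteq> lcoeffs n L'" by (auto simp: lcoeffs_def)

lemma lcoeffs_mono2: "L \<in> lideals R adj \<Longrightarrow> m \<le> n \<Longrightarrow> lcoeffs m L \<subseteq> lcoeffs n L"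
  by (rule lift_Suc_mono_le[of "\<lambda>n. lcoeffs n L"]) (use lcoeffs_Suc in auto)

text \<open>Subtracting an element of \<open>L\<close> with the same top coefficient lowers the
  formal degree and stays in \<open>L'\<close>, so induction on the degree applies.\<close>

lemma lcoeffs_determine:
  assumes L: "L \<in> lideals R adj" and L': "L' \<in> lideals R adj" and sub: "L \<subseteq> L'"
    and le: "\<And>n. lcoeffs n L' \<subseteq> lcoeffs n L"
  shows "L' \<subseteq> L"
proof -
  have "y \<in> L" if "y \<in> L'" "y \<in> tspan n" for n y
    using that
  proof (induction n arbitrary: y)
    case 0
    then show ?case using lidealsD(2)[OF L] by simp
  next
    case (Suc n)
    then obtain b v where bv: "b \<in> B" "v \<in> tspan n" "y = b \<otimes> x [^] n \<oplus> v" by auto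
    then have "b \<in> lcoeffs n L" using le[of n] Suc.prems(1) by (auto simp: lcoeffs_def)
    then obtain w where w: "w \<in> tspan n" "b \<otimes> x [^] n \<oplus> w \<in> L" by (auto simp: lcoeffs_def)
    define z where "z = b \<otimes> x [^] n \<oplus> w"
    have c: "v \<in> carrier R" "w \<in> carrier R" "z \<in> carrier R" "y \<in> carrier R"
      using bv w span_carrier by (auto simp: z_def)
    have "\<ominus> z = (\<ominus> \<one>) \<otimes> z" using c by (simp add: l_minus)
    then have nz: "\<ominus> z \<in> L" using lidealsD(4)[OF L, of "\<ominus> \<one>" z] w(2) B_adj by (simp add: z_def)
    have yz: "y \<oplus> \<ominus> z = v \<ominus> w" using bv(1) c unfolding bv(3) z_def
      by (simp add: minus_eq minus_add a_ac) (simp add: a_assoc[symmetric] r_neg l_neg)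
    then have "y \<oplus> \<ominus> z \<in> tspan n" using span_minus bv w by simp
    moreover have "y \<oplus> \<ominus> z \<in> L'" using lidealsD(3)[OF L'] nz sub Suc.prems(1) by blast
    ultimately have "y \<oplus> \<ominus> z \<in> L" by (intro Suc.IH)
    then have "(y \<oplus> \<ominus> z) \<oplus> z \<in> L" using lidealsD(3)[OF L] w(2) by (simp add: z_def)
    then show "y \<in> L" using c by (simp add: a_assoc l_neg)
  qed
  then show ?thesis using lidealsD(1)[OF L'] adjE by blast
qed

text \<open>The diagonal sequence \<open>lcoeffs i (C i)\<close> stabilises at some
  \<open>i0\<close>, which settles all degrees from \<open>i0\<close> on simultaneously; each of the
  finitely many smaller degrees stabilises on its own.\<close>

lemma hilbert_basis:
  assumes acc: "acc_on (lideals R B)" shows "acc_on (lideals R adj)"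
  unfolding acc_on_def
proof (intro allI impI)
  fix C :: "nat \<Rightarrow> 'a set" assume "\<forall>i. C i \<in> lideals R adj \<and> C i \<subseteq> C (Suc i)"
  then have C: "C i \<in> lideals R adj" "C i \<subseteq> C (Suc i)" for i by auto
  have Cm: "C i \<subseteq> C j" if "i \<le> j" for i j
    by (rule lift_Suc_mono_le[of C]) (use C that in auto)
  have "\<exists>m. \<forall>i\<ge>m. lcoeffs i (C i) = lcoeffs m (C m)"
    by (rule acc_onD[OF acc, of "\<lambda>i. lcoeffs i (C i)"])
      (use C lcoeffs_lideals lcoeffs_Suc lcoeffs_mono in blast)+
  then obtain i0 where i0: "\<forall>i\<ge>i0. lcoeffs i (C i) = lcoeffs i0 (C i0)" ..
  have "\<forall>n. \<exists>m. \<forall>i\<ge>m. lcoeffs n (C i) = lcoeffs n (C m)"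
    by (intro allI acc_onD[OF acc]) (use C lcoeffs_lideals lcoeffs_mono in blast)+
  then obtain m where m: "\<forall>n. \<forall>i\<ge>m n. lcoeffs n (C i) = lcoeffs n (C (m n))" by (rule exE[OF choice])
  define N where "N = Max (insert i0 (m ` {..<i0}))"
  have N: "i0 \<le> N" "\<And>n. n < i0 \<Longrightarrow> m n \<le> N" by (auto simp: N_def)
  have "C i = C N" if i: "i \<ge> N" for i
  proof
    show "C N \<subseteq> C i" using Cm i .
    show "C i \<subseteq> C N"
    proof (rule lcoeffs_determine[OF C(1) C(1) Cm[OF i]])
      fix n
      show "lcoeffs n (C i) \<subseteq> lcoeffs n (C N)"
      proof (cases "n < i0")
        case True
        then show ?thesis using m[rule_format, of n i] m[rule_format, of n N] N(2)[OF True] i by simp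
      next
        case False
        define k where "k = max n i"
        have "lcoeffs n (C i) \<subseteq> lcoeffs k (C i)" using lcoeffs_mono2[OF C(1)] by (simp add: k_def)
        also have "\<dots> \<subseteq> lcoeffs k (C k)" using lcoeffs_mono[OF Cm] by (simp add: k_def)
        also have "\<dots> = lcoeffs i0 (C i0)" using i0[rule_format, of k] False by (simp add: k_def)
        also have "\<dots> \<subseteq> lcoeffs n (C i0)" using lcoeffs_mono2[OF C(1)] False by simp
        also have "\<dots> \<subseteq> lcoeffs n (C N)" using lcoeffs_mono[OF Cm] N by simp
        finally show ?thesis .
      qed
    qed
  qed
  then have "\<forall>i\<ge>N. C i = C N" by (intro allI impI)
  then show "\<exists>n. \<forall>i\<ge>n. C i = C n" ..
qed

end

locale dadjoin = domain R for R :: "('a, 'm) ring_scheme" (structure) +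
  fixes B :: "'a set" and x :: 'a
  assumes subB': "subring B R" and xc': "x \<in> carrier R"

sublocale dadjoin \<subseteq> adjoin R B x
proof (intro adjoin.intro adjoin_axioms.intro ring_axioms subB' xc')
  fix b assume "b \<in> B"
  then have "b \<in> carrier R" using subringE(1)[OF subB'] by blast
  then have "x \<otimes> b \<ominus> b \<otimes> x = \<zero>" using xc' by (simp add: m_comm minus_eq r_neg)
  then show "x \<otimes> b \<ominus> b \<otimes> x \<in> B" using subringE(2)[OF subB'] by simp
qed

section \<open>Divisibility in extensions of a domain by one element\<close>

context domain
begin

definition dvd_in :: "'a set \<Rightarrow> 'a \<Rightarrow> 'a \<Rightarrow> bool" where
  "dvd_in B q c \<longleftrightarrow> (\<exists>u\<in>B. c = q \<otimes> u)"

text \<open>Every \<open>q \<in> A\<close> that becomes a unit in \<open>B[1/b]\<close> is already a unit in \<open>A[1/s]\<close>.\<close>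

definition lies_over :: "'a set \<Rightarrow> 'a set \<Rightarrow> bool" where
  "lies_over A B \<longleftrightarrow> (\<forall>b\<in>B - {\<zero>}. \<exists>s\<in>A - {\<zero>}. \<forall>q\<in>A. \<forall>k::nat.
     dvd_in B q (b [^] k) \<longrightarrow> (\<exists>m::nat. dvd_in A q (s [^] m)))"

lemma lies_over_refl: "lies_over A A" unfolding lies_over_def by blast

lemma lies_over_trans:
  assumes "lies_over A B" "lies_over B C" "A \<subseteq> B" shows "lies_over A C"
  unfolding lies_over_def
proof
  fix c assume "c \<in> C - {\<zero>}"
  then obtain b where b: "b \<in> B - {\<zero>}"
    "\<And>q k. q \<in> B \<Longrightarrow> dvd_in C q (c [^] (k::nat)) \<Longrightarrow> \<exists>m::nat. dvd_in B q (b [^] m)"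
    using assms(2) unfolding lies_over_def by metis
  then obtain s where s: "s \<in> A - {\<zero>}"
    "\<And>q k. q \<in> A \<Longrightarrow> dvd_in B q (b [^] (k::nat)) \<Longrightarrow> \<exists>m::nat. dvd_in A q (s [^] m)"
    using assms(1) unfolding lies_over_def by metis
  show "\<exists>s\<in>A - {\<zero>}. \<forall>q\<in>A. \<forall>k::nat. dvd_in C q (c [^] k) \<longrightarrow> (\<exists>m::nat. dvd_in A q (s [^] m))"
    using s b(2) assms(3) by (intro bexI[of _ s]) blast+
qed

lemma pow_nonzero: "a \<in> carrier R \<Longrightarrow> a \<noteq> \<zero> \<Longrightarrow> a [^] (n::nat) \<noteq> \<zero>"
  by (induction n) (auto simp: integral_iff)

end

context dadjoin
begin

lemma Bpow [simp]: "b \<in> B \<Longrightarrow> b [^] (n::nat) \<in> B"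
  by (induction n) auto

lemma span_one: "tspan (Suc 0) = B"
proof -
  have "b = b \<otimes> x [^] (0::nat) \<oplus> \<zero>" if "b \<in> B" for b using that by simp
  then show ?thesis by force
qed

lemma span_mult:
  "v \<in> tspan m \<Longrightarrow> u \<in> tspan (Suc n) \<Longrightarrow> v \<otimes> u \<in> tspan (m + n)"
proof (induction m arbitrary: v)
  case 0
  then show ?case using span_carrier[OF 0(2)] by simp
next
  case (Suc m)
  then obtain b w where *: "b \<in> B" "w \<in> tspan m" "v = b \<otimes> x [^] m \<oplus> w" by auto
  have uc: "u \<in> carrier R" using span_carrier Suc.prems by blast
  have "v \<otimes> u = b \<otimes> (x [^] m \<otimes> u) \<oplus> w \<otimes> u"
    using * uc span_carrier[OF *(2)] by (simp add: l_distr m_assoc)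
  moreover have "b \<otimes> (x [^] m \<otimes> u) \<in> tspan (Suc m + n)"
    using span_smult[OF *(1) span_x_pow[OF Suc.prems(2), of m]] by (simp add: add.commute del: pspan.simps)
  moreover have "w \<otimes> u \<in> tspan (Suc m + n)"
    using span_mono[OF _ Suc.IH[OF *(2) Suc.prems(2)], of "Suc m + n"] by (simp del: pspan.simps)
  ultimately show ?case using span_add by metis
qed

lemma lead_mult:
  assumes b: "b \<in> B" and c: "c \<in> B" and v: "v \<in> tspan m" and w: "w \<in> tspan n"
  shows "\<exists>z\<in>tspan (m + n). (b \<otimes> x [^] m \<oplus> v) \<otimes> (c \<otimes> x [^] n \<oplus> w) = (b \<otimes> c) \<otimes> x [^] (m + n) \<oplus> z"
proof -
  have k: "b \<in> carrier R" "c \<in> carrier R" "v \<in> carrier R" "w \<in> carrier R"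
    "x [^] m \<in> carrier R" "x [^] n \<in> carrier R"
    using assms span_carrier by auto
  have "b \<otimes> (x [^] m \<otimes> w) \<in> tspan (m + n)"
    using span_smult[OF b span_x_pow[OF w, of m]] by (simp add: add.commute)
  moreover have "v \<otimes> (c \<otimes> x [^] n \<oplus> w) \<in> tspan (m + n)"
    using span_mult[OF v spanI[OF c w]] .
  ultimately have "b \<otimes> (x [^] m \<otimes> w) \<oplus> v \<otimes> (c \<otimes> x [^] n \<oplus> w) \<in> tspan (m + n)" by (rule span_add)
  moreover have "x [^] (m + n) = x [^] m \<otimes> x [^] n" by (simp add: nat_pow_mult)
  moreover have "(b \<otimes> x [^] m \<oplus> v) \<otimes> (c \<otimes> x [^] n \<oplus> w) =
      (b \<otimes> c) \<otimes> (x [^] m \<otimes> x [^] n) \<oplus> (b \<otimes> (x [^] m \<otimes> w) \<oplus> v \<otimes> (c \<otimes> x [^] n \<oplus> w))"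
    using k by algebra
  ultimately show ?thesis by auto
qed

lemma lead_pow:
  assumes b: "b \<in> B" and v: "v \<in> tspan m"
  shows "\<exists>z\<in>tspan (m * k). (b \<otimes> x [^] m \<oplus> v) [^] k = b [^] k \<otimes> x [^] (m * k) \<oplus> z"
proof (induction k)
  case 0
  show ?case using b by (intro bexI[of _ \<zero>]) auto
next
  case (Suc k)
  then obtain z where z: "z \<in> tspan (m * k)" "(b \<otimes> x [^] m \<oplus> v) [^] k = b [^] k \<otimes> x [^] (m * k) \<oplus> z" ..
  show ?case using lead_mult[OF Bpow[OF b] b z(1) v, of k] z(2) by (simp add: add.commute)
qed

lemma lead_ex:
  "u \<in> tspan n \<Longrightarrow> u \<noteq> \<zero> \<Longrightarrow> \<exists>m<n. \<exists>b\<in>B. \<exists>v\<in>tspan m. b \<noteq> \<zero> \<and> u = b \<otimes> x [^] m \<oplus> v"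
proof (induction n arbitrary: u)
  case (Suc n)
  then obtain b w where *: "b \<in> B" "w \<in> tspan n" "u = b \<otimes> x [^] n \<oplus> w" by auto
  show ?case
  proof (cases "b = \<zero>")
    case True
    then have "u = w" using * span_carrier by simp
    then show ?thesis using Suc.IH[of w] *(2) Suc.prems(2) less_SucI by metis
  next
    case False
    then show ?thesis using * by blast
  qed
qed simp

text \<open>No polynomial equation of degree below \<open>N\<close> over \<open>B\<close> holds for
  \<open>x\<close>, so expressions in \<open>tspan N\<close> have unique coefficients.\<close>

definition free_upto :: "nat \<Rightarrow> bool" where
  "free_upto N \<longleftrightarrow> (\<forall>n<N. \<forall>b\<in>B. \<forall>v\<in>tspan n. b \<otimes> x [^] n \<oplus> v = \<zero> \<longrightarrow> b = \<zero>)"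

lemma free_lead_le:
  assumes "free_upto N" "n < N" "b \<in> B" "v \<in> tspan n" "u \<in> tspan n" "b \<otimes> x [^] n \<oplus> v = u"
  shows "b = \<zero>"
proof -
  have "b \<otimes> x [^] n \<oplus> (v \<ominus> u) = \<zero>"
    using assms(3,6) span_carrier[OF assms(4)] span_carrier[OF assms(5)]
    by (simp add: minus_eq a_assoc[symmetric] r_neg)
  then show ?thesis using assms(1-3) span_minus[OF assms(4,5)] unfolding free_upto_def by blast
qed

text \<open>The witness is the leading coefficient \<open>s\<close> of \<open>c\<close>: comparing
  leading coefficients in c^k = q u shows that s^k is q times the leading coefficient of
  \<open>u\<close>.\<close>

lemma lies_over_transcendental:
  assumes free: "\<And>N. free_upto N"
  shows "lies_over B adj"
  unfolding lies_over_def
proof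
  fix c assume c: "c \<in> adj - {\<zero>}"
  then obtain m s v where s: "s \<in> B" "s \<noteq> \<zero>" "v \<in> tspan m" "c = s \<otimes> x [^] m \<oplus> v"
    using adjE[of c] lead_ex by blast
  have "dvd_in B q (s [^] k)" if q: "q \<in> B" and d: "dvd_in adj q (c [^] k)" for q and k :: nat
  proof -
    obtain u where u: "u \<in> adj" "c [^] k = q \<otimes> u" using d by (auto simp: dvd_in_def)
    have cc: "c \<in> carrier R" using c adj_carrier by blast
    have uc: "u \<in> carrier R" using u adj_carrier by blast
    have "c [^] k \<noteq> \<zero>" using pow_nonzero[OF cc] c by blast
    then have nz: "q \<noteq> \<zero>" "u \<noteq> \<zero>" using u q uc by auto
    then obtain n b w where b: "b \<in> B" "b \<noteq> \<zero>" "w \<in> tspan n" "u = b \<otimes> x [^] n \<oplus> w"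
      using adjE[OF u(1)] lead_ex by blast
    obtain z where z: "z \<in> tspan (m * k)" "c [^] k = s [^] k \<otimes> x [^] (m * k) \<oplus> z"
      using lead_pow[OF s(1,3), of k] s(4) by blast
    have qw: "q \<otimes> w \<in> tspan n" by (rule span_smult[OF q b(3)])
    have eq: "s [^] k \<otimes> x [^] (m * k) \<oplus> z = (q \<otimes> b) \<otimes> x [^] n \<oplus> q \<otimes> w"
      using u(2) z(2) b q span_carrier[OF b(3)] by (simp add: r_distr m_assoc)
    have sk: "s [^] k \<in> B" "s [^] k \<noteq> \<zero>" using s(1,2) pow_nonzero[of s k] by auto
    have qb: "q \<otimes> b \<in> B" "q \<otimes> b \<noteq> \<zero>" using q b nz by (auto simp: integral_iff)
    have "\<not> m * k < n"
    proof
      assume lt: "m * k < n"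
      then have "s [^] k \<otimes> x [^] (m * k) \<oplus> z \<in> tspan n"
        using span_mono[OF _ spanI[OF sk(1) z(1)], of n] by (simp del: pspan.simps)
      then show False using free_lead_le[OF free lessI qb(1) qw] eq qb(2) by metis
    qed
    moreover have "\<not> n < m * k"
    proof
      assume lt: "n < m * k"
      then have "(q \<otimes> b) \<otimes> x [^] n \<oplus> q \<otimes> w \<in> tspan (m * k)"
        using span_mono[OF _ spanI[OF qb(1) qw], of "m * k"] by (simp del: pspan.simps)
      then show False using free_lead_le[OF free lessI sk(1) z(1)] eq sk(2) by metis
    qed
    ultimately have mk: "m * k = n" by simp
    have zc: "z \<in> carrier R" "q \<otimes> w \<in> carrier R" using span_carrier z(1) qw by auto
    have "(s [^] k \<ominus> q \<otimes> b) \<otimes> x [^] n \<oplus> z = q \<otimes> w"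
    proof -
      have k: "s [^] k \<in> carrier R" "q \<otimes> b \<in> carrier R" "x [^] n \<in> carrier R" using sk qb by auto
      have "(s [^] k \<ominus> q \<otimes> b) \<otimes> x [^] n \<oplus> z = (s [^] k \<otimes> x [^] n \<oplus> z) \<ominus> (q \<otimes> b) \<otimes> x [^] n"
        using k zc by algebra
      also have "\<dots> = ((q \<otimes> b) \<otimes> x [^] n \<oplus> q \<otimes> w) \<ominus> (q \<otimes> b) \<otimes> x [^] n" using eq mk by simp
      also have "\<dots> = q \<otimes> w" using k zc by algebra
      finally show ?thesis .
    qed
    then have "s [^] k \<ominus> q \<otimes> b = \<zero>"
      using free_lead_le[OF free lessI _ _ qw] z(1) mk sk(1) qb(1) by (simp add: minus_eq)
    then have "s [^] k = q \<otimes> b" using sk qb by simp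
    then show ?thesis using b(1) by (auto simp: dvd_in_def)
  qed
  then show "\<exists>s\<in>B - {\<zero>}. \<forall>q\<in>B. \<forall>k::nat. dvd_in adj q (c [^] k) \<longrightarrow> (\<exists>m::nat. dvd_in B q (s [^] m))"
    using s by (intro bexI[of _ s]) blast+
qed

text \<open>Each elimination step multiplies by \<beta> where ordinary division would divide by it.
  The degree bound on the quotient \<open>h\<close> is kept because a later step reads off a leading
  coefficient above it.\<close>

lemma pseudo_divide:
  assumes \<beta>: "\<beta> \<in> B" and u': "u' \<in> tspan d"
  shows "v \<in> tspan (d + i) \<Longrightarrow>
    \<exists>j::nat. \<exists>h\<in>tspan i. \<beta> [^] j \<otimes> v \<ominus> h \<otimes> (\<beta> \<otimes> x [^] d \<oplus> u') \<in> tspan d"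
proof (induction i arbitrary: v)
  case 0
  then show ?case using span_carrier[of v d] \<beta> span_carrier[OF u']
    by (intro exI[of _ 0] bexI[of _ \<zero>]) (simp_all add: minus_eq)
next
  case (Suc i)
  define u where "u = \<beta> \<otimes> x [^] d \<oplus> u'"
  obtain c w where cw: "c \<in> B" "w \<in> tspan (d + i)" "v = c \<otimes> x [^] (d + i) \<oplus> w" using Suc.prems by auto
  define v1 where "v1 = \<beta> \<otimes> w \<ominus> c \<otimes> (x [^] i \<otimes> u')"
  have v1: "v1 \<in> tspan (d + i)"
    unfolding v1_def by (intro span_minus span_smult \<beta> cw span_x_pow u')
  obtain j h where jh: "h \<in> tspan i" "\<beta> [^] (j::nat) \<otimes> v1 \<ominus> h \<otimes> u \<in> tspan d"
    using Suc.IH[OF v1] unfolding u_def by blast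
  have k: "\<beta> \<in> carrier R" "c \<in> carrier R" "w \<in> carrier R" "u' \<in> carrier R" "h \<in> carrier R"
    "x [^] d \<in> carrier R" "x [^] i \<in> carrier R" "\<beta> [^] j \<in> carrier R" "v1 \<in> carrier R" "u \<in> carrier R"
    using \<beta> cw u' jh span_carrier v1 by (auto simp: u_def)
  have xe: "x [^] (d + i) = x [^] d \<otimes> x [^] i" by (simp add: nat_pow_mult)
  have "v1 = \<beta> \<otimes> v \<ominus> c \<otimes> x [^] i \<otimes> u"
    unfolding v1_def u_def cw(3) xe using k(1-8) by algebra
  then have "\<beta> [^] Suc j \<otimes> v \<ominus> ((\<beta> [^] j \<otimes> c) \<otimes> x [^] i \<oplus> h) \<otimes> u = \<beta> [^] j \<otimes> v1 \<ominus> h \<otimes> u"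
  proof -
    assume e: "v1 = \<beta> \<otimes> v \<ominus> c \<otimes> x [^] i \<otimes> u"
    have vc: "v \<in> carrier R" using span_carrier[OF Suc.prems] .
    show ?thesis unfolding e nat_pow_Suc using k vc by algebra
  qed
  moreover have "(\<beta> [^] j \<otimes> c) \<otimes> x [^] i \<oplus> h \<in> tspan (Suc i)"
    using spanI[OF _ jh(1)] \<beta> cw(1) by simp
  ultimately show ?case using jh(2) unfolding u_def by metis
qed

section \<open>Extension by an algebraic element\<close>

context
  fixes n b\<^sub>0
  assumes free: "free_upto n" and b\<^sub>0: "b\<^sub>0 \<in> B" "b\<^sub>0 \<noteq> \<zero>" and rel: "b\<^sub>0 \<otimes> x [^] n \<in> tspan n"
begin

lemma reduce_one:
  assumes "y \<in> tspan (Suc N)" "n \<le> N" shows "b\<^sub>0 \<otimes> y \<in> tspan N"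
proof -
  obtain c w where cw: "c \<in> B" "w \<in> tspan N" "y = c \<otimes> x [^] N \<oplus> w" using assms by auto
  have e: "x [^] N = x [^] (N - n) \<otimes> x [^] n" using assms(2) by (simp add: nat_pow_mult)
  have k: "b\<^sub>0 \<in> carrier R" "c \<in> carrier R" "w \<in> carrier R" "x [^] (N - n) \<in> carrier R" "x [^] n \<in> carrier R"
    using b\<^sub>0 cw span_carrier by auto
  have "b\<^sub>0 \<otimes> y = c \<otimes> (x [^] (N - n) \<otimes> (b\<^sub>0 \<otimes> x [^] n)) \<oplus> b\<^sub>0 \<otimes> w"
    unfolding cw(3) e using k by algebra
  moreover have "x [^] (N - n) \<otimes> (b\<^sub>0 \<otimes> x [^] n) \<in> tspan N"
    using span_x_pow[OF rel, of "N - n"] assms(2) by simp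
  ultimately show ?thesis using span_add span_smult cw(1,2) b\<^sub>0(1) by metis
qed

text \<open>The denominator-free form of the statement that, once \<open>b\<^sub>0\<close> is
  inverted, the powers of \<open>x\<close> below \<open>n\<close> span the extension.\<close>

lemma reduce: "y \<in> tspan N \<Longrightarrow> \<exists>l::nat. b\<^sub>0 [^] l \<otimes> y \<in> tspan n"
proof (induction N arbitrary: y)
  case 0
  then show ?case by (intro exI[of _ 0]) auto
next
  case (Suc N)
  show ?case
  proof (cases "n \<le> N")
    case True
    obtain l where "b\<^sub>0 [^] (l::nat) \<otimes> (b\<^sub>0 \<otimes> y) \<in> tspan n"
      using Suc.IH[OF reduce_one[OF Suc.prems True]] by blast
    then have "b\<^sub>0 [^] Suc l \<otimes> y \<in> tspan n"
      using b\<^sub>0 span_carrier[OF Suc.prems] by (simp add: m_assoc)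
    then show ?thesis by blast
  next
    case False
    then have "y \<in> tspan n" using span_mono[OF _ Suc.prems, of n] by simp
    then show ?thesis using span_carrier[OF Suc.prems] by (intro exI[of _ 0]) simp
  qed
qed

text \<open>Below degree \<open>n\<close> coefficients are unique, and those of q y are q times
  those of y. If q y is constant and q is nonzero, the higher coefficients of y must vanish one
  after the other.\<close>

lemma constant_quotient:
  assumes q: "q \<in> B"
  shows "m < n \<Longrightarrow> y \<in> tspan (Suc m) \<Longrightarrow> q \<otimes> y \<in> B \<Longrightarrow> \<exists>z\<in>B. q \<otimes> y = q \<otimes> z"
proof (induction m arbitrary: y)
  case 0
  then show ?case using span_one by blast
next
  case (Suc m)
  then obtain c w where cw: "c \<in> B" "w \<in> tspan (Suc m)" "y = c \<otimes> x [^] Suc m \<oplus> w"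
    unfolding pspan.simps(2)[of R B x "Suc m"] by blast
  have wc: "w \<in> carrier R" using span_carrier cw by blast
  have "q \<otimes> y \<in> tspan (Suc m)" using span_mono[of "Suc 0" "Suc m" "q \<otimes> y"] Suc.prems(3) span_one by (simp del: pspan.simps)
  moreover have "(q \<otimes> c) \<otimes> x [^] Suc m \<oplus> q \<otimes> w = q \<otimes> y"
    unfolding cw(3) using q cw(1) wc by (simp add: r_distr m_assoc)
  ultimately have "q \<otimes> c = \<zero>"
    using free_lead_le[OF free Suc.prems(1) _ span_smult[OF q cw(2)]] q cw(1) by simp
  then consider "q = \<zero>" | "c = \<zero>" using q cw(1) integral[of q c] by auto
  then show ?case
  proof cases
    case 1
    then show ?thesis using span_carrier[OF Suc.prems(2)] by (intro bexI[of _ \<zero>]) simp_all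
  next
    case 2
    then have "y = w" using cw(3) wc by simp
    then show ?thesis using Suc.IH[of w] Suc.prems cw(2) by simp
  qed
qed

text \<open>A nonzero multiple of \<open>c\<close> of least degree \<open>d\<close> has degree \<open>0\<close>: otherwise dividing the
  minimal equation of \<open>x\<close> by it would give an equation of smaller degree.\<close>

lemma multiple_in_base:
  assumes c: "c \<in> adj" "c \<noteq> \<zero>"
  shows "\<exists>d\<in>B - {\<zero>}. dvd_in adj c d"
proof -
  define P where "P = (\<lambda>k. \<exists>u\<in>tspan k. u \<noteq> \<zero> \<and> (\<exists>t\<in>adj. u = c \<otimes> t))"
  have cc: "c \<in> carrier R" using c adj_carrier by blast
  obtain N where "c \<in> tspan N" using adjE c by blast
  then have "P N" using c cc B_adj[OF B1] unfolding P_def by (intro bexI[of _ c]) (auto intro!: bexI[of _ \<one>])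
  define k where "k = (LEAST k. P k)"
  have Pk: "P k" unfolding k_def using \<open>P N\<close> by (rule LeastI)
  have least: "\<not> P m" if "m < k" for m using that not_less_Least unfolding k_def by blast
  obtain u t where u: "u \<in> tspan k" "u \<noteq> \<zero>" "t \<in> adj" "u = c \<otimes> t" using Pk unfolding P_def by blast
  obtain d \<beta> u' where d: "d < k" "\<beta> \<in> B" "u' \<in> tspan d" "\<beta> \<noteq> \<zero>" "u = \<beta> \<otimes> x [^] d \<oplus> u'"
    using lead_ex[OF u(1,2)] by blast
  have ud: "u \<in> tspan (Suc d)" unfolding d(5) by (rule spanI[OF d(2,3)])
  have tc: "t \<in> carrier R" using u adj_carrier by blast
  have uc: "u \<in> carrier R" using u(1) span_carrier by blast
  have mult: "a \<otimes> u = c \<otimes> (a \<otimes> t)" "a \<otimes> t \<in> adj" if "a \<in> adj" for a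
    using u(3,4) tc cc adj_carrier[OF that] adj_mult[OF u(3) that] by (auto simp: m_lcomm)
  have small: "a \<otimes> u = \<zero>" if "a \<in> adj" "a \<otimes> u \<in> tspan d" for a
    using least[OF d(1)] mult[OF that(1)] that(2) unfolding P_def by blast
  have "d = 0"
  proof (rule ccontr)
    assume "d \<noteq> 0"
    have dn: "d < n"
    proof (rule ccontr)
      assume "\<not> d < n"
      then have "b\<^sub>0 \<otimes> u \<in> tspan d" using reduce_one[OF ud] by simp
      then have "b\<^sub>0 \<otimes> u = \<zero>" using small[OF B_adj[OF b\<^sub>0(1)]] by blast
      then show False using b\<^sub>0 u(2) uc integral[of b\<^sub>0 u] by simp
    qed
    \<comment> \<open>x^e u has formal degree n, exactly where the minimal equation lowers the
      degree after multiplication by \<open>b\<^sub>0\<close>. The case assumption on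
      \<open>d\<close> makes e < n, so the relation found below is too short to exist.\<close>
    define e where "e = n - d"
    have e: "d + e = n" "e < n" using dn \<open>d \<noteq> 0\<close> by (auto simp: e_def)
    have xe: "x [^] e \<in> adj" using span_adj[OF span_monom[OF B1, of e]] by simp
    have w: "b\<^sub>0 \<otimes> x [^] e \<otimes> u \<in> tspan n"
    proof -
      have xe: "x [^] n = x [^] e \<otimes> x [^] d" using e(1) by (simp add: nat_pow_mult add.commute)
      have k: "b\<^sub>0 \<in> carrier R" "\<beta> \<in> carrier R" "u' \<in> carrier R" "x [^] e \<in> carrier R" "x [^] d \<in> carrier R"
        using b\<^sub>0 d span_carrier by auto
      have "b\<^sub>0 \<otimes> x [^] e \<otimes> u = \<beta> \<otimes> (b\<^sub>0 \<otimes> x [^] n) \<oplus> b\<^sub>0 \<otimes> (x [^] e \<otimes> u')"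
        unfolding d(5) xe using k by algebra
      moreover have "x [^] e \<otimes> u' \<in> tspan n" using span_x_pow[OF d(3), of e] e by simp
      ultimately show ?thesis using span_add span_smult rel d(2) b\<^sub>0(1) by metis
    qed
    then obtain j h where jh: "h \<in> tspan e" "\<beta> [^] (j::nat) \<otimes> (b\<^sub>0 \<otimes> x [^] e \<otimes> u) \<ominus> h \<otimes> u \<in> tspan d"
      using pseudo_divide[OF d(2,3), of _ e] e(1) d(5) by metis
    have hc: "h \<in> carrier R" using jh span_carrier by blast
    define a where "a = \<beta> [^] j \<otimes> b\<^sub>0 \<otimes> x [^] e \<ominus> h"
    have a: "a \<in> tspan (Suc e)"
      unfolding a_def using d(2) b\<^sub>0(1) span_Suc[OF jh(1)]
      by (intro span_minus span_monom) (auto simp del: pspan.simps)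
    have "a \<otimes> u = \<beta> [^] j \<otimes> (b\<^sub>0 \<otimes> x [^] e \<otimes> u) \<ominus> h \<otimes> u"
    proof -
      have k: "\<beta> [^] j \<in> carrier R" "b\<^sub>0 \<in> carrier R" "x [^] e \<in> carrier R" using d(2) b\<^sub>0 by auto
      show ?thesis unfolding a_def using k uc hc by algebra
    qed
    then have "a \<otimes> u = \<zero>" using small[OF span_adj[OF a]] jh(2) by simp
    then have "a = \<zero>" using u(2) uc span_carrier[OF a] integral by blast
    then have "\<beta> [^] j \<otimes> b\<^sub>0 \<otimes> x [^] e \<oplus> \<ominus> h = \<zero>" by (simp add: a_def minus_eq)
    then have "\<beta> [^] j \<otimes> b\<^sub>0 = \<zero>"
      using free_lead_le[OF free e(2) _ span_neg[OF jh(1)] span_zero] d(2) b\<^sub>0(1) by simp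
    then show False using integral[of "\<beta> [^] j" b\<^sub>0] pow_nonzero[of \<beta> j] d(2,4) b\<^sub>0 by simp
  qed
  then have "u \<in> B" using ud span_one by (simp del: pspan.simps)
  then show ?thesis using u unfolding dvd_in_def by blast
qed

text \<open>The witness is s = b0 d, where d = c t is a nonzero multiple of \<open>c\<close> in
  \<open>B\<close>. From c^k = q u follows d^k = q (u t^k); a power of b0 brings u t^k below degree
  n, and then \<open>constant_quotient\<close> replaces it by an element of
  \<open>B\<close>.\<close>

lemma lies_over_algebraic:
  shows "lies_over B adj"
  unfolding lies_over_def
proof
  fix c assume c: "c \<in> adj - {\<zero>}"
  have cc: "c \<in> carrier R" using c adj_carrier by blast
  have n0: "n \<noteq> 0"
  proof
    assume "n = 0"
    then have "b\<^sub>0 = \<zero>" using rel b\<^sub>0(1) by simp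
    then show False using b\<^sub>0(2) by simp
  qed
  obtain d where d: "d \<in> B" "d \<noteq> \<zero>" "dvd_in adj c d" using multiple_in_base c by blast
  then obtain t where t: "t \<in> adj" "d = c \<otimes> t" by (auto simp: dvd_in_def)
  define s where "s = b\<^sub>0 \<otimes> d"
  have s: "s \<in> B" "s \<noteq> \<zero>" using b\<^sub>0 d by (auto simp: s_def integral_iff)
  have "\<exists>m::nat. dvd_in B q (s [^] m)" if q: "q \<in> B" and dv: "dvd_in adj q (c [^] k)" for q and k :: nat
  proof -
    obtain u where u: "u \<in> adj" "c [^] k = q \<otimes> u" using dv by (auto simp: dvd_in_def)
    have k: "u \<in> carrier R" "t \<in> carrier R" "q \<in> carrier R" "b\<^sub>0 \<in> carrier R" "d \<in> carrier R"
      using u t adj_carrier q b\<^sub>0 d by auto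
    have "t [^] k \<in> adj" by (induction k) (use B_adj adj_mult t(1) in auto)
    then have y: "u \<otimes> t [^] k \<in> adj" using adj_mult u(1) by blast
    then obtain l where l: "b\<^sub>0 [^] (l::nat) \<otimes> (u \<otimes> t [^] k) \<in> tspan n" using adjE reduce by blast
    have e: "q \<otimes> (b\<^sub>0 [^] l \<otimes> (u \<otimes> t [^] k)) = b\<^sub>0 [^] l \<otimes> d [^] k"
    proof -
      have "d [^] k = (q \<otimes> u) \<otimes> t [^] k" using t(2) cc k u(2) by (simp add: nat_pow_distrib)
      then show ?thesis using k by (simp add: m_ac)
    qed
    have "\<exists>z\<in>B. q \<otimes> (b\<^sub>0 [^] l \<otimes> (u \<otimes> t [^] k)) = q \<otimes> z"
      using constant_quotient[OF q, of "n - 1" "b\<^sub>0 [^] l \<otimes> (u \<otimes> t [^] k)"] l n0 e b\<^sub>0 d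
      by (simp del: pspan.simps)
    then obtain z where z: "z \<in> B" "b\<^sub>0 [^] l \<otimes> d [^] k = q \<otimes> z" using e by metis
    \<comment> \<open>The exponent l + k provides both the factor b0^l and the factor d^k; what is
      left over lies in \<open>B\<close>.\<close>
    have "s [^] (l + k) = (b\<^sub>0 [^] l \<otimes> d [^] k) \<otimes> (b\<^sub>0 [^] k \<otimes> d [^] l)"
      using k by (simp add: s_def nat_pow_distrib nat_pow_mult[symmetric] m_ac)
    also have "\<dots> = q \<otimes> (z \<otimes> (b\<^sub>0 [^] k \<otimes> d [^] l))"
      unfolding z(2) using k z(1) by (simp add: m_assoc)
    finally have "s [^] (l + k) = q \<otimes> (z \<otimes> (b\<^sub>0 [^] k \<otimes> d [^] l))" .
    moreover have "z \<otimes> (b\<^sub>0 [^] k \<otimes> d [^] l) \<in> B" using z(1) b\<^sub>0(1) d(1) by simp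
    ultimately show ?thesis unfolding dvd_in_def by blast
  qed
  then show "\<exists>s\<in>B - {\<zero>}. \<forall>q\<in>B. \<forall>k::nat. dvd_in adj q (c [^] k) \<longrightarrow> (\<exists>m::nat. dvd_in B q (s [^] m))"
    using s by (intro bexI[of _ s]) blast+
qed

end

lemma free_or_algebraic:
  "(\<forall>N. free_upto N) \<or>
   (\<exists>n. \<exists>b\<in>B. free_upto n \<and> b \<noteq> \<zero> \<and> b \<otimes> x [^] n \<in> tspan n)"
proof (cases "\<forall>N. free_upto N")
  case True
  then show ?thesis by blast
next
  case False
  define P where "P = (\<lambda>n. \<exists>b\<in>B. \<exists>v\<in>tspan n. b \<otimes> x [^] n \<oplus> v = \<zero> \<and> b \<noteq> \<zero>)"
  obtain n0 where "P n0" using False unfolding free_upto_def P_def by blast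
  define n where "n = (LEAST n. P n)"
  have "P n" unfolding n_def using \<open>P n0\<close> by (rule LeastI)
  then obtain b v where b: "b \<in> B" "b \<noteq> \<zero>" "v \<in> tspan n" "b \<otimes> x [^] n \<oplus> v = \<zero>"
    unfolding P_def by (elim bexE conjE)
  have "free_upto n"
    unfolding free_upto_def
  proof (intro allI ballI impI, rule ccontr)
    fix m c w assume "m < n" "c \<in> B" "w \<in> tspan m" "c \<otimes> x [^] m \<oplus> w = \<zero>" "c \<noteq> \<zero>"
    then have "P m" unfolding P_def by (intro bexI conjI)
    then show False using not_less_Least[of m P] \<open>m < n\<close> unfolding n_def by simp
  qed
  moreover have "b \<otimes> x [^] n = \<ominus> v"
    by (rule minus_equality[OF b(4), symmetric]) (use b span_carrier in auto)
  then have "b \<otimes> x [^] n \<in> tspan n" using span_neg[OF b(3)] by simp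
  ultimately show ?thesis using b(1,2) by blast
qed

lemma lies_over_adj: "lies_over B adj"
  using free_or_algebraic lies_over_transcendental lies_over_algebraic by blast

text \<open>For transcendental \<open>x\<close> the element 1 + x s has positive degree and degrees
  add, so its product with \<open>w\<close> cannot be the constant 1.\<close>

lemma invertible_imp_algebraic:
  assumes s: "s \<in> adj" "s \<noteq> \<zero>" and w: "w \<in> adj" "(\<one> \<oplus> x \<otimes> s) \<otimes> w = \<one>"
  shows "\<exists>n. \<exists>b\<in>B. free_upto n \<and> b \<noteq> \<zero> \<and> b \<otimes> x [^] n \<in> tspan n"
proof (rule ccontr)
  assume "\<not> ?thesis"
  then have free: "free_upto N" for N using free_or_algebraic by blast
  obtain m \<beta> v where v: "\<beta> \<in> B" "v \<in> tspan m" "\<beta> \<noteq> \<zero>" "s = \<beta> \<otimes> x [^] m \<oplus> v"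
    using adjE[OF s(1)] lead_ex[OF _ s(2)] by blast
  have "w \<noteq> \<zero>" using w(2) adj_carrier[OF s(1)] by auto
  then obtain n \<gamma> z where z: "\<gamma> \<in> B" "z \<in> tspan n" "\<gamma> \<noteq> \<zero>" "w = \<gamma> \<otimes> x [^] n \<oplus> z"
    using adjE[OF w(1)] lead_ex[of w] by blast
  have vc: "v \<in> carrier R" using v span_carrier by blast
  have one: "\<one> \<in> tspan (Suc k)" for k using span_mono[of "Suc 0" "Suc k" \<one>] span_one by (simp del: pspan.simps)
  have "\<one> \<oplus> x \<otimes> v \<in> tspan (Suc m)" by (intro span_add one span_x v(2))
  moreover have "\<one> \<oplus> x \<otimes> s = \<beta> \<otimes> x [^] Suc m \<oplus> (\<one> \<oplus> x \<otimes> v)"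
    unfolding v(4) using v(1) vc by (simp add: r_distr a_ac m_ac)
  ultimately obtain y where y: "y \<in> tspan (Suc m + n)"
    "(\<one> \<oplus> x \<otimes> s) \<otimes> w = (\<beta> \<otimes> \<gamma>) \<otimes> x [^] (Suc m + n) \<oplus> y"
    using lead_mult[OF v(1) z(1) _ z(2), of "\<one> \<oplus> x \<otimes> v" "Suc m"] z(4) by metis
  have "\<one> \<in> tspan (Suc m + n)" using one[of "m + n"] by (simp del: pspan.simps)
  then have "\<beta> \<otimes> \<gamma> = \<zero>"
    using free_lead_le[OF free lessI _ y(1), of "\<beta> \<otimes> \<gamma>" \<one>] y(2) w(2) v(1) z(1) by simp
  then show False using v(1,3) z(1,3) integral[of \<beta> \<gamma>] by simp
qed

end

section \<open>Affine domains\<close>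

lemma (in cring) lids_iff_ideal: "L \<in> lids \<longleftrightarrow> ideal L R"
proof
  assume L: "L \<in> lids"
  show "ideal L R"
  proof (rule idealI[OF ring_axioms])
    show "subgroup L (add_monoid R)"
    proof (rule subgroup.intro)
      fix y assume y: "y \<in> L"
      then have "\<zero> \<ominus> y \<in> L" using lids_minus[OF L lidealsD(2)[OF L]] by blast
      then show "inv\<^bsub>add_monoid R\<^esub> y \<in> L"
        using lidealsD(1)[OF L] y by (simp add: a_inv_def[symmetric] minus_eq subset_iff)
    qed (use lidealsD(1-3)[OF L] in auto)
    fix y z assume yz: "y \<in> L" "z \<in> carrier R"
    then show "z \<otimes> y \<in> L" using lidealsD(4)[OF L] by blast
    then show "y \<otimes> z \<in> L" using yz lidealsD(1)[OF L] m_comm[of y z] by auto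
  qed
next
  assume "ideal L R"
  then interpret ideal L R .
  show "L \<in> lids" by (rule lidealsI) (use a_subset I_l_closed in auto)
qed

locale noetherian_cring = cring +
  assumes acc: "acc_on lids"
begin

lemma maximal_ideal_above:
  assumes "ideal I R" "I \<noteq> carrier R"
  shows "\<exists>M. maximalideal M R \<and> I \<subseteq> M"
proof -
  let ?G = "{J \<in> lids. I \<subseteq> J \<and> J \<noteq> carrier R}"
  have "?G \<subseteq> lids" "?G \<noteq> {}" using assms by (auto simp: lids_iff_ideal)
  then have "\<exists>W\<in>?G. \<forall>Y\<in>?G. W \<subseteq> Y \<longrightarrow> Y \<subseteq> W" by (rule acc_on_maximal[OF acc])
  then obtain M where M: "M \<in> ?G" and mx: "\<forall>Y\<in>?G. M \<subseteq> Y \<longrightarrow> Y \<subseteq> M" by (rule bexE)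
  have "maximalideal M R"
  proof (rule maximalidealI)
    show "ideal M R" "carrier R \<noteq> M" using M by (auto simp: lids_iff_ideal)
    fix J assume J: "ideal J R" "M \<subseteq> J" "J \<subseteq> carrier R"
    show "J = M \<or> J = carrier R"
    proof (cases "J = carrier R")
      case False
      then have "J \<in> ?G" using J M by (auto simp: lids_iff_ideal)
      then show ?thesis using mx J(2) by blast
    qed simp
  qed
  then show ?thesis using M by blast
qed

lemma unit_iff_not_in_maximal:
  assumes "u \<in> carrier R" "\<And>M. maximalideal M R \<Longrightarrow> u \<notin> M"
  shows "u \<in> Units R"
proof -
  have "PIdl u = carrier R"
    using maximal_ideal_above[OF cgenideal_ideal[OF assms(1)]] cgenideal_self[OF assms(1)] assms(2) by blast
  then have "\<one> \<in> PIdl u" by simp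
  then obtain v where "v \<in> carrier R" "\<one> = v \<otimes> u" by (auto simp: cgenideal_def)
  then show ?thesis using assms(1) m_comm[of u v] by (auto simp: Units_def)
qed

end

lemma (in domain) adjoin_finite:
  assumes "finite G" "G \<subseteq> carrier R" "subring B R" "P B"
    and step: "\<And>B x. subring B R \<Longrightarrow> P B \<Longrightarrow> x \<in> carrier R \<Longrightarrow> P (adjoin.adj R B x)"
  shows "\<exists>C. subring C R \<and> B \<union> G \<subseteq> C \<and> P C"
  using assms(1,2)
proof (induction G rule: finite_induct)
  case empty
  then show ?case using assms by blast
next
  case (insert x G)
  then obtain C where C: "subring C R" "B \<union> G \<subseteq> C" "P C" by blast
  interpret C: dadjoin R C x
    using insert.prems C(1) by (intro dadjoin.intro dadjoin_axioms.intro domain_axioms) auto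
  show ?case
    using C.adj_subring step[OF C(1,3) C.xc] C(2) C.B_adj C.x_adj by (intro exI[of _ C.adj]) auto
qed

text \<open>The induction principle for finitely generated algebras: what holds for the ground ring
  and survives the adjunction of one element holds for the whole ring. It serves for the chain
  condition and for \<open>lies_over\<close>.\<close>

lemma (in domain) adjoin_finite_generate:
  assumes "finite G" "G \<subseteq> carrier R" "subring B R" "P B" "generate_ring R (A \<union> G) = carrier R" "A \<subseteq> B"
    and step: "\<And>B x. subring B R \<Longrightarrow> P B \<Longrightarrow> x \<in> carrier R \<Longrightarrow> P (adjoin.adj R B x)"
  shows "P (carrier R)"
proof -
  obtain C where C: "subring C R" "B \<union> G \<subseteq> C" "P C"
    using adjoin_finite[OF assms(1-4) step] by blast
  have "A \<union> G \<subseteq> C" using C assms by blast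
  then have "generate_ring R (A \<union> G) \<subseteq> C"
    using generate_ring_min_subring1[OF _ C(1)] subringE(1)[OF C(1)] by blast
  then have "C = carrier R" using subringE(1)[OF C(1)] assms(5) by auto
  then show ?thesis using C by simp
qed

locale affine_domain = domain R + alg: algebra K R + K: field K
  for K :: "('k, 'l) ring_scheme" and R :: "('k, 'r, 'm) module_scheme" (structure) +
  fixes G
  assumes G: "finite G" "G \<subseteq> carrier R"
    and gen: "generate_ring R ((\<lambda>c. c \<odot>\<^bsub>R\<^esub> \<one>) ` carrier K \<union> G) = carrier R"
begin

definition \<iota> :: "'k \<Rightarrow> 'r" where "\<iota> c = c \<odot>\<^bsub>R\<^esub> \<one>"

lemma \<iota>_closed [simp]: "c \<in> carrier K \<Longrightarrow> \<iota> c \<in> carrier R" by (simp add: \<iota>_def)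
lemma \<iota>_add: "c \<in> carrier K \<Longrightarrow> d \<in> carrier K \<Longrightarrow> \<iota> (c \<oplus>\<^bsub>K\<^esub> d) = \<iota> c \<oplus> \<iota> d"
  by (simp add: \<iota>_def alg.smult_l_distr)
lemma \<iota>_mult: "c \<in> carrier K \<Longrightarrow> d \<in> carrier K \<Longrightarrow> \<iota> (c \<otimes>\<^bsub>K\<^esub> d) = \<iota> c \<otimes> \<iota> d"
  by (simp add: \<iota>_def alg.smult_assoc1 alg.smult_assoc2)
lemma \<iota>_one: "\<iota> \<one>\<^bsub>K\<^esub> = \<one>" by (simp add: \<iota>_def)
lemma \<iota>_zero: "\<iota> \<zero>\<^bsub>K\<^esub> = \<zero>" by (simp add: \<iota>_def)

definition base :: "'r set" where "base = \<iota> ` carrier K"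

lemma base_subring: "subring base R"
proof (rule subringI)
  fix h assume "h \<in> base"
  then obtain c where c: "c \<in> carrier K" "h = \<iota> c" by (auto simp: base_def)
  have "\<iota> (\<ominus>\<^bsub>K\<^esub> c) \<oplus> \<iota> c = \<zero>" using \<iota>_add[of "\<ominus>\<^bsub>K\<^esub> c" c] c \<iota>_zero by (simp add: alg.R.l_neg)
  then have "\<ominus> h = \<iota> (\<ominus>\<^bsub>K\<^esub> c)" using c by (simp add: minus_equality)
  then show "\<ominus> h \<in> base" using c by (auto simp: base_def)
qed (auto simp: base_def \<iota>_one[symmetric] \<iota>_add[symmetric] \<iota>_mult[symmetric] simp del: \<iota>_closed intro: \<iota>_closed)

lemma base_inverse:
  assumes "b \<in> base" "b \<noteq> \<zero>" shows "\<exists>c\<in>base. c \<otimes> b = \<one>"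
proof -
  obtain k where k: "k \<in> carrier K" "b = \<iota> k" using assms by (auto simp: base_def)
  then have "k \<in> Units K" using assms \<iota>_zero by (auto simp: K.field_Units)
  then have "\<iota> (inv\<^bsub>K\<^esub> k) \<otimes> b = \<one>" "inv\<^bsub>K\<^esub> k \<in> carrier K"
    using k \<iota>_mult[of "inv\<^bsub>K\<^esub> k" k] by (auto simp: \<iota>_one)
  then show ?thesis by (auto simp: base_def)
qed

lemma base_acc: "acc_on (lideals R base)"
proof -
  have 1: "L = {\<zero>} \<or> L = base" if L: "L \<in> lideals R base" for L
  proof (cases "L = {\<zero>}")
    case False
    then obtain b where b: "b \<in> L" "b \<noteq> \<zero>" using lidealsD(2)[OF L] by blast
    have bb: "b \<in> base" using b lidealsD(1)[OF L] by blast
    then obtain c where "c \<in> base" "c \<otimes> b = \<one>" using base_inverse b(2) by blast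
    then have "\<one> \<in> L" using lidealsD(4)[OF L, of c b] b(1) by simp
    have "r \<in> L" if "r \<in> base" for r
      using lidealsD(4)[OF L that \<open>\<one> \<in> L\<close>] subringE(1)[OF base_subring] that by auto
    then show ?thesis using lidealsD(1)[OF L] by blast
  qed simp
  show ?thesis
    unfolding acc_on_def
  proof (intro allI impI)
    fix C :: "nat \<Rightarrow> 'r set" assume C: "\<forall>i. C i \<in> lideals R base \<and> C i \<subseteq> C (Suc i)"
    have Cm: "C i \<subseteq> C j" if "i \<le> j" for i j by (rule lift_Suc_mono_le[of C]) (use C that in auto)
    show "\<exists>n. \<forall>i\<ge>n. C i = C n"
    proof (cases "\<exists>n. C n = base")
      case True
      then obtain n where n: "C n = base" ..
      have "C i = base" if "i \<ge> n" for i using Cm[OF that] n C lidealsD(1) by fast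
      then show ?thesis using n by (intro exI[of _ n]) simp
    next
      case False
      then have "C i = {\<zero>}" for i using 1[of "C i"] C by blast
      then show ?thesis by simp
    qed
  qed
qed

lemma noetherian: "acc_on lids"
proof (rule adjoin_finite_generate[where P = "\<lambda>B. acc_on (lideals R B)", OF G base_subring base_acc gen])
  show "(\<lambda>c. c \<odot>\<^bsub>R\<^esub> \<one>) ` carrier K \<subseteq> base" by (auto simp: base_def \<iota>_def)
  fix B x assume *: "subring B R" "acc_on (lideals R B)" "x \<in> carrier R"
  interpret B: dadjoin R B x
    using * by (intro dadjoin.intro dadjoin_axioms.intro domain_axioms) auto
  show "acc_on (lideals R (adjoin.adj R B x))" by (rule B.hilbert_basis[OF *(2)])
qed

sublocale noetherian_cring R by unfold_locales (rule noetherian)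

text \<open>If \<open>a\<close> lies in every maximal ideal, then \<open>1 + a s\<close> is a unit of \<open>R\<close> for all \<open>s\<close>; a suitable
  \<open>s \<in> K[a]\<close> makes it a unit of \<open>K[a]\<close>, so \<open>a\<close> is algebraic over \<open>K\<close> and hence itself a unit.\<close>

lemma jacobson_radical_zero:
  assumes a: "a \<in> carrier R" "a \<noteq> \<zero>"
  shows "\<exists>M. maximalideal M R \<and> a \<notin> M"
proof (rule ccontr)
  assume "\<not> ?thesis"
  then have aM: "a \<in> M" if "maximalideal M R" for M using that by blast
  interpret A: dadjoin R base a
    using base_subring a by (intro dadjoin.intro dadjoin_axioms.intro domain_axioms) auto
  have "lies_over A.adj (carrier R) \<and> A.adj \<subseteq> carrier R"
  proof (rule adjoin_finite_generate[where P = "\<lambda>B. lies_over A.adj B \<and> A.adj \<subseteq> B", OF G A.adj_subring _ gen])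
    show "lies_over A.adj A.adj \<and> A.adj \<subseteq> A.adj" using lies_over_refl by blast
    show "(\<lambda>c. c \<odot>\<^bsub>R\<^esub> \<one>) ` carrier K \<subseteq> A.adj" using A.B_adj by (auto simp: base_def \<iota>_def)
    fix B x assume *: "subring B R" "lies_over A.adj B \<and> A.adj \<subseteq> B" "x \<in> carrier R"
    interpret B: dadjoin R B x
      using * by (intro dadjoin.intro dadjoin_axioms.intro domain_axioms) auto
    show "lies_over A.adj (adjoin.adj R B x) \<and> A.adj \<subseteq> adjoin.adj R B x"
      using lies_over_trans[OF _ B.lies_over_adj] * B.B_adj by blast
  qed
  \<comment> \<open>Applied to the element 1 of R, \<open>lies_over\<close> says that an element of
    K[a] which is a unit of R divides a power of \<open>s\<close> in K[a].\<close>
  moreover have "\<one> \<in> carrier R - {\<zero>}" by simp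
  ultimately obtain s where s: "s \<in> A.adj - {\<zero>}"
    "\<forall>q\<in>A.adj. \<forall>k::nat. dvd_in (carrier R) q (\<one> [^] k) \<longrightarrow> (\<exists>m::nat. dvd_in A.adj q (s [^] m))"
    unfolding lies_over_def by blast
  define q where "q = \<one> \<oplus> a \<otimes> s"
  have sc: "s \<in> carrier R" using s A.adj_carrier by blast
  have q: "q \<in> A.adj" unfolding q_def using s A.adj_add A.adj_mult A.x_adj A.B_adj[OF A.B1] by simp
  have qc: "q \<in> carrier R" using q A.adj_carrier by blast
  have "q \<in> Units R"
  proof (rule unit_iff_not_in_maximal[OF qc])
    fix M assume M: "maximalideal M R"
    then interpret M: maximalideal M R .
    have "M \<in> lids" using M.is_ideal by (simp add: lids_iff_ideal)
    have as: "a \<otimes> s \<in> M" using M.I_r_closed[OF aM[OF M] sc] .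
    show "q \<notin> M"
    proof
      assume "q \<in> M"
      then have "\<one> \<in> M" unfolding q_def by (rule lids_cancel(1)[OF \<open>M \<in> lids\<close> as one_closed])
      then show False using M.I_notcarr M.one_imp_carrier by metis
    qed
  qed
  then have "dvd_in (carrier R) q (\<one> [^] (1::nat))" unfolding dvd_in_def
    by (intro bexI[of _ "inv q"]) auto
  then obtain m where "dvd_in A.adj q (s [^] (m::nat))" using s(2) q by blast
  \<comment> \<open>Modulo q = 1 + a s the element s is invertible with inverse -a. Hence powers of
    s can be removed until q divides 1 in K[a].\<close>
  then have "dvd_in A.adj q \<one>"
  proof (induction m)
    case (Suc m)
    then obtain w where w: "w \<in> A.adj" "s [^] Suc m = q \<otimes> w" by (auto simp: dvd_in_def)
    have wc: "w \<in> carrier R" using w A.adj_carrier by blast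
    have sm: "s [^] m \<in> A.adj" by (induction m) (use s A.adj_mult A.B_adj[OF A.B1] in auto)
    have "s [^] m = q \<otimes> s [^] m \<ominus> a \<otimes> (s [^] Suc m)"
    proof -
      have "s [^] m \<in> carrier R" using sc by simp
      then show ?thesis unfolding q_def nat_pow_Suc using sc a(1) by algebra
    qed
    also have "\<dots> = q \<otimes> (s [^] m \<oplus> (\<ominus> a) \<otimes> w)"
    proof -
      have "s [^] m \<in> carrier R" using sc by simp
      then show ?thesis unfolding w(2) using wc qc a(1) by algebra
    qed
    finally have "s [^] m = q \<otimes> (s [^] m \<oplus> (\<ominus> a) \<otimes> w)" .
    moreover have "s [^] m \<oplus> (\<ominus> a) \<otimes> w \<in> A.adj"
      using A.adj_add A.adj_mult sm w(1) A.x_adj subringE(5)[OF A.adj_subring] by blast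
    ultimately have "dvd_in A.adj q (s [^] m)" unfolding dvd_in_def by blast
    then show ?case by (rule Suc.IH)
  qed simp
  then obtain w where w: "w \<in> A.adj" "q \<otimes> w = \<one>" by (auto simp: dvd_in_def)
  then obtain n b where "b \<in> base" "A.free_upto n" "b \<noteq> \<zero>" "b \<otimes> a [^] n \<in> A.tspan n"
    using A.invertible_imp_algebraic[of s w] s(1) unfolding q_def by blast
  then obtain d where d: "d \<in> base" "d \<noteq> \<zero>" "dvd_in A.adj a d"
    using A.multiple_in_base[of n b a] A.x_adj a(2) by blast
  obtain c where "c \<in> base" "c \<otimes> d = \<one>" using base_inverse[OF d(1,2)] ..
  moreover obtain u where "u \<in> A.adj" "d = a \<otimes> u" using d(3) unfolding dvd_in_def ..
  ultimately have cu: "c \<in> base" "c \<otimes> d = \<one>" "u \<in> A.adj" "d = a \<otimes> u" by simp_all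
  have c: "c \<in> carrier R" "u \<in> carrier R" using cu(1,3) A.adj_carrier A.Bc by blast+
  have "{\<zero>} \<noteq> carrier R" using one_not_zero one_closed by blast
  then obtain M where M: "maximalideal M R" using maximal_ideal_above[OF zeroideal] by blast
  then interpret M: maximalideal M R .
  have "c \<otimes> (a \<otimes> u) \<in> M" using M.I_l_closed M.I_r_closed aM[OF M] c by blast
  then show False using cu M.I_notcarr M.one_imp_carrier by simp
qed

lemma integer_unit:
  assumes "\<forall>n::nat. n > 0 \<longrightarrow> add_pow K n \<one>\<^bsub>K\<^esub> \<noteq> \<zero>\<^bsub>K\<^esub>" "n > 0"
  shows "add_pow R (n::nat) \<one> \<in> Units R"
proof -
  have e: "add_pow R n \<one> = \<iota> (add_pow K n \<one>\<^bsub>K\<^esub>)" for n :: nat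
    by (induction n) (simp_all add: \<iota>_zero \<iota>_add \<iota>_one)
  define b where "b = add_pow R n \<one>"
  have bb: "b \<in> base" by (simp add: b_def e base_def)
  obtain k where k: "k \<in> carrier K" "k \<otimes>\<^bsub>K\<^esub> add_pow K n \<one>\<^bsub>K\<^esub> = \<one>\<^bsub>K\<^esub>"
    using assms K.field_Units alg.R.Units_l_inv alg.R.Units_inv_closed by (metis Diff_iff alg.R.add.nat_pow_closed alg.R.one_closed empty_iff insert_iff)
  then have "\<iota> k \<otimes> b = \<one>" unfolding b_def e by (simp add: \<iota>_mult[symmetric] \<iota>_one)
  moreover have "b \<in> carrier R" by (simp add: b_def)
  ultimately show ?thesis using k m_comm[of b "\<iota> k"]
    unfolding b_def[symmetric] by (auto simp: Units_def intro!: bexI[of _ "\<iota> k"])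
qed

end

section \<open>Prime ideals and Krull dimension\<close>

text \<open>A nonzero element of \<open>P\<close> is a product of irreducibles; one of them lies in
  \<open>P\<close>, and irreducibles of a factorial domain are prime.\<close>

lemma (in domain) prime_ideal_contains_prime:
  assumes "factorial_monoid (mult_of R)" "primeideal P R" "P \<noteq> {\<zero>}"
  shows "\<exists>p\<in>P. p \<noteq> \<zero> \<and> primeideal (PIdl p) R"
proof -
  interpret F: factorial_monoid "mult_of R" by fact
  interpret P: primeideal P R by fact
  obtain a where a: "a \<in> P" "a \<noteq> \<zero>" using assms(3) P.zero_closed by blast
  then have am: "a \<in> carrier (mult_of R)" using P.a_subset by auto
  then obtain fs where fs: "set fs \<subseteq> carrier (mult_of R)" "wfactors (mult_of R) fs a"
    using F.wfactors_exist by blast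
  have "a divides\<^bsub>mult_of R\<^esub> foldr (\<otimes>) fs \<one>"
    using fs(2) by (simp add: wfactors_def associated_def)
  then obtain c where c: "c \<in> carrier R" "foldr (\<otimes>) fs \<one> = a \<otimes> c" by (auto simp: factor_def)
  then have "foldr (\<otimes>) fs \<one> \<in> P" using a P.I_r_closed by simp
  then have "\<exists>f\<in>set fs. f \<in> P" using fs(1)
  proof (induction fs)
    case Nil
    then show ?case using P.I_notcarr P.one_imp_carrier by simp
  next
    case (Cons f fs)
    have "foldr (\<otimes>) gs \<one> \<in> carrier R" if "set gs \<subseteq> carrier (mult_of R)" for gs
      using that by (induction gs) auto
    then show ?case using Cons P.I_prime[of f "foldr (\<otimes>) fs \<one>"] by auto
  qed
  then obtain f where f: "f \<in> set fs" "f \<in> P" by blast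
  then have fm: "f \<in> carrier (mult_of R)" using fs by blast
  have "irreducible (mult_of R) f" using f fs by (simp add: wfactors_def)
  then have "prime (mult_of R) f" using F.irreducible_prime fm by blast
  then have "primeideal (PIdl f) R" using primeideal_iff_prime[of f] ring_primeI'[of f] fm by simp
  then show ?thesis using f fm by auto
qed

lemma krull_dim_chain_le:
  assumes "krull_dim R \<le> enat d" "\<And>i. i \<le> n \<Longrightarrow> primeideal (P i) R" "\<And>i. i < n \<Longrightarrow> P i \<subset> P (Suc i)"
  shows "n \<le> d"
proof -
  have "enat n \<le> krull_dim R" unfolding krull_dim_def
    using assms(2,3) by (intro Sup_upper CollectI exI[of _ n] exI[of _ P] conjI allI impI refl)
  also note assms(1)
  finally show ?thesis by simp
qed

lemma krull_dim_chain_ge: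
  fixes R :: "('a, 'm) ring_scheme"
  assumes "enat d < krull_dim R"
  shows "\<exists>P n. d < n \<and> (\<forall>i\<le>n. primeideal (P i) R) \<and> (\<forall>i<n. P i \<subset> P (Suc i))"
proof -
  obtain e where e: "e \<in> {enat n |n. \<exists>P :: nat \<Rightarrow> 'a set.
     (\<forall>i\<le>n. primeideal (P i) R) \<and> (\<forall>i<n. P i \<subset> P (Suc i))}" "enat d < e"
    using assms unfolding krull_dim_def less_Sup_iff by (rule bexE)
  from e(1) obtain n P where "e = enat n" "\<forall>i\<le>n. primeideal (P i) R" "\<forall>i<n. P i \<subset> P (Suc i)"
    unfolding mem_Collect_eq by (elim exE conjE)
  then show ?thesis using e(2) by (intro exI[of _ P] exI[of _ n]) simp
qed

context noetherian_cring
begin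

text \<open>Noetherian induction: a largest counterexample J is not prime, since a maximal ideal has
  only two ideals above it. If a b lies in J but neither factor does, both \<open>colon J a\<close>
  and J + (a) are strictly larger than J, and the intervals below and above J + (a) glue.\<close>

lemma dcc_above_of_primes_maximal:
  assumes "ideal I R" "\<And>P. primeideal P R \<Longrightarrow> I \<subseteq> P \<Longrightarrow> maximalideal P R"
  shows "dcc_on (between lids I (carrier R))"
proof (rule ccontr)
  assume n: "\<not> ?thesis"
  let ?G = "{I \<in> lids. (\<forall>P. primeideal P R \<and> I \<subseteq> P \<longrightarrow> maximalideal P R) \<and>
    \<not> dcc_on (between lids I (carrier R))}"
  have "?G \<subseteq> lids" "?G \<noteq> {}" using assms n by (auto simp: lids_iff_ideal)
  then have "\<exists>W\<in>?G. \<forall>Y\<in>?G. W \<subseteq> Y \<longrightarrow> Y \<subseteq> W" by (rule acc_on_maximal[OF acc])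
  then obtain J where J: "J \<in> ?G" and mx: "\<forall>Y\<in>?G. J \<subseteq> Y \<longrightarrow> Y \<subseteq> J" by (rule bexE)
  have Jl: "J \<in> lids" and nd: "\<not> dcc_on (between lids J (carrier R))" using J by auto
  interpret J: ideal J R using Jl by (simp add: lids_iff_ideal)
  have bigger: "dcc_on (between lids Y (carrier R))" if "Y \<in> lids" "J \<subset> Y" for Y
  proof (rule ccontr)
    assume "\<not> ?thesis"
    then have "Y \<in> ?G" using that J by auto
    then show False using mx that by blast
  qed
  have two: "dcc_on (between lids J (carrier R))" if "\<And>Y. Y \<in> lids \<Longrightarrow> J \<subseteq> Y \<Longrightarrow> Y = J \<or> Y = carrier R"
    unfolding dcc_on_def
  proof (intro allI impI)
    fix C :: "nat \<Rightarrow> _" assume C: "\<forall>i. C i \<in> between lids J (carrier R) \<and> C (Suc i) \<subseteq> C i"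
    have C': "C i = J \<or> C i = carrier R" for i using that[of "C i"] C by (simp add: between_mem)
    have Cm: "C j \<subseteq> C i" if "i \<le> j" for i j by (rule lift_Suc_antimono_le[of C]) (use C that in auto)
    show "\<exists>n. \<forall>i\<ge>n. C i = C n"
    proof (cases "\<exists>n. C n = J")
      case True
      then obtain n where n: "C n = J" ..
      have "C i = J" if "i \<ge> n" for i using Cm[OF that] n C by (auto simp: between_mem)
      then show ?thesis using n by (intro exI[of _ n]) simp
    next
      case False
      then have "C i = carrier R" for i using C'[of i] by blast
      then show ?thesis by simp
    qed
  qed
  have Jc: "J \<noteq> carrier R" using two nd lidealsD(1) by blast
  have "\<not> primeideal J R"
  proof
    assume "primeideal J R"
    then interpret M: maximalideal J R using J by blast
    have "dcc_on (between lids J (carrier R))"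
    proof (rule two)
      fix Y assume "Y \<in> lids" "J \<subseteq> Y"
      then show "Y = J \<or> Y = carrier R" using M.I_maximal lidealsD(1)[of Y R] by (simp add: lids_iff_ideal)
    qed
    then show False using nd by blast
  qed
  then obtain a b where ab: "a \<in> carrier R" "b \<in> carrier R" "a \<otimes> b \<in> J" "a \<notin> J" "b \<notin> J"
    using primeidealI[OF J.is_ideal is_cring] Jc by blast
  have l1: "lsum J (lprinc a) \<in> lids" using lids_lsum Jl lids_lprinc ab(1) by blast
  have u1: "J \<subseteq> lsum J (lprinc a)" "a \<in> lsum J (lprinc a)"
    using lsum_upper[OF Jl lids_lprinc(1)[OF ab(1)]] lids_lprinc(2)[OF ab(1)] by auto
  have "b \<in> colon J a" "J \<subseteq> colon J a"
    using ab J.I_r_closed J.a_subset by (auto simp: colon_def m_comm)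
  then have "dcc_on (between lids (colon J a) (carrier R))"
    using bigger[OF lids_colon[OF Jl ab(1)]] ab by blast
  then have "dcc_on (between lids J (lsum J (lprinc a)))" by (rule dcc_between_lprinc[OF Jl ab(1)])
  moreover have "dcc_on (between lids (lsum J (lprinc a)) (carrier R))" using bigger[OF l1] u1 ab by blast
  ultimately have "dcc_on (between lids J (carrier R))"
    using dcc_between_trans[OF Jl l1 lids_carrier u1(1)] lidealsD(1)[OF l1] by blast
  then show False using nd by blast
qed

end

section \<open>The largest differential ideal in an ideal\<close>

context derivation
begin

text \<open>For an ideal \<open>M\<close> this is its largest \<delta>-ideal, by
  \<open>dcore_delta_ideal\<close> and \<open>dcore_greatest\<close>.\<close>

definition dcore :: "'r set \<Rightarrow> 'r set" where
  "dcore M = {r \<in> carrier R. \<forall>n. (\<delta> ^^ n) r \<in> M}"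

lemma deriv_pow_closed [simp]: "a \<in> carrier R \<Longrightarrow> (\<delta> ^^ n) a \<in> carrier R"
  by (induction n) auto

lemma deriv_pow_add:
  "a \<in> carrier R \<Longrightarrow> b \<in> carrier R \<Longrightarrow> (\<delta> ^^ n) (a \<oplus> b) = (\<delta> ^^ n) a \<oplus> (\<delta> ^^ n) b"
  by (induction n) (auto simp: deriv_add)

lemma deriv_pow_mult:
  "a \<in> carrier R \<Longrightarrow> b \<in> carrier R \<Longrightarrow>
   (\<delta> ^^ Suc n) (a \<otimes> b) = (\<delta> ^^ n) (\<delta> a \<otimes> b) \<oplus> (\<delta> ^^ n) (a \<otimes> \<delta> b)"
  by (simp add: funpow_swap1 deriv_mult deriv_pow_add)

lemma dcore_subset: "dcore M \<subseteq> M"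
proof
  fix r assume "r \<in> dcore M"
  then have "(\<delta> ^^ 0) r \<in> M" unfolding dcore_def by blast
  then show "r \<in> M" by simp
qed

lemma dcore_deriv: "r \<in> dcore M \<Longrightarrow> \<delta> r \<in> dcore M"
proof -
  assume r: "r \<in> dcore M"
  have "(\<delta> ^^ n) (\<delta> r) \<in> M" for n using r by (metis (mono_tags, lifting) dcore_def funpow.simps(2) funpow_swap1 mem_Collect_eq o_apply)
  then show ?thesis using r by (simp add: dcore_def)
qed

lemma dcore_delta_ideal:
  assumes "ideal M R" shows "delta_ideal R \<delta> (dcore M)"
proof -
  interpret M: ideal M R by fact
  have z: "(\<delta> ^^ n) \<zero> = \<zero>" for n by (induction n) auto
  have m: "(\<delta> ^^ n) (b \<otimes> r) \<in> M" if "r \<in> dcore M" "b \<in> carrier R" for n b r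
    using that
  proof (induction n arbitrary: b r)
    case 0
    then show ?case using dcore_subset M.I_l_closed by auto
  next
    case (Suc n)
    then show ?case using dcore_deriv[of r M] deriv_pow_mult[of b r n] M.a_closed by (auto simp: dcore_def)
  qed
  have "dcore M \<in> lids"
  proof (rule lidealsI)
    fix b r assume "b \<in> carrier R" "r \<in> dcore M"
    then show "b \<otimes> r \<in> dcore M" using m by (auto simp: dcore_def)
  qed (auto simp: dcore_def z deriv_pow_add M.a_closed)
  then have "ideal (dcore M) R" by (simp add: lids_iff_ideal)
  then show ?thesis using dcore_deriv by (auto simp: delta_ideal_def)
qed

lemma dcore_greatest:
  assumes "delta_ideal R \<delta> I" "I \<subseteq> M" shows "I \<subseteq> dcore M"
proof
  fix r assume r: "r \<in> I"
  interpret I: ideal I R using assms by (simp add: delta_ideal_def)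
  have "(\<delta> ^^ n) r \<in> I" for n using r assms(1) by (induction n) (auto simp: delta_ideal_def)
  then show "r \<in> dcore M" using r assms(2) I.a_subset by (auto simp: dcore_def)
qed

text \<open>In the Leibniz expansion of the k-th derivative of a b, every term but one
  differentiates a fewer than m times or b fewer than n times and so lies in M. The multiplicity
  \<open>c\<close> of the surviving term is a binomial coefficient; only its positivity is
  recorded.\<close>

lemma leibniz_leading:
  assumes "ideal M R"
  shows "a \<in> carrier R \<Longrightarrow> b \<in> carrier R \<Longrightarrow> m + n = k \<Longrightarrow>
    (\<And>i. i < m \<Longrightarrow> (\<delta> ^^ i) a \<in> M) \<Longrightarrow> (\<And>j. j < n \<Longrightarrow> (\<delta> ^^ j) b \<in> M) \<Longrightarrow>
    \<exists>c::nat. c > 0 \<and> (\<delta> ^^ k) (a \<otimes> b) \<ominus> add_pow R c ((\<delta> ^^ m) a \<otimes> (\<delta> ^^ n) b) \<in> M"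
proof (induction k arbitrary: m n a b)
  interpret M: ideal M R by fact
  case 0
  then show ?case by (intro exI[of _ 1]) (simp add: minus_eq R.r_neg M.zero_closed)
next
  interpret M: ideal M R by fact
  have Ml: "M \<in> lids" using assms by (simp add: lids_iff_ideal)
  case (Suc k)
  define y where "y = (\<delta> ^^ m) a \<otimes> (\<delta> ^^ n) b"
  have y: "y \<in> carrier R" using Suc.prems by (simp add: y_def)
  \<comment> \<open>For m = 0 this half contributes nothing, as b is differentiated only k < n
    times; then c = 0. Since m + n > 0, at least one of the two halves has a positive
    multiplicity.\<close>
  have 1: "\<exists>c::nat. (m > 0 \<longrightarrow> c > 0) \<and> (\<delta> ^^ k) (\<delta> a \<otimes> b) \<ominus> add_pow R c y \<in> M"
  proof (cases m)
    case 0
    have ex: "\<exists>c::nat. c > 0 \<and> (\<delta> ^^ k) (\<delta> a \<otimes> b) \<ominus> add_pow R c ((\<delta> ^^ 0) (\<delta> a) \<otimes> (\<delta> ^^ k) b) \<in> M"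
      by (rule Suc.IH) (use Suc.prems 0 in auto)
    then obtain c :: nat where c: "(\<delta> ^^ k) (\<delta> a \<otimes> b) \<ominus> add_pow R c (\<delta> a \<otimes> (\<delta> ^^ k) b) \<in> M" by auto
    have "(\<delta> ^^ k) b \<in> M" using Suc.prems 0 by simp
    then have "\<delta> a \<otimes> (\<delta> ^^ k) b \<in> M" using Suc.prems M.I_l_closed by simp
    then have "add_pow R c (\<delta> a \<otimes> (\<delta> ^^ k) b) \<in> M" by (induction c) (auto simp: M.a_closed M.zero_closed)
    then have "(\<delta> ^^ k) (\<delta> a \<otimes> b) \<in> M" using lids_cancel(3)[OF Ml _ _ c] Suc.prems by simp
    then show ?thesis using 0 Suc.prems by (intro exI[of _ 0]) (simp add: minus_eq)
  next
    case (Suc m')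
    have "\<exists>c::nat. c > 0 \<and> (\<delta> ^^ k) (\<delta> a \<otimes> b) \<ominus> add_pow R c ((\<delta> ^^ m') (\<delta> a) \<otimes> (\<delta> ^^ n) b) \<in> M"
    proof (rule Suc.IH)
      fix i assume "i < m'"
      then show "(\<delta> ^^ i) (\<delta> a) \<in> M" using Suc.prems(4)[of "Suc i"] Suc by (simp add: funpow_swap1)
    qed (use Suc.prems Suc in auto)
    then show ?thesis using Suc by (auto simp: y_def funpow_swap1)
  qed
  have 2: "\<exists>c::nat. (n > 0 \<longrightarrow> c > 0) \<and> (\<delta> ^^ k) (a \<otimes> \<delta> b) \<ominus> add_pow R c y \<in> M"
  proof (cases n)
    case 0
    have "\<exists>c::nat. c > 0 \<and> (\<delta> ^^ k) (a \<otimes> \<delta> b) \<ominus> add_pow R c ((\<delta> ^^ k) a \<otimes> (\<delta> ^^ 0) (\<delta> b)) \<in> M"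
      by (rule Suc.IH) (use Suc.prems 0 in auto)
    then obtain c :: nat where c: "(\<delta> ^^ k) (a \<otimes> \<delta> b) \<ominus> add_pow R c ((\<delta> ^^ k) a \<otimes> \<delta> b) \<in> M" by auto
    have "(\<delta> ^^ k) a \<in> M" using Suc.prems 0 by simp
    then have "(\<delta> ^^ k) a \<otimes> \<delta> b \<in> M" using Suc.prems M.I_r_closed by simp
    then have "add_pow R c ((\<delta> ^^ k) a \<otimes> \<delta> b) \<in> M" by (induction c) (auto simp: M.a_closed M.zero_closed)
    then have "(\<delta> ^^ k) (a \<otimes> \<delta> b) \<in> M" using lids_cancel(3)[OF Ml _ _ c] Suc.prems by simp
    then show ?thesis using 0 Suc.prems by (intro exI[of _ 0]) (simp add: minus_eq)
  next
    case (Suc n')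
    have "\<exists>c::nat. c > 0 \<and> (\<delta> ^^ k) (a \<otimes> \<delta> b) \<ominus> add_pow R c ((\<delta> ^^ m) a \<otimes> (\<delta> ^^ n') (\<delta> b)) \<in> M"
    proof (rule Suc.IH)
      fix i assume "i < n'"
      then show "(\<delta> ^^ i) (\<delta> b) \<in> M" using Suc.prems(5)[of "Suc i"] Suc by (simp add: funpow_swap1)
    qed (use Suc.prems Suc in auto)
    then show ?thesis using Suc by (auto simp: y_def funpow_swap1)
  qed
  obtain c d :: nat where cd: "m > 0 \<longrightarrow> c > 0" "n > 0 \<longrightarrow> d > 0"
    "(\<delta> ^^ k) (\<delta> a \<otimes> b) \<ominus> add_pow R c y \<in> M" "(\<delta> ^^ k) (a \<otimes> \<delta> b) \<ominus> add_pow R d y \<in> M"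
    using 1 2 by blast
  define u v where "u = (\<delta> ^^ k) (\<delta> a \<otimes> b)" and "v = (\<delta> ^^ k) (a \<otimes> \<delta> b)"
  have uv: "u \<in> carrier R" "v \<in> carrier R" using Suc.prems by (auto simp: u_def v_def)
  have "(u \<ominus> add_pow R c y) \<oplus> (v \<ominus> add_pow R d y) = (u \<oplus> v) \<ominus> (add_pow R c y \<oplus> add_pow R d y)"
  proof -
    have "add_pow R c y \<in> carrier R" "add_pow R d y \<in> carrier R" using y by auto
    then show ?thesis using uv by algebra
  qed
  also have "add_pow R c y \<oplus> add_pow R d y = add_pow R (c + d) y" using y by (simp add: R.add.nat_pow_mult)
  also have "u \<oplus> v = (\<delta> ^^ Suc k) (a \<otimes> b)" unfolding u_def v_def using Suc.prems by (simp add: deriv_pow_mult del: funpow.simps)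
  finally have "(\<delta> ^^ Suc k) (a \<otimes> b) \<ominus> add_pow R (c + d) y \<in> M"
    using cd(3,4) M.a_closed unfolding u_def v_def by metis
  moreover have "c + d > 0" using cd(1,2) Suc.prems(3) by auto
  ultimately show ?case unfolding y_def by blast
qed

end

text \<open>Characteristic zero in the form in which it acts on ideals: by
  \<open>add_pow_cancel\<close>, membership in an ideal can be divided by positive integers.\<close>

locale diff_domain = derivation R \<delta> + domain R for R :: "('r, 'm) ring_scheme" (structure) and \<delta> +
  assumes integer_unit: "n > 0 \<Longrightarrow> add_pow R (n::nat) \<one> \<in> Units R"
begin

lemma add_pow_cancel:
  assumes "ideal M R" "x \<in> carrier R" "(n::nat) > 0" "add_pow R n x \<in> M" shows "x \<in> M"
proof -
  interpret M: ideal M R by fact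
  have u: "add_pow R n \<one> \<in> Units R" by (rule integer_unit[OF assms(3)])
  have "add_pow R n x = add_pow R n \<one> \<otimes> x" using assms(2) by (simp add: R.add_pow_ldistr)
  then have "x = inv (add_pow R n \<one>) \<otimes> add_pow R n x"
    using u assms(2) by (simp add: R.m_assoc[symmetric])
  then show ?thesis using M.I_l_closed[OF assms(4), of "inv (add_pow R n \<one>)"] u by simp
qed

text \<open>Take the first derivatives of a and b that leave M. Their product is, up to a positive
  integer and modulo M, a derivative of a b, so it would lie in the prime ideal M.\<close>

lemma dcore_prime:
  assumes "primeideal M R" shows "primeideal (dcore M) R"
proof -
  interpret M: primeideal M R by fact
  show ?thesis
  proof (rule primeidealI)
    show "ideal (dcore M) R" using dcore_delta_ideal[OF M.is_ideal] by (simp add: delta_ideal_def)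
    show "cring R" by (rule R.is_cring)
    show "carrier R \<noteq> dcore M" using dcore_subset[of M] M.I_notcarr M.a_subset by blast
    fix a b assume ab: "a \<in> carrier R" "b \<in> carrier R" "a \<otimes> b \<in> dcore M"
    show "a \<in> dcore M \<or> b \<in> dcore M"
    proof (rule ccontr)
      assume "\<not> ?thesis"
      then obtain m0 n0 where "(\<delta> ^^ m0) a \<notin> M" "(\<delta> ^^ n0) b \<notin> M" using ab by (auto simp: dcore_def)
      define m n where "m = (LEAST m. (\<delta> ^^ m) a \<notin> M)" and "n = (LEAST n. (\<delta> ^^ n) b \<notin> M)"
      have m: "(\<delta> ^^ m) a \<notin> M" unfolding m_def by (rule LeastI) fact
      have n: "(\<delta> ^^ n) b \<notin> M" unfolding n_def by (rule LeastI) fact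
      have "\<exists>c::nat. c > 0 \<and> (\<delta> ^^ (m + n)) (a \<otimes> b) \<ominus> add_pow R c ((\<delta> ^^ m) a \<otimes> (\<delta> ^^ n) b) \<in> M"
        by (rule leibniz_leading[OF M.is_ideal ab(1,2) refl])
          (use not_less_Least in \<open>auto simp: m_def n_def\<close>)
      then obtain c :: nat where c: "c > 0"
        "(\<delta> ^^ (m + n)) (a \<otimes> b) \<ominus> add_pow R c ((\<delta> ^^ m) a \<otimes> (\<delta> ^^ n) b) \<in> M" by blast
      have in_M: "(\<delta> ^^ (m + n)) (a \<otimes> b) \<in> M" using ab(3) unfolding dcore_def by blast
      have "add_pow R c ((\<delta> ^^ m) a \<otimes> (\<delta> ^^ n) b) \<in> M"
        by (rule lids_cancel(4)[OF _ in_M _ c(2)]) (use M.is_ideal ab in \<open>simp_all add: lids_iff_ideal\<close>)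
      then have "(\<delta> ^^ m) a \<otimes> (\<delta> ^^ n) b \<in> M"
        by (rule add_pow_cancel[OF M.is_ideal R.m_closed[OF deriv_pow_closed[OF ab(1)] deriv_pow_closed[OF ab(2)]] c(1)])
      then show False
        using M.I_prime[OF deriv_pow_closed[OF ab(1)] deriv_pow_closed[OF ab(2)]] m n by blast
    qed
  qed
qed

end

text \<open>The ground field and the generators disappear here: an affine factorial domain enters
  the remaining argument only through these consequences.\<close>

locale diff_surface = diff_domain R \<delta> + noetherian_cring R
  for R :: "('r, 'm) ring_scheme" (structure) and \<delta> +
  assumes prime_contains_prime:
      "primeideal P R \<Longrightarrow> P \<noteq> {\<zero>} \<Longrightarrow> \<exists>p\<in>P. p \<noteq> \<zero> \<and> primeideal (PIdl p) R"
    and jacobson_zero: "a \<in> carrier R \<Longrightarrow> a \<noteq> \<zero> \<Longrightarrow> \<exists>M. maximalideal M R \<and> a \<notin> M"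
    and dim: "krull_dim R = 2"
    and no_delta_maximal: "maximalideal M R \<Longrightarrow> \<not> delta_ideal R \<delta> M"
begin

text \<open>Otherwise 0, P, Q and a maximal ideal above Q would form a chain of length
  three.\<close>

lemma above_prime_maximal:
  assumes "primeideal P R" "P \<noteq> {\<zero>}" "primeideal Q R" "P \<subset> Q"
  shows "maximalideal Q R"
proof (rule ccontr)
  assume n: "\<not> ?thesis"
  interpret P: primeideal P R by fact
  interpret Q: primeideal Q R by fact
  obtain M where M: "maximalideal M R" "Q \<subseteq> M"
    using maximal_ideal_above[OF Q.is_ideal] Q.I_notcarr by metis
  have "Q \<noteq> M" using n M by blast
  define C where "C = (\<lambda>i::nat. if i = 0 then {\<zero>} else if i = 1 then P else if i = 2 then Q else M)"
  have "3 \<le> (2::nat)"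
  proof (rule krull_dim_chain_le)
    show "krull_dim R \<le> enat 2" using dim by (simp add: numeral_eq_enat)
    show "primeideal (C i) R" for i
      using zeroprimeideal assms R.maximalideal_prime[OF M(1)] by (auto simp: C_def)
    show "C i \<subset> C (Suc i)" if "i < 3" for i
    proof -
      have "i = 0 \<or> i = 1 \<or> i = 2" using that by auto
      then show ?thesis using P.zero_closed assms(2,4) M(2) \<open>Q \<noteq> M\<close> by (auto simp: C_def)
    qed
  qed
  then show False by simp
qed

text \<open>The middle prime of a chain of length two is nonzero and contains a prime element, whose
  ideal then lies strictly below the top prime of the chain.\<close>

lemma nonmaximal_prime_element:
  "\<exists>f\<in>carrier R. f \<noteq> \<zero> \<and> primeideal (PIdl f) R \<and> \<not> maximalideal (PIdl f) R"
proof -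
  have "enat 1 < krull_dim R" using dim by (simp add: numeral_eq_enat)
  then obtain P n where P: "1 < n" "\<forall>i\<le>n. primeideal (P i) R" "\<forall>i<n. P i \<subset> P (Suc i)"
    using krull_dim_chain_ge by meson
  obtain A B C where pr: "primeideal A R" "primeideal B R" "primeideal C R"
    and c: "A \<subset> B" "B \<subset> C"
  proof (rule that)
    show "primeideal (P 0) R" "primeideal (P (Suc 0)) R" "primeideal (P (Suc (Suc 0))) R"
      using P(1,2) by auto
    show "P 0 \<subset> P (Suc 0)" "P (Suc 0) \<subset> P (Suc (Suc 0))"
      using P(1) by (intro P(3)[rule_format], simp)+
  qed
  interpret A: primeideal A R by (rule pr)
  interpret B: primeideal B R by (rule pr)
  interpret C: primeideal C R by (rule pr)
  have "B \<noteq> {\<zero>}" using c(1) A.zero_closed by auto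
  then obtain f where f: "f \<in> B" "f \<noteq> \<zero>" "primeideal (PIdl f) R" using prime_contains_prime[OF pr(2)] by auto
  have sub: "PIdl f \<subseteq> B" by (rule R.cgenideal_minimal[OF B.is_ideal f(1)])
  have "\<not> maximalideal (PIdl f) R"
  proof
    assume "maximalideal (PIdl f) R"
    then interpret M: maximalideal "PIdl f" R .
    have "C = PIdl f \<or> C = carrier R"
      by (rule M.I_maximal[OF C.is_ideal]) (use sub c C.a_subset in auto)
    then show False using sub c C.I_notcarr by auto
  qed
  then show ?thesis using f B.a_subset by auto
qed

text \<open>The analogue of an irreducible Darboux polynomial: a prime element p that divides
  \<delta>(p).\<close>

definition darboux :: "'r \<Rightarrow> bool" where
  "darboux p \<longleftrightarrow> p \<in> carrier R \<and> p \<noteq> \<zero> \<and> primeideal (PIdl p) R \<and> delta_ideal R \<delta> (PIdl p)"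

text \<open>The core is a nonzero prime, so it contains a prime element p. Were it strictly larger
  than (p), it would be maximal for reasons of dimension, and no maximal ideal is a
  \<delta>-ideal.\<close>

lemma dcore_darboux:
  assumes M: "maximalideal M R" and nz: "dcore M \<noteq> {\<zero>}"
  shows "\<exists>p. darboux p \<and> dcore M = PIdl p"
proof -
  interpret M: maximalideal M R by fact
  have pr: "primeideal (dcore M) R" by (rule dcore_prime[OF R.maximalideal_prime[OF M]])
  then interpret D: primeideal "dcore M" R .
  have di: "delta_ideal R \<delta> (dcore M)" by (rule dcore_delta_ideal[OF M.is_ideal])
  obtain p where p: "p \<in> dcore M" "p \<noteq> \<zero>" "primeideal (PIdl p) R" using prime_contains_prime[OF pr nz] by blast
  have pc: "p \<in> carrier R" using p D.a_subset by blast
  have sub: "PIdl p \<subseteq> dcore M" by (rule R.cgenideal_minimal[OF D.is_ideal p(1)])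
  have "PIdl p = dcore M"
  proof (rule ccontr)
    assume "PIdl p \<noteq> dcore M"
    moreover have "PIdl p \<noteq> {\<zero>}" using R.cgenideal_self[OF pc] p(2) by blast
    ultimately have "maximalideal (dcore M) R" using above_prime_maximal[OF p(3) _ pr] sub by blast
    then show False using no_delta_maximal di by blast
  qed
  then have "darboux p" "dcore M = PIdl p" unfolding darboux_def using di p pc by simp_all
  then show ?thesis by blast
qed

lemma delta_ideal_below_darboux:
  assumes I: "delta_ideal R \<delta> I" "I \<noteq> carrier R" "I \<noteq> {\<zero>}"
  shows "\<exists>p. darboux p \<and> I \<subseteq> PIdl p"
proof -
  interpret I: ideal I R using I by (simp add: delta_ideal_def)
  obtain M where M: "maximalideal M R" "I \<subseteq> M" using maximal_ideal_above[OF I.is_ideal I(2)] by blast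
  have "I \<subseteq> dcore M" by (rule dcore_greatest[OF I(1) M(2)])
  moreover have "dcore M \<noteq> {\<zero>}" using calculation I(3) I.zero_closed by blast
  ultimately show ?thesis using dcore_darboux[OF M(1)] by metis
qed

text \<open>A proper such ideal would lie in (q) for a Darboux element q; then (q) is a prime
  strictly above (p), hence a maximal ideal that is a \<delta>-ideal.\<close>

lemma delta_ideal_above_darboux:
  assumes p: "darboux p" and I: "delta_ideal R \<delta> I" "PIdl p \<subset> I"
  shows "I = carrier R"
proof (rule ccontr)
  assume n: "I \<noteq> carrier R"
  have pc: "p \<in> carrier R" "p \<noteq> \<zero>" "primeideal (PIdl p) R" using p by (auto simp: darboux_def)
  have "I \<noteq> {\<zero>}" using I(2) R.cgenideal_self[OF pc(1)] pc(2) by blast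
  then obtain q where q: "darboux q" "I \<subseteq> PIdl q" using delta_ideal_below_darboux[OF I(1) n] by blast
  have "PIdl p \<noteq> {\<zero>}" using R.cgenideal_self[OF pc(1)] pc(2) by blast
  then have "maximalideal (PIdl q) R"
    using above_prime_maximal[OF pc(3)] q I(2) by (auto simp: darboux_def)
  then show False using no_delta_maximal q(1) by (auto simp: darboux_def)
qed

lemma dcc_above_darboux:
  assumes p: "darboux p" and I: "ideal I R" "PIdl p \<subset> I"
  shows "dcc_on (between lids I (carrier R))"
proof (rule dcc_above_of_primes_maximal[OF I(1)])
  fix P assume P: "primeideal P R" "I \<subseteq> P"
  have pc: "p \<in> carrier R" "p \<noteq> \<zero>" "primeideal (PIdl p) R" using p by (auto simp: darboux_def)
  have "PIdl p \<noteq> {\<zero>}" using R.cgenideal_self[OF pc(1)] pc(2) by blast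
  then show "maximalideal P R" using above_prime_maximal[OF pc(3) _ P(1)] P(2) I(2) by blast
qed

lemma delta_primitive_iff: "delta_primitive R \<delta> \<longleftrightarrow> (\<exists>M. maximalideal M R \<and> dcore M = {\<zero>})"
proof
  assume "delta_primitive R \<delta>"
  then obtain M where M: "maximalideal M R" "\<And>I. delta_ideal R \<delta> I \<Longrightarrow> I \<subseteq> M \<Longrightarrow> I = {\<zero>}"
    unfolding delta_primitive_def by blast
  interpret M: maximalideal M R by (rule M(1))
  show "\<exists>M. maximalideal M R \<and> dcore M = {\<zero>}"
    using M dcore_delta_ideal[OF M.is_ideal] dcore_subset by blast
next
  assume "\<exists>M. maximalideal M R \<and> dcore M = {\<zero>}"
  then obtain M where M: "maximalideal M R" "dcore M = {\<zero>}" by blast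
  have "I = {\<zero>}" if "delta_ideal R \<delta> I" "I \<subseteq> M" for I
  proof -
    interpret I: ideal I R using that by (simp add: delta_ideal_def)
    show ?thesis using dcore_greatest[OF that] M(2) I.zero_closed by blast
  qed
  then show "delta_primitive R \<delta>" using M unfolding delta_primitive_def by blast
qed

end

section \<open>Degrees and left ideals of the differential operator ring\<close>

sublocale derivation \<subseteq> S: ring S by (rule diff_op_ring_ring)

context derivation
begin

lemma S_carrier [simp]: "carrier S = up R" by (simp add: diff_op_simps)
lemma S_add_closed [simp]: "p \<in> up R \<Longrightarrow> q \<in> up R \<Longrightarrow> p \<oplus>\<^bsub>S\<^esub> q \<in> up R" using S.a_closed by simp
lemma S_neg_closed [simp]: "p \<in> up R \<Longrightarrow> \<ominus>\<^bsub>S\<^esub> p \<in> up R" using S.a_inv_closed by simp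
lemma S_minus_closed [simp]: "p \<in> up R \<Longrightarrow> q \<in> up R \<Longrightarrow> p \<ominus>\<^bsub>S\<^esub> q \<in> up R" using S.minus_closed by simp
lemma S_zero_closed [simp]: "\<zero>\<^bsub>S\<^esub> \<in> up R" using S.zero_closed by simp
lemma S_add_coeff: "(p \<oplus>\<^bsub>S\<^esub> q) n = p n \<oplus> q n" by (simp add: diff_op_simps)
lemma S_zero_coeff: "\<zero>\<^bsub>S\<^esub> n = \<zero>" by (simp add: diff_op_simps)

lemma S_neg_coeff:
  assumes "p \<in> up R" shows "(\<ominus>\<^bsub>S\<^esub> p) n = \<ominus> (p n)"
proof -
  have "(\<ominus>\<^bsub>S\<^esub> p \<oplus>\<^bsub>S\<^esub> p) n = \<zero>" using assms S.l_neg[of p] by (simp add: S_zero_coeff)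
  then show ?thesis using assms by (simp add: S_add_coeff R.minus_equality)
qed

lemma S_minus_coeff: "p \<in> up R \<Longrightarrow> q \<in> up R \<Longrightarrow> (p \<ominus>\<^bsub>S\<^esub> q) n = p n \<ominus> q n"
  by (simp add: a_minus_def S_add_coeff S_neg_coeff)

lemma S_const_coeff: "a \<in> carrier R \<Longrightarrow> q \<in> up R \<Longrightarrow> (dconst R a \<otimes>\<^bsub>S\<^esub> q) n = a \<otimes> q n"
  by (simp add: dmult_const)

lemmas S_coeff = S_add_coeff S_zero_coeff S_neg_coeff S_minus_coeff S_const_coeff

lemma dconst_coeff_0 [simp]: "dconst R a 0 = a" by (simp add: dconst_def)

lemma dtheta_up [simp]: "dtheta R \<in> up R" using dtheta_closed by simp

lemma dconst_simps:
  "a \<in> carrier R \<Longrightarrow> b \<in> carrier R \<Longrightarrow> dconst R (a \<oplus> b) = dconst R a \<oplus>\<^bsub>S\<^esub> dconst R b"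
  "a \<in> carrier R \<Longrightarrow> b \<in> carrier R \<Longrightarrow> dconst R (a \<otimes> b) = dconst R a \<otimes>\<^bsub>S\<^esub> dconst R b"
  "dconst R \<zero> = \<zero>\<^bsub>S\<^esub>" "dconst R \<one> = \<one>\<^bsub>S\<^esub>"
  "a \<in> carrier R \<Longrightarrow> dconst R (\<ominus> a) = \<ominus>\<^bsub>S\<^esub> dconst R a"
  by (auto simp: fun_eq_iff diff_op_simps(2) S_coeff) (auto simp: dconst_def)

lemma T_coeff:
  "q \<in> up R \<Longrightarrow> T q 0 = \<delta> (q 0)" "T q (Suc n) = q n \<oplus> \<delta> (q (Suc n))"
  by (simp_all add: theta_times_def)

lemma T_const_mult:
  assumes "a \<in> carrier R" "s \<in> up R"
  shows "T (dconst R a \<otimes>\<^bsub>S\<^esub> s) = dconst R a \<otimes>\<^bsub>S\<^esub> T s \<oplus>\<^bsub>S\<^esub> dconst R (\<delta> a) \<otimes>\<^bsub>S\<^esub> s"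
proof
  fix n
  show "T (dconst R a \<otimes>\<^bsub>S\<^esub> s) n = (dconst R a \<otimes>\<^bsub>S\<^esub> T s \<oplus>\<^bsub>S\<^esub> dconst R (\<delta> a) \<otimes>\<^bsub>S\<^esub> s) n"
    using assms by (cases n) (simp_all add: T_coeff S_coeff deriv_mult R.r_distr R.a_ac)
qed

lemma T_S_add: "p \<in> up R \<Longrightarrow> q \<in> up R \<Longrightarrow> T (p \<oplus>\<^bsub>S\<^esub> q) = T p \<oplus>\<^bsub>S\<^esub> T q"
  by (auto simp: fun_eq_iff theta_times_def S_coeff deriv_add R.a_ac split: nat.split)

lemma T_zero: "T \<zero>\<^bsub>S\<^esub> = \<zero>\<^bsub>S\<^esub>"
  by (auto simp: fun_eq_iff theta_times_def S_coeff split: nat.split)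

lemma S_lids_T: "L \<in> S.lids \<Longrightarrow> s \<in> L \<Longrightarrow> T s \<in> L"
  using lidealsD(1,4)[of L S "up R"] dtheta_mult[of s] by (metis S_carrier dtheta_up subsetD)

lemma S_lids_funpow_T: "L \<in> S.lids \<Longrightarrow> s \<in> L \<Longrightarrow> (T ^^ n) s \<in> L"
  by (induction n) (auto intro: S_lids_T)

text \<open>Strict bounds replace a degree function, so the zero operator needs no conventional
  degree and \<open>deg_less 0\<close> is the zero ideal.\<close>

definition deg_less :: "nat \<Rightarrow> (nat \<Rightarrow> 'r) set" where
  "deg_less n = {s \<in> up R. \<forall>i\<ge>n. s i = \<zero>}"

lemma deg_lessI: "s \<in> up R \<Longrightarrow> (\<And>i. i \<ge> n \<Longrightarrow> s i = \<zero>) \<Longrightarrow> s \<in> deg_less n"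
  by (simp add: deg_less_def)

lemma deg_less_up: "s \<in> deg_less n \<Longrightarrow> s \<in> up R" by (simp add: deg_less_def)
lemma deg_less_coeff: "s \<in> deg_less n \<Longrightarrow> n \<le> i \<Longrightarrow> s i = \<zero>" by (simp add: deg_less_def)

lemma deg_less_ex: "s \<in> up R \<Longrightarrow> \<exists>n. s \<in> deg_less n"
proof -
  assume s: "s \<in> up R"
  then obtain N where "\<forall>n>N. s n = \<zero>" using up_bound by blast
  then have "s \<in> deg_less (Suc N)" using s by (simp add: deg_less_def)
  then show ?thesis by blast
qed

lemma deg_less_mono: "m \<le> n \<Longrightarrow> s \<in> deg_less m \<Longrightarrow> s \<in> deg_less n" by (simp add: deg_less_def)

lemma deg_less_zero: "\<zero>\<^bsub>S\<^esub> \<in> deg_less n"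
  by (intro deg_lessI S_zero_closed S_zero_coeff)

lemma deg_less_0 [simp]: "deg_less 0 = {\<zero>\<^bsub>S\<^esub>}"
proof (intro equalityI subsetI)
  fix s assume "s \<in> deg_less 0"
  then show "s \<in> {\<zero>\<^bsub>S\<^esub>}" by (simp add: deg_less_def diff_op_simps(3) fun_eq_iff)
qed (use deg_less_zero in blast)

lemma deg_less_1: "s \<in> deg_less (Suc 0) \<Longrightarrow> s = dconst R (s 0)"
  by (auto simp: deg_less_def fun_eq_iff dconst_def)

lemma deg_less_dconst: "a \<in> carrier R \<Longrightarrow> dconst R a \<in> deg_less (Suc 0)"
  by (rule deg_lessI, simp, simp add: dconst_def)

lemma deg_less_add: "p \<in> deg_less n \<Longrightarrow> q \<in> deg_less n \<Longrightarrow> p \<oplus>\<^bsub>S\<^esub> q \<in> deg_less n"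
  by (rule deg_lessI, simp add: deg_less_up, simp add: S_add_coeff deg_less_coeff)

lemma deg_less_minus: "p \<in> deg_less n \<Longrightarrow> q \<in> deg_less n \<Longrightarrow> p \<ominus>\<^bsub>S\<^esub> q \<in> deg_less n"
  by (rule deg_lessI, simp add: deg_less_up, simp add: S_minus_coeff deg_less_up deg_less_coeff R.minus_eq)

lemma deg_less_const_mult: "a \<in> carrier R \<Longrightarrow> q \<in> deg_less n \<Longrightarrow> dconst R a \<otimes>\<^bsub>S\<^esub> q \<in> deg_less n"
  by (rule deg_lessI, simp add: deg_less_up, simp add: S_const_coeff deg_less_up deg_less_coeff)

lemma deg_less_SucD: "s \<in> deg_less (Suc n) \<Longrightarrow> s n = \<zero> \<Longrightarrow> s \<in> deg_less n"
  by (auto simp: deg_less_def) (metis le_antisym not_less_eq_eq)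

lemma lead_exists:
  assumes "s \<in> up R" "s \<noteq> \<zero>\<^bsub>S\<^esub>" shows "\<exists>n. s \<in> deg_less (Suc n) \<and> s n \<noteq> \<zero>"
proof -
  obtain N where N: "s \<in> deg_less N" using deg_less_ex[OF assms(1)] ..
  define k where "k = (LEAST n. s \<in> deg_less n)"
  have k: "s \<in> deg_less k" unfolding k_def using N by (rule LeastI)
  then have "k \<noteq> 0" using assms(2) by (metis deg_less_0 singletonD)
  then obtain n where n: "k = Suc n" by (cases k) auto
  have "s n \<noteq> \<zero>"
  proof
    assume "s n = \<zero>"
    then have "s \<in> deg_less n" using deg_less_SucD k n by simp
    then have "k \<le> n" unfolding k_def by (rule Least_le)
    then show False using n by simp
  qed
  then show ?thesis using k n by blast
qed

lemma T_deg:
  assumes "q \<in> deg_less n" shows "T q \<in> deg_less (Suc n)"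
proof (rule deg_lessI)
  fix i assume "Suc n \<le> i"
  then show "T q i = \<zero>" using assms by (cases i) (simp_all add: T_coeff deg_less_coeff)
qed (use assms deg_less_up in simp)

lemma T_lead: "q \<in> deg_less (Suc n) \<Longrightarrow> T q (Suc n) = q n"
  by (simp add: deg_less_def theta_times_def)

lemma T_deg_rev:
  assumes q: "q \<in> up R" and Tq: "T q \<in> deg_less (Suc n)" shows "q \<in> deg_less n"
proof (cases "q = \<zero>\<^bsub>S\<^esub>")
  case True
  then show ?thesis using deg_less_zero by simp
next
  case False
  then obtain m where m: "q \<in> deg_less (Suc m)" "q m \<noteq> \<zero>" using lead_exists[OF q] by blast
  then have "Suc m < Suc n" using T_lead[OF m(1)] deg_less_coeff[OF Tq, of "Suc m"] by (metis not_less)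
  then show ?thesis using deg_less_mono[OF _ m(1)] by simp
qed

lemma T_pow_deg:
  "q \<in> deg_less n \<Longrightarrow> (T ^^ i) q \<in> deg_less (n + i)"
  by (induction i) (auto simp: T_deg)

lemma T_pow_lead:
  "q \<in> deg_less (Suc n) \<Longrightarrow> ((T ^^ i) q) (n + i) = q n"
proof (induction i)
  case (Suc i)
  have "(T ^^ i) q \<in> deg_less (Suc (n + i))" using T_pow_deg[OF Suc.prems, of i] by simp
  then show ?case using T_lead[of "(T ^^ i) q" "n + i"] Suc by simp
qed simp

text \<open>The second coefficient in \<theta>^n r = r \<theta>^n + n \<delta>(r) \<theta>^(n-1) +
  ..., for n = i + 1.\<close>

lemma T_pow_const_sub: 
  assumes "r \<in> carrier R"
  shows "((T ^^ Suc i) (dconst R r)) i = add_pow R (Suc i) (\<delta> r)"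
proof (induction i)
  case 0
  then show ?case using assms by (simp add: theta_times_def dconst_def)
next
  case (Suc i)
  have "((T ^^ Suc i) (dconst R r)) (Suc i) = r"
    using T_pow_lead[OF deg_less_dconst[OF assms], of "Suc i"] by (simp add: dconst_def)
  moreover have "((T ^^ Suc (Suc i)) (dconst R r)) (Suc i) =
      ((T ^^ Suc i) (dconst R r)) i \<oplus> \<delta> (((T ^^ Suc i) (dconst R r)) (Suc i))"
    by (subst funpow.simps(2)) (simp only: theta_times_def o_apply nat.case)
  ultimately show ?case using Suc assms by simp
qed

lemma finsum_top:
  assumes "f n \<in> carrier R" "\<And>i. i < n \<Longrightarrow> f i = \<zero>"
  shows "(\<Oplus>i\<in>{..n::nat}. f i) = f n"
proof -
  have "(\<Oplus>i\<in>{n}. f i) = (\<Oplus>i\<in>{..n}. f i)"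
    by (rule R.add.finprod_mono_neutral_cong_left) (use assms in \<open>auto simp: le_less\<close>)
  then show ?thesis using assms(1) by (simp add: R.finsum_insert)
qed

lemma mult_deg:
  assumes p: "p \<in> deg_less m" and q: "q \<in> deg_less (Suc n)"
  shows "p \<otimes>\<^bsub>S\<^esub> q \<in> deg_less (m + n)"
proof (cases m)
  case 0
  then have "p = \<zero>\<^bsub>S\<^esub>" using p by simp
  then show ?thesis using S.l_null[of q] deg_less_up[OF q] deg_less_zero by simp
next
  case (Suc m')
  have pq: "p \<in> up R" "q \<in> up R" using p q deg_less_up by auto
  have "(p \<otimes>\<^bsub>S\<^esub> q) k = \<zero>" if "k \<ge> m + n" for k
  proof -
    have "(p \<otimes>\<^bsub>S\<^esub> q) k = (\<Oplus>i\<in>{..m'}. p i \<otimes> (T ^^ i) q k)"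
      by (rule dmult_bound[OF pq]) (use Suc p in \<open>auto simp: deg_less_def\<close>)
    also have "\<dots> = (\<Oplus>i\<in>{..m'}. \<zero>)"
    proof (rule R.finsum_cong')
      fix i assume "i \<in> {..m'}"
      then have "(T ^^ i) q k = \<zero>" using T_pow_deg[OF q, of i] that Suc by (simp add: deg_less_def)
      then show "p i \<otimes> (T ^^ i) q k = \<zero>" using pq by simp
    qed auto
    finally show ?thesis by simp
  qed
  then show ?thesis using pq by (simp add: deg_less_def)
qed

lemma mult_lead:
  assumes p: "p \<in> deg_less (Suc m)" and q: "q \<in> deg_less (Suc n)"
  shows "(p \<otimes>\<^bsub>S\<^esub> q) (m + n) = p m \<otimes> q n"
proof -
  have pq: "p \<in> up R" "q \<in> up R" using p q deg_less_up by auto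
  have "(p \<otimes>\<^bsub>S\<^esub> q) (m + n) = (\<Oplus>i\<in>{..m}. p i \<otimes> (T ^^ i) q (m + n))"
    by (rule dmult_bound[OF pq]) (use p in \<open>auto simp: deg_less_def\<close>)
  also have "\<dots> = p m \<otimes> (T ^^ m) q (m + n)"
  proof (rule finsum_top)
    fix i assume "i < m"
    then have "(T ^^ i) q (m + n) = \<zero>" using T_pow_deg[OF q, of i] by (simp add: deg_less_def)
    then show "p i \<otimes> (T ^^ i) q (m + n) = \<zero>" using pq by simp
  qed (use pq in simp)
  also have "(T ^^ m) q (m + n) = q n" using T_pow_lead[OF q, of m] by (simp add: add.commute)
  finally show ?thesis .
qed

lemma mult_const_sublead:
  assumes s: "s \<in> deg_less (Suc (Suc n))" and r: "r \<in> carrier R"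
  shows "(s \<otimes>\<^bsub>S\<^esub> dconst R r) n = s n \<otimes> r \<oplus> s (Suc n) \<otimes> add_pow R (Suc n) (\<delta> r)"
proof -
  have su: "s \<in> up R" using s deg_less_up by auto
  let ?f = "\<lambda>i. s i \<otimes> (T ^^ i) (dconst R r) n"
  have fc: "?f i \<in> carrier R" for i using su r by simp
  have "(s \<otimes>\<^bsub>S\<^esub> dconst R r) n = (\<Oplus>i\<in>{..Suc n}. ?f i)"
    by (rule dmult_bound[OF su]) (use s r in \<open>auto simp: deg_less_def\<close>)
  also have "\<dots> = ?f (Suc n) \<oplus> (\<Oplus>i\<in>{..n}. ?f i)" using fc by (intro R.finsum_Suc) auto
  also have "(\<Oplus>i\<in>{..n}. ?f i) = ?f n"
  proof (rule finsum_top)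
    fix i assume "i < n"
    then have "(T ^^ i) (dconst R r) n = \<zero>"
      using T_pow_deg[OF deg_less_dconst[OF r], of i] by (simp add: deg_less_def)
    then show "?f i = \<zero>" using su by simp
  qed (rule fc)
  also have "(T ^^ n) (dconst R r) n = r"
    using T_pow_lead[OF deg_less_dconst[OF r], of n] by (simp add: dconst_def)
  also have "(T ^^ Suc n) (dconst R r) n = add_pow R (Suc n) (\<delta> r)" by (rule T_pow_const_sub[OF r])
  finally show ?thesis using su r by (simp add: R.a_comm del: R.add.nat_pow_Suc)
qed

text \<open>Bracketing with a coefficient r lowers the degree by at least one, and the coefficient
  left in front is a nonzero integer multiple of the old leading coefficient times \<delta>(r). This
  is the degree-lowering device for left and two-sided ideals.\<close>

definition commutator :: "'r \<Rightarrow> (nat \<Rightarrow> 'r) \<Rightarrow> nat \<Rightarrow> 'r" where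
  "commutator r s = dconst R r \<otimes>\<^bsub>S\<^esub> s \<ominus>\<^bsub>S\<^esub> s \<otimes>\<^bsub>S\<^esub> dconst R r"

lemma commutator_deg:
  assumes s: "s \<in> deg_less (Suc n)" and r: "r \<in> carrier R"
  shows "commutator r s \<in> deg_less n"
proof (rule deg_less_SucD)
  have su: "s \<in> up R" using s deg_less_up by auto
  show "commutator r s \<in> deg_less (Suc n)"
    unfolding commutator_def using deg_less_const_mult[OF r s] mult_deg[OF s deg_less_dconst[OF r]]
    by (intro deg_less_minus) simp_all
  show "commutator r s n = \<zero>"
    using mult_lead[OF s deg_less_dconst[OF r]] su r
    by (simp add: commutator_def S_coeff R.m_comm R.minus_eq R.r_neg)
qed

lemma commutator_sublead:
  assumes s: "s \<in> deg_less (Suc (Suc n))" and r: "r \<in> carrier R"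
  shows "commutator r s n = \<ominus> add_pow R (Suc n) (s (Suc n) \<otimes> \<delta> r)"
proof -
  have su: "s \<in> up R" using s deg_less_up by auto
  define d where "d = add_pow R (Suc n) (\<delta> r)"
  have d: "d \<in> carrier R" using r by (simp add: d_def del: R.add.nat_pow_Suc)
  have "commutator r s n = r \<otimes> s n \<ominus> (s n \<otimes> r \<oplus> s (Suc n) \<otimes> d)"
    using mult_const_sublead[OF s r] su r by (simp add: commutator_def S_coeff d_def del: R.add.nat_pow_Suc)
  also have "\<dots> = \<ominus> (s (Suc n) \<otimes> d)"
  proof -
    have "s n \<in> carrier R" "s (Suc n) \<in> carrier R" using su by auto
    then show ?thesis using r d by algebra
  qed
  also have "s (Suc n) \<otimes> d = add_pow R (Suc n) (s (Suc n) \<otimes> \<delta> r)"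
    unfolding d_def using su r by (intro R.add_pow_rdistr) auto
  finally show ?thesis .
qed

text \<open>The multiplier is a power of the leading coefficient of \<open>g\<close> whose exponent
  depends only on the excess \<open>N\<close>, not on \<open>l\<close>; a single multiplier
  therefore serves all operators of bounded degree.\<close>

lemma pseudo_division:
  assumes g: "g \<in> deg_less (Suc n)"
  shows "l \<in> deg_less (n + N) \<Longrightarrow>
    \<exists>h\<in>up R. dconst R (g n [^] N) \<otimes>\<^bsub>S\<^esub> l \<ominus>\<^bsub>S\<^esub> h \<otimes>\<^bsub>S\<^esub> g \<in> deg_less n"
proof (induction N arbitrary: l)
  case 0
  have gu: "g \<in> up R" using g deg_less_up by auto
  have "dconst R (g n [^] (0::nat)) \<otimes>\<^bsub>S\<^esub> l \<ominus>\<^bsub>S\<^esub> \<zero>\<^bsub>S\<^esub> \<otimes>\<^bsub>S\<^esub> g = l"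
    using deg_less_up[OF 0] gu by (simp add: dconst_simps(4) S.minus_eq)
  then show ?case using 0 by (intro bexI[of _ "\<zero>\<^bsub>S\<^esub>"]) simp_all
next
  case (Suc N)
  have gu: "g \<in> up R" and lu: "l \<in> up R" using g Suc.prems deg_less_up by auto
  define a b where "a = g n" and "b = l (n + N)"
  have ab: "a \<in> carrier R" "b \<in> carrier R" using gu lu by (auto simp: a_def b_def)
  \<comment> \<open>The monomial b \<theta>^N: the top coefficient of m g is b a, that of a l is a
    b.\<close>
  define m where "m = (\<lambda>i. if i = N then b else \<zero>)"
  have mu: "m \<in> up R" using ab by (intro upI[of _ N]) (auto simp: m_def)
  have m: "m \<in> deg_less (Suc N)" by (rule deg_lessI[OF mu]) (simp add: m_def)
  define l1 where "l1 = dconst R a \<otimes>\<^bsub>S\<^esub> l \<ominus>\<^bsub>S\<^esub> m \<otimes>\<^bsub>S\<^esub> g"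
  have "l1 \<in> deg_less (n + N)"
  proof (rule deg_less_SucD)
    show "l1 \<in> deg_less (Suc (n + N))"
      unfolding l1_def using deg_less_const_mult[OF ab(1) Suc.prems] mult_deg[OF m g]
      by (intro deg_less_minus) (simp_all add: add.commute)
    show "l1 (n + N) = \<zero>"
      using mult_lead[OF m g] ab lu gu mu b_def
      by (simp add: l1_def S_coeff a_def[symmetric] add.commute R.m_comm R.minus_eq
          R.r_neg m_def[THEN fun_cong])
  qed
  then obtain h where h: "h \<in> up R" "dconst R (a [^] N) \<otimes>\<^bsub>S\<^esub> l1 \<ominus>\<^bsub>S\<^esub> h \<otimes>\<^bsub>S\<^esub> g \<in> deg_less n"
    using Suc.IH unfolding a_def by blast
  have aj: "a [^] N \<in> carrier R" using ab by simp
  define c where "c = dconst R (a [^] N)"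
  have c: "c \<in> up R" using aj by (simp add: c_def)
  have "dconst R (a [^] Suc N) = c \<otimes>\<^bsub>S\<^esub> dconst R a" unfolding c_def using ab dconst_simps(2) by simp
  moreover have "(c \<otimes>\<^bsub>S\<^esub> dconst R a) \<otimes>\<^bsub>S\<^esub> l \<ominus>\<^bsub>S\<^esub> (c \<otimes>\<^bsub>S\<^esub> m \<oplus>\<^bsub>S\<^esub> h) \<otimes>\<^bsub>S\<^esub> g = c \<otimes>\<^bsub>S\<^esub> l1 \<ominus>\<^bsub>S\<^esub> h \<otimes>\<^bsub>S\<^esub> g"
  proof -
    have "c \<in> carrier S" "dconst R a \<in> carrier S" "l \<in> carrier S" "m \<in> carrier S" "h \<in> carrier S" "g \<in> carrier S"
      using c ab lu mu h(1) gu by auto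
    then show ?thesis unfolding l1_def
      by (simp add: S.minus_eq S.r_distr S.l_distr S.m_assoc S.r_minus S.minus_add S.a_assoc del: S_carrier)
  qed
  ultimately show ?case using h c mu unfolding a_def[symmetric] c_def[symmetric]
    by (intro bexI[of _ "c \<otimes>\<^bsub>S\<^esub> m \<oplus>\<^bsub>S\<^esub> h"]) simp_all
qed

subsection \<open>The left ideal generated by an ideal of the coefficient ring\<close>

text \<open>Writing an element of \<open>S I\<close> in Horner form \<open>r\<^sub>0 + \<theta> (r\<^sub>1 + \<theta> (r\<^sub>2 + \<dots>))\<close> keeps the
  coefficients on the right, where they lie in \<open>I\<close>.\<close>

inductive_set left_span :: "'r set \<Rightarrow> (nat \<Rightarrow> 'r) set" for I where
  zero: "\<zero>\<^bsub>S\<^esub> \<in> left_span I"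
| step: "r \<in> I \<Longrightarrow> s \<in> left_span I \<Longrightarrow> dconst R r \<oplus>\<^bsub>S\<^esub> T s \<in> left_span I"

context
  fixes I assumes I: "ideal I R"
begin

interpretation I: ideal I R by (rule I)

lemma left_span_up: "s \<in> left_span I \<Longrightarrow> s \<in> up R"
  by (induction rule: left_span.induct) (auto dest: subsetD[OF I.a_subset])

lemma left_span_T: "s \<in> left_span I \<Longrightarrow> T s \<in> left_span I"
  using left_span.step[OF I.zero_closed, of s] left_span_up[of s] by (simp add: dconst_simps S.l_zero)

lemma left_span_const: "r \<in> I \<Longrightarrow> dconst R r \<in> left_span I"
  using left_span.step[OF _ left_span.zero, of r] subsetD[OF I.a_subset, of r] by (simp add: T_zero S.r_zero)

lemma left_span_add: "s \<in> left_span I \<Longrightarrow> t \<in> left_span I \<Longrightarrow> s \<oplus>\<^bsub>S\<^esub> t \<in> left_span I"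
proof (induction s arbitrary: t rule: left_span.induct)
  case zero
  then show ?case using left_span_up by (simp add: S.l_zero)
next
  case (step r s)
  have su: "s \<in> up R" "r \<in> carrier R" using step left_span_up I.a_subset by auto
  note IH = step.IH and r = step.hyps(1)
  from step(4) show ?case
  proof cases
    case zero
    then show ?thesis using left_span.step[OF step(1,2)] su by (simp add: S.r_zero)
  next
    case (step r' s')
    have su': "s' \<in> up R" "r' \<in> carrier R" using step left_span_up I.a_subset by auto
    have "(dconst R r \<oplus>\<^bsub>S\<^esub> T s) \<oplus>\<^bsub>S\<^esub> t = dconst R (r \<oplus> r') \<oplus>\<^bsub>S\<^esub> T (s \<oplus>\<^bsub>S\<^esub> s')"
      using su su' by (simp add: step(1) dconst_simps T_S_add S.a_ac)
    moreover have "\<dots> \<in> left_span I"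
      using left_span.step[OF I.a_closed[OF r step(2)] IH[OF step(3)]] .
    ultimately show ?thesis by simp
  qed
qed

text \<open>A coefficient passes through the Horner form by a \<theta> s = \<theta> (a s) -
  \<delta>(a) s, and both terms on the right are covered by the induction hypothesis for
  \<open>s\<close>.\<close>

lemma left_span_lids: "left_span I \<in> S.lids"
proof -
  have c: "dconst R a \<otimes>\<^bsub>S\<^esub> s \<in> left_span I" if "s \<in> left_span I" "a \<in> carrier R" for a s
    using that
  proof (induction s arbitrary: a rule: left_span.induct)
    case zero
    then show ?case using left_span.zero by (simp add: S.r_null)
  next
    case (step r s)
    have su: "s \<in> up R" "r \<in> carrier R" using step left_span_up I.a_subset by auto
    have e: "T (dconst R a \<otimes>\<^bsub>S\<^esub> s) \<oplus>\<^bsub>S\<^esub> dconst R (\<ominus> \<delta> a) \<otimes>\<^bsub>S\<^esub> s = dconst R a \<otimes>\<^bsub>S\<^esub> T s"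
      using su step.prems
      by (simp add: T_const_mult) (simp add: dconst_simps S.l_minus S.a_assoc S.r_neg S.r_zero)
    have "dconst R a \<otimes>\<^bsub>S\<^esub> (dconst R r \<oplus>\<^bsub>S\<^esub> T s) =
        (dconst R (a \<otimes> r) \<oplus>\<^bsub>S\<^esub> T (dconst R a \<otimes>\<^bsub>S\<^esub> s)) \<oplus>\<^bsub>S\<^esub> dconst R (\<ominus> \<delta> a) \<otimes>\<^bsub>S\<^esub> s"
      using su step.prems by (simp add: S.a_assoc e S.r_distr dconst_simps(2))
    moreover have "dconst R (a \<otimes> r) \<oplus>\<^bsub>S\<^esub> T (dconst R a \<otimes>\<^bsub>S\<^esub> s) \<in> left_span I"
      using step by (intro left_span.step I.I_l_closed) auto
    moreover have "dconst R (\<ominus> \<delta> a) \<otimes>\<^bsub>S\<^esub> s \<in> left_span I" using step by auto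
    ultimately show ?case using left_span_add by simp
  qed
  show ?thesis
  proof (rule lidealsI)
    fix p s assume "p \<in> carrier S" and s: "s \<in> left_span I"
    then have "p \<in> up R" by simp
    then show "p \<otimes>\<^bsub>S\<^esub> s \<in> left_span I"
    proof (induction p rule: up_induct)
      case (add p q)
      then have "(p \<oplus>\<^bsub>S\<^esub> q) \<otimes>\<^bsub>S\<^esub> s = p \<otimes>\<^bsub>S\<^esub> s \<oplus>\<^bsub>S\<^esub> q \<otimes>\<^bsub>S\<^esub> s"
        using left_span_up[OF s] by (intro S.l_distr) auto
      then show ?case using left_span_add add by (simp add: diff_op_simps(4))
    next
      case (theta p)
      then show ?case using left_span_T left_span_up[OF s] by (simp add: dmult_T)
    qed (use c s in auto)
  qed (use left_span_up left_span_add left_span.zero in auto)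
qed

lemma left_span_least:
  assumes "L \<in> S.lids" "dconst R ` I \<subseteq> L" shows "left_span I \<subseteq> L"
proof
  fix s assume "s \<in> left_span I"
  then show "s \<in> L"
  proof (induction rule: left_span.induct)
    case (step r s)
    have "dconst R r \<in> L" using assms(2) step by blast
    then show ?case using lidealsD(3)[OF assms(1)] S_lids_T[OF assms(1)] step by blast
  qed (rule lidealsD(2)[OF assms(1)])
qed

text \<open>Rewriting a sum of \<theta>^i r_i with coefficients on the left changes only terms below
  the leading one, so the leading coefficient is the last r_i and lies in \<open>I\<close>.\<close>

lemma left_span_lead:
  "s \<in> left_span I \<Longrightarrow> s \<in> deg_less (Suc n) \<Longrightarrow> s n \<in> I"
proof (induction s arbitrary: n rule: left_span.induct)
  case zero
  then show ?case using I.zero_closed by (simp add: S_zero_coeff)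
next
  case (step r s)
  have su: "s \<in> up R" "r \<in> carrier R" using step left_span_up I.a_subset by auto
  have "(dconst R r \<oplus>\<^bsub>S\<^esub> T s) \<ominus>\<^bsub>S\<^esub> dconst R r \<in> deg_less (Suc n)"
    using deg_less_mono[OF _ deg_less_dconst[OF su(2)], of "Suc n"] step.prems by (intro deg_less_minus) auto
  moreover have "(dconst R r \<oplus>\<^bsub>S\<^esub> T s) \<ominus>\<^bsub>S\<^esub> dconst R r = T s"
    using su S.minus_eq[of "dconst R r \<oplus>\<^bsub>S\<^esub> T s" "dconst R r"] S.a_comm[of "dconst R r" "T s"]
    by (simp add: S.a_assoc S.r_neg)
  ultimately have s: "s \<in> deg_less n" using T_deg_rev su by simp
  show ?case
  proof (cases n)
    case 0
    then have "s = \<zero>\<^bsub>S\<^esub>" using s by simp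
    then show ?thesis using 0 step(1) su by (simp add: T_zero)
  next
    case (Suc m)
    then have "s m \<in> I" using step.IH s by simp
    moreover have "(dconst R r \<oplus>\<^bsub>S\<^esub> T s) n = s m"
      using Suc T_lead[of s m] s su by (simp add: S_add_coeff) (simp add: dconst_def)
    ultimately show ?thesis by simp
  qed
qed

lemma left_span_const_iff: "r \<in> carrier R \<Longrightarrow> dconst R r \<in> left_span I \<longleftrightarrow> r \<in> I"
  using left_span_const left_span_lead[OF _ deg_less_dconst, of r] by auto

lemma left_span_right_const: "s \<in> up R \<Longrightarrow> r \<in> I \<Longrightarrow> s \<otimes>\<^bsub>S\<^esub> dconst R r \<in> left_span I"
  using lidealsD(4)[OF left_span_lids] left_span_const by simp

end

lemma contraction_ideal:
  assumes L: "L \<in> S.lids" shows "ideal {r \<in> carrier R. dconst R r \<in> L} R"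
proof -
  have "{r \<in> carrier R. dconst R r \<in> L} \<in> R.lids"
    by (rule lidealsI)
      (use lidealsD(2,3,4)[OF L] in \<open>auto simp: dconst_simps(1,2,3)\<close>)
  then show ?thesis by (simp add: lids_iff_ideal)
qed

text \<open>For a \<delta>-ideal I the product I S lies in S I, because q \<theta> = \<theta> q -
  \<delta>(q) and \<delta>(q) is again in I.\<close>

lemma delta_ideal_right_mult:
  assumes I: "delta_ideal R \<delta> I" and L: "L \<in> S.lids" and sub: "dconst R ` I \<subseteq> L" and s: "s \<in> up R"
  shows "q \<in> I \<Longrightarrow> dconst R q \<otimes>\<^bsub>S\<^esub> s \<in> L"
  using s
proof (induction s arbitrary: q rule: up_induct)
  interpret I: ideal I R using I by (simp add: delta_ideal_def)
  case (const a)
  then have "q \<otimes> a \<in> I" "q \<in> carrier R" using I.I_r_closed I.a_subset by auto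
  then show ?case using sub const by (auto simp: dconst_simps(2)[symmetric])
next
  interpret I: ideal I R using I by (simp add: delta_ideal_def)
  case (add s t)
  then have "dconst R q \<otimes>\<^bsub>S\<^esub> (s \<oplus>\<^bsub>S\<^esub> t) = dconst R q \<otimes>\<^bsub>S\<^esub> s \<oplus>\<^bsub>S\<^esub> dconst R q \<otimes>\<^bsub>S\<^esub> t"
    using I.a_subset by (intro S.r_distr) auto
  then show ?case using lidealsD(3)[OF L] add by (simp add: diff_op_simps(4))
next
  interpret I: ideal I R using I by (simp add: delta_ideal_def)
  case (theta s)
  have q: "q \<in> carrier R" "\<delta> q \<in> I" using theta I I.a_subset by (auto simp: delta_ideal_def)
  have "T (dconst R q \<otimes>\<^bsub>S\<^esub> s) \<in> L" using S_lids_T[OF L theta.IH[OF theta.prems]] .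
  then have "dconst R q \<otimes>\<^bsub>S\<^esub> T s \<oplus>\<^bsub>S\<^esub> dconst R (\<delta> q) \<otimes>\<^bsub>S\<^esub> s \<in> L"
    using theta.hyps q(1) by (simp add: T_const_mult)
  then show ?case by (rule S.lids_cancel(1)[OF L theta.IH[OF q(2)], rotated]) (use theta q in simp)
qed

end

context diff_domain
begin

lemma S_integral:
  assumes "p \<in> up R" "q \<in> up R" "p \<noteq> \<zero>\<^bsub>S\<^esub>" "q \<noteq> \<zero>\<^bsub>S\<^esub>" shows "p \<otimes>\<^bsub>S\<^esub> q \<noteq> \<zero>\<^bsub>S\<^esub>"
proof -
  obtain m n where m: "p \<in> deg_less (Suc m)" "p m \<noteq> \<zero>" and n: "q \<in> deg_less (Suc n)" "q n \<noteq> \<zero>"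
    using lead_exists assms by meson
  have "(p \<otimes>\<^bsub>S\<^esub> q) (m + n) \<noteq> \<zero>"
    using mult_lead[OF m(1) n(1)] m(2) n(2) assms integral[of "p m" "q n"] by auto
  then show ?thesis by (metis S_zero_coeff)
qed

text \<open>Fix m in P with \<delta>(m) outside P. For s in L of degree n, the commutator of m and s
  lies in L and has smaller degree, hence lies in S P by induction. Its coefficient in degree n - 1
  is -n s_n \<delta>(m), which forces the leading coefficient s_n into P; then \<theta>^n s_n can be
  subtracted.\<close>

lemma left_ideal_over_prime:
  assumes P: "primeideal P R" and nst: "\<not> delta_ideal R \<delta> P" and L: "L \<in> S.lids"
    and LP: "{r \<in> carrier R. dconst R r \<in> L} = P"
  shows "L = left_span P"
proof
  interpret P: primeideal P R by (rule P)
  have sub: "left_span P \<subseteq> L" using left_span_least[OF P.is_ideal L] LP by blast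
  then show "left_span P \<subseteq> L" .
  obtain m where m: "m \<in> P" "\<delta> m \<notin> P" using nst P.is_ideal by (auto simp: delta_ideal_def)
  have mc: "m \<in> carrier R" using m P.a_subset by blast
  have "s \<in> left_span P" if "s \<in> L" "s \<in> deg_less n" for n s
    using that
  proof (induction n arbitrary: s)
    case 0
    then have "s = \<zero>\<^bsub>S\<^esub>" by simp
    then show ?case by (simp only: left_span.zero)
  next
    case (Suc n)
    have su: "s \<in> up R" using deg_less_up Suc.prems by blast
    show ?case
    proof (cases "s n \<in> P")
      case True
      define t where "t = (T ^^ n) (dconst R (s n))"
      have t: "t \<in> left_span P" unfolding t_def
        by (intro S_lids_funpow_T left_span_lids left_span_const P.is_ideal True)
      have tu: "t \<in> up R" using left_span_up[OF P.is_ideal t] .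
      have td: "t \<in> deg_less (Suc n)" unfolding t_def using T_pow_deg[OF deg_less_dconst, of "s n" n] su by simp
      have tn: "t n = s n" unfolding t_def using T_pow_lead[OF deg_less_dconst, of "s n" n] su by simp
      have "s \<ominus>\<^bsub>S\<^esub> t \<in> deg_less n"
        by (rule deg_less_SucD[OF deg_less_minus[OF Suc.prems(2) td]])
          (use tn su tu in \<open>simp add: S_minus_coeff R.minus_eq R.r_neg\<close>)
      then have "s \<ominus>\<^bsub>S\<^esub> t \<in> left_span P"
        by (rule Suc.IH[OF S.lids_minus[OF L Suc.prems(1) subsetD[OF sub t]]])
      then show ?thesis by (rule S.lids_cancel(3)[OF left_span_lids[OF P.is_ideal] t, rotated]) (use su in simp)
    next
      case False
      show ?thesis
      proof (cases n)
        case 0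
        then have "s = dconst R (s 0)" using deg_less_1 Suc.prems(2) by simp
        then have "s 0 \<in> P" using LP Suc.prems(1) su by auto
        then show ?thesis using False 0 by simp
      next
        case (Suc k)
        have "dconst R m \<otimes>\<^bsub>S\<^esub> s \<in> L" using lidealsD(4)[OF L] Suc.prems(1) mc by simp
        moreover have "s \<otimes>\<^bsub>S\<^esub> dconst R m \<in> L" using left_span_right_const[OF P.is_ideal su m(1)] sub by blast
        ultimately have "commutator m s \<in> L" unfolding commutator_def by (rule S.lids_minus[OF L])
        moreover have cd: "commutator m s \<in> deg_less n" by (rule commutator_deg[OF Suc.prems(2) mc])
        ultimately have "commutator m s \<in> left_span P" by (rule Suc.IH)
        then have "commutator m s k \<in> P" using left_span_lead[OF P.is_ideal] cd Suc by simp
        moreover have "commutator m s k = \<ominus> add_pow R (Suc k) (s (Suc k) \<otimes> \<delta> m)"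
          using commutator_sublead[of s k m] Suc.prems(2) Suc mc by simp
        ultimately have "\<ominus> add_pow R (Suc k) (s n \<otimes> \<delta> m) \<in> P" using Suc by simp
        then have "\<ominus> (\<ominus> add_pow R (Suc k) (s n \<otimes> \<delta> m)) \<in> P" by (rule P.a_inv_closed)
        then have "add_pow R (Suc k) (s n \<otimes> \<delta> m) \<in> P" using su mc by (simp del: R.add.nat_pow_Suc)
        then have "s n \<otimes> \<delta> m \<in> P" using add_pow_cancel[OF P.is_ideal, of "s n \<otimes> \<delta> m" "Suc k"] su mc by simp
        then show ?thesis using P.I_prime[of "s n" "\<delta> m"] False m(2) su mc by simp
      qed
    qed
  qed
  then show "L \<subseteq> left_span P" using deg_less_ex lidealsD(1)[OF L] by (metis S_carrier subsetD subsetI)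
qed

lemma left_span_maximal:
  assumes M: "maximalideal M R" and nst: "\<not> delta_ideal R \<delta> M" and L: "L \<in> S.lids"
    and sub: "left_span M \<subseteq> L" and ne: "L \<noteq> up R"
  shows "L = left_span M"
proof (rule left_ideal_over_prime[OF _ nst L])
  interpret M: maximalideal M R by (rule M)
  show "primeideal M R" by (rule R.maximalideal_prime[OF M])
  let ?J = "{r \<in> carrier R. dconst R r \<in> L}"
  have "M \<subseteq> ?J" using left_span_const[OF M.is_ideal] sub M.a_subset by blast
  then have "?J = M \<or> ?J = carrier R" by (intro M.I_maximal contraction_ideal[OF L]) auto
  moreover have "\<one> \<notin> ?J" using S.lids_one[OF L] ne by (auto simp: dconst_simps(4))
  ultimately show "?J = M" by auto
qed

text \<open>Commutators with \<open>r\<close> stay in a two-sided ideal and lower the degree by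
  exactly one, since \<delta>(r) is nonzero and positive integers are invertible; a nonzero constant
  is reached at the end.\<close>

lemma two_sided_meets_coefficients:
  assumes J: "J \<in> S.lids" and right: "\<And>s t. s \<in> J \<Longrightarrow> t \<in> up R \<Longrightarrow> s \<otimes>\<^bsub>S\<^esub> t \<in> J"
    and nz: "s \<in> J" "s \<noteq> \<zero>\<^bsub>S\<^esub>" and r: "r \<in> carrier R" "\<delta> r \<noteq> \<zero>"
  shows "\<exists>a\<in>carrier R. a \<noteq> \<zero> \<and> dconst R a \<in> J"
proof -
  have "\<exists>a\<in>carrier R. a \<noteq> \<zero> \<and> dconst R a \<in> J" if "s \<in> J" "s \<in> deg_less (Suc n)" "s n \<noteq> \<zero>" for n s
    using that
  proof (induction n arbitrary: s)
    case 0
    have "s \<in> up R" using 0 deg_less_up by blast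
    moreover have "dconst R (s 0) \<in> J" using 0(1) deg_less_1[OF 0(2)] by metis
    ultimately show ?case using 0(3) by (intro bexI[of _ "s 0"]) auto
  next
    case (Suc n)
    have su: "s \<in> up R" using Suc deg_less_up by blast
    have "commutator r s \<in> J" unfolding commutator_def
      using lidealsD(4)[OF J] right Suc.prems(1) r(1) by (intro S.lids_minus[OF J]) auto
    moreover have "commutator r s \<in> deg_less (Suc n)" by (rule commutator_deg[OF Suc.prems(2) r(1)])
    moreover have "commutator r s n \<noteq> \<zero>"
    proof
      assume "commutator r s n = \<zero>"
      then have "\<ominus> (add_pow R (Suc n) (s (Suc n) \<otimes> \<delta> r)) = \<zero>" using commutator_sublead[OF Suc.prems(2) r(1)] by simp
      then have "add_pow R (Suc n) (s (Suc n) \<otimes> \<delta> r) \<in> {\<zero>}"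
        using su r R.minus_minus[of "add_pow R (Suc n) (s (Suc n) \<otimes> \<delta> r)"] by (simp del: R.add.nat_pow_Suc R.minus_minus)
      then have "s (Suc n) \<otimes> \<delta> r \<in> {\<zero>}" using add_pow_cancel[OF R.zeroideal, of "s (Suc n) \<otimes> \<delta> r" "Suc n"] su r by simp
      then show False using integral[of "s (Suc n)" "\<delta> r"] Suc.prems(3) r su by simp
    qed
    ultimately show ?case by (rule Suc.IH)
  qed
  moreover have "s \<in> up R" using nz lidealsD(1)[OF J] by auto
  ultimately show ?thesis using lead_exists nz by blast
qed

end

section \<open>Primitivity\<close>

context ring
begin

definition max_lideal :: "'a set \<Rightarrow> bool" where
  "max_lideal L \<longleftrightarrow> L \<in> lids \<and> L \<noteq> carrier R \<and> (\<forall>Y\<in>lids. L \<subseteq> Y \<longrightarrow> Y = L \<or> Y = carrier R)"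

text \<open>The annihilator of the module \<open>R/L\<close>.\<close>

definition bound :: "'a set \<Rightarrow> 'a set" where
  "bound L = {s \<in> carrier R. \<forall>t\<in>carrier R. s \<otimes> t \<in> L}"

lemma lids_bound: "L \<in> lids \<Longrightarrow> bound L \<in> lids"
  by (rule lidealsI) (auto simp: bound_def l_distr m_assoc dest: lidealsD(2,3,4))

lemma bound_right: "s \<in> bound L \<Longrightarrow> t \<in> carrier R \<Longrightarrow> s \<otimes> t \<in> bound L"
  by (auto simp: bound_def m_assoc)

lemma max_lideal_lsum:
  assumes "max_lideal L" "s \<in> carrier R" "s \<notin> L" shows "lsum L (lprinc s) = carrier R"
proof -
  have L: "L \<in> lids" using assms by (simp add: max_lideal_def)
  have "lsum L (lprinc s) \<in> lids" "L \<subseteq> lsum L (lprinc s)" "s \<in> lsum L (lprinc s)"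
    using lids_lsum[OF L] lsum_upper[OF L] lids_lprinc[OF assms(2)] by blast+
  then show ?thesis using assms(1,3) by (auto simp: max_lideal_def)
qed

lemma lsum_lprincE:
  assumes "u \<in> lsum L (lprinc s)"
  obtains l t where "l \<in> L" "t \<in> carrier R" "u = l \<oplus> t \<otimes> s"
  using assms by (auto simp: lsum_def lprinc_def)

text \<open>The assumption says that every nonzero multiple of the class of \<open>s\<close> in R/L
  generates it, i.e. that its cyclic submodule is simple. If s = l + t x s, then 1 - t x annihilates
  the class, so \<open>x\<close> and the annihilator generate everything.\<close>

lemma max_lideal_colon:
  assumes L: "L \<in> lids" and s: "s \<in> carrier R" "s \<notin> L"
    and gen: "\<And>x. x \<in> carrier R \<Longrightarrow> x \<otimes> s \<notin> L \<Longrightarrow> s \<in> lsum L (lprinc (x \<otimes> s))"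
  shows "max_lideal (colon L s)"
  unfolding max_lideal_def
proof (intro conjI ballI impI)
  show "colon L s \<in> lids" by (rule lids_colon[OF L s(1)])
  have "\<one> \<notin> colon L s" using s by (simp add: colon_def)
  then show "colon L s \<noteq> carrier R" by blast
  fix Y assume Y: "Y \<in> lids" "colon L s \<subseteq> Y"
  show "Y = colon L s \<or> Y = carrier R"
  proof (cases "Y \<subseteq> colon L s")
    case False
    then obtain x where x: "x \<in> Y" "x \<notin> colon L s" by blast
    have xc: "x \<in> carrier R" using x(1) lidealsD(1)[OF Y(1)] by blast
    then have "x \<otimes> s \<notin> L" using x(2) by (simp add: colon_def)
    then have "s \<in> lsum L (lprinc (x \<otimes> s))" by (rule gen[OF xc])
    then obtain l t where lt: "l \<in> L" "t \<in> carrier R" "s = l \<oplus> t \<otimes> (x \<otimes> s)" by (rule lsum_lprincE)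
    have lc: "l \<in> carrier R" using lt lidealsD(1)[OF L] by blast
    have "(\<one> \<ominus> t \<otimes> x) \<otimes> s = s \<ominus> t \<otimes> (x \<otimes> s)"
      using s xc lt by (simp add: minus_eq l_distr l_minus m_assoc)
    also have "\<dots> = (l \<oplus> t \<otimes> (x \<otimes> s)) \<ominus> t \<otimes> (x \<otimes> s)" using lt(3) by simp
    also have "\<dots> = l" using lc lt(2) xc s by (simp add: minus_eq a_assoc r_neg)
    finally have "\<one> \<ominus> t \<otimes> x \<in> colon L s" using lt xc by (simp add: colon_def)
    then have "\<one> \<ominus> t \<otimes> x \<in> Y" using Y(2) by blast
    moreover have "t \<otimes> x \<in> Y" using lidealsD(4)[OF Y(1) lt(2) x(1)] .
    ultimately have "\<one> \<in> Y" using lids_cancel(3)[OF Y(1)] by blast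
    then show ?thesis using lids_one[OF Y(1)] by blast
  qed (use Y in blast)
qed

end

section \<open>Operators modulo a differential ideal of coefficients\<close>

context derivation
begin

text \<open>For a \<delta>-ideal I this is the two-sided ideal I S, with factor ring
  (R/I)[\<theta>;\<delta>].\<close>

definition coeffs_in :: "'r set \<Rightarrow> (nat \<Rightarrow> 'r) set" where
  "coeffs_in I = {s \<in> up R. \<forall>i. s i \<in> I}"

text \<open>With coefficients written on the left, this is right multiplication by \<theta>; see
  \<open>mult_theta\<close>.\<close>

definition shift :: "(nat \<Rightarrow> 'r) \<Rightarrow> nat \<Rightarrow> 'r" where
  "shift s = (\<lambda>n. case n of 0 \<Rightarrow> \<zero> | Suc m \<Rightarrow> s m)"

lemma shift_coeff [simp]: "shift s 0 = \<zero>" "shift s (Suc n) = s n" by (simp_all add: shift_def)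

lemma mult_theta: "s \<in> up R \<Longrightarrow> s \<otimes>\<^bsub>S\<^esub> dtheta R = shift s"
proof (induction s rule: up_induct)
  case (const a)
  then have "dconst R a \<otimes>\<^bsub>S\<^esub> dtheta R = (\<lambda>n. a \<otimes> dtheta R n)" by (simp add: dmult_const)
  then show ?case using const by (auto simp: fun_eq_iff dtheta_def dconst_def shift_def split: nat.split)
next
  case (add p q)
  then show ?case by (auto simp: dmult_add_left fun_eq_iff shift_def split: nat.split)
next
  case (theta p)
  have "T (shift p) n = shift (T p) n" for n using theta(1)
    by (cases n; cases "n - 1") (auto simp: theta_times_def)
  then have "T (shift p) = shift (T p)" by (rule ext)
  then show ?case using theta by (simp add: dmult_T)
qed

lemma shift_up [simp]: "s \<in> up R \<Longrightarrow> shift s \<in> up R"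
  using mult_theta[of s] dmult_closed[of s "dtheta R"] by simp

lemma shift_surj:
  assumes "s \<in> up R" "s 0 = \<zero>" shows "\<exists>t\<in>up R. s = t \<otimes>\<^bsub>S\<^esub> dtheta R"
proof -
  obtain N where N: "\<forall>n>N. s n = \<zero>" using up_bound assms by blast
  have t: "(\<lambda>n. s (Suc n)) \<in> up R" by (rule upI[of _ N]) (use assms N in auto)
  have "s = shift (\<lambda>n. s (Suc n))" using assms(2) by (auto simp: fun_eq_iff shift_def split: nat.split)
  then show ?thesis using mult_theta[OF t] t by (intro bexI[of _ "\<lambda>n. s (Suc n)"]) auto
qed

lemma theta_const:
  assumes "a \<in> carrier R" shows "T (dconst R a) = dconst R a \<otimes>\<^bsub>S\<^esub> dtheta R \<oplus>\<^bsub>S\<^esub> dconst R (\<delta> a)"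
  using dtheta_commute[OF assms] dtheta_mult[of "dconst R a"] assms by simp

definition truncate :: "nat \<Rightarrow> (nat \<Rightarrow> 'r) \<Rightarrow> nat \<Rightarrow> 'r" where
  "truncate m s = (\<lambda>i. if i \<le> m then s i else \<zero>)"

lemma truncate_deg: "s \<in> up R \<Longrightarrow> truncate m s \<in> deg_less (Suc m)"
proof (rule deg_lessI)
  assume "s \<in> up R"
  then show "truncate m s \<in> up R" by (intro upI[of _ m]) (auto simp: truncate_def)
qed (simp add: truncate_def)

context
  fixes I assumes I: "delta_ideal R \<delta> I"
begin

interpretation I: ideal I R using I by (simp add: delta_ideal_def)

lemma I_deriv: "r \<in> I \<Longrightarrow> \<delta> r \<in> I" using I by (auto simp: delta_ideal_def)

lemma coeffs_in_T: "s \<in> coeffs_in I \<Longrightarrow> T s \<in> coeffs_in I"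
  by (auto simp: coeffs_in_def theta_times_def I_deriv I.a_closed I.zero_closed split: nat.split
      intro: up_T[unfolded theta_times_def])

lemma coeffs_in_add: "s \<in> coeffs_in I \<Longrightarrow> t \<in> coeffs_in I \<Longrightarrow> s \<oplus>\<^bsub>S\<^esub> t \<in> coeffs_in I"
  unfolding coeffs_in_def mem_Collect_eq by (auto simp: S_add_coeff I.a_closed)

lemma coeffs_in_lids: "coeffs_in I \<in> S.lids"
proof (rule lidealsI)
  show "\<zero>\<^bsub>S\<^esub> \<in> coeffs_in I" unfolding coeffs_in_def mem_Collect_eq
    by (intro conjI allI S_zero_closed) (simp add: S_zero_coeff I.zero_closed)
  show "coeffs_in I \<subseteq> carrier S" by (auto simp: coeffs_in_def)
  fix p s assume "p \<in> carrier S" and s: "s \<in> coeffs_in I"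
  then have "p \<in> up R" "s \<in> up R" by (auto simp: coeffs_in_def)
  then show "p \<otimes>\<^bsub>S\<^esub> s \<in> coeffs_in I"
  proof (induction p rule: up_induct)
    case (const a)
    then show ?case using s unfolding coeffs_in_def mem_Collect_eq
      by (intro conjI allI dmult_closed) (auto simp: S_const_coeff I.I_l_closed)
  next
    case (add p q)
    have "(p \<oplus>\<^bsub>S\<^esub> q) \<otimes>\<^bsub>S\<^esub> s = p \<otimes>\<^bsub>S\<^esub> s \<oplus>\<^bsub>S\<^esub> q \<otimes>\<^bsub>S\<^esub> s" using add by (intro S.l_distr) auto
    then show ?case using add coeffs_in_add by (simp add: diff_op_simps(4))
  next
    case (theta p)
    then show ?case using coeffs_in_T by (simp add: dmult_T)
  qed
qed (rule coeffs_in_add)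

lemma finsum_in_ideal:
  assumes "finite A" "\<And>i. i \<in> A \<Longrightarrow> f i \<in> I" shows "finsum R f A \<in> I"
  using assms
proof (induction A rule: finite_induct)
  case (insert x F)
  then have "finsum R f (insert x F) = f x \<oplus> finsum R f F"
    using I.a_subset by (intro R.finsum_insert) auto
  then show ?case using insert I.a_closed by simp
qed (simp add: I.zero_closed)

lemma coeffs_in_right:
  assumes s: "s \<in> coeffs_in I" and t: "t \<in> up R" shows "s \<otimes>\<^bsub>S\<^esub> t \<in> coeffs_in I"
proof -
  have su: "s \<in> up R" using s by (simp add: coeffs_in_def)
  obtain N where N: "\<forall>n>N. s n = \<zero>" using up_bound su by blast
  have "(s \<otimes>\<^bsub>S\<^esub> t) k \<in> I" for k
  proof -
    have "(s \<otimes>\<^bsub>S\<^esub> t) k = (\<Oplus>i\<in>{..N}. s i \<otimes> (T ^^ i) t k)"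
      by (rule dmult_bound[OF su t]) (use N in auto)
    also have "\<dots> \<in> I" by (rule finsum_in_ideal) (use s t in \<open>auto simp: coeffs_in_def I.I_r_closed\<close>)
    finally show ?thesis .
  qed
  then show ?thesis using su t by (simp add: coeffs_in_def)
qed

lemma truncate_mod:
  assumes s: "s \<in> up R" "\<And>i. i > m \<Longrightarrow> s i \<in> I" shows "s \<ominus>\<^bsub>S\<^esub> truncate m s \<in> coeffs_in I"
proof -
  have t: "truncate m s \<in> up R" using truncate_deg[OF s(1)] deg_less_up by blast
  have "(s \<ominus>\<^bsub>S\<^esub> truncate m s) i \<in> I" for i
  proof (cases "i \<le> m")
    case True
    then have "(s \<ominus>\<^bsub>S\<^esub> truncate m s) i = \<zero>" using s t by (simp add: S_minus_coeff truncate_def R.r_neg R.minus_eq)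
    then show ?thesis using I.zero_closed by simp
  next
    case False
    then have "(s \<ominus>\<^bsub>S\<^esub> truncate m s) i = s i" using s t by (simp add: S_minus_coeff truncate_def R.minus_eq)
    then show ?thesis using s False by simp
  qed
  then show ?thesis using s t by (simp add: coeffs_in_def)
qed

text \<open>Degrees can be computed modulo \<open>I\<close>, because \<open>coeffs_in I\<close> is a two-sided ideal.\<close>

lemma mult_lead_mod:
  assumes s: "s \<in> up R" "\<And>i. i > m \<Longrightarrow> s i \<in> I" and t: "t \<in> up R" "\<And>i. i > n \<Longrightarrow> t i \<in> I"
  shows "(s \<otimes>\<^bsub>S\<^esub> t) (m + n) \<ominus> s m \<otimes> t n \<in> I" "k > m + n \<Longrightarrow> (s \<otimes>\<^bsub>S\<^esub> t) k \<in> I"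
proof -
  define s' t' where "s' = truncate m s" and "t' = truncate n t"
  have d: "s' \<in> deg_less (Suc m)" "t' \<in> deg_less (Suc n)"
    using truncate_deg s t by (auto simp: s'_def t'_def)
  have u: "s' \<in> up R" "t' \<in> up R" using d deg_less_up by auto
  define x where "x = s' \<otimes>\<^bsub>S\<^esub> (t \<ominus>\<^bsub>S\<^esub> t') \<oplus>\<^bsub>S\<^esub> (s \<ominus>\<^bsub>S\<^esub> s') \<otimes>\<^bsub>S\<^esub> t"
  have m: "s \<ominus>\<^bsub>S\<^esub> s' \<in> coeffs_in I" "t \<ominus>\<^bsub>S\<^esub> t' \<in> coeffs_in I"
    using truncate_mod s t unfolding s'_def t'_def by blast+
  have x: "x \<in> coeffs_in I" unfolding x_def
    using lidealsD(4)[OF coeffs_in_lids, of s'] m u t coeffs_in_right by (intro coeffs_in_add) auto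
  have xu: "x \<in> up R" using x by (simp add: coeffs_in_def)
  have e: "s \<otimes>\<^bsub>S\<^esub> t = s' \<otimes>\<^bsub>S\<^esub> t' \<oplus>\<^bsub>S\<^esub> x"
  proof -
    have c: "s \<in> carrier S" "t \<in> carrier S" "s' \<in> carrier S" "t' \<in> carrier S" using s t u by auto
    have "s' \<otimes>\<^bsub>S\<^esub> t' \<oplus>\<^bsub>S\<^esub> x = s' \<otimes>\<^bsub>S\<^esub> (t' \<oplus>\<^bsub>S\<^esub> (t \<ominus>\<^bsub>S\<^esub> t')) \<oplus>\<^bsub>S\<^esub> (s \<ominus>\<^bsub>S\<^esub> s') \<otimes>\<^bsub>S\<^esub> t"
      unfolding x_def using c by (simp add: S.r_distr S.a_assoc del: S_carrier)
    also have "t' \<oplus>\<^bsub>S\<^esub> (t \<ominus>\<^bsub>S\<^esub> t') = t" using c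
      by (simp add: S.minus_eq S.a_comm[of t] S.a_assoc[symmetric] S.r_neg del: S_carrier)
    also have "s' \<otimes>\<^bsub>S\<^esub> t \<oplus>\<^bsub>S\<^esub> (s \<ominus>\<^bsub>S\<^esub> s') \<otimes>\<^bsub>S\<^esub> t = (s' \<oplus>\<^bsub>S\<^esub> (s \<ominus>\<^bsub>S\<^esub> s')) \<otimes>\<^bsub>S\<^esub> t"
      using c by (simp add: S.l_distr del: S_carrier)
    also have "s' \<oplus>\<^bsub>S\<^esub> (s \<ominus>\<^bsub>S\<^esub> s') = s" using c
      by (simp add: S.minus_eq S.a_comm[of s] S.a_assoc[symmetric] S.r_neg del: S_carrier)
    finally show ?thesis by simp
  qed
  have "(s \<otimes>\<^bsub>S\<^esub> t) (m + n) = s m \<otimes> t n \<oplus> x (m + n)"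
    using mult_lead[OF d] u xu unfolding e by (simp add: S_add_coeff) (simp add: s'_def t'_def truncate_def)
  moreover have "x (m + n) \<in> I" using x by (simp add: coeffs_in_def)
  ultimately show "(s \<otimes>\<^bsub>S\<^esub> t) (m + n) \<ominus> s m \<otimes> t n \<in> I"
    using s t xu by (simp add: R.minus_eq R.a_comm[of "s m \<otimes> t n"] R.a_assoc R.r_neg)
  show "(s \<otimes>\<^bsub>S\<^esub> t) k \<in> I" if "k > m + n"
  proof -
    have "(s' \<otimes>\<^bsub>S\<^esub> t') k = \<zero>" using mult_deg[OF d] that by (simp add: deg_less_def)
    moreover have "x k \<in> I" using x by (simp add: coeffs_in_def)
    ultimately show ?thesis using xu unfolding e by (simp add: S_add_coeff)
  qed
qed

lemma top_mod:
  assumes "s \<in> up R" "s \<notin> coeffs_in I"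
  shows "\<exists>m. s m \<notin> I \<and> (\<forall>i>m. s i \<in> I)"
proof -
  obtain j where j: "s j \<notin> I" using assms by (auto simp: coeffs_in_def)
  obtain N where N: "\<forall>n>N. s n = \<zero>" using up_bound assms by blast
  have b: "\<forall>y. s y \<notin> I \<longrightarrow> y \<le> N" using N I.zero_closed by (metis not_le)
  define m where "m = (GREATEST m. s m \<notin> I)"
  have "s m \<notin> I" unfolding m_def by (rule GreatestI_nat[of "\<lambda>m. s m \<notin> I", OF j]) (use b in blast)
  moreover have "s i \<in> I" if "i > m" for i
    using Greatest_le_nat[of "\<lambda>m. s m \<notin> I" i N] b that unfolding m_def by (meson not_le)
  ultimately show ?thesis by blast
qed

end

end

section \<open>Annihilators of simple modules\<close>

context diff_surface
begin

lemma deriv_nonzero: "\<exists>r\<in>carrier R. \<delta> r \<noteq> \<zero>"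
proof (rule ccontr)
  assume n: "\<not> ?thesis"
  \<comment> \<open>With the element 1 this merely provides some maximal ideal.\<close>
  obtain M where M: "maximalideal M R" using jacobson_zero[of \<one>] by auto
  interpret M: maximalideal M R by (rule M)
  have "delta_ideal R \<delta> M" using n M.is_ideal M.zero_closed M.a_subset by (auto simp: delta_ideal_def)
  then show False using no_delta_maximal M by blast
qed

lemma prime_delta_ideal_darboux:
  assumes P: "primeideal P R" "delta_ideal R \<delta> P" "P \<noteq> {\<zero>}"
  shows "\<exists>p. darboux p \<and> P = PIdl p"
proof -
  interpret P: primeideal P R by (rule P)
  obtain p where p: "p \<in> P" "p \<noteq> \<zero>" "primeideal (PIdl p) R" using prime_contains_prime[OF P(1,3)] by blast
  have pc: "p \<in> carrier R" using p P.a_subset by blast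
  have sub: "PIdl p \<subseteq> P" by (rule R.cgenideal_minimal[OF P.is_ideal p(1)])
  have "PIdl p = P"
  proof (rule ccontr)
    assume "PIdl p \<noteq> P"
    moreover have "PIdl p \<noteq> {\<zero>}" using R.cgenideal_self[OF pc] p(2) by blast
    ultimately have "maximalideal P R" using above_prime_maximal[OF p(3) _ P(1)] sub by blast
    then show False using no_delta_maximal P(2) by blast
  qed
  then have "darboux p" "P = PIdl p" using p pc P(2) by (auto simp: darboux_def)
  then show ?thesis by blast
qed

lemma left_span_max_lideal:
  assumes M: "maximalideal M R" shows "S.max_lideal (left_span M)"
proof -
  interpret M: maximalideal M R by (rule M)
  have "\<one> \<notin> M" using M.I_notcarr M.one_imp_carrier by metis
  then have "dconst R \<one> \<notin> left_span M" using left_span_const_iff[OF M.is_ideal] by simp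
  then have "left_span M \<noteq> carrier S" using up_dconst[OF R.one_closed] by auto
  then show ?thesis unfolding S.max_lideal_def
    using left_span_lids[OF M.is_ideal] left_span_maximal[OF M no_delta_maximal[OF M]] by auto
qed

text \<open>The annihilator is two-sided, so its coefficients form a \<delta>-ideal by \<delta>(r) =
  \<theta> r - r \<theta>. That ideal lies in M, hence is zero, and a nonzero two-sided ideal would
  contain a nonzero coefficient.\<close>

lemma bound_left_span:
  assumes M: "maximalideal M R" and core: "dcore M = {\<zero>}"
  shows "S.bound (left_span M) = {\<zero>\<^bsub>S\<^esub>}"
proof -
  interpret M: maximalideal M R by (rule M)
  let ?J = "S.bound (left_span M)"
  have J: "?J \<in> S.lids" by (rule S.lids_bound[OF left_span_lids[OF M.is_ideal]])
  let ?I = "{r \<in> carrier R. dconst R r \<in> ?J}"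
  have d: "\<delta> r \<in> ?I" if r: "r \<in> ?I" for r
  proof -
    have rc: "r \<in> carrier R" "dconst R r \<in> ?J" using r by auto
    have t: "T (dconst R r) \<in> ?J" by (rule S_lids_T[OF J rc(2)])
    have "dconst R r \<otimes>\<^bsub>S\<^esub> dtheta R \<in> ?J" using S.bound_right[OF rc(2)] by simp
    then have "dconst R (\<delta> r) \<in> ?J"
      by (rule S.lids_cancel(2)[OF J]) (use t theta_const[OF rc(1)] rc in auto)
    then show ?thesis using rc by simp
  qed
  have "delta_ideal R \<delta> ?I" unfolding delta_ideal_def using contraction_ideal[OF J] d by blast
  moreover have "?I \<subseteq> M"
  proof
    fix r assume r: "r \<in> ?I"
    then have "dconst R r \<otimes>\<^bsub>S\<^esub> \<one>\<^bsub>S\<^esub> \<in> left_span M" using S.one_closed by (auto simp: S.bound_def)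
    then have "dconst R r \<in> left_span M" using r by simp
    then show "r \<in> M" using left_span_const_iff[OF M.is_ideal] r by blast
  qed
  ultimately have "?I \<subseteq> {\<zero>}" using dcore_greatest core by blast
  moreover obtain r where r: "r \<in> carrier R" "\<delta> r \<noteq> \<zero>" using deriv_nonzero by blast
  have right: "s \<otimes>\<^bsub>S\<^esub> t \<in> ?J" if "s \<in> ?J" "t \<in> up R" for s t using S.bound_right[OF that(1)] that(2) by simp
  ultimately have "s = \<zero>\<^bsub>S\<^esub>" if "s \<in> ?J" for s
    using two_sided_meets_coefficients[OF J right that _ r] by blast
  then show ?thesis using lidealsD(2)[OF J] by blast
qed

text \<open>Among nonzero annihilators in R of nonzero elements of S/L, a maximal one, P, is prime.
  If P is a \<delta>-ideal, it is generated by a Darboux element. If not, the annihilator of the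
  element in S is S P; it is a maximal left ideal, so P is a maximal ideal, and its core supplies
  the Darboux element.\<close>

lemma annihilated_by_darboux_torsion:
  assumes core: "\<And>M. maximalideal M R \<Longrightarrow> dcore M \<noteq> {\<zero>}" and L: "S.max_lideal L"
    and s0: "s\<^sub>0 \<in> up R" "s\<^sub>0 \<notin> L" "r\<^sub>0 \<in> carrier R" "r\<^sub>0 \<noteq> \<zero>" "dconst R r\<^sub>0 \<otimes>\<^bsub>S\<^esub> s\<^sub>0 \<in> L"
  shows "\<exists>p. darboux p \<and> dconst R p \<in> S.bound L"
proof -
  have Ll: "L \<in> S.lids" using L by (simp add: S.max_lideal_def)
  define ann where "ann = (\<lambda>s. {r \<in> carrier R. dconst R r \<in> S.colon L s})"
  have ann_mem: "r \<in> ann s \<longleftrightarrow> r \<in> carrier R \<and> dconst R r \<otimes>\<^bsub>S\<^esub> s \<in> L" for r s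
    by (auto simp: ann_def S.colon_def)
  have colon: "S.colon L s \<in> S.lids" if "s \<in> up R" for s using S.lids_colon[OF Ll] that by simp
  have ann_ideal: "ideal (ann s) R" if "s \<in> up R" for s
    unfolding ann_def by (rule contraction_ideal[OF colon[OF that]])
  let ?G = "{ann s |s. s \<in> up R \<and> s \<notin> L \<and> ann s \<noteq> {\<zero>}}"
  have "?G \<subseteq> R.lids" using ann_ideal by (auto simp: lids_iff_ideal)
  moreover have "r\<^sub>0 \<in> ann s\<^sub>0" using s0 by (simp add: ann_mem)
  then have "ann s\<^sub>0 \<in> ?G" using s0 by blast
  then have "?G \<noteq> {}" by blast
  ultimately have "\<exists>W\<in>?G. \<forall>Y\<in>?G. W \<subseteq> Y \<longrightarrow> Y \<subseteq> W" by (rule acc_on_maximal[OF acc])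
  then obtain P where "P \<in> ?G" and mx: "\<forall>Y\<in>?G. P \<subseteq> Y \<longrightarrow> Y \<subseteq> P" by (rule bexE)
  then obtain s where s: "s \<in> up R" "s \<notin> L" "ann s \<noteq> {\<zero>}" "P = ann s" by blast
  have Pi: "ideal P R" using ann_ideal s by simp
  interpret P: ideal P R by (rule Pi)
  have one: "\<one> \<notin> P" using s by (simp add: ann_mem dconst_simps(4))
  have prime: "primeideal P R"
  proof (rule primeidealI[OF Pi R.is_cring])
    show "carrier R \<noteq> P" using one by blast
    fix a b assume ab: "a \<in> carrier R" "b \<in> carrier R" "a \<otimes> b \<in> P"
    show "a \<in> P \<or> b \<in> P"
    proof (cases "b \<in> P")
      case False
      let ?t = "dconst R b \<otimes>\<^bsub>S\<^esub> s"
      have t: "?t \<in> up R" "?t \<notin> L" using False s ab by (auto simp: ann_mem)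
      have comm: "dconst R r \<otimes>\<^bsub>S\<^esub> ?t = dconst R (r \<otimes> b) \<otimes>\<^bsub>S\<^esub> s" if "r \<in> carrier R" for r
        using that ab s by (simp add: dconst_simps(2) dmult_assoc)
      have sub: "P \<subseteq> ann ?t"
      proof
        fix r assume r: "r \<in> P"
        then have "r \<otimes> b \<in> P" using P.I_r_closed ab by blast
        then show "r \<in> ann ?t" using r comm P.a_subset s(4) by (auto simp: ann_mem)
      qed
      then have "ann ?t \<noteq> {\<zero>}" using s(3,4) P.zero_closed by blast
      then have "ann ?t \<in> ?G" using t by blast
      then have "ann ?t \<subseteq> P" using mx sub by blast
      moreover have "a \<in> ann ?t" using ab comm s(4) by (auto simp: ann_mem)
      ultimately show ?thesis by blast
    qed simp
  qed
  have contr: "{r \<in> carrier R. dconst R r \<in> S.colon L s} = P" unfolding s(4) ann_def ..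
  have mc: "S.max_lideal (S.colon L s)"
  proof (rule S.max_lideal_colon[OF Ll _ s(2)])
    fix x assume x: "x \<in> carrier S" "x \<otimes>\<^bsub>S\<^esub> s \<notin> L"
    have "S.lsum L (S.lprinc (x \<otimes>\<^bsub>S\<^esub> s)) = carrier S"
      by (rule S.max_lideal_lsum[OF L _ x(2)]) (use x(1) s(1) in simp)
    then show "s \<in> S.lsum L (S.lprinc (x \<otimes>\<^bsub>S\<^esub> s))" using s(1) by simp
  qed (use s(1) in simp)
  have "\<exists>p. darboux p \<and> dconst R ` (PIdl p) \<subseteq> S.colon L s"
  proof (cases "delta_ideal R \<delta> P")
    case True
    then obtain p where "darboux p" "P = PIdl p" using prime_delta_ideal_darboux[OF prime True] s(3) unfolding s(4) by blast
    then show ?thesis using contr by blast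
  next
    case False
    have eq: "S.colon L s = left_span P" by (rule left_ideal_over_prime[OF prime False colon[OF s(1)] contr])
    obtain M where M: "maximalideal M R" "P \<subseteq> M" using maximal_ideal_above[OF Pi] one by auto
    interpret M: maximalideal M R by (rule M(1))
    have "left_span P \<subseteq> left_span M"
      by (rule left_span_least[OF Pi left_span_lids[OF M.is_ideal]]) (use left_span_const[OF M.is_ideal] M(2) in blast)
    moreover have "left_span M \<noteq> carrier S" using left_span_max_lideal[OF M(1)] by (simp add: S.max_lideal_def)
    ultimately have "left_span M = left_span P"
      using mc left_span_lids[OF M.is_ideal] unfolding S.max_lideal_def eq by blast
    then have PM: "P = M" using left_span_const_iff[OF Pi] left_span_const_iff[OF M.is_ideal] P.a_subset M.a_subset by blast
    obtain p where p: "darboux p" "dcore M = PIdl p" using dcore_darboux[OF M(1) core[OF M(1)]] by blast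
    then have "PIdl p \<subseteq> P" using dcore_subset[of M] PM by simp
    then show ?thesis using p(1) contr by blast
  qed
  then obtain p where p: "darboux p" "dconst R ` (PIdl p) \<subseteq> S.colon L s" by blast
  have pc: "p \<in> carrier R" "delta_ideal R \<delta> (PIdl p)" using p by (auto simp: darboux_def)
  \<comment> \<open>So far (p) is known to kill only the class of s. That class generates S/L, and p
    commutes past any t into S (p), so p kills everything.\<close>
  have "dconst R p \<otimes>\<^bsub>S\<^esub> u \<in> L" if u: "u \<in> up R" for u
  proof -
    have "u \<in> S.lsum L (S.lprinc s)" using S.max_lideal_lsum[OF L] s u by simp
    then obtain l t where lt: "l \<in> L" "t \<in> carrier S" "u = l \<oplus>\<^bsub>S\<^esub> t \<otimes>\<^bsub>S\<^esub> s" by (rule S.lsum_lprincE)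
    have lu: "l \<in> up R" using lt lidealsD(1)[OF Ll] by auto
    have "dconst R p \<otimes>\<^bsub>S\<^esub> t \<in> S.colon L s"
      using delta_ideal_right_mult[OF pc(2) colon[OF s(1)] p(2)] lt R.cgenideal_self[OF pc(1)] by simp
    then have "dconst R p \<otimes>\<^bsub>S\<^esub> (t \<otimes>\<^bsub>S\<^esub> s) \<in> L" using lt s pc by (simp add: S.colon_def dmult_assoc)
    moreover have "dconst R p \<otimes>\<^bsub>S\<^esub> l \<in> L" using lidealsD(4)[OF Ll] lt pc by simp
    ultimately show ?thesis unfolding lt(3) using lidealsD(3)[OF Ll] lt lu s pc by (simp add: S.r_distr)
  qed
  then show ?thesis using p(1) pc by (auto simp: S.bound_def)
qed

text \<open>If \<open>S/L\<close> is torsion-free over \<open>R\<close>, divide by an element \<open>g\<close> of \<open>L\<close> of least degree, whose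
  leading coefficient \<open>a\<close> lies outside some maximal ideal. Unless the differential ideal \<open>Q\<close> in the
  latter annihilates \<open>S/L\<close>, some \<open>1 - x\<close> with \<open>x \<in> Q S\<close> lies in \<open>L\<close>, and \<open>a\<^sup>N (1 - x) = h g\<close> is
  impossible modulo \<open>Q\<close> for degree reasons.\<close>

lemma annihilated_by_darboux_torsion_free:
  assumes core: "\<And>M. maximalideal M R \<Longrightarrow> dcore M \<noteq> {\<zero>}" and L: "S.max_lideal L"
    and tf: "\<And>s r. s \<in> up R \<Longrightarrow> s \<notin> L \<Longrightarrow> r \<in> carrier R \<Longrightarrow> r \<noteq> \<zero> \<Longrightarrow> dconst R r \<otimes>\<^bsub>S\<^esub> s \<notin> L"
  shows "\<exists>p. darboux p \<and> dconst R p \<in> S.bound L"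
proof (rule ccontr)
  assume none: "\<not> ?thesis"
  have Ll: "L \<in> S.lids" using L by (simp add: S.max_lideal_def)
  have Lu: "s \<in> up R" if "s \<in> L" for s using that lidealsD(1)[OF Ll] by auto
  have one: "\<one>\<^bsub>S\<^esub> \<notin> L" using S.lids_one[OF Ll] L by (auto simp: S.max_lideal_def)
  \<comment> \<open>If L were zero, \<theta> would have a left inverse, but left multiples of
    \<theta> have no constant term.\<close>
  have "L \<noteq> {\<zero>\<^bsub>S\<^esub>}"
  proof
    assume L0: "L = {\<zero>\<^bsub>S\<^esub>}"
    have "dtheta R 1 = \<one>" by (simp add: dtheta_def)
    then have "dtheta R \<noteq> \<zero>\<^bsub>S\<^esub>" by (metis S_zero_coeff one_not_zero)
    then have "\<one>\<^bsub>S\<^esub> \<in> S.lsum L (S.lprinc (dtheta R))" using S.max_lideal_lsum[OF L] L0 S.one_closed by simp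
    then obtain l t where lt: "l \<in> L" "t \<in> carrier S" "\<one>\<^bsub>S\<^esub> = l \<oplus>\<^bsub>S\<^esub> t \<otimes>\<^bsub>S\<^esub> dtheta R" by (rule S.lsum_lprincE)
    then have "\<one>\<^bsub>S\<^esub> = shift t" using L0 mult_theta[of t] by simp
    then have "\<one>\<^bsub>S\<^esub> 0 = \<zero>" by simp
    then show False by (simp add: diff_op_simps(2))
  qed
  then obtain g0 where g0: "g0 \<in> L" "g0 \<noteq> \<zero>\<^bsub>S\<^esub>" using lidealsD(2)[OF Ll] by blast
  define Pr where "Pr = (\<lambda>n. \<exists>g\<in>L. g \<in> deg_less (Suc n) \<and> g n \<noteq> \<zero>)"
  have "\<exists>n. Pr n" unfolding Pr_def using lead_exists[OF Lu[OF g0(1)] g0(2)] g0(1) by blast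
  then have "Pr (LEAST n. Pr n)" by (rule LeastI_ex)
  then obtain n where n: "Pr n" and least: "\<And>m. m < n \<Longrightarrow> \<not> Pr m" using not_less_Least by metis
  obtain g where g: "g \<in> L" "g \<in> deg_less (Suc n)" "g n \<noteq> \<zero>" using n unfolding Pr_def by blast
  have small: "s = \<zero>\<^bsub>S\<^esub>" if s: "s \<in> L" "s \<in> deg_less n" for s
  proof (rule ccontr)
    assume "s \<noteq> \<zero>\<^bsub>S\<^esub>"
    then obtain m where m: "s \<in> deg_less (Suc m)" "s m \<noteq> \<zero>" using lead_exists[OF Lu[OF s(1)]] by blast
    then have "m < n" using deg_less_coeff[OF s(2)] by (meson not_le)
    then show False using least[of m] m s unfolding Pr_def by blast
  qed
  have gu: "g \<in> up R" by (rule Lu[OF g(1)])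
  define a where "a = g n"
  have a: "a \<in> carrier R" "a \<noteq> \<zero>" using g gu by (auto simp: a_def)
  \<comment> \<open>A nonzero constant in L would annihilate the class of 1, contrary to
    torsion-freeness.\<close>
  have n0: "n > 0"
  proof (rule ccontr)
    assume "\<not> n > 0"
    then have "g = dconst R a" using deg_less_1[of g] g(2) by (simp add: a_def)
    then have "dconst R a \<otimes>\<^bsub>S\<^esub> \<one>\<^bsub>S\<^esub> \<in> L" using g(1) a by simp
    then show False using tf[of "\<one>\<^bsub>S\<^esub>" a] one a S.one_closed by simp
  qed
  obtain M where M: "maximalideal M R" "a \<notin> M" using jacobson_zero[OF a] by blast
  obtain p where p: "darboux p" "dcore M = PIdl p" using dcore_darboux[OF M(1) core[OF M(1)]] by blast
  define Q where "Q = PIdl p"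
  have pc: "p \<in> carrier R" "delta_ideal R \<delta> Q" "primeideal Q R" using p by (auto simp: darboux_def Q_def)
  interpret Q: primeideal Q R by (rule pc(3))
  have aQ: "a \<notin> Q" using M p(2) dcore_subset[of M] by (auto simp: Q_def)
  have aQN: "a [^] (N::nat) \<notin> Q" for N
  proof (induction N)
    case 0
    then show ?case using Q.I_notcarr Q.one_imp_carrier by auto
  next
    case (Suc N)
    then show ?case using Q.I_prime[of "a [^] N" a] aQ a by auto
  qed
  have "dconst R p \<notin> S.bound L" using none p(1) by blast
  then obtain t where t: "t \<in> up R" "dconst R p \<otimes>\<^bsub>S\<^esub> t \<notin> L" using pc(1) by (auto simp: S.bound_def)
  let ?w = "dconst R p \<otimes>\<^bsub>S\<^esub> t"
  have wu: "?w \<in> up R" using t pc by simp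
  have "?w \<in> coeffs_in Q" unfolding coeffs_in_def mem_Collect_eq
  proof (intro conjI allI wu)
    fix i show "?w i \<in> Q" using t pc R.cgenideal_self[OF pc(1)] Q.I_r_closed by (simp add: S_const_coeff Q_def[symmetric])
  qed
  moreover have "\<one>\<^bsub>S\<^esub> \<in> S.lsum L (S.lprinc ?w)" using S.max_lideal_lsum[OF L, of ?w] t wu S.one_closed by simp
  then obtain l v where lv: "l \<in> L" "v \<in> carrier S" "\<one>\<^bsub>S\<^esub> = l \<oplus>\<^bsub>S\<^esub> v \<otimes>\<^bsub>S\<^esub> ?w" by (rule S.lsum_lprincE)
  define x where "x = v \<otimes>\<^bsub>S\<^esub> ?w"
  ultimately have x: "x \<in> coeffs_in Q" using lidealsD(4)[OF coeffs_in_lids[OF pc(2)] lv(2)] by simp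
  have lx: "l i \<oplus> x i = \<one>\<^bsub>S\<^esub> i" for i
  proof -
    have "(l \<oplus>\<^bsub>S\<^esub> x) i = \<one>\<^bsub>S\<^esub> i" using lv(3) by (simp add: x_def)
    then show ?thesis by (simp add: S_add_coeff)
  qed
  have lu: "l \<in> up R" by (rule Lu[OF lv(1)])
  have Ql: "Q \<in> R.lids" using Q.is_ideal by (simp add: lids_iff_ideal)
  have xi: "x i \<in> Q" for i using x by (simp add: coeffs_in_def)
  have l_pos: "l i \<in> Q" if "i > 0" for i
  proof -
    have "l i \<oplus> x i = \<zero>" using lx[of i] that by (simp add: diff_op_simps(2) dconst_def)
    then show ?thesis using R.lids_cancel(1)[OF Ql xi[of i], of "l i"] lu Q.zero_closed by simp
  qed
  have l_0: "l 0 \<notin> Q"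
  proof
    assume "l 0 \<in> Q"
    then have "l 0 \<oplus> x 0 \<in> Q" using xi Q.a_closed by blast
    then show False using lx[of 0] Q.I_notcarr Q.one_imp_carrier by (simp add: diff_op_simps(2))
  qed
  obtain k where "l \<in> deg_less k" using deg_less_ex[OF lu] by blast
  then have lk: "l \<in> deg_less (n + k)" using deg_less_mono[of k "n + k"] by simp
  obtain h where h: "h \<in> up R" "dconst R (a [^] k) \<otimes>\<^bsub>S\<^esub> l \<ominus>\<^bsub>S\<^esub> h \<otimes>\<^bsub>S\<^esub> g \<in> deg_less n"
    using pseudo_division[OF g(2) lk] unfolding a_def by blast
  have ak: "a [^] k \<in> carrier R" using a by simp
  have "dconst R (a [^] k) \<otimes>\<^bsub>S\<^esub> l \<in> L" "h \<otimes>\<^bsub>S\<^esub> g \<in> L" using lidealsD(4)[OF Ll] lv(1) g(1) h(1) ak by auto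
  then have z: "dconst R (a [^] k) \<otimes>\<^bsub>S\<^esub> l \<ominus>\<^bsub>S\<^esub> h \<otimes>\<^bsub>S\<^esub> g = \<zero>\<^bsub>S\<^esub>" using small[OF S.lids_minus[OF Ll] h(2)] by blast
  have eq: "a [^] k \<otimes> l i = (h \<otimes>\<^bsub>S\<^esub> g) i" for i
  proof -
    have "(dconst R (a [^] k) \<otimes>\<^bsub>S\<^esub> l \<ominus>\<^bsub>S\<^esub> h \<otimes>\<^bsub>S\<^esub> g) i = \<zero>" using z S_zero_coeff by metis
    then have "a [^] k \<otimes> l i \<ominus> (h \<otimes>\<^bsub>S\<^esub> g) i = \<zero>" using lu h(1) gu ak by (simp add: S_minus_coeff S_const_coeff)
    then show ?thesis using lu h(1) gu ak by simp
  qed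
  show False
  \<comment> \<open>Modulo Q the left side a^k l is a nonzero constant. If h vanishes modulo Q, the
    constant terms disagree; otherwise the product of the leading coefficients of h and g would have
    to vanish modulo Q in the positive degree m + n.\<close>
  proof (cases "h \<in> coeffs_in Q")
    case True
    then have "(h \<otimes>\<^bsub>S\<^esub> g) 0 \<in> Q" using coeffs_in_right[OF pc(2) True gu] by (simp add: coeffs_in_def)
    then have "a [^] k \<otimes> l 0 \<in> Q" using eq[of 0] by simp
    then show False using Q.I_prime[of "a [^] k" "l 0"] aQN l_0 ak lu by auto
  next
    case False
    then obtain m where m: "h m \<notin> Q" "\<forall>i>m. h i \<in> Q" using top_mod[OF pc(2) h(1)] by blast
    have "g i \<in> Q" if "i > n" for i using deg_less_coeff[OF g(2), of i] that Q.zero_closed by simp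
    then have "(h \<otimes>\<^bsub>S\<^esub> g) (m + n) \<ominus> h m \<otimes> g n \<in> Q" using mult_lead_mod(1)[OF pc(2) h(1) _ gu] m(2) by blast
    moreover have hg: "(h \<otimes>\<^bsub>S\<^esub> g) (m + n) \<in> Q" using Q.I_l_closed[OF l_pos[of "m + n"] ak] n0 unfolding eq by simp
    ultimately have "h m \<otimes> g n \<in> Q" by (intro R.lids_cancel(4)[OF Ql hg R.m_closed[OF up_closed[OF h(1)] up_closed[OF gu]]])
    then show False using Q.I_prime[of "h m" "g n"] m(1) aQ a h(1) by (auto simp: a_def)
  qed
qed

lemma annihilated_by_darboux:
  assumes "\<And>M. maximalideal M R \<Longrightarrow> dcore M \<noteq> {\<zero>}" "S.max_lideal L"
  shows "\<exists>p. darboux p \<and> dconst R p \<in> S.bound L"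
  using annihilated_by_darboux_torsion[OF assms] annihilated_by_darboux_torsion_free[OF assms] by metis

lemma delta_primitive_iff_bound:
  "delta_primitive R \<delta> \<longleftrightarrow> (\<exists>L. S.max_lideal L \<and> S.bound L = {\<zero>\<^bsub>S\<^esub>})"
proof
  assume "delta_primitive R \<delta>"
  then show "\<exists>L. S.max_lideal L \<and> S.bound L = {\<zero>\<^bsub>S\<^esub>}"
    unfolding delta_primitive_iff using left_span_max_lideal bound_left_span by blast
next
  assume "\<exists>L. S.max_lideal L \<and> S.bound L = {\<zero>\<^bsub>S\<^esub>}"
  then obtain L where L: "S.max_lideal L" "S.bound L = {\<zero>\<^bsub>S\<^esub>}" by blast
  show "delta_primitive R \<delta>"
  proof (rule ccontr)
    assume "\<not> ?thesis"
    then have "\<exists>p. darboux p \<and> dconst R p \<in> S.bound L"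
      using annihilated_by_darboux[OF _ L(1)] unfolding delta_primitive_iff by blast
    then obtain p where p: "darboux p" "dconst R p = \<zero>\<^bsub>S\<^esub>" using L(2) by auto
    then have "dconst R p 0 = \<zero>" using S_zero_coeff by metis
    then show False using p(1) by (simp add: darboux_def)
  qed
qed

end

section \<open>The diamond property in the case that the ring is not primitive\<close>

lemma (in ring) minus_eq_of_sums:
  assumes c: "a \<in> carrier R" "b \<in> carrier R" "l \<in> carrier R" "l' \<in> carrier R" and e: "l \<oplus> a = l' \<oplus> b"
  shows "a \<ominus> b = l' \<ominus> l"
proof -
  have "l' = (l' \<oplus> b) \<ominus> b" using c by (simp add: minus_eq a_assoc r_neg)
  also have "\<dots> = (a \<ominus> b) \<oplus> l" unfolding e[symmetric] using c by (simp add: minus_eq a_ac)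
  finally show ?thesis using c by (simp add: minus_eq a_assoc r_neg)
qed

text \<open>In terms of \<open>M = R/L\<close>: if \<open>M\<close> has a simple submodule \<open>N/L\<close> contained in every nonzero
  submodule, then \<open>M\<close> is artinian.\<close>

definition (in ring) diamond_lids :: bool where
  "diamond_lids \<longleftrightarrow> (\<forall>L\<in>lids. \<forall>N\<in>lids. L \<subset> N \<and> (\<forall>Y\<in>lids. L \<subset> Y \<longrightarrow> N \<subseteq> Y) \<longrightarrow>
     dcc_on (between lids L (carrier R)))"

context derivation
begin

lemma delta_ideal_principal:
  assumes r: "r \<in> carrier R" "\<delta> r \<in> PIdl r" shows "delta_ideal R \<delta> (PIdl r)"
proof -
  obtain c where c: "c \<in> carrier R" "\<delta> r = c \<otimes> r" using r by (auto simp: cgenideal_def)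
  have "\<delta> (y \<otimes> r) \<in> PIdl r" if "y \<in> carrier R" for y
  proof -
    have "\<delta> (y \<otimes> r) = (\<delta> y \<oplus> y \<otimes> c) \<otimes> r" using that r c by (simp add: deriv_mult R.l_distr R.m_assoc)
    then show ?thesis using that c by (auto simp: cgenideal_def)
  qed
  then show ?thesis using R.cgenideal_ideal[OF r(1)] by (auto simp: delta_ideal_def cgenideal_def)
qed

lemma deriv_power_dvd:
  assumes r: "r \<in> carrier R" "\<delta> r \<in> PIdl r" shows "\<delta> (r [^] (n::nat)) \<in> PIdl (r [^] n)"
proof (induction n)
  case 0
  show ?case by (auto simp: cgenideal_def intro!: exI[of _ \<zero>])
next
  case (Suc n)
  obtain c where c: "c \<in> carrier R" "\<delta> r = c \<otimes> r" using r by (auto simp: cgenideal_def)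
  obtain d where d: "d \<in> carrier R" "\<delta> (r [^] n) = d \<otimes> r [^] n" using Suc by (auto simp: cgenideal_def)
  have rn: "r [^] n \<in> carrier R" using r by simp
  have "\<delta> (r [^] Suc n) = d \<otimes> r [^] n \<otimes> r \<oplus> r [^] n \<otimes> (c \<otimes> r)"
    using r rn c d by (simp add: deriv_mult)
  also have "\<dots> = (d \<oplus> c) \<otimes> (r [^] n \<otimes> r)" using r(1) rn c(1) d(1) by algebra
  finally show ?case using c d by (auto simp: cgenideal_def)
qed

text \<open>With \<delta>(r) = c r the defining relation reads r \<theta> = (\<theta> - c) r, so r S
  = S r.\<close>

lemma normal_element:
  assumes r: "r \<in> carrier R" "\<delta> r \<in> PIdl r" and t: "t \<in> up R"
  shows "\<exists>t'\<in>up R. dconst R r \<otimes>\<^bsub>S\<^esub> t = t' \<otimes>\<^bsub>S\<^esub> dconst R r"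
    and "\<exists>t'\<in>up R. t \<otimes>\<^bsub>S\<^esub> dconst R r = dconst R r \<otimes>\<^bsub>S\<^esub> t'"
proof -
  obtain c where c: "c \<in> carrier R" "\<delta> r = c \<otimes> r" using r by (auto simp: cgenideal_def)
  let ?r = "dconst R r" and ?c = "dconst R c"
  have cr: "dconst R (\<delta> r) = ?c \<otimes>\<^bsub>S\<^esub> ?r" using c r by (simp add: dconst_simps(2))
  have rc: "dconst R (\<delta> r) = ?r \<otimes>\<^bsub>S\<^esub> ?c" using c r by (simp add: R.m_comm[of c r] dconst_simps(2))
  have ru: "?r \<in> up R" "?c \<in> up R" using r c by auto
  show "\<exists>t'\<in>up R. ?r \<otimes>\<^bsub>S\<^esub> t = t' \<otimes>\<^bsub>S\<^esub> ?r" using t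
  proof (induction t rule: up_induct)
    case (const a)
    then have "?r \<otimes>\<^bsub>S\<^esub> dconst R a = dconst R a \<otimes>\<^bsub>S\<^esub> ?r" using r by (simp add: dconst_simps(2)[symmetric] R.m_comm)
    then show ?case using const by (intro bexI[of _ "dconst R a"]) auto
  next
    case (add s t)
    then obtain s' t' where *: "s' \<in> up R" "t' \<in> up R" "?r \<otimes>\<^bsub>S\<^esub> s = s' \<otimes>\<^bsub>S\<^esub> ?r" "?r \<otimes>\<^bsub>S\<^esub> t = t' \<otimes>\<^bsub>S\<^esub> ?r" by blast
    have "?r \<otimes>\<^bsub>S\<^esub> (s \<oplus>\<^bsub>S\<^esub> t) = (s' \<oplus>\<^bsub>S\<^esub> t') \<otimes>\<^bsub>S\<^esub> ?r" using * add ru by (simp add: S.r_distr S.l_distr)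
    then show ?case using * by (intro bexI[of _ "s' \<oplus>\<^bsub>S\<^esub> t'"]) (auto simp: diff_op_simps(4))
  next
    case (theta t)
    then obtain t' where *: "t' \<in> up R" "?r \<otimes>\<^bsub>S\<^esub> t = t' \<otimes>\<^bsub>S\<^esub> ?r" by blast
    let ?x = "T t' \<ominus>\<^bsub>S\<^esub> ?c \<otimes>\<^bsub>S\<^esub> t'"
    have e: "?r \<otimes>\<^bsub>S\<^esub> T t \<oplus>\<^bsub>S\<^esub> ?c \<otimes>\<^bsub>S\<^esub> (t' \<otimes>\<^bsub>S\<^esub> ?r) = T t' \<otimes>\<^bsub>S\<^esub> ?r"
    proof -
      have "T (?r \<otimes>\<^bsub>S\<^esub> t) = ?r \<otimes>\<^bsub>S\<^esub> T t \<oplus>\<^bsub>S\<^esub> ?c \<otimes>\<^bsub>S\<^esub> ?r \<otimes>\<^bsub>S\<^esub> t"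
        using T_const_mult[OF r(1) theta(1)] cr by simp
      moreover have "T (?r \<otimes>\<^bsub>S\<^esub> t) = T t' \<otimes>\<^bsub>S\<^esub> ?r" using * ru by (simp add: dmult_T)
      moreover have "?c \<otimes>\<^bsub>S\<^esub> ?r \<otimes>\<^bsub>S\<^esub> t = ?c \<otimes>\<^bsub>S\<^esub> (t' \<otimes>\<^bsub>S\<^esub> ?r)" using * ru theta(1) by (simp add: dmult_assoc)
      ultimately show ?thesis by simp
    qed
    have "?x \<otimes>\<^bsub>S\<^esub> ?r = T t' \<otimes>\<^bsub>S\<^esub> ?r \<ominus>\<^bsub>S\<^esub> ?c \<otimes>\<^bsub>S\<^esub> (t' \<otimes>\<^bsub>S\<^esub> ?r)"
      using * ru by (simp add: S.minus_eq S.l_distr S.l_minus dmult_assoc)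
    also have "\<dots> = (?r \<otimes>\<^bsub>S\<^esub> T t \<oplus>\<^bsub>S\<^esub> ?c \<otimes>\<^bsub>S\<^esub> (t' \<otimes>\<^bsub>S\<^esub> ?r)) \<ominus>\<^bsub>S\<^esub> ?c \<otimes>\<^bsub>S\<^esub> (t' \<otimes>\<^bsub>S\<^esub> ?r)" using e by simp
    also have "\<dots> = ?r \<otimes>\<^bsub>S\<^esub> T t"
      using * ru theta(1) by (simp add: S.minus_eq S.a_assoc S.r_neg)
    finally show ?case using * ru by (intro bexI[of _ ?x]) auto
  qed
  show "\<exists>t'\<in>up R. t \<otimes>\<^bsub>S\<^esub> ?r = ?r \<otimes>\<^bsub>S\<^esub> t'" using t
  proof (induction t rule: up_induct)
    case (const a)
    then have "dconst R a \<otimes>\<^bsub>S\<^esub> ?r = ?r \<otimes>\<^bsub>S\<^esub> dconst R a" using r by (simp add: dconst_simps(2)[symmetric] R.m_comm)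
    then show ?case using const by (intro bexI[of _ "dconst R a"]) auto
  next
    case (add s t)
    then obtain s' t' where *: "s' \<in> up R" "t' \<in> up R" "s \<otimes>\<^bsub>S\<^esub> ?r = ?r \<otimes>\<^bsub>S\<^esub> s'" "t \<otimes>\<^bsub>S\<^esub> ?r = ?r \<otimes>\<^bsub>S\<^esub> t'" by blast
    have "(s \<oplus>\<^bsub>S\<^esub> t) \<otimes>\<^bsub>S\<^esub> ?r = ?r \<otimes>\<^bsub>S\<^esub> (s' \<oplus>\<^bsub>S\<^esub> t')" using * add ru by (simp add: S.r_distr S.l_distr)
    then show ?case using * by (intro bexI[of _ "s' \<oplus>\<^bsub>S\<^esub> t'"]) (auto simp: diff_op_simps(4))
  next
    case (theta t)
    then obtain t' where *: "t' \<in> up R" "t \<otimes>\<^bsub>S\<^esub> ?r = ?r \<otimes>\<^bsub>S\<^esub> t'" by blast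
    have "T t \<otimes>\<^bsub>S\<^esub> ?r = T (?r \<otimes>\<^bsub>S\<^esub> t')" using * theta ru by (simp add: dmult_T)
    also have "\<dots> = ?r \<otimes>\<^bsub>S\<^esub> T t' \<oplus>\<^bsub>S\<^esub> ?r \<otimes>\<^bsub>S\<^esub> ?c \<otimes>\<^bsub>S\<^esub> t'" using T_const_mult[OF r(1) *(1)] rc by simp
    also have "\<dots> = ?r \<otimes>\<^bsub>S\<^esub> (T t' \<oplus>\<^bsub>S\<^esub> ?c \<otimes>\<^bsub>S\<^esub> t')" using * ru by (simp add: S.r_distr dmult_assoc)
    finally show ?case using * ru by (intro bexI[of _ "T t' \<oplus>\<^bsub>S\<^esub> ?c \<otimes>\<^bsub>S\<^esub> t'"]) auto
  qed
qed

lemma coeffs_in_principal: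
  assumes p: "p \<in> carrier R" and s: "s \<in> coeffs_in (PIdl p)"
  shows "\<exists>t\<in>up R. s = dconst R p \<otimes>\<^bsub>S\<^esub> t"
proof -
  have su: "s \<in> up R" and si: "\<And>i. \<exists>y\<in>carrier R. s i = y \<otimes> p" using s by (auto simp: coeffs_in_def cgenideal_def)
  obtain y where y: "\<And>i. y i \<in> carrier R" "\<And>i. s i = y i \<otimes> p" using si by metis
  obtain N where N: "\<forall>n>N. s n = \<zero>" using up_bound su by blast
  define t where "t = (\<lambda>i. if i \<le> N then y i else \<zero>)"
  have t: "t \<in> up R" by (rule upI[of _ N]) (use y in \<open>auto simp: t_def\<close>)
  have "s i = (dconst R p \<otimes>\<^bsub>S\<^esub> t) i" for i
    using y[of i] N p t by (simp add: S_const_coeff) (auto simp: t_def R.m_comm)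
  then show ?thesis using t by (intro bexI[of _ t]) auto
qed

definition lead_coeffs :: "nat \<Rightarrow> (nat \<Rightarrow> 'r) set \<Rightarrow> 'r set" where
  "lead_coeffs k L = {r \<in> carrier R. \<exists>s\<in>L. s \<in> deg_less (Suc k) \<and> s k = r}"

lemma lead_coeffs_lids:
  assumes L: "L \<in> S.lids" shows "lead_coeffs k L \<in> R.lids"
proof (rule lidealsI)
  show "\<zero> \<in> lead_coeffs k L"
    using lidealsD(2)[OF L] deg_less_zero S_zero_coeff by (auto simp: lead_coeffs_def)
next
  fix a b assume "a \<in> lead_coeffs k L" "b \<in> lead_coeffs k L"
  then obtain s t where *: "s \<in> L" "t \<in> L" "s \<in> deg_less (Suc k)" "t \<in> deg_less (Suc k)" "s k = a" "t k = b"
    "a \<in> carrier R" "b \<in> carrier R" by (auto simp: lead_coeffs_def)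
  then have "s \<oplus>\<^bsub>S\<^esub> t \<in> L" "s \<oplus>\<^bsub>S\<^esub> t \<in> deg_less (Suc k)" "(s \<oplus>\<^bsub>S\<^esub> t) k = a \<oplus> b"
    using lidealsD(3)[OF L] deg_less_add by (simp_all add: S_add_coeff)
  then show "a \<oplus> b \<in> lead_coeffs k L" using * unfolding lead_coeffs_def by blast
next
  fix c a assume c: "c \<in> carrier R" and "a \<in> lead_coeffs k L"
  then obtain s where *: "s \<in> L" "s \<in> deg_less (Suc k)" "s k = a" "a \<in> carrier R" by (auto simp: lead_coeffs_def)
  then have "dconst R c \<otimes>\<^bsub>S\<^esub> s \<in> L" "dconst R c \<otimes>\<^bsub>S\<^esub> s \<in> deg_less (Suc k)" "(dconst R c \<otimes>\<^bsub>S\<^esub> s) k = c \<otimes> a"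
    using lidealsD(4)[OF L, of "dconst R c" s] deg_less_const_mult[OF c *(2)] c deg_less_up[OF *(2)]
    by (simp_all add: S_const_coeff)
  then show "c \<otimes> a \<in> lead_coeffs k L" using * c unfolding lead_coeffs_def by blast
qed (auto simp: lead_coeffs_def)

lemma lead_coeffs_Suc:
  assumes L: "L \<in> S.lids" shows "lead_coeffs k L \<subseteq> lead_coeffs (Suc k) L"
proof
  fix a assume "a \<in> lead_coeffs k L"
  then obtain s where *: "s \<in> L" "s \<in> deg_less (Suc k)" "s k = a" "a \<in> carrier R" by (auto simp: lead_coeffs_def)
  then show "a \<in> lead_coeffs (Suc k) L"
    unfolding lead_coeffs_def using S_lids_T[OF L] T_deg[OF *(2)] T_lead[OF *(2)] by blast
qed

lemma lead_coeffs_mono: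
  assumes L: "L \<in> S.lids" "k \<le> l" shows "lead_coeffs k L \<subseteq> lead_coeffs l L"
  by (rule lift_Suc_mono_le[of "\<lambda>k. lead_coeffs k L", OF lead_coeffs_Suc[OF L(1)] L(2)])

text \<open>Left multiplication by \<theta> carries a leading coefficient one degree up, so this is
  an increasing union of ideals.\<close>

definition all_lead_coeffs :: "(nat \<Rightarrow> 'r) set \<Rightarrow> 'r set" where
  "all_lead_coeffs L = (\<Union>k. lead_coeffs k L)"

lemma all_lead_coeffs_lids:
  assumes L: "L \<in> S.lids" shows "all_lead_coeffs L \<in> R.lids"
proof (rule lidealsI)
  fix a b assume "a \<in> all_lead_coeffs L" "b \<in> all_lead_coeffs L"
  then obtain k l where "a \<in> lead_coeffs k L" "b \<in> lead_coeffs l L" by (auto simp: all_lead_coeffs_def)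
  then have "a \<in> lead_coeffs (max k l) L" "b \<in> lead_coeffs (max k l) L"
    using lead_coeffs_mono[OF L, of k "max k l"] lead_coeffs_mono[OF L, of l "max k l"] by auto
  then show "a \<oplus> b \<in> all_lead_coeffs L" using lidealsD(3)[OF lead_coeffs_lids[OF L]] by (auto simp: all_lead_coeffs_def)
next
  show "all_lead_coeffs L \<subseteq> carrier R" using lidealsD(1)[OF lead_coeffs_lids[OF L]] unfolding all_lead_coeffs_def by blast
  show "\<zero> \<in> all_lead_coeffs L" using lidealsD(2)[OF lead_coeffs_lids[OF L]] unfolding all_lead_coeffs_def by blast
  fix c a assume "c \<in> carrier R" "a \<in> all_lead_coeffs L"
  then show "c \<otimes> a \<in> all_lead_coeffs L"
    using lidealsD(4)[OF lead_coeffs_lids[OF L]] unfolding all_lead_coeffs_def by blast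
qed

end

context diff_surface
begin

text \<open>S arises from the copy of R by adjoining \<theta>, whose commutators with coefficients
  are again coefficients; \<open>hilbert_basis\<close> covers this noncommutative case.\<close>

lemma S_acc: "acc_on S.lids"
proof -
  let ?B = "dconst R ` carrier R"
  interpret A: adjoin S ?B "dtheta R"
  proof (intro adjoin.intro adjoin_axioms.intro S.ring_axioms)
    show "subring ?B S"
    proof (rule S.subringI)
      fix h assume "h \<in> ?B"
      then obtain a where a: "a \<in> carrier R" "h = dconst R a" by blast
      show "\<ominus>\<^bsub>S\<^esub> h \<in> ?B" unfolding a(2) dconst_simps(5)[OF a(1), symmetric] using a(1) by blast
      fix h' assume "h' \<in> ?B"
      then obtain b where b: "b \<in> carrier R" "h' = dconst R b" by blast
      show "h \<otimes>\<^bsub>S\<^esub> h' \<in> ?B" unfolding a(2) b(2) dconst_simps(2)[OF a(1) b(1), symmetric] using a(1) b(1) by blast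
      show "h \<oplus>\<^bsub>S\<^esub> h' \<in> ?B" unfolding a(2) b(2) dconst_simps(1)[OF a(1) b(1), symmetric] using a(1) b(1) by blast
    qed (auto simp: dconst_simps(4)[symmetric])
    show "dtheta R \<in> carrier S" by simp
    fix b assume "b \<in> ?B"
    then obtain a where a: "a \<in> carrier R" "b = dconst R a" by blast
    have "dtheta R \<otimes>\<^bsub>S\<^esub> b \<ominus>\<^bsub>S\<^esub> b \<otimes>\<^bsub>S\<^esub> dtheta R = dconst R (\<delta> a)"
      unfolding a(2) dtheta_commute[OF a(1)] using a(1) S.a_comm[of "dconst R a \<otimes>\<^bsub>S\<^esub> dtheta R" "dconst R (\<delta> a)"]
      by (simp add: S.minus_eq S.a_assoc S.r_neg)
    then show "dtheta R \<otimes>\<^bsub>S\<^esub> b \<ominus>\<^bsub>S\<^esub> b \<otimes>\<^bsub>S\<^esub> dtheta R \<in> ?B" using a(1) by auto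
  qed
  have acc_B: "acc_on (lideals S ?B)"
    unfolding acc_on_def
  proof (intro allI impI)
    fix C :: "nat \<Rightarrow> _" assume C: "\<forall>i. C i \<in> lideals S ?B \<and> C i \<subseteq> C (Suc i)"
    have "\<exists>n. \<forall>i\<ge>n. {r \<in> carrier R. dconst R r \<in> C i} = {r \<in> carrier R. dconst R r \<in> C n}"
    proof (rule acc_onD[OF acc])
      fix i
      have Ci: "C i \<in> lideals S ?B" using C by blast
      show "{r \<in> carrier R. dconst R r \<in> C i} \<in> R.lids"
        by (rule lidealsI) (use lidealsD(2,3,4)[OF Ci] in \<open>auto simp: dconst_simps(1,2,3)\<close>)
      show "{r \<in> carrier R. dconst R r \<in> C i} \<subseteq> {r \<in> carrier R. dconst R r \<in> C (Suc i)}" using C by blast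
    qed
    then obtain n where n: "\<forall>i\<ge>n. {r \<in> carrier R. dconst R r \<in> C i} = {r \<in> carrier R. dconst R r \<in> C n}" ..
    have im: "C i = dconst R ` {r \<in> carrier R. dconst R r \<in> C i}" for i using C lidealsD(1)[of "C i" S ?B] by blast
    have "C i = C n" if "i \<ge> n" for i
      using im[of i] im[of n] n[rule_format, OF that] by metis
    then have "\<forall>i\<ge>n. C i = C n" by (intro allI impI)
    then show "\<exists>n. \<forall>i\<ge>n. C i = C n" ..
  qed
  have "p \<in> A.adj" if "p \<in> up R" for p using that
  proof (induction p rule: up_induct)
    case (add p q)
    then show ?case using A.adj_add[of p q] by (simp add: diff_op_simps(4))
  next
    case (theta p)
    then show ?case using A.adj_mult[OF theta(2) A.x_adj] by (simp add: dtheta_mult)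
  qed (use A.B_adj in auto)
  then have "A.adj = carrier S" using A.adj_carrier by auto
  then show ?thesis using A.hilbert_basis[OF acc_B] by simp
qed

section \<open>The factor ring of S by a Darboux element\<close>

context
  fixes p assumes p: "darboux p"
begin

private definition "Q = PIdl p"
text \<open>The ideal p S = S p, so that S/W is the domain (R/Q)[\<theta>;\<delta>].\<close>

private definition "W = coeffs_in Q"

lemma pc: "p \<in> carrier R" "p \<noteq> \<zero>" "primeideal Q R" "delta_ideal R \<delta> Q"
  using p by (auto simp: darboux_def Q_def)

interpretation Q: primeideal Q R by (rule pc(3))

lemma Q_lids: "Q \<in> R.lids" using Q.is_ideal by (simp add: lids_iff_ideal)

lemma W_lids: "W \<in> S.lids" unfolding W_def by (rule coeffs_in_lids[OF pc(4)])

lemma deriv_p: "\<delta> p \<in> PIdl p"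
  using pc(1,4) R.cgenideal_self by (auto simp: delta_ideal_def Q_def)

text \<open>Cutting off the top coefficients that lie in Q changes \<open>s\<close> by an element of
  W, hence stays in \<open>Y\<close>, and turns the degree modulo Q into an actual degree. The
  condition on \<open>s n\<close> records that this degree is one at which \<open>s\<close> itself
  does not vanish.\<close>

lemma mod_lead_exists:
  assumes Y: "Y \<in> S.lids" "W \<subseteq> Y" and s: "s \<in> Y" "s \<notin> W"
  shows "\<exists>g\<in>Y. \<exists>n. g \<in> deg_less (Suc n) \<and> g n \<notin> Q \<and> s n \<notin> Q"
proof -
  have su: "s \<in> up R" using s lidealsD(1)[OF Y(1)] by auto
  obtain m where m: "s m \<notin> Q" "\<forall>i>m. s i \<in> Q" using top_mod[OF pc(4) su] s(2) unfolding W_def by blast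
  have "s \<ominus>\<^bsub>S\<^esub> truncate m s \<in> Y" using truncate_mod[OF pc(4) su, of m] m(2) Y(2) unfolding W_def by blast
  then have "truncate m s \<in> Y"
    by (rule S.lids_cancel(4)[OF Y(1) s(1), rotated]) (use deg_less_up[OF truncate_deg[OF su]] in simp)
  moreover have "truncate m s m = s m" by (simp add: truncate_def)
  ultimately show ?thesis using truncate_deg[OF su] m(1) by metis
qed

private definition "mindeg Y = (LEAST n. \<exists>g\<in>Y. g \<in> deg_less (Suc n) \<and> g n \<notin> Q)"

lemma mindeg_ex:
  assumes "Y \<in> S.lids" "W \<subseteq> Y" "\<not> Y \<subseteq> W"
  shows "\<exists>g\<in>Y. g \<in> deg_less (Suc (mindeg Y)) \<and> g (mindeg Y) \<notin> Q"
  unfolding mindeg_def by (rule LeastI_ex) (use mod_lead_exists[OF assms(1,2)] assms(3) in blast)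

lemma mindeg_antimono:
  assumes "Y \<in> S.lids" "W \<subseteq> Y" "\<not> Y \<subseteq> W" "Y \<subseteq> Z" shows "mindeg Z \<le> mindeg Y"
  unfolding mindeg_def[of Z] by (rule Least_le) (use mindeg_ex[OF assms(1-3)] assms(4) in blast)

lemma below_mindeg:
  assumes Y: "Y \<in> S.lids" "W \<subseteq> Y" and s: "s \<in> Y" "s \<in> deg_less (mindeg Y)" shows "s \<in> W"
proof (rule ccontr)
  assume "s \<notin> W"
  then obtain g n where g: "g \<in> Y" "g \<in> deg_less (Suc n)" "g n \<notin> Q" "s n \<notin> Q" using mod_lead_exists[OF Y s(1)] by blast
  then have "mindeg Y \<le> n" unfolding mindeg_def by (intro Least_le) blast
  then have "s n = \<zero>" using deg_less_coeff[OF s(2)] by blast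
  then show False using g(4) Q.zero_closed by simp
qed

text \<open>Subtracting elements of \<open>Y\<close> with the same leading coefficient reduces \<open>Z\<close> modulo \<open>Y\<close> to
  bounded degree, where pseudo-division multiplies it into \<open>Y\<close> by a fixed \<open>c \<notin> Q\<close>. The coefficients that
  multiply \<open>Z\<close> into \<open>Y\<close> thus form a differential ideal strictly above \<open>Q\<close>.\<close>

lemma eq_of_lead_coeffs:
  assumes Y: "Y \<in> S.lids" "W \<subseteq> Y" "\<not> Y \<subseteq> W" and Z: "Z \<in> S.lids" "Y \<subseteq> Z"
    and md: "mindeg Z = mindeg Y" and lc: "all_lead_coeffs Z \<subseteq> all_lead_coeffs Y"
  shows "Z \<subseteq> Y"
proof -
  define n where "n = mindeg Y"
  obtain g where g: "g \<in> Y" "g \<in> deg_less (Suc n)" "g n \<notin> Q" using mindeg_ex[OF Y] unfolding n_def by blast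
  have Zu: "s \<in> up R" if "s \<in> Z" for s using that lidealsD(1)[OF Z(1)] by auto
  have gu: "g \<in> up R" using Zu g(1) Z(2) by blast
  define a where "a = g n"
  have a: "a \<in> carrier R" using gu by (simp add: a_def)
  \<comment> \<open>From some degree k on, Y realises all of its leading coefficients in every
    degree. Elements of Z thus reduce modulo Y to degree below k, and the power a^k is enough for
    the pseudo-division there.\<close>
  have "\<exists>k. \<forall>i\<ge>k. lead_coeffs i Y = lead_coeffs k Y"
    by (rule acc_onD[where C = "\<lambda>k. lead_coeffs k Y", OF acc lead_coeffs_lids[OF Y(1)] lead_coeffs_Suc[OF Y(1)]])
  then obtain k where k: "\<forall>i\<ge>k. lead_coeffs i Y = lead_coeffs k Y" ..
  have lead_k: "all_lead_coeffs Y \<subseteq> lead_coeffs k Y"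
  proof
    fix r assume "r \<in> all_lead_coeffs Y"
    then obtain i where "r \<in> lead_coeffs i Y" by (auto simp: all_lead_coeffs_def)
    then have "r \<in> lead_coeffs (max i k) Y" using lead_coeffs_mono[OF Y(1), of i "max i k"] by auto
    then show "r \<in> lead_coeffs k Y" using k[rule_format, of "max i k"] by simp
  qed
  define c where "c = a [^] k"
  have c: "c \<in> carrier R" using a by (simp add: c_def)
  have cQ: "c \<notin> Q" unfolding c_def
  proof (induction k)
    case 0
    then show ?case using Q.I_notcarr Q.one_imp_carrier by auto
  next
    case (Suc k)
    then show ?case using Q.I_prime[of "a [^] k" a] g(3) a by (auto simp: a_def)
  qed
  have small: "dconst R c \<otimes>\<^bsub>S\<^esub> s \<in> Y" if s: "s \<in> Z" "s \<in> deg_less k" for s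
  proof -
    have "s \<in> deg_less (n + k)" using deg_less_mono[OF _ s(2)] by simp
    then obtain h where h: "h \<in> up R" "dconst R c \<otimes>\<^bsub>S\<^esub> s \<ominus>\<^bsub>S\<^esub> h \<otimes>\<^bsub>S\<^esub> g \<in> deg_less n"
      using pseudo_division[OF g(2)] unfolding c_def a_def by blast
    have hg: "h \<otimes>\<^bsub>S\<^esub> g \<in> Y" using lidealsD(4)[OF Y(1)] h(1) g(1) by simp
    have "dconst R c \<otimes>\<^bsub>S\<^esub> s \<in> Z" using lidealsD(4)[OF Z(1)] c s(1) by simp
    then have "dconst R c \<otimes>\<^bsub>S\<^esub> s \<ominus>\<^bsub>S\<^esub> h \<otimes>\<^bsub>S\<^esub> g \<in> Z" using S.lids_minus[OF Z(1)] hg Z(2) by blast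
    then have "dconst R c \<otimes>\<^bsub>S\<^esub> s \<ominus>\<^bsub>S\<^esub> h \<otimes>\<^bsub>S\<^esub> g \<in> W"
      by (rule below_mindeg[OF Z(1) subset_trans[OF Y(2) Z(2)]]) (use h(2) md in \<open>simp add: n_def\<close>)
    then have "dconst R c \<otimes>\<^bsub>S\<^esub> s \<ominus>\<^bsub>S\<^esub> h \<otimes>\<^bsub>S\<^esub> g \<in> Y" using Y(2) by blast
    then show ?thesis by (rule S.lids_cancel(3)[OF Y(1) hg, rotated]) (use c Zu[OF s(1)] in simp)
  qed
  have all: "dconst R c \<otimes>\<^bsub>S\<^esub> s \<in> Y" if "s \<in> Z" "s \<in> deg_less (k + m)" for m s
    using that
  proof (induction m arbitrary: s)
    case 0
    then show ?case using small by simp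
  next
    case (Suc m)
    have su: "s \<in> up R" by (rule Zu[OF Suc.prems(1)])
    have "s (k + m) \<in> lead_coeffs (k + m) Z" using Suc.prems su by (auto simp: lead_coeffs_def)
    then have "s (k + m) \<in> lead_coeffs k Y" using lc lead_k by (auto simp: all_lead_coeffs_def)
    then have "s (k + m) \<in> lead_coeffs (k + m) Y" using lead_coeffs_mono[OF Y(1), of k "k + m"] by auto
    then obtain t where t: "t \<in> Y" "t \<in> deg_less (Suc (k + m))" "t (k + m) = s (k + m)" by (auto simp: lead_coeffs_def)
    have tu: "t \<in> up R" using Zu t(1) Z(2) by blast
    have sk: "s \<in> deg_less (Suc (k + m))" using Suc.prems by simp
    have "s \<ominus>\<^bsub>S\<^esub> t \<in> deg_less (k + m)"
      by (rule deg_less_SucD[OF deg_less_minus[OF sk t(2)]])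
        (use su tu t(3) in \<open>simp add: S_minus_coeff R.minus_eq R.r_neg\<close>)
    moreover have "s \<ominus>\<^bsub>S\<^esub> t \<in> Z" using S.lids_minus[OF Z(1) Suc.prems(1)] t(1) Z(2) by blast
    ultimately have "dconst R c \<otimes>\<^bsub>S\<^esub> (s \<ominus>\<^bsub>S\<^esub> t) \<in> Y" by (intro Suc.IH)
    moreover have "dconst R c \<otimes>\<^bsub>S\<^esub> t \<in> Y" using lidealsD(4)[OF Y(1)] c t(1) by simp
    moreover have "dconst R c \<otimes>\<^bsub>S\<^esub> (s \<ominus>\<^bsub>S\<^esub> t) = dconst R c \<otimes>\<^bsub>S\<^esub> s \<ominus>\<^bsub>S\<^esub> dconst R c \<otimes>\<^bsub>S\<^esub> t"
      using c su tu by (simp add: S.minus_eq S.r_distr S.r_minus)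
    ultimately have "dconst R c \<otimes>\<^bsub>S\<^esub> s \<ominus>\<^bsub>S\<^esub> dconst R c \<otimes>\<^bsub>S\<^esub> t \<in> Y" "dconst R c \<otimes>\<^bsub>S\<^esub> t \<in> Y" by auto
    then show ?case using S.lids_cancel(3)[OF Y(1), of "dconst R c \<otimes>\<^bsub>S\<^esub> t" "dconst R c \<otimes>\<^bsub>S\<^esub> s"] c su by simp
  qed
  have cZ: "dconst R c \<otimes>\<^bsub>S\<^esub> s \<in> Y" if s: "s \<in> Z" for s
  proof -
    obtain m where "s \<in> deg_less m" using deg_less_ex[OF Zu[OF s]] by blast
    then have "s \<in> deg_less (k + m)" using deg_less_mono[of m "k + m"] by simp
    then show ?thesis by (rule all[OF s])
  qed
  define I where "I = {r \<in> carrier R. \<forall>s\<in>Z. dconst R r \<otimes>\<^bsub>S\<^esub> s \<in> Y}"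
  have "I \<in> R.lids"
  proof (rule lidealsI)
    show "\<zero> \<in> I" using Zu lidealsD(2)[OF Y(1)] by (auto simp: I_def dconst_simps(3))
    show "a \<oplus> b \<in> I" if "a \<in> I" "b \<in> I" for a b
      using that Zu lidealsD(3)[OF Y(1)] by (auto simp: I_def dconst_simps(1) S.l_distr)
    show "a \<otimes> b \<in> I" if "a \<in> carrier R" "b \<in> I" for a b
      using that Zu lidealsD(4)[OF Y(1), of "dconst R a"] by (auto simp: I_def dconst_simps(2) dmult_assoc)
  qed (auto simp: I_def)
  moreover have "\<delta> r \<in> I" if r: "r \<in> I" for r
  proof -
    have rc: "r \<in> carrier R" and rs: "\<And>s. s \<in> Z \<Longrightarrow> dconst R r \<otimes>\<^bsub>S\<^esub> s \<in> Y" using r by (auto simp: I_def)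
    \<comment> \<open>\<delta>(r) s = \<theta> (r s) - r (\<theta> s), and both terms lie in Y
      because \<theta> s is again in Z.\<close>
    have "dconst R (\<delta> r) \<otimes>\<^bsub>S\<^esub> s \<in> Y" if s: "s \<in> Z" for s
    proof -
      have "dconst R r \<otimes>\<^bsub>S\<^esub> T s \<oplus>\<^bsub>S\<^esub> dconst R (\<delta> r) \<otimes>\<^bsub>S\<^esub> s \<in> Y"
        using S_lids_T[OF Y(1) rs[OF s]] T_const_mult[OF rc Zu[OF s]] by simp
      then show ?thesis
        by (rule S.lids_cancel(2)[OF Y(1) rs[OF S_lids_T[OF Z(1) s]], rotated]) (use rc Zu[OF s] in simp)
    qed
    then show ?thesis using rc by (simp add: I_def)
  qed
  ultimately have dI: "delta_ideal R \<delta> I" by (auto simp: delta_ideal_def lids_iff_ideal)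
  have "Q \<subseteq> I"
  proof
    fix r assume r: "r \<in> Q"
    have "dconst R r \<otimes>\<^bsub>S\<^esub> s \<in> W" if s: "s \<in> Z" for s
    proof -
      have "r \<in> carrier R" using r Q.a_subset by blast
      then show ?thesis using Zu[OF s] r Q.I_r_closed
        unfolding W_def coeffs_in_def mem_Collect_eq by (intro conjI allI dmult_closed) (auto simp: S_const_coeff)
    qed
    then show "r \<in> I" using r Q.a_subset Y(2) by (auto simp: I_def)
  qed
  moreover have "c \<in> I" using c cZ by (simp add: I_def)
  ultimately have "PIdl p \<subset> I" using cQ unfolding Q_def by blast
  then have "I = carrier R" by (rule delta_ideal_above_darboux[OF p dI])
  then have "\<one> \<in> I" by simp
  then have "\<forall>s\<in>Z. dconst R \<one> \<otimes>\<^bsub>S\<^esub> s \<in> Y" by (simp add: I_def)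
  moreover have "dconst R \<one> \<otimes>\<^bsub>S\<^esub> s = s" if "s \<in> Z" for s using Zu[OF that] by (simp add: dconst_simps(4))
  ultimately show ?thesis by auto
qed

lemma nat_seq_attains_sup:
  fixes f :: "nat \<Rightarrow> nat"
  assumes "\<And>i. f i \<le> b" shows "\<exists>j\<ge>i0. \<forall>i\<ge>i0. f i \<le> f j"
proof -
  have fin: "finite (f ` {i0..})" by (rule finite_subset[of _ "{..b}"]) (use assms in auto)
  then have "Max (f ` {i0..}) \<in> f ` {i0..}" by (intro Max_in) auto
  then obtain j where j: "j \<ge> i0" "Max (f ` {i0..}) = f j" by auto
  have "f i \<le> f j" if "i \<ge> i0" for i using Max_ge[OF fin, of "f i"] that j(2) by auto
  then show ?thesis using j(1) by blast
qed

text \<open>Two invariants stabilise along a descending chain: the ideals of leading coefficients,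
  which lie strictly above Q where R satisfies the descending chain condition, and the minimal
  degree modulo Q, which can only grow but is bounded by that of H. Together they determine the left
  ideal.\<close>

lemma dcc_above:
  assumes H: "H \<in> S.lids" "W \<subseteq> H" "\<not> H \<subseteq> W"
  shows "dcc_on (between S.lids H (carrier S))"
  unfolding dcc_on_def
proof (intro allI impI)
  fix C :: "nat \<Rightarrow> _" assume C: "\<forall>i. C i \<in> between S.lids H (carrier S) \<and> C (Suc i) \<subseteq> C i"
  have Cl: "C i \<in> S.lids" "H \<subseteq> C i" for i using C by (auto simp: between_mem)
  have W: "W \<subseteq> C i" "\<not> C i \<subseteq> W" for i using Cl(2)[of i] H by auto
  have Cm: "C j \<subseteq> C i" if "i \<le> j" for i j by (rule lift_Suc_antimono_le[of C]) (use C that in auto)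
  let ?J = "all_lead_coeffs H"
  have J: "ideal ?J R" using all_lead_coeffs_lids[OF H(1)] by (simp add: lids_iff_ideal)
  have "Q \<subseteq> ?J"
  proof
    fix q assume q: "q \<in> Q"
    then have qc: "q \<in> carrier R" using Q.a_subset by blast
    have "dconst R q \<in> W" unfolding W_def coeffs_in_def mem_Collect_eq
      using qc q Q.zero_closed by (simp, simp add: dconst_def)
    then have "q \<in> lead_coeffs 0 H" using qc H(2) deg_less_dconst[OF qc] dconst_coeff_0
      unfolding lead_coeffs_def by blast
    then show "q \<in> ?J" by (auto simp: all_lead_coeffs_def)
  qed
  moreover obtain g where g: "g \<in> H" "g \<in> deg_less (Suc (mindeg H))" "g (mindeg H) \<notin> Q" using mindeg_ex[OF H] by blast
  then have "g (mindeg H) \<in> ?J" using deg_less_up[OF g(2)] by (auto simp: all_lead_coeffs_def lead_coeffs_def)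
  ultimately have "PIdl p \<subset> ?J" using g(3) unfolding Q_def by blast
  then have dJ: "dcc_on (between R.lids ?J (carrier R))" by (rule dcc_above_darboux[OF p J])
  have mono: "all_lead_coeffs Y \<subseteq> all_lead_coeffs Z" if "Y \<subseteq> Z" for Y Z
    using that by (auto simp: all_lead_coeffs_def lead_coeffs_def)
  have "\<exists>n. \<forall>i\<ge>n. all_lead_coeffs (C i) = all_lead_coeffs (C n)"
  proof (rule dcc_onD[OF dJ])
    show "all_lead_coeffs (C i) \<in> between R.lids ?J (carrier R)" for i
      using all_lead_coeffs_lids[OF Cl(1)] mono[OF Cl(2)] lidealsD(1)[OF all_lead_coeffs_lids[OF Cl(1)]]
      by (simp add: between_mem)
    show "all_lead_coeffs (C (Suc i)) \<subseteq> all_lead_coeffs (C i)" for i using mono C by blast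
  qed
  then obtain i0 where i0: "\<forall>i\<ge>i0. all_lead_coeffs (C i) = all_lead_coeffs (C i0)" ..
  have "\<exists>n\<ge>i0. \<forall>i\<ge>i0. mindeg (C i) \<le> mindeg (C n)"
    by (rule nat_seq_attains_sup[of "\<lambda>i. mindeg (C i)"]) (rule mindeg_antimono[OF H Cl(2)])
  then obtain n where n: "n \<ge> i0" "\<forall>i\<ge>i0. mindeg (C i) \<le> mindeg (C n)" by (elim exE conjE)
  have "C i = C n" if i: "i \<ge> n" for i
  proof
    show "C i \<subseteq> C n" using Cm i .
    have i': "i \<ge> i0" using i n(1) by simp
    show "C n \<subseteq> C i"
    proof (rule eq_of_lead_coeffs[OF Cl(1) W Cl(1) Cm[OF i]])
      show "mindeg (C n) = mindeg (C i)"
        using mindeg_antimono[OF Cl(1) W Cm[OF i]] n(2)[rule_format, OF i'] by simp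
      show "all_lead_coeffs (C n) \<subseteq> all_lead_coeffs (C i)"
        using i0[rule_format, OF i'] i0[rule_format, OF n(1)] by simp
    qed
  qed
  then have "\<forall>i\<ge>n. C i = C n" by (intro allI impI)
  then show "\<exists>n. \<forall>i\<ge>n. C i = C n" ..
qed

text \<open>\<open>S/pS\<close> is a domain that is not a division ring, so it has no minimal left ideals.\<close>

lemma not_congruent_theta_multiple:
  assumes t: "t \<in> up R" "t \<notin> W" and s: "s \<in> up R" "t \<ominus>\<^bsub>S\<^esub> s \<otimes>\<^bsub>S\<^esub> T t \<in> W"
  shows False
proof -
  obtain m where m: "t m \<notin> Q" "\<forall>i>m. t i \<in> Q" using top_mod[OF pc(4) t(1)] t(2) unfolding W_def by blast
  \<comment> \<open>Moving \<theta> to the left factor shows the degree modulo Q: s \<theta> has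
    degree k + 1, so s \<theta> t has degree k + 1 + m, above the degree m of t.\<close>
  have e: "s \<otimes>\<^bsub>S\<^esub> T t = shift s \<otimes>\<^bsub>S\<^esub> t"
    using s(1) t(1) mult_theta[OF s(1)] dtheta_mult[OF t(1)] dmult_assoc[of s "dtheta R" t] by simp
  have "s \<notin> W"
  proof
    assume "s \<in> W"
    then have sT: "s \<otimes>\<^bsub>S\<^esub> T t \<in> W" using coeffs_in_right[OF pc(4)] t(1) unfolding W_def by simp
    have "t \<in> W" by (rule S.lids_cancel(3)[OF W_lids sT _ s(2)]) (use t in simp)
    then show False using t(2) by blast
  qed
  then obtain k where k: "s k \<notin> Q" "\<forall>i>k. s i \<in> Q" using top_mod[OF pc(4) s(1)] unfolding W_def by blast
  have sh: "shift s i \<in> Q" if "i > Suc k" for i using that k(2) by (cases i) auto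
  have "(shift s \<otimes>\<^bsub>S\<^esub> t) (Suc k + m) \<ominus> shift s (Suc k) \<otimes> t m \<in> Q"
    using mult_lead_mod(1)[OF pc(4) shift_up[OF s(1)] sh t(1)] m(2) by blast
  moreover have st: "(shift s \<otimes>\<^bsub>S\<^esub> t) (Suc k + m) \<in> Q"
  proof -
    have "(t \<ominus>\<^bsub>S\<^esub> shift s \<otimes>\<^bsub>S\<^esub> t) (Suc k + m) \<in> Q" using s(2) unfolding e W_def by (simp add: coeffs_in_def)
    then have d: "t (Suc k + m) \<ominus> (shift s \<otimes>\<^bsub>S\<^esub> t) (Suc k + m) \<in> Q" using s(1) t(1) by (simp add: S_minus_coeff)
    have tQ: "t (Suc k + m) \<in> Q" using m(2) by simp
    show ?thesis by (rule R.lids_cancel(4)[OF Q_lids tQ _ d]) (use s(1) t(1) in simp)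
  qed
  ultimately have "shift s (Suc k) \<otimes> t m \<in> Q" by (intro R.lids_cancel(4)[OF Q_lids st R.m_closed[OF up_closed[OF shift_up[OF s(1)]] up_closed[OF t(1)]]])
  then show False using Q.I_prime[of "s k" "t m"] k(1) m(1) s(1) t(1) by auto
qed

section \<open>Essential extensions of a simple module killed by a Darboux element\<close>

context
  fixes L N
  assumes L: "L \<in> S.lids" and N: "N \<in> S.lids" and LN: "L \<subset> N"
    and least: "\<And>Y. Y \<in> S.lids \<Longrightarrow> L \<subset> Y \<Longrightarrow> N \<subseteq> Y"
    and pN: "\<And>v. v \<in> N \<Longrightarrow> dconst R p \<otimes>\<^bsub>S\<^esub> v \<in> L"
begin

private definition "P i = dconst R (p [^] (i::nat))"
text \<open>The part of S/L that is killed by p^i; it is a submodule because p^i is normal.\<close>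

private definition "K i = {s \<in> up R. P i \<otimes>\<^bsub>S\<^esub> s \<in> L}"

lemma Lu: "s \<in> L \<Longrightarrow> s \<in> up R" using lidealsD(1)[OF L] by auto

lemma P_up: "P i \<in> up R" using pc by (simp add: P_def)

lemma P_Suc: "P (Suc i) = dconst R p \<otimes>\<^bsub>S\<^esub> P i" "P (Suc i) = P i \<otimes>\<^bsub>S\<^esub> dconst R p"
  using pc(1) by (simp_all add: P_def dconst_simps(2)[symmetric] R.m_comm)

lemma P_normal:
  assumes "t \<in> up R"
  shows "\<exists>t'\<in>up R. P i \<otimes>\<^bsub>S\<^esub> t = t' \<otimes>\<^bsub>S\<^esub> P i" "\<exists>t'\<in>up R. t \<otimes>\<^bsub>S\<^esub> P i = P i \<otimes>\<^bsub>S\<^esub> t'"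
  unfolding P_def using normal_element[OF _ deriv_power_dvd[OF pc(1) deriv_p] assms] pc(1) by auto

lemma K_lids: "K i \<in> S.lids"
proof (rule lidealsI)
  fix t s assume t: "t \<in> carrier S" and s: "s \<in> K i"
  then have su: "s \<in> up R" "t \<in> up R" by (auto simp: K_def)
  obtain t' where t': "t' \<in> up R" "P i \<otimes>\<^bsub>S\<^esub> t = t' \<otimes>\<^bsub>S\<^esub> P i" using P_normal(1)[OF su(2)] by blast
  have "P i \<otimes>\<^bsub>S\<^esub> (t \<otimes>\<^bsub>S\<^esub> s) = t' \<otimes>\<^bsub>S\<^esub> (P i \<otimes>\<^bsub>S\<^esub> s)"
    using su t' P_up by (simp add: dmult_assoc[symmetric])
  then show "t \<otimes>\<^bsub>S\<^esub> s \<in> K i" using lidealsD(4)[OF L] s t' su by (simp add: K_def)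
next
  show "\<zero>\<^bsub>S\<^esub> \<in> K i" using lidealsD(2)[OF L] P_up by (simp add: K_def)
  show "x \<oplus>\<^bsub>S\<^esub> y \<in> K i" if "x \<in> K i" "y \<in> K i" for x y
    using that lidealsD(3)[OF L] P_up by (simp add: K_def S.r_distr)
qed (auto simp: K_def)

lemma K_0: "K 0 = L"
  using Lu pc(1) by (auto simp: K_def P_def dconst_simps(4))

lemma K_Suc: "K i \<subseteq> K (Suc i)"
proof
  fix s assume "s \<in> K i"
  then have s: "s \<in> up R" "P i \<otimes>\<^bsub>S\<^esub> s \<in> L" by (auto simp: K_def)
  have "dconst R p \<otimes>\<^bsub>S\<^esub> (P i \<otimes>\<^bsub>S\<^esub> s) \<in> L" using lidealsD(4)[OF L _ s(2)] pc(1) by simp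
  then have "P (Suc i) \<otimes>\<^bsub>S\<^esub> s \<in> L" unfolding P_Suc(1) using pc(1) s(1) P_up by (simp add: dmult_assoc)
  then show "s \<in> K (Suc i)" using s(1) by (simp add: K_def)
qed

text \<open>Let the K i be constant from n on. If p^n did not kill S/L, the submodule generated by
  the class of p^n would contain N/L, so some u in N outside L is p^n y modulo L. As p kills u, y is
  killed by p^(n+1), hence by p^n, and u lies in L after all.\<close>

lemma K_exhaust: "\<exists>n. K n = carrier S"
proof -
  have "\<exists>n. \<forall>i\<ge>n. K i = K n" by (rule acc_onD[where C = K, OF S_acc K_lids K_Suc])
  then obtain n where n: "\<forall>i\<ge>n. K i = K n" ..
  have "P n \<otimes>\<^bsub>S\<^esub> s \<in> L" if s: "s \<in> up R" for s
  proof (rule ccontr)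
    assume not: "P n \<otimes>\<^bsub>S\<^esub> s \<notin> L"
    obtain s' where s': "s' \<in> up R" "P n \<otimes>\<^bsub>S\<^esub> s = s' \<otimes>\<^bsub>S\<^esub> P n" using P_normal(1)[OF s] by blast
    have pr: "S.lprinc (P n) \<in> S.lids" using S.lids_lprinc P_up by simp
    have "s' \<otimes>\<^bsub>S\<^esub> P n \<in> S.lprinc (P n)" using s' by (auto simp: S.lprinc_def)
    then have "L \<subset> S.lsum L (S.lprinc (P n))" using S.lsum_upper[OF L pr] not s'(2) by auto
    then have sub: "N \<subseteq> S.lsum L (S.lprinc (P n))" by (rule least[OF S.lids_lsum[OF L pr]])
    obtain u where u: "u \<in> N" "u \<notin> L" using LN by blast
    then have "u \<in> S.lsum L (S.lprinc (P n))" using sub by blast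
    then obtain l t where lt: "l \<in> L" "t \<in> carrier S" "u = l \<oplus>\<^bsub>S\<^esub> t \<otimes>\<^bsub>S\<^esub> P n" by (rule S.lsum_lprincE)
    have "t \<in> up R" using lt(2) by simp
    then obtain y where y: "y \<in> up R" "t \<otimes>\<^bsub>S\<^esub> P n = P n \<otimes>\<^bsub>S\<^esub> y" using P_normal(2) by meson
    have pu: "dconst R p \<in> up R" using pc by simp
    have "dconst R p \<otimes>\<^bsub>S\<^esub> l \<oplus>\<^bsub>S\<^esub> P (Suc n) \<otimes>\<^bsub>S\<^esub> y = dconst R p \<otimes>\<^bsub>S\<^esub> u"
      unfolding lt(3) y(2) P_Suc(1) using Lu[OF lt(1)] y(1) pu P_up[of n] by (simp add: S.r_distr dmult_assoc)
    moreover have "dconst R p \<otimes>\<^bsub>S\<^esub> l \<in> L" using lidealsD(4)[OF L] lt(1) pu by simp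
    ultimately have "P (Suc n) \<otimes>\<^bsub>S\<^esub> y \<in> L"
      using S.lids_cancel(2)[OF L, of "dconst R p \<otimes>\<^bsub>S\<^esub> l" "P (Suc n) \<otimes>\<^bsub>S\<^esub> y"] pN[OF u(1)] y(1) P_up by simp
    then have "y \<in> K (Suc n)" using y(1) by (simp add: K_def)
    then have "y \<in> K n" using n[rule_format, of "Suc n"] by simp
    then have "P n \<otimes>\<^bsub>S\<^esub> y \<in> L" by (simp add: K_def)
    then show False using u(2) lt(1,3) lidealsD(3)[OF L] y(2) by simp
  qed
  then have "K n = carrier S" by (auto simp: K_def)
  then show ?thesis ..
qed

lemma W_sub_colon:
  assumes x: "x \<in> K (Suc 0)" shows "W \<subseteq> S.colon L x"
proof
  fix w assume w: "w \<in> W"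
  have xu: "x \<in> up R" "dconst R p \<otimes>\<^bsub>S\<^esub> x \<in> L" using x pc(1) by (auto simp: K_def P_def)
  have pu: "dconst R p \<in> up R" using pc by simp
  obtain t where t: "t \<in> up R" "w = dconst R p \<otimes>\<^bsub>S\<^esub> t" using coeffs_in_principal[OF pc(1)] w unfolding W_def Q_def by blast
  obtain t' where t': "t' \<in> up R" "w = t' \<otimes>\<^bsub>S\<^esub> dconst R p" using normal_element(1)[OF pc(1) deriv_p t(1)] t(2) by metis
  then have "w \<otimes>\<^bsub>S\<^esub> x = t' \<otimes>\<^bsub>S\<^esub> (dconst R p \<otimes>\<^bsub>S\<^esub> x)" using xu(1) pu by (simp add: dmult_assoc)
  then have "w \<otimes>\<^bsub>S\<^esub> x \<in> L" using lidealsD(4)[OF L] xu(2) t'(1) by simp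
  then show "w \<in> S.colon L x" using t pu by (simp add: S.colon_def)
qed

text \<open>Otherwise S x would be a copy of S/W with a least nonzero submodule. A nonzero element t
  x of it and its multiple \<theta> t x would then generate the same submodule, so t would be
  congruent to s \<theta> t modulo W.\<close>

lemma colon_not_W:
  assumes x: "x \<in> K (Suc 0)" "x \<notin> L" shows "\<not> S.colon L x \<subseteq> W"
proof
  assume sub: "S.colon L x \<subseteq> W"
  have xu: "x \<in> up R" using x by (auto simp: K_def)
  have gen: "N \<subseteq> S.lsum L (S.lprinc y)" if "y \<in> up R" "y \<notin> L" for y
  proof (rule least)
    have pr: "S.lprinc y \<in> S.lids" "y \<in> S.lprinc y" using S.lids_lprinc that by auto
    show "S.lsum L (S.lprinc y) \<in> S.lids" by (rule S.lids_lsum[OF L pr(1)])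
    show "L \<subset> S.lsum L (S.lprinc y)" using S.lsum_upper[OF L pr(1)] pr(2) that(2) by auto
  qed
  obtain u where u: "u \<in> N" "u \<notin> L" using LN by blast
  have "u \<in> S.lsum L (S.lprinc x)" using gen[OF xu x(2)] u(1) by blast
  then obtain l t where lt: "l \<in> L" "t \<in> carrier S" "u = l \<oplus>\<^bsub>S\<^esub> t \<otimes>\<^bsub>S\<^esub> x" by (rule S.lsum_lprincE)
  have tu: "t \<in> up R" using lt by simp
  have "t \<notin> W"
  proof
    assume "t \<in> W"
    then have "t \<otimes>\<^bsub>S\<^esub> x \<in> L" using W_sub_colon[OF x(1)] by (auto simp: S.colon_def)
    then show False using u(2) lt lidealsD(3)[OF L] by simp
  qed
  \<comment> \<open>If t has degree m modulo Q, then \<theta> t has t_m as its coefficient in degree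
    m + 1, up to \<delta> of a coefficient in Q.\<close>
  have "T t \<notin> W"
  proof
    assume w: "T t \<in> W"
    obtain m where m: "t m \<notin> Q" "\<forall>i>m. t i \<in> Q" using top_mod[OF pc(4) tu] \<open>t \<notin> W\<close> unfolding W_def by blast
    have "\<delta> (t (Suc m)) \<in> Q" using m(2) pc(4) by (auto simp: delta_ideal_def)
    moreover have "T t (Suc m) \<in> Q" using w unfolding W_def coeffs_in_def by blast
    then have "t m \<oplus> \<delta> (t (Suc m)) \<in> Q" unfolding T_coeff(2) .
    ultimately show False using m(1) R.lids_cancel(1)[OF Q_lids, of "\<delta> (t (Suc m))" "t m"] tu by simp
  qed
  then have "T t \<notin> S.colon L x" using sub by blast
  then have Tx: "T t \<otimes>\<^bsub>S\<^esub> x \<notin> L" using tu by (simp add: S.colon_def)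
  have "u \<in> S.lsum L (S.lprinc (T t \<otimes>\<^bsub>S\<^esub> x))" using gen[OF _ Tx] u(1) tu xu by auto
  then obtain l' s where ls: "l' \<in> L" "s \<in> carrier S" "u = l' \<oplus>\<^bsub>S\<^esub> s \<otimes>\<^bsub>S\<^esub> (T t \<otimes>\<^bsub>S\<^esub> x)" by (rule S.lsum_lprincE)
  have su: "s \<in> up R" using ls by simp
  define v where "v = s \<otimes>\<^bsub>S\<^esub> T t"
  have vu: "v \<in> up R" using su tu by (simp add: v_def)
  have e: "l \<oplus>\<^bsub>S\<^esub> t \<otimes>\<^bsub>S\<^esub> x = l' \<oplus>\<^bsub>S\<^esub> v \<otimes>\<^bsub>S\<^esub> x" using lt(3) ls(3) su tu xu by (simp add: v_def dmult_assoc)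
  have "(t \<ominus>\<^bsub>S\<^esub> v) \<otimes>\<^bsub>S\<^esub> x = l' \<ominus>\<^bsub>S\<^esub> l"
  proof -
    define a b where "a = t \<otimes>\<^bsub>S\<^esub> x" and "b = v \<otimes>\<^bsub>S\<^esub> x"
    have c: "a \<in> carrier S" "b \<in> carrier S" "l \<in> carrier S" "l' \<in> carrier S"
      using tu vu xu Lu lt ls by (auto simp: a_def b_def)
    have "(t \<ominus>\<^bsub>S\<^esub> v) \<otimes>\<^bsub>S\<^esub> x = a \<ominus>\<^bsub>S\<^esub> b" using tu vu xu by (simp add: a_def b_def S.minus_eq S.l_distr S.l_minus)
    also have "\<dots> = l' \<ominus>\<^bsub>S\<^esub> l" by (rule S.minus_eq_of_sums[OF c]) (use e in \<open>simp add: a_def b_def\<close>)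
    finally show ?thesis .
  qed
  then have "(t \<ominus>\<^bsub>S\<^esub> v) \<otimes>\<^bsub>S\<^esub> x \<in> L" using S.lids_minus[OF L ls(1) lt(1)] by simp
  then have "t \<ominus>\<^bsub>S\<^esub> v \<in> W" using sub tu vu by (auto simp: S.colon_def)
  then show False using not_congruent_theta_multiple[OF tu \<open>t \<notin> W\<close> su] unfolding v_def by blast
qed

lemma dcc_K_1: "dcc_on (between S.lids L (K (Suc 0)))"
proof (rule S.dcc_between_of_colon[OF S_acc L K_lids])
  show "L \<subseteq> K (Suc 0)" using K_Suc[of 0] K_0 by simp
  fix x assume x: "x \<in> K (Suc 0)"
  then have xc: "x \<in> carrier S" by (simp add: K_def)
  show "dcc_on (between S.lids (S.colon L x) (carrier S))"
  proof (cases "x \<in> L")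
    case True
    then have eq: "S.colon L x = carrier S" using lidealsD(4)[OF L] by (auto simp: S.colon_def)
    have "\<exists>n. \<forall>i\<ge>n. C i = C n"
      if C: "\<forall>i. C i \<in> between S.lids (carrier S) (carrier S) \<and> C (Suc i) \<subseteq> C i" for C :: "nat \<Rightarrow> _"
    proof -
      have "C i = carrier S" for i using spec[OF C, of i] by (auto simp: between_mem)
      then show ?thesis by simp
    qed
    then show ?thesis unfolding eq dcc_on_def by blast
  next
    case False
    show ?thesis by (rule dcc_above[OF S.lids_colon[OF L xc] W_sub_colon[OF x] colon_not_W[OF x False]])
  qed
qed

text \<open>Multiplication by p^i maps the layer K(i+1)/K(i) injectively into K(1)/L. It is not
  S-linear, but since p^i is normal it still carries left ideals to left ideals.\<close>

lemma dcc_K_step: "dcc_on (between S.lids (K i) (K (Suc i)))"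
proof (rule dcc_on_embed[OF dcc_K_1, of _ "\<lambda>Y. S.lsum L ((\<otimes>\<^bsub>S\<^esub>) (P i) ` Y)"])
  let ?f = "\<lambda>Y. S.lsum L ((\<otimes>\<^bsub>S\<^esub>) (P i) ` Y)"
  fix Y assume "Y \<in> between S.lids (K i) (K (Suc i))"
  then have Y: "Y \<in> S.lids" "K i \<subseteq> Y" "Y \<subseteq> K (Suc i)" by (auto simp: between_mem)
  have Yu: "y \<in> up R" if "y \<in> Y" for y using that lidealsD(1)[OF Y(1)] by auto
  have im: "(\<otimes>\<^bsub>S\<^esub>) (P i) ` Y \<in> S.lids"
  proof (rule lidealsI)
    show "(\<otimes>\<^bsub>S\<^esub>) (P i) ` Y \<subseteq> carrier S" using Yu P_up by auto
    have "P i \<otimes>\<^bsub>S\<^esub> \<zero>\<^bsub>S\<^esub> = \<zero>\<^bsub>S\<^esub>" using P_up by simp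
    then show "\<zero>\<^bsub>S\<^esub> \<in> (\<otimes>\<^bsub>S\<^esub>) (P i) ` Y" using lidealsD(2)[OF Y(1)] by (metis image_eqI)
  next
    fix u v assume "u \<in> (\<otimes>\<^bsub>S\<^esub>) (P i) ` Y" "v \<in> (\<otimes>\<^bsub>S\<^esub>) (P i) ` Y"
    then obtain y z where *: "y \<in> Y" "z \<in> Y" "u = P i \<otimes>\<^bsub>S\<^esub> y" "v = P i \<otimes>\<^bsub>S\<^esub> z" by blast
    then have "u \<oplus>\<^bsub>S\<^esub> v = P i \<otimes>\<^bsub>S\<^esub> (y \<oplus>\<^bsub>S\<^esub> z)" using Yu P_up by (simp add: S.r_distr)
    then show "u \<oplus>\<^bsub>S\<^esub> v \<in> (\<otimes>\<^bsub>S\<^esub>) (P i) ` Y" using lidealsD(3)[OF Y(1) *(1,2)] by blast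
  next
    fix t u assume t: "t \<in> carrier S" and "u \<in> (\<otimes>\<^bsub>S\<^esub>) (P i) ` Y"
    then obtain y where y: "y \<in> Y" "u = P i \<otimes>\<^bsub>S\<^esub> y" by blast
    have "t \<in> up R" using t by simp
    then obtain t' where t': "t' \<in> up R" "t \<otimes>\<^bsub>S\<^esub> P i = P i \<otimes>\<^bsub>S\<^esub> t'" using P_normal(2) by meson
    have "t \<otimes>\<^bsub>S\<^esub> u = P i \<otimes>\<^bsub>S\<^esub> (t' \<otimes>\<^bsub>S\<^esub> y)" unfolding y(2) using t t' Yu[OF y(1)] P_up
      by (simp add: dmult_assoc[symmetric])
    then show "t \<otimes>\<^bsub>S\<^esub> u \<in> (\<otimes>\<^bsub>S\<^esub>) (P i) ` Y" using lidealsD(4)[OF Y(1) _ y(1), of t'] t'(1) by auto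
  qed
  have "(\<otimes>\<^bsub>S\<^esub>) (P i) ` Y \<subseteq> K (Suc 0)"
  proof
    fix u assume "u \<in> (\<otimes>\<^bsub>S\<^esub>) (P i) ` Y"
    then obtain y where y: "y \<in> Y" "u = P i \<otimes>\<^bsub>S\<^esub> y" by blast
    have "P (Suc i) \<otimes>\<^bsub>S\<^esub> y \<in> L" using Y(3) y(1) by (auto simp: K_def)
    moreover have "P (Suc i) \<otimes>\<^bsub>S\<^esub> y = P (Suc 0) \<otimes>\<^bsub>S\<^esub> u"
      unfolding y(2) P_Suc(1)[of i] using pc(1) Yu[OF y(1)] P_up[of i] by (simp add: P_def[of "Suc 0"] dmult_assoc)
    ultimately show "u \<in> K (Suc 0)" using y Yu[OF y(1)] P_up by (simp add: K_def)
  qed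
  then show "?f Y \<in> between S.lids L (K (Suc 0))"
    using S.lids_lsum[OF L im] S.lsum_upper[OF L im] S.lsum_least[OF K_lids] K_Suc[of 0] K_0 by (simp add: between_mem)
next
  fix Y Z assume "Y \<in> between S.lids (K i) (K (Suc i))" "Z \<in> between S.lids (K i) (K (Suc i))" and YZ: "Y \<subseteq> Z"
  then have Y: "Y \<in> S.lids" "K i \<subseteq> Y" and Z: "Z \<in> S.lids" by (auto simp: between_mem)
  show "S.lsum L ((\<otimes>\<^bsub>S\<^esub>) (P i) ` Y) \<subseteq> S.lsum L ((\<otimes>\<^bsub>S\<^esub>) (P i) ` Z)"
    by (rule S.lsum_mono) (use YZ in auto)
  assume eq: "S.lsum L ((\<otimes>\<^bsub>S\<^esub>) (P i) ` Y) = S.lsum L ((\<otimes>\<^bsub>S\<^esub>) (P i) ` Z)"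
  show "Z \<subseteq> Y"
  proof
    fix z assume z: "z \<in> Z"
    have zu: "z \<in> up R" using z lidealsD(1)[OF Z] by auto
    have "P i \<otimes>\<^bsub>S\<^esub> z = \<zero>\<^bsub>S\<^esub> \<oplus>\<^bsub>S\<^esub> P i \<otimes>\<^bsub>S\<^esub> z" using zu P_up by simp
    then have "P i \<otimes>\<^bsub>S\<^esub> z \<in> S.lsum L ((\<otimes>\<^bsub>S\<^esub>) (P i) ` Z)" using lidealsD(2)[OF L] z unfolding S.lsum_def by blast
    then obtain l y where ly: "l \<in> L" "y \<in> Y" "P i \<otimes>\<^bsub>S\<^esub> z = l \<oplus>\<^bsub>S\<^esub> P i \<otimes>\<^bsub>S\<^esub> y"
      unfolding eq[symmetric] by (auto simp: S.lsum_def)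
    have yu: "y \<in> up R" using ly lidealsD(1)[OF Y(1)] by auto
    have "P i \<otimes>\<^bsub>S\<^esub> (z \<ominus>\<^bsub>S\<^esub> y) = P i \<otimes>\<^bsub>S\<^esub> z \<ominus>\<^bsub>S\<^esub> P i \<otimes>\<^bsub>S\<^esub> y" using zu yu P_up by (simp add: S.minus_eq S.r_distr S.r_minus)
    also have "\<dots> = l" unfolding ly(3) using Lu[OF ly(1)] yu P_up by (simp add: S.minus_eq S.a_assoc S.r_neg)
    finally have "z \<ominus>\<^bsub>S\<^esub> y \<in> K i" using ly(1) zu yu by (simp add: K_def)
    then have "z \<ominus>\<^bsub>S\<^esub> y \<in> Y" using Y(2) by blast
    then show "z \<in> Y" by (rule S.lids_cancel(3)[OF Y(1) ly(2), rotated]) (use zu in simp)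
  qed
qed

lemma dcc_above_essential: "dcc_on (between S.lids L (carrier S))"
proof -
  have "dcc_on (between S.lids L (K n)) \<and> L \<subseteq> K n" for n
  proof (induction n)
    case 0
    show ?case using dcc_on_mono[OF dcc_K_1, of "between S.lids L (K 0)"] K_Suc[of 0] K_0 by (auto simp: between_def)
  next
    case (Suc n)
    then show ?case using S.dcc_between_trans[OF L K_lids K_lids _ K_Suc _ dcc_K_step] K_Suc[of n] by blast
  qed
  then show ?thesis using K_exhaust by metis
qed

end

end

text \<open>N/L is generated by the class of any u outside L, so it is isomorphic to S modulo the
  maximal left ideal \<open>S.colon L u\<close>; the Darboux element annihilating that simple module
  kills N/L.\<close>

lemma not_delta_primitive_imp_diamond:
  assumes nd: "\<not> delta_primitive R \<delta>" shows "S.diamond_lids"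
  unfolding S.diamond_lids_def
proof (intro ballI impI, elim conjE)
  fix L N assume L: "L \<in> S.lids" and N: "N \<in> S.lids" and LN: "L \<subset> N"
    and "\<forall>Y\<in>S.lids. L \<subset> Y \<longrightarrow> N \<subseteq> Y"
  then have least: "\<And>Y. Y \<in> S.lids \<Longrightarrow> L \<subset> Y \<Longrightarrow> N \<subseteq> Y" by blast
  obtain u where u: "u \<in> N" "u \<notin> L" using LN by blast
  have uc: "u \<in> carrier S" using u lidealsD(1)[OF N] by auto
  have gen: "N \<subseteq> S.lsum L (S.lprinc y)" if "y \<in> carrier S" "y \<notin> L" for y
  proof (rule least)
    have pr: "S.lprinc y \<in> S.lids" "y \<in> S.lprinc y" using S.lids_lprinc that by blast+
    show "S.lsum L (S.lprinc y) \<in> S.lids" by (rule S.lids_lsum[OF L pr(1)])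
    show "L \<subset> S.lsum L (S.lprinc y)" using S.lsum_upper[OF L pr(1)] pr(2) that(2) by auto
  qed
  have "S.max_lideal (S.colon L u)"
  proof (rule S.max_lideal_colon[OF L uc u(2)])
    fix x assume "x \<in> carrier S" "x \<otimes>\<^bsub>S\<^esub> u \<notin> L"
    then show "u \<in> S.lsum L (S.lprinc (x \<otimes>\<^bsub>S\<^esub> u))" using gen[of "x \<otimes>\<^bsub>S\<^esub> u"] u(1) S.m_closed[OF _ uc] by blast
  qed
  then obtain p where p: "darboux p" "dconst R p \<in> S.bound (S.colon L u)"
    using annihilated_by_darboux nd unfolding delta_primitive_iff by metis
  have pu: "dconst R p \<in> up R" using p by (simp add: darboux_def)
  have pN: "dconst R p \<otimes>\<^bsub>S\<^esub> v \<in> L" if v: "v \<in> N" for v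
  proof -
    have "v \<in> S.lsum L (S.lprinc u)" using gen[OF uc u(2)] v by blast
    then obtain l t where lt: "l \<in> L" "t \<in> carrier S" "v = l \<oplus>\<^bsub>S\<^esub> t \<otimes>\<^bsub>S\<^esub> u" by (rule S.lsum_lprincE)
    have "dconst R p \<otimes>\<^bsub>S\<^esub> t \<in> S.colon L u" using p(2) lt(2) by (simp add: S.bound_def)
    then have "dconst R p \<otimes>\<^bsub>S\<^esub> (t \<otimes>\<^bsub>S\<^esub> u) \<in> L" using lt(2) uc pu by (simp add: S.colon_def dmult_assoc)
    moreover have "dconst R p \<otimes>\<^bsub>S\<^esub> l \<in> L" using lidealsD(4)[OF L] lt(1) pu by simp
    moreover have "l \<in> up R" using lt(1) lidealsD(1)[OF L] by auto
    ultimately show ?thesis unfolding lt(3) using lidealsD(3)[OF L] lt(2) uc pu by (simp add: S.r_distr)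
  qed
  show "dcc_on (between S.lids L (carrier S))" by (rule dcc_above_essential[OF p(1) L N LN least pN])
qed

end

section \<open>Failure of the diamond property in the primitive case\<close>

context derivation
begin

text \<open>In m s = s m + [m, s] the first term lies in S I and the commutator has lower degree, so
  each factor m gains one degree. Consequently S/SI is torsion over R as soon as I contains an
  element that is not nilpotent.\<close>

lemma power_into_left_span:
  assumes I: "ideal I R" and m: "m \<in> I"
  shows "s \<in> deg_less n \<Longrightarrow> dconst R (m [^] n) \<otimes>\<^bsub>S\<^esub> s \<in> left_span I"
proof (induction n arbitrary: s)
  interpret I: ideal I R by (rule I)
  case 0
  then have "s = \<zero>\<^bsub>S\<^esub>" by simp
  then show ?case using left_span.zero by simp
next
  interpret I: ideal I R by (rule I)
  case (Suc n)
  have mc: "m \<in> carrier R" "m [^] n \<in> carrier R" using m I.a_subset by auto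
  have su: "s \<in> up R" using deg_less_up[OF Suc.prems] .
  have cu: "commutator m s \<in> up R" using su mc by (simp add: commutator_def)
  have e: "commutator m s \<oplus>\<^bsub>S\<^esub> s \<otimes>\<^bsub>S\<^esub> dconst R m = dconst R m \<otimes>\<^bsub>S\<^esub> s"
    using su mc by (simp add: commutator_def S.minus_eq S.a_assoc S.l_neg)
  have "dconst R (m [^] Suc n) \<otimes>\<^bsub>S\<^esub> s = dconst R (m [^] n) \<otimes>\<^bsub>S\<^esub> (dconst R m \<otimes>\<^bsub>S\<^esub> s)"
    using su mc by (simp add: dconst_simps(2) dmult_assoc)
  also have "\<dots> = dconst R (m [^] n) \<otimes>\<^bsub>S\<^esub> commutator m s \<oplus>\<^bsub>S\<^esub> dconst R (m [^] n) \<otimes>\<^bsub>S\<^esub> (s \<otimes>\<^bsub>S\<^esub> dconst R m)"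
    unfolding e[symmetric] using cu su mc by (simp add: S.r_distr)
  finally have "dconst R (m [^] Suc n) \<otimes>\<^bsub>S\<^esub> s =
    dconst R (m [^] n) \<otimes>\<^bsub>S\<^esub> commutator m s \<oplus>\<^bsub>S\<^esub> dconst R (m [^] n) \<otimes>\<^bsub>S\<^esub> (s \<otimes>\<^bsub>S\<^esub> dconst R m)" .
  moreover have "dconst R (m [^] n) \<otimes>\<^bsub>S\<^esub> commutator m s \<in> left_span I"
    by (rule Suc.IH[OF commutator_deg[OF Suc.prems mc(1)]])
  moreover have "dconst R (m [^] n) \<otimes>\<^bsub>S\<^esub> (s \<otimes>\<^bsub>S\<^esub> dconst R m) \<in> left_span I"
    using lidealsD(4)[OF left_span_lids[OF I] _ left_span_right_const[OF I su m]] mc by simp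
  ultimately show ?case using left_span_add[OF I] by simp
qed

text \<open>Taking the constant term is the projection of S onto S/S\<theta>, which is R with
  \<theta> acting as \<delta>; preimages of \<delta>-ideals are left ideals.\<close>

lemma constant_term_lids:
  assumes I: "delta_ideal R \<delta> I" shows "{s \<in> up R. s 0 \<in> I} \<in> S.lids"
proof (rule lidealsI)
  interpret I: ideal I R using I by (simp add: delta_ideal_def)
  show "\<zero>\<^bsub>S\<^esub> \<in> {s \<in> up R. s 0 \<in> I}" using I.zero_closed S_zero_coeff[of 0] S_zero_closed by simp
  show "x \<oplus>\<^bsub>S\<^esub> y \<in> {s \<in> up R. s 0 \<in> I}" if "x \<in> {s \<in> up R. s 0 \<in> I}" "y \<in> {s \<in> up R. s 0 \<in> I}" for x y
    using that I.a_closed S_add_coeff[of x y 0] S_add_closed[of x y] by simp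
  fix t s assume "t \<in> carrier S" and s: "s \<in> {s \<in> up R. s 0 \<in> I}"
  then have "t \<in> up R" "s \<in> up R" "s 0 \<in> I" by auto
  then have "(t \<otimes>\<^bsub>S\<^esub> s) 0 \<in> I"
  proof (induction t rule: up_induct)
    case (const a)
    then show ?case using I.I_l_closed by (simp add: S_const_coeff)
  next
    case (add p q)
    then show ?case using I.a_closed by (simp add: dmult_add_left)
  next
    case (theta p)
    then show ?case using I by (auto simp: dmult_T T_coeff delta_ideal_def)
  qed
  then show "t \<otimes>\<^bsub>S\<^esub> s \<in> {s \<in> up R. s 0 \<in> I}" using \<open>t \<in> up R\<close> \<open>s \<in> up R\<close> by simp
qed auto

end

context ring
begin

lemma diamond_lidsD:
  assumes "diamond_lids" "L \<in> lids" "N \<in> lids" "L \<subset> N" "\<And>Y. Y \<in> lids \<Longrightarrow> L \<subset> Y \<Longrightarrow> N \<subseteq> Y"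
  shows "dcc_on (between lids L (carrier R))"
  using assms(1)[unfolded diamond_lids_def, rule_format, OF assms(2,3)] assms(4,5) by simp

lemma lids_image_right:
  assumes L: "L \<in> lids" and w: "w \<in> carrier R" shows "(\<lambda>s. s \<otimes> w) ` L \<in> lids"
proof (rule lidealsI)
  have c: "s \<in> L \<Longrightarrow> s \<in> carrier R" for s using lidealsD(1)[OF L] by blast
  show "(\<lambda>s. s \<otimes> w) ` L \<subseteq> carrier R" using c w by auto
  show "\<zero> \<in> (\<lambda>s. s \<otimes> w) ` L" using lidealsD(2)[OF L] w by (auto intro!: image_eqI[of _ _ \<zero>])
next
  have c: "s \<in> L \<Longrightarrow> s \<in> carrier R" for s using lidealsD(1)[OF L] by blast
  fix x y assume "x \<in> (\<lambda>s. s \<otimes> w) ` L" "y \<in> (\<lambda>s. s \<otimes> w) ` L"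
  then obtain s t where *: "s \<in> L" "t \<in> L" "x = s \<otimes> w" "y = t \<otimes> w" by blast
  then show "x \<oplus> y \<in> (\<lambda>s. s \<otimes> w) ` L"
    using lidealsD(3)[OF L *(1,2)] c w by (intro image_eqI[of _ _ "s \<oplus> t"]) (auto simp: l_distr)
next
  have c: "s \<in> L \<Longrightarrow> s \<in> carrier R" for s using lidealsD(1)[OF L] by blast
  fix b x assume b: "b \<in> carrier R" and "x \<in> (\<lambda>s. s \<otimes> w) ` L"
  then obtain s where *: "s \<in> L" "x = s \<otimes> w" by blast
  then show "b \<otimes> x \<in> (\<lambda>s. s \<otimes> w) ` L"
    using lidealsD(4)[OF L b *(1)] c w b by (intro image_eqI[of _ _ "b \<otimes> s"]) (auto simp: m_assoc)
qed

lemma not_dcc_between: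
  assumes "\<And>i::nat. C i \<in> lids" "\<And>i. L \<subseteq> C i" "\<And>i. C (Suc i) \<subset> C i"
  shows "\<not> dcc_on (between lids L (carrier R))"
proof
  assume d: "dcc_on (between lids L (carrier R))"
  have "\<exists>n. \<forall>i\<ge>n. C i = C n"
  proof (rule dcc_onD[OF d])
    show "C i \<in> between lids L (carrier R)" for i using assms(1,2) lidealsD(1)[OF assms(1)] by (simp add: between_mem)
    show "C (Suc i) \<subseteq> C i" for i using assms(3) by blast
  qed
  then obtain n where "\<forall>i\<ge>n. C i = C n" ..
  then have "C (Suc n) = C n" by (rule allE[of _ "Suc n"]) simp
  then show False using assms(3)[of n] by simp
qed

end

context diff_surface
begin

definition theta_span :: "'r set \<Rightarrow> (nat \<Rightarrow> 'r) set" where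
  "theta_span M = (\<lambda>s. s \<otimes>\<^bsub>S\<^esub> dtheta R) ` left_span M"

text \<open>The submodule \<open>S \<theta> / S M \<theta>\<close> of \<open>S / S M \<theta>\<close> is simple; it is essential because the constants
  in a larger left ideal \<open>Y\<close> can be differentiated until one of them, \<open>c\<close>, leaves \<open>M\<close>, and then
  \<open>c (\<theta> c) - \<delta>(c) c = c\<^sup>2 \<theta>\<close> lies in \<open>Y\<close>.\<close>

context
  fixes M assumes M: "maximalideal M R" and core: "dcore M = {\<zero>}"
begin

interpretation M: maximalideal M R by (rule M)

lemma theta_span_lids: "theta_span M \<in> S.lids"
  unfolding theta_span_def by (rule S.lids_image_right[OF left_span_lids[OF M.is_ideal]]) simp

text \<open>The left ideal \<open>S.colon Y (dtheta R)\<close> contains the maximal left ideal S M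
  and also \<open>s\<close>, which is not in it, so it contains 1.\<close>

lemma theta_mem_of_multiple:
  assumes Y: "Y \<in> S.lids" "theta_span M \<subseteq> Y" and s: "s \<in> up R" "s \<notin> left_span M" "s \<otimes>\<^bsub>S\<^esub> dtheta R \<in> Y"
  shows "dtheta R \<in> Y"
proof -
  let ?C = "S.colon Y (dtheta R)"
  have C: "?C \<in> S.lids" using S.lids_colon[OF Y(1)] by simp
  have "left_span M \<subseteq> ?C" using Y(2) left_span_up[OF M.is_ideal] by (auto simp: S.colon_def theta_span_def)
  moreover have "s \<in> ?C" using s by (simp add: S.colon_def)
  ultimately have "?C = carrier S" using left_span_max_lideal[OF M] C s(2) unfolding S.max_lideal_def by blast
  then have "\<one>\<^bsub>S\<^esub> \<in> ?C" using S.one_closed by blast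
  then show ?thesis by (simp add: S.colon_def)
qed

lemma theta_mem_of_constant_outside:
  assumes Y: "Y \<in> S.lids" "theta_span M \<subseteq> Y" and c: "c \<in> carrier R" "c \<notin> M" "dconst R c \<in> Y"
  shows "dtheta R \<in> Y"
proof (rule theta_mem_of_multiple[OF Y])
  let ?c = "dconst R c"
  have cc: "c \<otimes> c \<in> carrier R" using c by simp
  show "dconst R (c \<otimes> c) \<in> up R" using cc by simp
  have "c \<otimes> c \<notin> M" using primeideal.I_prime[OF R.maximalideal_prime[OF M], of c c] c by blast
  then show "dconst R (c \<otimes> c) \<notin> left_span M" using left_span_const_iff[OF M.is_ideal cc] by blast
  have "?c \<otimes>\<^bsub>S\<^esub> T ?c \<in> Y" using lidealsD(4)[OF Y(1) _ S_lids_T[OF Y(1) c(3)]] c(1) by simp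
  moreover have "?c \<otimes>\<^bsub>S\<^esub> T ?c = dconst R (c \<otimes> c) \<otimes>\<^bsub>S\<^esub> dtheta R \<oplus>\<^bsub>S\<^esub> dconst R (\<delta> c) \<otimes>\<^bsub>S\<^esub> ?c"
    unfolding theta_const[OF c(1)] using c(1)
    by (simp add: S.r_distr dconst_simps(2) dmult_assoc) (simp add: dconst_simps(2)[symmetric] R.m_comm)
  moreover have "dconst R (\<delta> c) \<otimes>\<^bsub>S\<^esub> ?c \<in> Y" using lidealsD(4)[OF Y(1) _ c(3)] c(1) by simp
  ultimately show "dconst R (c \<otimes> c) \<otimes>\<^bsub>S\<^esub> dtheta R \<in> Y"
    using S.lids_cancel(1)[OF Y(1), of "dconst R (\<delta> c) \<otimes>\<^bsub>S\<^esub> ?c" "dconst R (c \<otimes> c) \<otimes>\<^bsub>S\<^esub> dtheta R"] cc by simp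
qed

lemma theta_mem_of_constant:
  assumes Y: "Y \<in> S.lids" "theta_span M \<subseteq> Y" and b: "b \<in> carrier R" "b \<noteq> \<zero>" "dconst R b \<in> Y"
  shows "dtheta R \<in> Y"
proof -
  have "b \<notin> dcore M" using core b(2) by simp
  then have "\<exists>n. (\<delta> ^^ n) b \<notin> M" using b(1) by (auto simp: dcore_def)
  define n where "n = (LEAST n. (\<delta> ^^ n) b \<notin> M)"
  have n: "(\<delta> ^^ n) b \<notin> M" unfolding n_def by (rule LeastI_ex) fact
  have least: "(\<delta> ^^ i) b \<in> M" if "i < n" for i using not_less_Least that unfolding n_def by blast
  have "dconst R ((\<delta> ^^ i) b) \<in> Y" if "i \<le> n" for i using that
  proof (induction i)
    case 0
    then show ?case using b(3) by simp
  next
    case (Suc i)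
    define c where "c = (\<delta> ^^ i) b"
    have c: "c \<in> carrier R" "c \<in> M" "dconst R c \<in> Y" using b(1) least Suc by (auto simp: c_def)
    \<comment> \<open>This is where c must still lie in M: only then is c \<theta> in S M \<theta>,
      so that \<delta>(c) = \<theta> c - c \<theta> is a constant of Y.\<close>
    have ct: "dconst R c \<otimes>\<^bsub>S\<^esub> dtheta R \<in> Y" using left_span_const[OF M.is_ideal c(2)] Y(2) by (auto simp: theta_span_def)
    have "dconst R c \<otimes>\<^bsub>S\<^esub> dtheta R \<oplus>\<^bsub>S\<^esub> dconst R (\<delta> c) \<in> Y"
      using S_lids_T[OF Y(1) c(3)] unfolding theta_const[OF c(1)] .
    then have "dconst R (\<delta> c) \<in> Y" by (rule S.lids_cancel(2)[OF Y(1) ct, rotated]) (use c(1) in simp)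
    then show ?case by (simp add: c_def)
  qed
  then have "dconst R ((\<delta> ^^ n) b) \<in> Y" by simp
  then show ?thesis by (rule theta_mem_of_constant_outside[OF Y _ n, rotated]) (use b(1) in simp)
qed

text \<open>Write x = s \<theta> + b. If b is nonzero, a power of a nonzero element of M moves s
  into S M, which leaves a nonzero constant in Y. Such an element exists, since the zero ideal is a
  \<delta>-ideal and M is not.\<close>

lemma theta_mem_above:
  assumes Y: "Y \<in> S.lids" "theta_span M \<subset> Y" shows "dtheta R \<in> Y"
proof -
  have Y': "theta_span M \<subseteq> Y" using Y by blast
  obtain x where x: "x \<in> Y" "x \<notin> theta_span M" using Y(2) by blast
  have xu: "x \<in> up R" using x lidealsD(1)[OF Y(1)] by auto
  define b where "b = x 0"
  have b: "b \<in> carrier R" using xu by (simp add: b_def)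
  have yu: "x \<ominus>\<^bsub>S\<^esub> dconst R b \<in> up R" using xu b by simp
  have "(x \<ominus>\<^bsub>S\<^esub> dconst R b) 0 = \<zero>" using xu b by (simp add: S_minus_coeff b_def R.minus_eq R.r_neg)
  then obtain s where s: "s \<in> up R" "x \<ominus>\<^bsub>S\<^esub> dconst R b = s \<otimes>\<^bsub>S\<^esub> dtheta R" using shift_surj[OF yu] by blast
  have xe: "x = s \<otimes>\<^bsub>S\<^esub> dtheta R \<oplus>\<^bsub>S\<^esub> dconst R b"
    unfolding s(2)[symmetric] using xu b by (simp add: S.minus_eq S.a_assoc S.l_neg)
  show ?thesis
  proof (cases "b = \<zero>")
    case True
    then have "x = s \<otimes>\<^bsub>S\<^esub> dtheta R" using xe s(1) by (simp add: dconst_simps(3))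
    then show ?thesis using theta_mem_of_multiple[OF Y(1) Y' s(1)] x by (auto simp: theta_span_def)
  next
    case False
    have "M \<noteq> {\<zero>}"
    proof
      assume "M = {\<zero>}"
      then have "delta_ideal R \<delta> M" using M.is_ideal by (auto simp: delta_ideal_def)
      then show False using no_delta_maximal[OF M] by blast
    qed
    then obtain m where m: "m \<in> M" "m \<noteq> \<zero>" using M.zero_closed by blast
    have mc: "m \<in> carrier R" using m M.a_subset by blast
    obtain n where n: "s \<in> deg_less n" using deg_less_ex[OF s(1)] by blast
    define q where "q = m [^] n"
    have q: "q \<in> carrier R" "q \<noteq> \<zero>" using mc m(2) pow_nonzero by (auto simp: q_def)
    have "dconst R q \<otimes>\<^bsub>S\<^esub> s \<in> left_span M" unfolding q_def by (rule power_into_left_span[OF M.is_ideal m(1) n])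
    then have "(dconst R q \<otimes>\<^bsub>S\<^esub> s) \<otimes>\<^bsub>S\<^esub> dtheta R \<in> Y" using Y' by (auto simp: theta_span_def)
    moreover have "dconst R q \<otimes>\<^bsub>S\<^esub> x = (dconst R q \<otimes>\<^bsub>S\<^esub> s) \<otimes>\<^bsub>S\<^esub> dtheta R \<oplus>\<^bsub>S\<^esub> dconst R (q \<otimes> b)"
      unfolding xe using q b s(1) by (simp add: S.r_distr dmult_assoc dconst_simps(2))
    moreover have "dconst R q \<otimes>\<^bsub>S\<^esub> x \<in> Y" using lidealsD(4)[OF Y(1) _ x(1)] q by simp
    ultimately have "dconst R (q \<otimes> b) \<in> Y"
      using S.lids_cancel(2)[OF Y(1), of "(dconst R q \<otimes>\<^bsub>S\<^esub> s) \<otimes>\<^bsub>S\<^esub> dtheta R" "dconst R (q \<otimes> b)"] q b by simp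
    then show ?thesis
      by (rule theta_mem_of_constant[OF Y(1) Y' R.m_closed[OF q(1) b], rotated])
        (use q b False integral[of q b] in auto)
  qed
qed

lemma theta_notin_theta_span: "dtheta R \<notin> theta_span M"
proof
  assume "dtheta R \<in> theta_span M"
  then obtain s where s: "s \<in> left_span M" "dtheta R = s \<otimes>\<^bsub>S\<^esub> dtheta R" by (auto simp: theta_span_def)
  have su: "s \<in> up R" using left_span_up[OF M.is_ideal s(1)] .
  have "dtheta R (Suc n) = s n" for n using s(2) mult_theta[OF su] by (metis shift_coeff(2))
  then have "s = dconst R \<one>" by (auto simp: fun_eq_iff dtheta_def dconst_def)
  then have "\<one> \<in> M" using left_span_const_iff[OF M.is_ideal R.one_closed] s(1) by blast
  then show False using M.I_notcarr M.one_imp_carrier by metis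
qed

text \<open>The factor S/S\<theta>, which is R, has the strictly descending submodules p^i R,
  because \<delta>(p^i) is a multiple of p^i. Their preimages C i all contain S M \<theta>, whose
  elements have zero constant term.\<close>

lemma not_diamond_of_darboux:
  assumes p: "darboux p" shows "\<not> S.diamond_lids"
proof
  assume d: "S.diamond_lids"
  have pc: "p \<in> carrier R" "p \<noteq> \<zero>" "primeideal (PIdl p) R" "delta_ideal R \<delta> (PIdl p)" using p by (auto simp: darboux_def)
  have pr: "S.lprinc (dtheta R) \<in> S.lids" "dtheta R \<in> S.lprinc (dtheta R)" using S.lids_lprinc[of "dtheta R"] by simp_all
  have "theta_span M \<subseteq> S.lprinc (dtheta R)" using left_span_up[OF M.is_ideal] by (auto simp: theta_span_def S.lprinc_def)
  then have "theta_span M \<subset> S.lprinc (dtheta R)" using theta_notin_theta_span pr(2) by blast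
  moreover have "S.lprinc (dtheta R) \<subseteq> Y" if "Y \<in> S.lids" "theta_span M \<subset> Y" for Y
    by (rule S.lprinc_least[OF that(1) theta_mem_above[OF that]])
  ultimately have dcc: "dcc_on (between S.lids (theta_span M) (carrier S))"
    by (rule S.diamond_lidsD[OF d theta_span_lids pr(1)])
  have dp: "\<delta> p \<in> PIdl p" using pc(1,4) R.cgenideal_self by (auto simp: delta_ideal_def)
  define C where "C = (\<lambda>i::nat. {s \<in> up R. s 0 \<in> PIdl (p [^] i)})"
  have pi: "p [^] i \<in> carrier R" for i :: nat using pc by simp
  have "\<not> dcc_on (between S.lids (theta_span M) (carrier S))"
  proof (rule S.not_dcc_between[of C])
    fix i
    show "C i \<in> S.lids" unfolding C_def
      by (rule constant_term_lids[OF delta_ideal_principal[OF pi deriv_power_dvd[OF pc(1) dp]]])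
    show "theta_span M \<subseteq> C i"
    proof
      fix x assume "x \<in> theta_span M"
      then obtain s where s: "s \<in> up R" "x = shift s" using left_span_up[OF M.is_ideal] mult_theta by (auto simp: theta_span_def)
      have "\<zero> \<in> PIdl (p [^] i)" using pi by (auto simp: cgenideal_def intro!: exI[of _ \<zero>])
      then show "x \<in> C i" using s by (simp add: C_def)
    qed
    have "PIdl (p [^] Suc i) \<subseteq> PIdl (p [^] i)"
    proof
      fix y assume "y \<in> PIdl (p [^] Suc i)"
      then obtain z where z: "z \<in> carrier R" "y = z \<otimes> (p [^] i \<otimes> p)" by (auto simp: cgenideal_def)
      then have "y = (z \<otimes> p) \<otimes> p [^] i" using pi pc(1) by (simp add: R.m_ac)
      then show "y \<in> PIdl (p [^] i)" using z pc(1) by (auto simp: cgenideal_def)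
    qed
    then have "C (Suc i) \<subseteq> C i" unfolding C_def by blast
    moreover have "dconst R (p [^] i) \<in> C i" using pi R.cgenideal_self[OF pi] by (simp add: C_def)
    moreover have "dconst R (p [^] i) \<notin> C (Suc i)"
    proof
      assume "dconst R (p [^] i) \<in> C (Suc i)"
      then obtain z where z: "z \<in> carrier R" "p [^] i = z \<otimes> (p [^] i \<otimes> p)" by (auto simp: C_def cgenideal_def)
      have "p [^] i \<otimes> (z \<otimes> p) = z \<otimes> (p [^] i \<otimes> p)" using z(1) pi pc(1) by (simp add: R.m_ac)
      also have "\<dots> = p [^] i \<otimes> \<one>" using z(2) pi[of i] by simp
      finally have "p [^] i \<otimes> (z \<otimes> p) = p [^] i \<otimes> \<one>" .
      then have "z \<otimes> p = \<one>" by (rule iffD1[OF m_lcancel[OF pow_nonzero[OF pc(1,2)] pi R.m_closed[OF z(1) pc(1)] R.one_closed]])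
      then have "\<one> \<in> PIdl p" using z(1) unfolding cgenideal_def by force
      then have "carrier R = PIdl p" using ideal.one_imp_carrier[OF primeideal.axioms(1)[OF pc(3)]] by simp
      then show False using primeideal.I_notcarr[OF pc(3)] by simp
    qed
    ultimately show "C (Suc i) \<subset> C i" by blast
  qed
  then show False using dcc by blast
qed

end

section \<open>The case without Darboux elements\<close>

lemma right_const_deg:
  assumes v: "v \<in> up R" and f: "f \<in> carrier R" "f \<noteq> \<zero>" and vf: "v \<otimes>\<^bsub>S\<^esub> dconst R f \<in> deg_less k"
  shows "v \<in> deg_less k"
proof (cases "v = \<zero>\<^bsub>S\<^esub>")
  case True
  then show ?thesis using deg_less_zero by simp
next
  case False
  then obtain m where m: "v \<in> deg_less (Suc m)" "v m \<noteq> \<zero>" using lead_exists[OF v] by blast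
  have "(v \<otimes>\<^bsub>S\<^esub> dconst R f) m = v m \<otimes> f" using mult_lead[OF m(1) deg_less_dconst[OF f(1)]] by simp
  then have "(v \<otimes>\<^bsub>S\<^esub> dconst R f) m \<noteq> \<zero>" using m(2) f v integral[of "v m" f] by auto
  then have "m < k" using deg_less_coeff[OF vf] by (meson not_le)
  then show ?thesis using deg_less_mono[OF _ m(1)] by simp
qed

text \<open>Put v = w \<theta> and compare coefficients in f x = v f. The top ones give v_n = x_n =
  r; the next ones give n r \<delta>(f) in (f), so r = c f, as \<delta>(f) is not in the prime ideal
  (f). Subtracting c \<theta>^n f from x lowers its degree, and induction applies.\<close>

lemma left_factor_of_theta_multiple:
  assumes f: "f \<in> carrier R" "f \<noteq> \<zero>" "primeideal (PIdl f) R" "\<delta> f \<notin> PIdl f"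
  shows "x \<in> deg_less n \<Longrightarrow> w \<in> up R \<Longrightarrow>
    dconst R f \<otimes>\<^bsub>S\<^esub> x = w \<otimes>\<^bsub>S\<^esub> dtheta R \<otimes>\<^bsub>S\<^esub> dconst R f \<Longrightarrow> x \<in> S.lprinc (dconst R f)"
proof (induction n arbitrary: x w)
  case 0
  then have "x = \<zero>\<^bsub>S\<^esub>" by simp
  then show ?case using lidealsD(2)[OF S.lids_lprinc(1)[of "dconst R f"]] f(1) by simp
next
  case (Suc n)
  interpret F: primeideal "PIdl f" R by (rule f(3))
  let ?f = "dconst R f"
  have fu: "?f \<in> up R" using f by simp
  have pr: "S.lprinc ?f \<in> S.lids" using S.lids_lprinc fu by simp
  have xu: "x \<in> up R" by (rule deg_less_up[OF Suc.prems(1)])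
  define v where "v = shift w"
  have vu: "v \<in> up R" using Suc.prems(2) by (simp add: v_def)
  have eq: "?f \<otimes>\<^bsub>S\<^esub> x = v \<otimes>\<^bsub>S\<^esub> ?f" using Suc.prems(3) mult_theta[OF Suc.prems(2)] by (simp add: v_def)
  have eqc: "f \<otimes> x i = (v \<otimes>\<^bsub>S\<^esub> ?f) i" for i using S_const_coeff[OF f(1) xu, of i] eq by simp
  have vd: "v \<in> deg_less (Suc n)"
    by (rule right_const_deg[OF vu f(1,2)]) (use deg_less_const_mult[OF f(1) Suc.prems(1)] eq in simp)
  define r where "r = x n"
  have r: "r \<in> carrier R" using xu by (simp add: r_def)
  have "(v \<otimes>\<^bsub>S\<^esub> ?f) n = v n \<otimes> f" using mult_lead[OF vd deg_less_dconst[OF f(1)]] by simp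
  then have "f \<otimes> r = f \<otimes> v n" using eqc[of n] vu f(1) by (simp add: r_def R.m_comm)
  then have vr: "v n = r" using m_lcancel[OF f(2,1) r up_closed[OF vu]] by simp
  show ?case
  proof (cases n)
    case 0
    \<comment> \<open>In degree zero the factor \<theta> decides: v = w \<theta> has no constant
      term.\<close>
    then have "r = \<zero>" using vr by (simp add: v_def)
    then have "x \<in> deg_less n" using deg_less_SucD[OF Suc.prems(1)] by (simp add: r_def)
    then have "x = \<zero>\<^bsub>S\<^esub>" using 0 by simp
    then show ?thesis using lidealsD(2)[OF pr] by simp
  next
    case (Suc k)
    define d where "d = add_pow R (Suc k) (\<delta> f)"
    have d: "d \<in> carrier R" using f(1) by (simp add: d_def del: R.add.nat_pow_Suc)
    have vk: "(v \<otimes>\<^bsub>S\<^esub> ?f) k = v k \<otimes> f \<oplus> r \<otimes> d"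
      using mult_const_sublead[of v k f] vd Suc vr f(1) by (simp add: d_def del: R.add.nat_pow_Suc)
    have "f \<otimes> x k \<in> PIdl f" using F.I_r_closed[OF R.cgenideal_self[OF f(1)]] xu by simp
    then have "v k \<otimes> f \<oplus> r \<otimes> d \<in> PIdl f" using eqc[of k] vk by simp
    moreover have vf: "v k \<otimes> f \<in> PIdl f" using F.I_l_closed[OF R.cgenideal_self[OF f(1)]] vu by simp
    ultimately have "r \<otimes> d \<in> PIdl f"
      using R.lids_cancel(2)[of "PIdl f", OF _ vf R.m_closed[OF r d]] F.is_ideal by (simp add: lids_iff_ideal)
    moreover have "r \<otimes> d = add_pow R (Suc k) (r \<otimes> \<delta> f)"
      unfolding d_def using r f(1) by (intro R.add_pow_rdistr) auto
    ultimately have "add_pow R (Suc k) (r \<otimes> \<delta> f) \<in> PIdl f" by simp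
    then have "r \<otimes> \<delta> f \<in> PIdl f" using add_pow_cancel[OF F.is_ideal, of "r \<otimes> \<delta> f" "Suc k"] r f(1) by simp
    then have "r \<in> PIdl f" using F.I_prime[of r "\<delta> f"] f(1,4) r by simp
    then obtain c where c: "c \<in> carrier R" "r = c \<otimes> f"
      unfolding cgenideal_def mem_Collect_eq by (elim exE conjE)
    \<comment> \<open>m = c \<theta>^n is written as m' \<theta> so that f (m f) = (f m') \<theta>
      f; the difference y then satisfies the same equation with w - f m' in place of w.\<close>
    define m' m where "m' = (\<lambda>i. if i = k then c else \<zero>)" and "m = shift m'"
    have m'u: "m' \<in> up R" using c by (intro upI[of _ k]) (auto simp: m'_def)
    have mu: "m \<in> up R" using m'u by (simp add: m_def)
    have md: "m \<in> deg_less (Suc n)"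
    proof (rule deg_lessI[OF mu])
      fix i assume "Suc n \<le> i"
      then show "m i = \<zero>" using Suc by (cases i) (simp_all add: m_def m'_def)
    qed
    have mn: "m n = c" using Suc by (simp add: m_def m'_def)
    have mt: "m = m' \<otimes>\<^bsub>S\<^esub> dtheta R" using mult_theta[OF m'u] by (simp add: m_def)
    define y where "y = x \<ominus>\<^bsub>S\<^esub> m \<otimes>\<^bsub>S\<^esub> ?f"
    have yd: "y \<in> deg_less n"
    proof (rule deg_less_SucD)
      show "y \<in> deg_less (Suc n)" unfolding y_def
        using mult_deg[OF md deg_less_dconst[OF f(1)]] by (intro deg_less_minus Suc.prems(1)) simp
      show "y n = \<zero>" using mult_lead[OF md deg_less_dconst[OF f(1)]] xu mu fu c r mn
        by (simp add: y_def S_minus_coeff r_def[symmetric] R.minus_eq R.r_neg)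
    qed
    have c4: "?f \<in> carrier S" "m' \<in> carrier S" "w \<in> carrier S" "dtheta R \<in> carrier S" "x \<in> carrier S"
      using fu m'u Suc.prems(2) xu by auto
    have "?f \<otimes>\<^bsub>S\<^esub> y = ?f \<otimes>\<^bsub>S\<^esub> x \<ominus>\<^bsub>S\<^esub> ?f \<otimes>\<^bsub>S\<^esub> m' \<otimes>\<^bsub>S\<^esub> dtheta R \<otimes>\<^bsub>S\<^esub> ?f"
      unfolding y_def mt using c4 by (simp add: S.minus_eq S.r_distr S.r_minus S.m_assoc del: S_carrier)
    also have "\<dots> = (w \<ominus>\<^bsub>S\<^esub> ?f \<otimes>\<^bsub>S\<^esub> m') \<otimes>\<^bsub>S\<^esub> dtheta R \<otimes>\<^bsub>S\<^esub> ?f"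
      unfolding Suc.prems(3) using c4 by (simp add: S.minus_eq S.l_distr S.l_minus del: S_carrier)
    finally have "y \<in> S.lprinc ?f" by (rule Suc.IH[OF yd, rotated]) (use fu m'u Suc.prems(2) in simp)
    moreover have mf: "m \<otimes>\<^bsub>S\<^esub> ?f \<in> S.lprinc ?f" using mu by (auto simp: S.lprinc_def)
    ultimately show ?thesis unfolding y_def by (rule S.lids_cancel(3)[OF pr, rotated 2]) (use xu in simp)
  qed
qed

text \<open>Without a differential ideal to provide the descending chain, \<open>S / S M \<theta>\<close> is replaced by
  \<open>S / S M \<theta> f\<close> for a prime element \<open>f\<close> that does not generate a maximal ideal; its quotient \<open>S / S f\<close>
  has the submodules \<open>S (f, g\<^sup>n) / S f\<close>.\<close>

lemma not_diamond_of_no_darboux: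
  assumes M: "maximalideal M R" and core: "dcore M = {\<zero>}" and none: "\<And>p. \<not> darboux p"
  shows "\<not> S.diamond_lids"
proof
  assume dia: "S.diamond_lids"
  interpret M: maximalideal M R by (rule M)
  obtain f where f: "f \<in> carrier R" "f \<noteq> \<zero>" "primeideal (PIdl f) R" "\<not> maximalideal (PIdl f) R"
    using nonmaximal_prime_element by blast
  interpret F: primeideal "PIdl f" R by (rule f(3))
  have df: "\<delta> f \<notin> PIdl f" using none[of f] delta_ideal_principal[OF f(1)] f by (auto simp: darboux_def)
  let ?f = "dconst R f" and ?L0 = "(\<lambda>s. s \<otimes>\<^bsub>S\<^esub> dtheta R) ` left_span M"
  have fu: "?f \<in> up R" using f by simp
  have fne: "?f \<noteq> \<zero>\<^bsub>S\<^esub>" using f(2) dconst_coeff_0[of f] S_zero_coeff[of 0] by metis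
  have pr: "S.lprinc ?f \<in> S.lids" "?f \<in> S.lprinc ?f" using S.lids_lprinc[of ?f] fu by simp_all
  have L0: "?L0 \<in> S.lids" using theta_span_lids[OF M core] unfolding theta_span_def .
  have L0u: "s \<in> up R" if "s \<in> ?L0" for s using that lidealsD(1)[OF L0] by auto
  define L where "L = (\<lambda>s. s \<otimes>\<^bsub>S\<^esub> ?f) ` ?L0"
  have L: "L \<in> S.lids" unfolding L_def by (rule S.lids_image_right[OF L0]) (use fu in simp)
  let ?N = "S.lprinc (dtheta R \<otimes>\<^bsub>S\<^esub> ?f)"
  have Nl: "?N \<in> S.lids" "dtheta R \<otimes>\<^bsub>S\<^esub> ?f \<in> ?N" using S.lids_lprinc[of "dtheta R \<otimes>\<^bsub>S\<^esub> ?f"] fu by simp_all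
  have "L \<subseteq> ?N"
  proof
    fix x assume "x \<in> L"
    then obtain s where "s \<in> left_span M" "x = s \<otimes>\<^bsub>S\<^esub> dtheta R \<otimes>\<^bsub>S\<^esub> ?f" by (auto simp: L_def)
    then show "x \<in> ?N" using left_span_up[OF M.is_ideal] fu by (auto simp: S.lprinc_def dmult_assoc)
  qed
  moreover have "dtheta R \<otimes>\<^bsub>S\<^esub> ?f \<notin> L"
  proof
    assume "dtheta R \<otimes>\<^bsub>S\<^esub> ?f \<in> L"
    then obtain s where s: "s \<in> ?L0" "dtheta R \<otimes>\<^bsub>S\<^esub> ?f = s \<otimes>\<^bsub>S\<^esub> ?f" by (auto simp: L_def)
    have "(dtheta R \<ominus>\<^bsub>S\<^esub> s) \<otimes>\<^bsub>S\<^esub> ?f = \<zero>\<^bsub>S\<^esub>"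
      using L0u[OF s(1)] fu s(2) by (simp add: S.minus_eq S.l_distr S.l_minus S.r_neg)
    then have "dtheta R \<ominus>\<^bsub>S\<^esub> s = \<zero>\<^bsub>S\<^esub>" using S_integral[of "dtheta R \<ominus>\<^bsub>S\<^esub> s" ?f] L0u[OF s(1)] fu fne by auto
    then have "dtheta R = s" using L0u[OF s(1)] by simp
    then show False using s(1) theta_notin_theta_span[OF M core] unfolding theta_span_def by blast
  qed
  ultimately have LN: "L \<subset> ?N" using Nl(2) by blast
  have least: "?N \<subseteq> Y" if Y: "Y \<in> S.lids" "L \<subset> Y" for Y
  proof -
    have C: "S.colon Y ?f \<in> S.lids" using S.lids_colon[OF Y(1)] fu by simp
    have sub: "?L0 \<subseteq> S.colon Y ?f" using Y(2) L0u by (auto simp: L_def S.colon_def)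
    \<comment> \<open>If the colon ideal were only S M \<theta>, an element x of Y outside L would
      lead to a contradiction: some power of f moves x into S f, while the induction below keeps
      every f^k x outside S f.\<close>
    have "\<not> S.colon Y ?f \<subseteq> ?L0"
    proof
      assume eq: "S.colon Y ?f \<subseteq> ?L0"
      obtain x where x: "x \<in> Y" "x \<notin> L" using Y(2) by blast
      have xu: "x \<in> up R" using x lidealsD(1)[OF Y(1)] by auto
      have cancel_f: "y \<in> ?L0" if "y \<in> up R" "y \<otimes>\<^bsub>S\<^esub> ?f \<in> Y" for y using that eq by (auto simp: S.colon_def)
      obtain n where n: "x \<in> deg_less n" using deg_less_ex[OF xu] ..
      have im: "dconst R ` (PIdl f) \<subseteq> S.lprinc ?f"
      proof
        fix u assume "u \<in> dconst R ` (PIdl f)"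
        then obtain y where y: "y \<in> PIdl f" "u = dconst R y" by (elim imageE)
        from y(1) obtain c where c: "c \<in> carrier R" "y = c \<otimes> f"
          unfolding cgenideal_def mem_Collect_eq by (elim exE conjE)
        have "u = dconst R c \<otimes>\<^bsub>S\<^esub> ?f" unfolding y(2) c(2) using c(1) f(1) by (rule dconst_simps(2))
        then show "u \<in> S.lprinc ?f" unfolding S.lprinc_def
          by (intro CollectI exI[of _ "dconst R c"] conjI) (use c(1) in simp_all)
      qed
      have "dconst R (f [^] n) \<otimes>\<^bsub>S\<^esub> x \<in> S.lprinc ?f"
        using power_into_left_span[OF F.is_ideal R.cgenideal_self[OF f(1)] n] left_span_least[OF F.is_ideal pr(1) im] by blast
      \<comment> \<open>In the induction step f z = y f with z in Y puts y into the colon ideal,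
        hence y = w \<theta> with w in S M, and \<open>left_factor_of_theta_multiple\<close> would
        place z in S f already.\<close>
      moreover have "dconst R (f [^] k) \<otimes>\<^bsub>S\<^esub> x \<notin> S.lprinc ?f" for k :: nat
      proof (induction k)
        case 0
        show ?case
        proof
          assume "dconst R (f [^] (0::nat)) \<otimes>\<^bsub>S\<^esub> x \<in> S.lprinc ?f"
          then have "x \<in> S.lprinc ?f" using xu by (simp add: dconst_simps(4))
          then obtain y where y: "y \<in> up R" "x = y \<otimes>\<^bsub>S\<^esub> ?f" by (auto simp: S.lprinc_def)
          then have "y \<in> ?L0" using cancel_f x(1) by blast
          then show False using y(2) x(2) by (auto simp: L_def)
        qed
      next
        case (Suc k)
        define z where "z = dconst R (f [^] k) \<otimes>\<^bsub>S\<^esub> x"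
        have fk: "f [^] k \<in> carrier R" using f by simp
        have zu: "z \<in> up R" and zY: "z \<in> Y" using lidealsD(4)[OF Y(1) _ x(1)] fk xu by (auto simp: z_def)
        have e: "dconst R (f [^] Suc k) \<otimes>\<^bsub>S\<^esub> x = ?f \<otimes>\<^bsub>S\<^esub> z"
          using f(1) fk xu by (simp add: z_def R.m_comm[of _ f] dconst_simps(2) dmult_assoc)
        show ?case
        proof
          assume "dconst R (f [^] Suc k) \<otimes>\<^bsub>S\<^esub> x \<in> S.lprinc ?f"
          then obtain y where y: "y \<in> up R" "?f \<otimes>\<^bsub>S\<^esub> z = y \<otimes>\<^bsub>S\<^esub> ?f" unfolding e by (auto simp: S.lprinc_def)
          have "?f \<otimes>\<^bsub>S\<^esub> z \<in> Y" using lidealsD(4)[OF Y(1) _ zY] fu by simp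
          then have "y \<in> ?L0" using cancel_f y by simp
          then obtain w where w: "w \<in> left_span M" "y = w \<otimes>\<^bsub>S\<^esub> dtheta R" by blast
          obtain d where "z \<in> deg_less d" using deg_less_ex[OF zu] by blast
          then have "z \<in> S.lprinc ?f"
            using left_factor_of_theta_multiple[OF f(1-3) df _ left_span_up[OF M.is_ideal w(1)]] y(2) w(2) by blast
          then show False using Suc by (simp add: z_def)
        qed
      qed
      ultimately show False by blast
    qed
    then have "dtheta R \<in> S.colon Y ?f" using theta_mem_above[OF M core C] sub unfolding theta_span_def by blast
    then have "dtheta R \<otimes>\<^bsub>S\<^esub> ?f \<in> Y" by (simp add: S.colon_def)
    then show ?thesis by (rule S.lprinc_least[OF Y(1)])
  qed
  have dcc: "dcc_on (between S.lids L (carrier S))"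
    by (rule S.diamond_lidsD[OF dia L Nl(1) LN least])
  obtain M' where M': "maximalideal M' R" "PIdl f \<subseteq> M'"
    using maximal_ideal_above[OF F.is_ideal] F.I_notcarr by metis
  interpret M': maximalideal M' R by (rule M'(1))
  have "M' \<noteq> PIdl f" using f(4) M'(1) by blast
  then obtain g where g: "g \<in> M'" "g \<notin> PIdl f" using M'(2) by blast
  have gc: "g \<in> carrier R" using g M'.a_subset by blast
  define I where "I = (\<lambda>n::nat. R.lsum (PIdl f) (PIdl (g [^] n)))"
  have Fl: "PIdl f \<in> R.lids" using F.is_ideal by (simp add: lids_iff_ideal)
  have gn: "g [^] n \<in> carrier R" for n :: nat using gc by simp
  have Gl: "PIdl (g [^] n) \<in> R.lids" for n :: nat using R.cgenideal_ideal[OF gn] by (simp add: lids_iff_ideal)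
  have Il: "I n \<in> R.lids" for n unfolding I_def by (rule R.lids_lsum[OF Fl Gl])
  have Ii: "ideal (I n) R" for n using Il by (simp add: lids_iff_ideal)
  have gI: "g [^] n \<in> I n" for n using R.lsum_upper(2)[OF Fl Gl, of n] R.cgenideal_self[OF gn] by (auto simp: I_def)
  \<comment> \<open>Otherwise g^n (1 - b g) lies in the prime ideal (f), which does not contain g;
    then 1 - b g is in M', and so is b g.\<close>
  have gnI: "g [^] n \<notin> I (Suc n)" for n
  proof
    assume "g [^] n \<in> I (Suc n)"
    then obtain a y where ay: "a \<in> PIdl f" "y \<in> PIdl (g [^] Suc n)" "g [^] n = a \<oplus> y"
      unfolding I_def R.lsum_def mem_Collect_eq by (elim exE conjE)
    from ay(2) obtain b where b: "b \<in> carrier R" "y = b \<otimes> (g [^] n \<otimes> g)"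
      unfolding cgenideal_def mem_Collect_eq nat_pow_Suc by (elim exE conjE)
    note ab = ay(1) b(1) ay(3)[unfolded b(2)]
    have ac: "a \<in> carrier R" using ab F.a_subset by blast
    have "g [^] n \<otimes> (\<one> \<ominus> b \<otimes> g) = g [^] n \<ominus> b \<otimes> (g [^] n \<otimes> g)" using gn[of n] gc ab(2) by algebra
    also have "\<dots> = (a \<oplus> b \<otimes> (g [^] n \<otimes> g)) \<ominus> b \<otimes> (g [^] n \<otimes> g)" using ab(3) by simp
    also have "\<dots> = a" using ac ab(2) gn[of n] gc by (simp add: R.minus_eq R.a_assoc R.r_neg)
    finally have "g [^] n \<otimes> (\<one> \<ominus> b \<otimes> g) \<in> PIdl f" using ab(1) by simp
    moreover have "g [^] n \<notin> PIdl f"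
    proof (induction n)
      case 0
      then show ?case using F.I_notcarr F.one_imp_carrier by auto
    next
      case (Suc n)
      then show ?case using F.I_prime[of "g [^] n" g] g(2) gc by auto
    qed
    ultimately have "\<one> \<ominus> b \<otimes> g \<in> M'" using F.I_prime[of "g [^] n" "\<one> \<ominus> b \<otimes> g"] gc ab(2) M'(2) by auto
    moreover have bg: "b \<otimes> g \<in> M'" using M'.I_l_closed[OF g(1) ab(2)] .
    ultimately have "\<one> \<in> M'" using R.lids_cancel(3)[of M', OF _ bg R.one_closed] M'.is_ideal by (simp add: lids_iff_ideal)
    then show False using M'.I_notcarr M'.one_imp_carrier by metis
  qed
  have "\<not> dcc_on (between S.lids L (carrier S))"
  proof (rule S.not_dcc_between[of "\<lambda>n. left_span (I n)"])
    fix n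
    show "left_span (I n) \<in> S.lids" by (rule left_span_lids[OF Ii])
    have "f \<in> I n" using R.lsum_upper(1)[OF Fl Gl, of n] R.cgenideal_self[OF f(1)] by (auto simp: I_def)
    then have "y \<otimes>\<^bsub>S\<^esub> ?f \<in> left_span (I n)" if "y \<in> up R" for y by (rule left_span_right_const[OF Ii that])
    then show "L \<subseteq> left_span (I n)" using L0u by (auto simp: L_def)
    have "g [^] Suc n \<in> PIdl (g [^] n)"
      unfolding cgenideal_def by (intro CollectI exI[of _ g] conjI gc) (use gn[of n] gc in \<open>simp add: R.m_comm\<close>)
    then have "PIdl (g [^] Suc n) \<subseteq> PIdl (g [^] n)"
      by (rule R.cgenideal_minimal[OF R.cgenideal_ideal[OF gn]])
    then have "I (Suc n) \<subseteq> I n" unfolding I_def by (intro R.lsum_mono) auto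
    then have "left_span (I (Suc n)) \<subseteq> left_span (I n)"
      using left_span_const[OF Ii] by (intro left_span_least[OF Ii left_span_lids[OF Ii]]) blast
    moreover have "dconst R (g [^] n) \<in> left_span (I n)" "dconst R (g [^] n) \<notin> left_span (I (Suc n))"
      using left_span_const_iff[OF Ii gn] gI gnI by auto
    ultimately show "left_span (I (Suc n)) \<subset> left_span (I n)" by blast
  qed
  then show False using dcc by blast
qed

lemma diamond_iff_not_delta_primitive: "S.diamond_lids \<longleftrightarrow> \<not> delta_primitive R \<delta>"
proof
  assume d: "S.diamond_lids"
  show "\<not> delta_primitive R \<delta>"
  proof
    assume "delta_primitive R \<delta>"
    then obtain M where M: "maximalideal M R" "dcore M = {\<zero>}" unfolding delta_primitive_iff by blast
    show False using not_diamond_of_darboux[OF M] not_diamond_of_no_darboux[OF M] d by blast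
  qed
qed (rule not_delta_primitive_imp_diamond)

end

section \<open>Cyclic modules and left ideals\<close>

text \<open>The module is isomorphic to R/\<open>ann\<close>; \<open>pre\<close> and
  \<open>img\<close> are the resulting inverse bijections between its submodules and the left ideals
  above \<open>ann\<close>.\<close>

locale cyclic_left_module = left_module R M
  for R :: "('s, 'm) ring_scheme" (structure) and M :: "('s, 'a, 'n) module_scheme" +
  fixes x
  assumes gen_closed: "x \<in> carrier M" and gen: "carrier M = (\<lambda>s. s \<odot>\<^bsub>M\<^esub> x) ` carrier R"
begin

definition ann :: "'s set" where "ann = {s \<in> carrier R. s \<odot>\<^bsub>M\<^esub> x = \<zero>\<^bsub>M\<^esub>}"

definition pre :: "'a set \<Rightarrow> 's set" where "pre N = {s \<in> carrier R. s \<odot>\<^bsub>M\<^esub> x \<in> N}"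

definition img :: "'s set \<Rightarrow> 'a set" where "img Y = (\<lambda>s. s \<odot>\<^bsub>M\<^esub> x) ` Y"

lemma pre_lids:
  assumes "submodule N R M" shows "pre N \<in> S.lids" "ann \<subseteq> pre N"
proof -
  have N: "\<zero>\<^bsub>M\<^esub> \<in> N" "\<And>y z. y \<in> N \<Longrightarrow> z \<in> N \<Longrightarrow> y \<oplus>\<^bsub>M\<^esub> z \<in> N"
    "\<And>s y. s \<in> carrier R \<Longrightarrow> y \<in> N \<Longrightarrow> s \<odot>\<^bsub>M\<^esub> y \<in> N"
    using assms by (auto simp: submodule_iff)
  show "pre N \<in> S.lids"
    by (rule lidealsI)
      (use N gen_closed in \<open>auto simp: pre_def smult_l_null smult_l_distr smult_assoc\<close>)
  show "ann \<subseteq> pre N" using N by (auto simp: ann_def pre_def)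
qed

lemma submodule_zero: "submodule {\<zero>\<^bsub>M\<^esub>} R M"
proof -
  have "s \<odot>\<^bsub>M\<^esub> \<zero>\<^bsub>M\<^esub> = \<zero>\<^bsub>M\<^esub>" if "s \<in> carrier R" for s
    using smult_r_distr[OF that M.zero_closed M.zero_closed] smult_closed[OF that M.zero_closed] that
    by (metis M.add.r_cancel_one' M.l_zero M.zero_closed)
  then show ?thesis by (auto simp: submodule_iff)
qed

lemma ann_pre: "ann = pre {\<zero>\<^bsub>M\<^esub>}" by (auto simp: ann_def pre_def)

lemma ann_lids: "ann \<in> S.lids" unfolding ann_pre by (rule pre_lids[OF submodule_zero])

lemma img_pre:
  assumes "N \<subseteq> carrier M" shows "img (pre N) = N"
  using assms gen by (auto simp: img_def pre_def)

lemma img_submodule: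
  assumes Y: "Y \<in> S.lids" shows "submodule (img Y) R M"
  unfolding submodule_iff
proof (intro conjI ballI)
  have Yc: "y \<in> carrier R" if "y \<in> Y" for y using that lidealsD(1)[OF Y] by blast
  show "img Y \<subseteq> carrier M" using Yc gen_closed by (auto simp: img_def)
  show "\<zero>\<^bsub>M\<^esub> \<in> img Y" unfolding img_def
    by (rule image_eqI[of _ _ \<zero>]) (use lidealsD(2)[OF Y] smult_l_null gen_closed in auto)
  fix u v s assume u: "u \<in> img Y"
  then obtain y where y: "y \<in> Y" "u = y \<odot>\<^bsub>M\<^esub> x" by (auto simp: img_def)
  show "s \<odot>\<^bsub>M\<^esub> u \<in> img Y" if "s \<in> carrier R" unfolding img_def
    by (rule image_eqI[of _ _ "s \<otimes> y"])
      (use that y Yc gen_closed lidealsD(4)[OF Y] in \<open>auto simp: smult_assoc\<close>)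
  assume "v \<in> img Y"
  then obtain z where z: "z \<in> Y" "v = z \<odot>\<^bsub>M\<^esub> x" by (auto simp: img_def)
  show "u \<oplus>\<^bsub>M\<^esub> v \<in> img Y" unfolding img_def
    by (rule image_eqI[of _ _ "y \<oplus> z"])
      (use y z Yc gen_closed lidealsD(3)[OF Y] in \<open>auto simp: smult_l_distr\<close>)
qed

lemma pre_img:
  assumes Y: "Y \<in> S.lids" "ann \<subseteq> Y" shows "pre (img Y) = Y"
proof
  have Yc: "y \<in> carrier R" if "y \<in> Y" for y using that lidealsD(1)[OF Y(1)] by blast
  show "Y \<subseteq> pre (img Y)" using Yc by (auto simp: pre_def img_def)
  show "pre (img Y) \<subseteq> Y"
  proof
    fix s assume "s \<in> pre (img Y)"
    then obtain y where s: "s \<in> carrier R" and y: "y \<in> Y" "s \<odot>\<^bsub>M\<^esub> x = y \<odot>\<^bsub>M\<^esub> x" by (auto simp: pre_def img_def)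
    have "(s \<ominus> y \<oplus> y) \<odot>\<^bsub>M\<^esub> x = y \<odot>\<^bsub>M\<^esub> x"
      using s y Yc by (simp add: S.minus_eq S.a_assoc S.l_neg)
    then have "(s \<ominus> y) \<odot>\<^bsub>M\<^esub> x \<oplus>\<^bsub>M\<^esub> y \<odot>\<^bsub>M\<^esub> x = y \<odot>\<^bsub>M\<^esub> x"
      using s y(1) Yc gen_closed smult_l_distr[of "s \<ominus> y" y x] by simp
    then have "(s \<ominus> y) \<odot>\<^bsub>M\<^esub> x = \<zero>\<^bsub>M\<^esub>"
      using s y(1) Yc gen_closed by (metis M.add.r_cancel_one smult_closed S.minus_closed)
    then have "s \<ominus> y \<in> Y" using Y(2) s y(1) Yc by (auto simp: ann_def)
    then show "s \<in> Y" using S.lids_cancel(3)[OF Y(1) y(1) s] by blast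
  qed
qed

lemma img_ann: "img ann = {\<zero>\<^bsub>M\<^esub>}"
  unfolding ann_pre by (rule img_pre) simp

lemma img_carrier: "img (carrier R) = carrier M" using gen by (simp add: img_def)

lemma pre_carrier: "pre (carrier M) = carrier R" using gen_closed by (auto simp: pre_def)

lemma simple_iff: "simple_module R M \<longleftrightarrow> S.max_lideal ann"
proof
  assume s: "simple_module R M"
  show "S.max_lideal ann" unfolding S.max_lideal_def
  proof (intro conjI ballI impI ann_lids)
    show "ann \<noteq> carrier R" using s img_ann img_carrier by (auto simp: simple_module_def)
    fix Y assume Y: "Y \<in> S.lids" "ann \<subseteq> Y"
    have "img Y = {\<zero>\<^bsub>M\<^esub>} \<or> img Y = carrier M" using s img_submodule[OF Y(1)] by (simp add: simple_module_def)
    then show "Y = ann \<or> Y = carrier R" using pre_img[OF Y] ann_pre pre_carrier by metis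
  qed
next
  assume m: "S.max_lideal ann"
  have "carrier M \<noteq> {\<zero>\<^bsub>M\<^esub>}" using m ann_pre pre_carrier by (auto simp: S.max_lideal_def)
  moreover have "N = {\<zero>\<^bsub>M\<^esub>} \<or> N = carrier M" if N: "submodule N R M" for N
  proof -
    have "pre N = ann \<or> pre N = carrier R" using m pre_lids[OF N] by (auto simp: S.max_lideal_def)
    then show ?thesis using img_pre[OF submodule_subset[OF N]] img_ann img_carrier by metis
  qed
  ultimately show "simple_module R M" using left_module_axioms by (simp add: simple_module_def)
qed

lemma faithful_iff: "faithful_module R M \<longleftrightarrow> S.bound ann = {\<zero>}"
proof -
  have "s \<in> S.bound ann \<longleftrightarrow> s \<in> carrier R \<and> (\<forall>y\<in>carrier M. s \<odot>\<^bsub>M\<^esub> y = \<zero>\<^bsub>M\<^esub>)" for s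
    using gen gen_closed by (auto simp: S.bound_def ann_def smult_assoc)
  moreover have "\<zero> \<odot>\<^bsub>M\<^esub> y = \<zero>\<^bsub>M\<^esub>" if "y \<in> carrier M" for y using that by (rule smult_l_null)
  ultimately show ?thesis
    using left_module_axioms S.zero_closed unfolding faithful_module_def by blast
qed

lemma artinian_iff: "artinian_module R M \<longleftrightarrow> dcc_on (between S.lids ann (carrier R))"
proof -
  have "artinian_module R M \<longleftrightarrow> dcc_on {N. submodule N R M}"
    using left_module_axioms by (simp add: artinian_module_def dcc_on_def all_conj_distrib)
  also have "\<dots> \<longleftrightarrow> dcc_on (between S.lids ann (carrier R))"
  proof
    assume d: "dcc_on {N. submodule N R M}"
    show "dcc_on (between S.lids ann (carrier R))"
    proof (rule dcc_on_embed[OF d, of _ img])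
      fix Y assume "Y \<in> between S.lids ann (carrier R)"
      then have Y: "Y \<in> S.lids" "ann \<subseteq> Y" by (simp_all add: between_mem)
      show "img Y \<in> {N. submodule N R M}" using img_submodule[OF Y(1)] by simp
      fix Z assume "Z \<in> between S.lids ann (carrier R)"
      then have Z: "Z \<in> S.lids" "ann \<subseteq> Z" by (simp_all add: between_mem)
      show "img Y \<subseteq> img Z" if "Y \<subseteq> Z" using that unfolding img_def by (rule image_mono)
      assume "img Y = img Z"
      then have "pre (img Y) = pre (img Z)" by simp
      then show "Z \<subseteq> Y" unfolding pre_img[OF Y] pre_img[OF Z] by simp
    qed
  next
    assume d: "dcc_on (between S.lids ann (carrier R))"
    show "dcc_on {N. submodule N R M}"
    proof (rule dcc_on_embed[OF d, of _ pre])
      fix Y assume "Y \<in> {N. submodule N R M}"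
      then have Y: "submodule Y R M" by simp
      have "pre Y \<subseteq> carrier R" unfolding pre_def by blast
      then show "pre Y \<in> between S.lids ann (carrier R)" using pre_lids[OF Y] by (simp add: between_mem)
      fix Z assume "Z \<in> {N. submodule N R M}"
      then have Z: "submodule Z R M" by simp
      show "pre Y \<subseteq> pre Z" if "Y \<subseteq> Z" using that unfolding pre_def by blast
      assume "pre Y = pre Z"
      then have "img (pre Y) = img (pre Z)" by simp
      then show "Z \<subseteq> Y" unfolding img_pre[OF submodule_subset[OF Y]] img_pre[OF submodule_subset[OF Z]] by simp
    qed
  qed
  finally show ?thesis .
qed

lemma submodule_restrict_iff:
  assumes N: "submodule N R M"
  shows "submodule K R (M\<lparr>carrier := N\<rparr>) \<longleftrightarrow> submodule K R M \<and> K \<subseteq> N"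
proof -
  interpret N: left_module R "M\<lparr>carrier := N\<rparr>" by (rule left_module_submodule[OF left_module_axioms N])
  show ?thesis unfolding N.submodule_iff submodule_iff using submodule_subset[OF N] by auto
qed

text \<open>A simple essential submodule meets every nonzero submodule in something nonzero, hence
  lies inside it: both conditions together say that N is the least nonzero submodule.\<close>

lemma essential_simple_iff:
  assumes N: "submodule N R M"
  shows "essential_submodule R N M \<and> simple_module R (M\<lparr>carrier := N\<rparr>) \<longleftrightarrow>
    ann \<subset> pre N \<and> (\<forall>Y\<in>S.lids. ann \<subset> Y \<longrightarrow> pre N \<subseteq> Y)"
proof
  have Nc: "N \<subseteq> carrier M" by (rule submodule_subset[OF N])
  assume es: "essential_submodule R N M \<and> simple_module R (M\<lparr>carrier := N\<rparr>)"
  then have ess: "\<And>K. submodule K R M \<Longrightarrow> K \<noteq> {\<zero>\<^bsub>M\<^esub>} \<Longrightarrow> N \<inter> K \<noteq> {\<zero>\<^bsub>M\<^esub>}"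
    and sim: "\<And>K. submodule K R M \<Longrightarrow> K \<subseteq> N \<Longrightarrow> K = {\<zero>\<^bsub>M\<^esub>} \<or> K = N" and Nz: "N \<noteq> {\<zero>\<^bsub>M\<^esub>}"
    using submodule_restrict_iff[OF N] by (auto simp: essential_submodule_def simple_module_def)
  have "ann \<noteq> pre N" using img_pre[OF Nc] img_ann Nz by metis
  then have "ann \<subset> pre N" using pre_lids[OF N] by blast
  moreover have "pre N \<subseteq> Y" if Y: "Y \<in> S.lids" "ann \<subset> Y" for Y
  proof -
    have K: "submodule (img Y) R M" by (rule img_submodule[OF Y(1)])
    have p: "pre (img Y) = Y" using pre_img Y by blast
    then have "img Y \<noteq> {\<zero>\<^bsub>M\<^esub>}" using Y(2) ann_pre by auto
    then have "N \<inter> img Y \<noteq> {\<zero>\<^bsub>M\<^esub>}" by (rule ess[OF K])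
    moreover have "submodule (N \<inter> img Y) R M" using N K by (auto simp: submodule_iff)
    ultimately have "N \<subseteq> img Y" using sim[of "N \<inter> img Y"] by blast
    then have "pre N \<subseteq> pre (img Y)" by (auto simp: pre_def)
    then show ?thesis using p by simp
  qed
  ultimately show "ann \<subset> pre N \<and> (\<forall>Y\<in>S.lids. ann \<subset> Y \<longrightarrow> pre N \<subseteq> Y)" by blast
next
  have Nc: "N \<subseteq> carrier M" by (rule submodule_subset[OF N])
  assume r: "ann \<subset> pre N \<and> (\<forall>Y\<in>S.lids. ann \<subset> Y \<longrightarrow> pre N \<subseteq> Y)"
  have Nz: "N \<noteq> {\<zero>\<^bsub>M\<^esub>}" using r ann_pre by auto
  have sub: "N \<subseteq> K" if K: "submodule K R M" "K \<noteq> {\<zero>\<^bsub>M\<^esub>}" for K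
  proof -
    have "ann \<noteq> pre K" using img_pre[OF submodule_subset[OF K(1)]] img_ann K(2) by metis
    then have "pre N \<subseteq> pre K" using r pre_lids[OF K(1)] by blast
    then have "img (pre N) \<subseteq> img (pre K)" by (auto simp: img_def)
    then show ?thesis using img_pre[OF Nc] img_pre[OF submodule_subset[OF K(1)]] by simp
  qed
  have "N \<inter> K \<noteq> {\<zero>\<^bsub>M\<^esub>}" if "submodule K R M" "K \<noteq> {\<zero>\<^bsub>M\<^esub>}" for K
    using sub[OF that] Nz by (simp add: Int_absorb2)
  then have "essential_submodule R N M" using N left_module_axioms by (simp add: essential_submodule_def)
  moreover have "simple_module R (M\<lparr>carrier := N\<rparr>)"
    unfolding simple_module_def submodule_restrict_iff[OF N]
    using left_module_submodule[OF left_module_axioms N] Nz sub by auto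
  ultimately show "essential_submodule R N M \<and> simple_module R (M\<lparr>carrier := N\<rparr>)" by blast
qed

end

section \<open>Quotients of the ring by left ideals\<close>

context ring
begin

definition coset :: "'a set \<Rightarrow> 'a \<Rightarrow> 'a set" where
  "coset L y = {z \<in> carrier R. z \<ominus> y \<in> L}"

definition rep :: "'a set \<Rightarrow> 'a" where "rep A = (SOME z. z \<in> A)"

text \<open>Cosets as sets put R/L on the very type over which \<open>primitive_ring\<close> and
  \<open>diamond\<close> quantify. Operations go through chosen representatives, and the
  multiplicative fields are fillers that the module record inherits from rings.\<close>

definition quotient_module :: "'a set \<Rightarrow> ('a, 'a set) module" where
  "quotient_module L = \<lparr>carrier = coset L ` carrier R, monoid.mult = undefined, one = undefined,
     ring.zero = coset L \<zero>, ring.add = (\<lambda>A B. coset L (rep A \<oplus> rep B)),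
     smult = (\<lambda>s A. coset L (s \<otimes> rep A))\<rparr>"

context
  fixes L assumes L: "L \<in> lids"
begin

lemma coset_eq_iff:
  assumes "y \<in> carrier R" "z \<in> carrier R" shows "coset L y = coset L z \<longleftrightarrow> y \<ominus> z \<in> L"
proof
  assume eq: "coset L y = coset L z"
  have "y \<in> coset L y" using assms lidealsD(2)[OF L] by (simp add: coset_def minus_eq r_neg)
  then show "y \<ominus> z \<in> L" unfolding eq by (simp add: coset_def)
next
  assume d: "y \<ominus> z \<in> L"
  have "w \<ominus> y \<in> L \<longleftrightarrow> w \<ominus> z \<in> L" if w: "w \<in> carrier R" for w
  proof -
    have e: "w \<ominus> z = (w \<ominus> y) \<oplus> (y \<ominus> z)"
      using w assms by (simp add: minus_eq a_assoc) (simp add: a_assoc[symmetric] l_neg)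
    have wy: "w \<ominus> y \<in> carrier R" using w assms by simp
    show ?thesis unfolding e using lidealsD(3)[OF L _ d] lids_cancel(1)[OF L d wy] by (intro iffI)
  qed
  then show "coset L y = coset L z" unfolding coset_def by blast
qed

lemma rep_coset:
  assumes "y \<in> carrier R"
  shows "rep (coset L y) \<in> carrier R" "rep (coset L y) \<ominus> y \<in> L"
proof -
  have "y \<in> coset L y" using assms lidealsD(2)[OF L] by (simp add: coset_def minus_eq r_neg)
  then have "rep (coset L y) \<in> coset L y" unfolding rep_def by (rule someI)
  then show "rep (coset L y) \<in> carrier R" "rep (coset L y) \<ominus> y \<in> L" by (auto simp: coset_def)
qed

lemma coset_add:
  assumes "y \<in> carrier R" "z \<in> carrier R"
  shows "coset L (rep (coset L y) \<oplus> rep (coset L z)) = coset L (y \<oplus> z)"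
proof -
  define u v where "u = rep (coset L y)" and "v = rep (coset L z)"
  have uv: "u \<in> carrier R" "v \<in> carrier R" "u \<ominus> y \<in> L" "v \<ominus> z \<in> L"
    using rep_coset assms by (auto simp: u_def v_def)
  have "(u \<oplus> v) \<ominus> (y \<oplus> z) = (u \<ominus> y) \<oplus> (v \<ominus> z)" using assms uv by (simp add: minus_eq minus_add a_ac)
  then have "(u \<oplus> v) \<ominus> (y \<oplus> z) \<in> L" using lidealsD(3)[OF L uv(3,4)] by simp
  then show ?thesis unfolding u_def[symmetric] v_def[symmetric] using coset_eq_iff[of "u \<oplus> v" "y \<oplus> z"] uv assms by simp
qed

lemma coset_smult:
  assumes "s \<in> carrier R" "y \<in> carrier R"
  shows "coset L (s \<otimes> rep (coset L y)) = coset L (s \<otimes> y)"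
proof -
  define u where "u = rep (coset L y)"
  have u: "u \<in> carrier R" "u \<ominus> y \<in> L" using rep_coset assms by (auto simp: u_def)
  have "s \<otimes> u \<ominus> s \<otimes> y = s \<otimes> (u \<ominus> y)" using assms u by (simp add: minus_eq r_distr r_minus)
  then have "s \<otimes> u \<ominus> s \<otimes> y \<in> L" using lidealsD(4)[OF L assms(1) u(2)] by simp
  then show ?thesis unfolding u_def[symmetric] using coset_eq_iff[of "s \<otimes> u" "s \<otimes> y"] u assms by simp
qed

lemma quotient_module_left_module: "left_module R (quotient_module L)"
proof -
  have "abelian_group (quotient_module L)"
  proof (rule abelian_groupI)
    fix A assume "A \<in> carrier (quotient_module L)"
    then obtain y where y: "y \<in> carrier R" "A = coset L y" by (auto simp: quotient_module_def)
    then show "\<exists>B\<in>carrier (quotient_module L). B \<oplus>\<^bsub>quotient_module L\<^esub> A = \<zero>\<^bsub>quotient_module L\<^esub>"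
      by (intro bexI[of _ "coset L (\<ominus> y)"]) (simp_all add: quotient_module_def coset_add l_neg)
  qed (auto simp: quotient_module_def coset_add a_ac)
  then show ?thesis using ring_axioms
    by (auto intro!: left_module.intro left_module_axioms.intro
        simp: quotient_module_def coset_add coset_smult l_distr r_distr m_assoc)
qed

lemma quotient_module_cyclic: "cyclic_left_module R (quotient_module L) (coset L \<one>)"
proof (intro cyclic_left_module.intro cyclic_left_module_axioms.intro quotient_module_left_module)
  show "coset L \<one> \<in> carrier (quotient_module L)" by (simp add: quotient_module_def)
  show "carrier (quotient_module L) = (\<lambda>s. s \<odot>\<^bsub>quotient_module L\<^esub> coset L \<one>) ` carrier R"
    by (auto simp: quotient_module_def coset_smult)
qed

lemma quotient_module_ann: "cyclic_left_module.ann R (quotient_module L) (coset L \<one>) = L"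
proof -
  interpret C: cyclic_left_module R "quotient_module L" "coset L \<one>" by (rule quotient_module_cyclic)
  have "s \<odot>\<^bsub>quotient_module L\<^esub> coset L \<one> = \<zero>\<^bsub>quotient_module L\<^esub> \<longleftrightarrow> s \<in> L" if "s \<in> carrier R" for s
    using that coset_eq_iff[of s \<zero>] by (simp add: quotient_module_def coset_smult minus_eq)
  then show ?thesis unfolding C.ann_def using lidealsD(1)[OF L] by auto
qed

end

lemma primitive_ring_iff: "primitive_ring R \<longleftrightarrow> (\<exists>L. max_lideal L \<and> bound L = {\<zero>})"
proof
  assume "primitive_ring R"
  then obtain M :: "('a, 'a set) module" where M: "simple_module R M" "faithful_module R M"
    unfolding primitive_ring_def by blast
  obtain x where "x \<in> carrier M" "carrier M = (\<lambda>s. s \<odot>\<^bsub>M\<^esub> x) ` carrier R" "left_module R M"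
    using simple_imp_cyclic[OF M(1)] unfolding cyclic_module_def by blast
  then interpret C: cyclic_left_module R M x
    by (intro cyclic_left_module.intro cyclic_left_module_axioms.intro)
  show "\<exists>L. max_lideal L \<and> bound L = {\<zero>}" using C.simple_iff C.faithful_iff M by blast
next
  assume "\<exists>L. max_lideal L \<and> bound L = {\<zero>}"
  then obtain L where L: "max_lideal L" "bound L = {\<zero>}" by blast
  then have Ll: "L \<in> lids" by (simp add: max_lideal_def)
  interpret C: cyclic_left_module R "quotient_module L" "coset L \<one>" by (rule quotient_module_cyclic[OF Ll])
  show "primitive_ring R" unfolding primitive_ring_def
    using C.simple_iff C.faithful_iff L quotient_module_ann[OF Ll] by metis
qed

lemma diamond_iff_lids: "diamond R \<longleftrightarrow> diamond_lids"
proof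
  assume d: "diamond R"
  show "diamond_lids" unfolding diamond_lids_def
  proof (intro ballI impI)
    fix L N assume L: "L \<in> lids" and N: "N \<in> lids" and LN: "L \<subset> N \<and> (\<forall>Y\<in>lids. L \<subset> Y \<longrightarrow> N \<subseteq> Y)"
    interpret C: cyclic_left_module R "quotient_module L" "coset L \<one>" by (rule quotient_module_cyclic[OF L])
    have ann: "C.ann = L" by (rule quotient_module_ann[OF L])
    have sN: "submodule (C.img N) R (quotient_module L)" by (rule C.img_submodule[OF N])
    have "C.pre (C.img N) = N" using C.pre_img[OF N] LN ann by blast
    then have "essential_submodule R (C.img N) (quotient_module L) \<and>
        simple_module R ((quotient_module L)\<lparr>carrier := C.img N\<rparr>)"
      using C.essential_simple_iff[OF sN] LN ann by simp
    moreover have "cyclic_module R (quotient_module L)"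
      unfolding cyclic_module_def using C.left_module_axioms C.gen_closed C.gen by blast
    ultimately have "artinian_module R (quotient_module L)" using d unfolding diamond_def by blast
    then show "dcc_on (between lids L (carrier R))" using C.artinian_iff ann by simp
  qed
next
  assume d: "diamond_lids"
  show "diamond R" unfolding diamond_def
  proof (intro allI impI, elim conjE)
    fix M :: "('a, 'a set) module" and N
    assume "cyclic_module R M" and N: "essential_submodule R N M" "simple_module R (M\<lparr>carrier := N\<rparr>)"
    then obtain x where "x \<in> carrier M" "carrier M = (\<lambda>s. s \<odot>\<^bsub>M\<^esub> x) ` carrier R" "left_module R M"
      unfolding cyclic_module_def by blast
    then interpret C: cyclic_left_module R M x
      by (intro cyclic_left_module.intro cyclic_left_module_axioms.intro)
    have sN: "submodule N R M" using N by (simp add: essential_submodule_def)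
    have e: "C.ann \<subset> C.pre N \<and> (\<forall>Y\<in>lids. C.ann \<subset> Y \<longrightarrow> C.pre N \<subseteq> Y)"
      using C.essential_simple_iff[OF sN] N by blast
    have "dcc_on (between lids C.ann (carrier R))"
      by (rule diamond_lidsD[OF d C.ann_lids C.pre_lids(1)[OF sN]]) (use e in auto)
    then show "artinian_module R M" using C.artinian_iff by simp
  qed
qed

end

theorem theorem4p3:
  fixes K :: "('k, 'l) ring_scheme"
    and R :: "('k, 'r, 'm) module_scheme"
    and \<delta> :: "'r \<Rightarrow> 'r"
  assumes "field_char_zero K"
    and "affine_algebra K R"
    and "factorial_domain R"
    and "krull_dim R = 2"
    and "derivation R \<delta>"
    and "\<And>M. maximalideal M R \<Longrightarrow> \<not> delta_ideal R \<delta> M"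
  shows "(diamond (diff_op_ring R \<delta>) \<longleftrightarrow> \<not> delta_primitive R \<delta>) \<and>
    (\<not> delta_primitive R \<delta> \<longleftrightarrow> \<not> primitive_ring (diff_op_ring R \<delta>))"
proof -
  have K: "field K" "\<forall>n::nat. n > 0 \<longrightarrow> add_pow K n \<one>\<^bsub>K\<^esub> \<noteq> \<zero>\<^bsub>K\<^esub>"
    using assms(1) by (auto simp: field_char_zero_def)
  have dom: "domain R" by (rule factorial_domain.axioms(1)[OF assms(3)])
  have fac: "factorial_monoid (mult_of R)" by (rule factorial_domain.axioms(2)[OF assms(3)])
  obtain G where alg: "algebra K R" and G: "G \<subseteq> carrier R" "finite G"
    "generate_ring R ((\<lambda>c. c \<odot>\<^bsub>R\<^esub> \<one>\<^bsub>R\<^esub>) ` carrier K \<union> G) = carrier R"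
    using assms(2) unfolding affine_algebra_def by blast
  interpret A: affine_domain K R G
    by (intro affine_domain.intro affine_domain_axioms.intro dom alg K(1) G)
  have dd: "diff_domain R \<delta>"
    by (intro diff_domain.intro diff_domain_axioms.intro assms(5) dom A.integer_unit K(2))
  interpret D: diff_surface R \<delta>
    by (intro diff_surface.intro diff_surface_axioms.intro dd A.noetherian_cring_axioms
        A.prime_ideal_contains_prime[OF fac] A.jacobson_radical_zero assms(4,6))
  have "ring (diff_op_ring R \<delta>)" by (rule D.diff_op_ring_ring)
  then show ?thesis
    using ring.diamond_iff_lids ring.primitive_ring_iff D.diamond_iff_not_delta_primitive
      D.delta_primitive_iff_bound by blast
qed

end
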